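(* Let $H^{(2)}_Z$ be the two-electron atomic Hamiltonian with nuclear charge $Z>0$ and let $Z_c$ be the critical charge. Let $\psi\in L^2(\mathbb{R}^6)$ be a ground state of $H^{(2)}_{Z_c}$ at the ionization threshold, i.e. $\psi\neq0$ and $H^{(2)}_{Z_c}\psi=E^{(1)}_{Z_c}\psi$. Let $\alpha\in(\tfrac12,1)$ and $\delta>0$. Then there exist constants $1>\epsilon_0>\tfrac12>\epsilon_\infty>0$, $K_0,K_\infty>0$ and $c>0$ such that $$\int_{A_{\delta,\alpha}} \exp\!\Big(2\Big[\sqrt{2|E^{(1)}_{Z_c}|}\,|x|_0-K_0|x|_0^{\epsilon_0}+c\sqrt{|x|_\infty}-K_\infty|x|_\infty^{\epsilon_\infty}\Big]\Big)|\psi(x)|^2\,dx<\infty$$ and $$\int_{A^c_{\delta,\alpha}} \exp\!\Big(2\Big[c\sqrt{|x|_\infty}-K_\infty|x|_\infty^{\epsilon_\infty}\Big]\Big)|\psi(x)|^2\,dx<\infty .$$ That is, $\psi$ falls off faster than $\exp(-\sqrt{2|E^{(1)}_{Z_c}|}|x|_0+K_0|x|_0^{\epsilon_0}-c\sqrt{|x|_\infty}+K_\infty|x|_\infty^{\epsilon_\infty})$ in $A_{\delta,\alpha}$ and faster than $\exp(-c\sqrt{|x|_\infty}+K_\infty|x|_\infty^{\epsilon_\infty})$ outside $A_{\delta,\alpha}$.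
   Context: Atomic units, Born–Oppenheimer approximation (nucleus fixed at the origin). For $N\ge1$ and $Z>0$ the $N$-electron atomic Hamiltonian on $L^2(\mathbb{R}^{3N})$ is $H^{(N)}_Z=\sum_{j=1}^N\big(-\tfrac12\Delta_{x_j}-\tfrac{Z}{|x_j|}+\sum_{k<j}\tfrac{1}{|x_j-x_k|}\big)$, and $E^{(N)}_Z$ denotes its ground state energy (infimum of its spectrum); in particular $E^{(1)}_Z=-Z^2/2$. The critical charge $Z_c$ for $N=2$ is the value such that $E^{(2)}_Z<E^{(1)}_Z$ for $Z>Z_c$ and no bound state below $E^{(1)}_Z$ exists for $Z<Z_c$; at $Z=Z_c$ one has $E^{(2)}_{Z_c}=E^{(1)}_{Z_c}$. For $x=(x_1,x_2)\in\mathbb{R}^6$: $|x|_\infty:=\max\{|x_1|,|x_2|\}$, $|x|_0:=\min\{|x_1|,|x_2|\}$, and $A_{\delta,\alpha}:=\{x\in\mathbb{R}^6: |x|_0\ge\delta|x|_\infty^\alpha\}$, $A^c_{\delta,\alpha}$ its complement. *)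

theory Defs
  imports "HOL-Analysis.Analysis"
begin

type_synonym conf2 = "(real^3) \<times> (real^3)"

text \<open>Compactly supported C^2 real test functions (an operator core for the
  Coulomb Hamiltonian).\<close>
definition test_fun :: "('a::euclidean_space \<Rightarrow> real) \<Rightarrow> bool" where
  "test_fun f \<longleftrightarrow>
     (\<exists>f' f''. (\<forall>x. (f has_derivative blinfun_apply (f' x)) (at x))
             \<and> (\<forall>x. (f' has_derivative blinfun_apply (f'' x)) (at x))
             \<and> continuous_on UNIV f''
             \<and> bounded {x. f x \<noteq> 0})"

definition laplacian :: "('a::euclidean_space \<Rightarrow> real) \<Rightarrow> 'a \<Rightarrow> real" where
  "laplacian f x = (\<Sum>b\<in>Basis. deriv (deriv (\<lambda>t. f (x + t *\<^sub>R b))) 0)"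

text \<open>Two-electron Coulomb potential with nuclear charge Z (division by 0 gives 0,
  only on a null set).\<close>
definition V2 :: "real \<Rightarrow> conf2 \<Rightarrow> real" where
  "V2 Z x = - Z / norm (fst x) - Z / norm (snd x) + 1 / norm (fst x - snd x)"

definition H2 :: "real \<Rightarrow> (conf2 \<Rightarrow> real) \<Rightarrow> conf2 \<Rightarrow> real" where
  "H2 Z f x = - (1/2) * laplacian f x + V2 Z x * f x"

text \<open>Ground state energy (bottom of the spectrum) via the Rayleigh-Ritz
  variational principle over the core of test functions.\<close>
definition E2 :: "real \<Rightarrow> real" where
  "E2 Z = Inf {(\<integral>x. f x * H2 Z f x \<partial>lebesgue) / (\<integral>x. (f x)\<^sup>2 \<partial>lebesgue)
               | f. test_fun f \<and> f \<noteq> (\<lambda>_. 0)}"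

definition E1 :: "real \<Rightarrow> real" where
  "E1 Z = - (Z\<^sup>2) / 2"

definition critical_charge :: "real \<Rightarrow> bool" where
  "critical_charge Zc \<longleftrightarrow> Zc > 0
     \<and> (\<forall>Z>Zc. E2 Z < E1 Z)
     \<and> (\<forall>Z. 0 < Z \<and> Z < Zc \<longrightarrow> \<not> E2 Z < E1 Z)
     \<and> E2 Zc = E1 Zc"

text \<open>psi in L^2(R^6) is an eigenfunction of the (self-adjoint) H^(2)_Z with
  eigenvalue E: psi in L^2 and <psi, (H - E) phi> = 0 for all test functions phi
  (H is essentially self-adjoint on the core, so this is psi in D(H), H psi = E psi).\<close>
definition eigenfunction2 :: "real \<Rightarrow> real \<Rightarrow> (conf2 \<Rightarrow> complex) \<Rightarrow> bool" where
  "eigenfunction2 Z E psi \<longleftrightarrow>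
     psi \<in> borel_measurable lebesgue
     \<and> integrable lebesgue (\<lambda>x. (cmod (psi x))\<^sup>2)
     \<and> (\<forall>f. test_fun f \<longrightarrow>
          (\<integral>x. psi x * complex_of_real (H2 Z f x - E * f x) \<partial>lebesgue) = 0)"

definition norm_inf :: "conf2 \<Rightarrow> real" where
  "norm_inf x = max (norm (fst x)) (norm (snd x))"

definition norm_0 :: "conf2 \<Rightarrow> real" where
  "norm_0 x = min (norm (fst x)) (norm (snd x))"

definition A_set :: "real \<Rightarrow> real \<Rightarrow> conf2 set" where
  "A_set \<delta> \<alpha> = {x. norm_0 x \<ge> \<delta> * norm_inf x powr \<alpha>}"

end

theory Submission
 imports Defs "HOL-Probability.Probability" "HOL-Real_Asymp.Real_Asymp"
begin

text \<open>
 Let \<open>u\<close> be the modulus of the real or the imaginary part of \<open>psi\<close>. By Kato's inequality it is a weak subsolution,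
 \<open>- 1/2 \<Delta> u + (V2 Z + Z^2 / 2) u \<le> 0\<close> at \<open>Z = Zc\<close>. The factor \<open>exp (- Z (|x1| + |x2|))\<close> removes the attraction exactly,
 and what is left of the potential is the repulsion \<open>1 / |x1 - x2| \<ge> 1 / (t1 + t2)\<close>, where \<open>t = sqrt (1 + |x|^2)\<close>. Since \<open>Zc < 1\<close>,
 the repulsion felt by an outer electron exceeds the term \<open>Z / t\<close> produced by the Laplacian of \<open>exp (Z t)\<close>, and the surplus of order
 \<open>1 / t\<close> pays for a factor \<open>exp (c sqrt t)\<close>. This yields a supersolution \<open>Psi\<close> carrying the weight of the theorem and a second one,
 \<open>Theta\<close>, with \<open>c\<close> replaced by \<open>- c\<close>, which is integrable against \<open>u\<close>. Testing with the harmonic means of \<open>Psi\<close> and \<open>n Theta\<close>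
 and letting \<open>n\<close> tend to infinity gives a weighted \<open>L^1\<close> bound on \<open>u\<close>; a local mean value inequality turns it into the weighted
 \<open>L^2\<close> bound. That \<open>Zc < 1\<close> holds is a variational statement: a combination of six Gaussians has energy below \<open>- 1/2\<close> at \<open>Z = 1\<close>.
\<close>

text \<open>Nothing is known about \<open>psi\<close> at infinity beyond square integrability, so
  the usual comparison of a sub- with a supersolution, which presupposes decay of their difference,
  cannot start. The dual route puts all derivatives on explicit test functions: one with controlled
  derivatives may be used as soon as its product with \<open>w = u exp (- Z (|x1| + |x2|))\<close>
  is integrable. In the transformed operator a factor \<open>exp (m t)\<close> for one electron
  contributes \<open>Z m - m^2 / 2\<close> to leading order. This vanishes for \<open>m = 0\<close>
  and \<open>m = 2 Z\<close> and equals the threshold \<open>Z^2 / 2\<close> for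
  \<open>m = Z\<close>. An outer electron with \<open>m = Z\<close> and an inner one with
  \<open>m = 0\<close> or \<open>m = 2 Z\<close> therefore cancel all terms of order one, and
  \<open>m = 2 Z\<close> is what leaves \<open>exp (Z |x|_0)\<close> once the factor in
  \<open>w\<close> is taken off. The obstacle is the region where both distances are comparable,
  since there the repulsion need not exceed \<open>Z / t\<close>. A term \<open>- t^(3/4)\<close> in
  the inner exponent of \<open>Psi\<close>, and a product \<open>exp ((Z - be) (t1 + t2))\<close> in
  \<open>Theta\<close>, provide the positivity there.\<close>

lemmas bintegrable_add = Bochner_Integration.integrable_add
lemmas bintegrable_bound = Bochner_Integration.integrable_bound
lemmas bintegrable_diff = Bochner_Integration.integrable_diff
lemmas bintegrable_sum = Bochner_Integration.integrable_sum
lemmas bintegral_add = Bochner_Integration.integral_add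
lemmas bintegral_cong = Bochner_Integration.integral_cong
lemmas bintegral_diff = Bochner_Integration.integral_diff
lemmas bintegral_mult_right = Bochner_Integration.integral_mult_right
lemmas bintegral_sum = Bochner_Integration.integral_sum

section \<open>Twice continuously differentiable functions\<close>

text \<open>Value, gradient and Laplacian travel together, so that each calculus rule below yields
  all three at once. The Hessian stays behind an existential quantifier: estimates only mention the
  gradient \<open>g\<close> and the trace \<open>l\<close>, while its continuity is what
  \<open>test_fun\<close> asks for.\<close>

definition C2GL :: "('a::euclidean_space \<Rightarrow> real) \<Rightarrow> ('a \<Rightarrow> 'a) \<Rightarrow> ('a \<Rightarrow> real) \<Rightarrow> bool" where
 "C2GL f g l \<longleftrightarrow> (\<exists>H. (\<forall>x. (f has_derivative (\<lambda>h. g x \<bullet> h)) (at x))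
   \<and> (\<forall>x. (g has_derivative blinfun_apply (H x)) (at x))
   \<and> continuous_on UNIV H \<and> (\<forall>x. l x = (\<Sum>b\<in>Basis. H x b \<bullet> b)))"

lemma C2GL_D:
 assumes "C2GL f g l"
 shows "(f has_derivative (\<lambda>h. g x \<bullet> h)) (at x)" "continuous_on UNIV f"
  "continuous_on UNIV g" "continuous_on UNIV l"
proof -
 obtain H where H: "\<And>x. (f has_derivative (\<lambda>h. g x \<bullet> h)) (at x)"
   "\<And>x. (g has_derivative blinfun_apply (H x)) (at x)"
   "continuous_on UNIV H" "\<And>x. l x = (\<Sum>b\<in>Basis. H x b \<bullet> b)"
  using assms unfolding C2GL_def by auto
 show "(f has_derivative (\<lambda>h. g x \<bullet> h)) (at x)" by (fact H)
 show "continuous_on UNIV f"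
  using H(1) by (meson continuous_at_imp_continuous_on has_derivative_continuous)
 show "continuous_on UNIV g"
  using H(2) by (meson continuous_at_imp_continuous_on has_derivative_continuous)
 have "l = (\<lambda>x. \<Sum>b\<in>Basis. H x b \<bullet> b)" using H(4) by auto
 then show "continuous_on UNIV l"
  using H(3) by (auto intro!: continuous_intros)
qed

lemma C2GL_measurable:
 assumes "C2GL f g l"
 shows "f \<in> borel_measurable borel" "g \<in> borel_measurable borel" "l \<in> borel_measurable borel"
 using C2GL_D(2-4)[OF assms] by (auto intro: borel_measurable_continuous_onI)

lemma C2GL_cong:
 assumes "C2GL f g l" "\<And>x. f' x = f x" "\<And>x. g' x = g x" "\<And>x. l' x = l x"
 shows "C2GL f' g' l'"
proof -
 have "f' = f" "g' = g" "l' = l" using assms by auto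
 then show ?thesis using assms by simp
qed

lemma has_derivative_grad_line:
 assumes "(f has_derivative (\<lambda>h. v \<bullet> h)) (at (x + t *\<^sub>R b))"
 shows "((\<lambda>t. f (x + t *\<^sub>R b)) has_real_derivative v \<bullet> b) (at t)"
proof -
 have 1: "((\<lambda>t. x + t *\<^sub>R b) has_derivative (\<lambda>s. s *\<^sub>R b)) (at t)"
  by (auto intro!: derivative_eq_intros)
 have "((\<lambda>t. f (x + t *\<^sub>R b)) has_derivative (\<lambda>s. v \<bullet> (s *\<^sub>R b))) (at t)"
  using has_derivative_compose[OF 1 assms] .
 then show ?thesis unfolding has_field_derivative_def
  by (rule has_derivative_eq_rhs) (simp add: fun_eq_iff)
qed

text \<open>Along a line with direction \<open>b\<close> the derivative of \<open>f\<close> is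
  \<open>g \<bullet> b\<close>, and differentiating once more gives a diagonal entry of the Hessian.
  This ties the \<open>deriv\<close>-based \<open>laplacian\<close> of the Hamiltonian to the
  function \<open>l\<close> with which all estimates work.\<close>

lemma C2GL_laplacian:
 assumes "C2GL f g l"
 shows "laplacian f = l"
proof
 fix x
 obtain H where H: "\<And>x. (f has_derivative (\<lambda>h. g x \<bullet> h)) (at x)"
   "\<And>x. (g has_derivative blinfun_apply (H x)) (at x)"
   "\<And>x. l x = (\<Sum>b\<in>Basis. H x b \<bullet> b)"
  using assms unfolding C2GL_def by auto
 have "deriv (deriv (\<lambda>t. f (x + t *\<^sub>R b))) 0 = H x b \<bullet> b" for b
 proof -
  have 1: "deriv (\<lambda>t. f (x + t *\<^sub>R b)) = (\<lambda>t. g (x + t *\<^sub>R b) \<bullet> b)"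
   by (rule ext, rule DERIV_imp_deriv, rule has_derivative_grad_line, rule H)
  have 2: "((\<lambda>t. x + t *\<^sub>R b) has_derivative (\<lambda>s. s *\<^sub>R b)) (at 0)"
   by (auto intro!: derivative_eq_intros)
  have 3: "((\<lambda>t. g (x + t *\<^sub>R b)) has_derivative (\<lambda>s. H x (s *\<^sub>R b))) (at 0)"
   using has_derivative_compose[OF 2, of g "H x"] H(2)[of x] by simp
  have "((\<lambda>t. g (x + t *\<^sub>R b) \<bullet> b) has_derivative (\<lambda>s. H x (s *\<^sub>R b) \<bullet> b)) (at 0)"
   by (rule has_derivative_inner_left[OF 3])
  then have "((\<lambda>t. g (x + t *\<^sub>R b) \<bullet> b) has_real_derivative (H x b \<bullet> b)) (at 0)"
   unfolding has_field_derivative_def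
   by (rule has_derivative_eq_rhs) (simp add: fun_eq_iff blinfun.scaleR_right)
  then show ?thesis unfolding 1 by (rule DERIV_imp_deriv)
 qed
 then show "laplacian f x = l x" unfolding laplacian_def H(3) by simp
qed

lemma C2GL_test_fun:
 assumes "C2GL f g l" "bounded {x. f x \<noteq> 0}"
 shows "test_fun f"
proof -
 obtain H where H: "\<And>x. (f has_derivative (\<lambda>h. g x \<bullet> h)) (at x)"
   "\<And>x. (g has_derivative blinfun_apply (H x)) (at x)" "continuous_on UNIV H"
  using assms unfolding C2GL_def by auto
 have d: "((\<lambda>x. blinfun_inner_right (g x)) has_derivative
   blinfun_apply (Blinfun blinfun_inner_right o\<^sub>L H x)) (at x)" for x
 proof -
  have "((\<lambda>x. blinfun_inner_right (g x)) has_derivative (\<lambda>h. blinfun_inner_right (H x h))) (at x)"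
   by (rule bounded_linear.has_derivative[OF bounded_linear_blinfun_inner_right H(2)])
  then show ?thesis
   by (simp add: blinfun_compose.rep_eq o_def bounded_linear_Blinfun_apply[OF bounded_linear_blinfun_inner_right])
 qed
 show ?thesis unfolding test_fun_def
  by (rule exI[of _ "\<lambda>x. blinfun_inner_right (g x)"],
    rule exI[of _ "\<lambda>x. Blinfun blinfun_inner_right o\<^sub>L H x"])
    (use H d assms in \<open>auto intro!: continuous_intros\<close>)
qed

lemma test_fun_C2GL:
 assumes "test_fun f"
 obtains g l where "C2GL f g l"
proof -
 obtain f' f'' where H: "\<And>x. (f has_derivative blinfun_apply (f' x)) (at x)"
   "\<And>x. (f' has_derivative blinfun_apply (f'' x)) (at x)" "continuous_on UNIV f''"
  using assms unfolding test_fun_def by auto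
 \<comment> \<open>The Riesz vector of a functional, written in the basis so that it is visibly
   bounded and linear in \<open>F\<close>; it converts the derivative into a gradient field.\<close>
 define R :: "('a \<Rightarrow>\<^sub>L real) \<Rightarrow> 'a" where "R = (\<lambda>F. \<Sum>b\<in>Basis. F b *\<^sub>R b)"
 have lin: "bounded_linear R" unfolding R_def
  by (auto intro!: bounded_linear_intros bounded_linear_sum)
 have R: "R F \<bullet> h = F h" for F h
 proof -
  have "F h = F (\<Sum>b\<in>Basis. (h \<bullet> b) *\<^sub>R b)" by (simp add: euclidean_representation)
  also have "\<dots> = (\<Sum>b\<in>Basis. (h \<bullet> b) * F b)"
   by (simp add: blinfun.sum_right blinfun.scaleR_right)
  finally show ?thesis unfolding R_def inner_sum_left
   by (simp add: inner_commute mult.commute)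
 qed
 have "C2GL f (\<lambda>x. R (f' x)) (\<lambda>x. \<Sum>b\<in>Basis. (Blinfun R o\<^sub>L f'' x) b \<bullet> b)"
  unfolding C2GL_def
 proof (rule exI[of _ "\<lambda>x. Blinfun R o\<^sub>L f'' x"], safe)
  show "(f has_derivative (\<bullet>) (R (f' x))) (at x)" for x
   using H(1)[of x] by (rule has_derivative_eq_rhs) (simp add: R fun_eq_iff)
  have "((\<lambda>x. R (f' x)) has_derivative (\<lambda>h. R (f'' x h))) (at x)" for x
   by (rule bounded_linear.has_derivative[OF lin H(2)])
  then show "((\<lambda>x. R (f' x)) has_derivative blinfun_apply (Blinfun R o\<^sub>L f'' x)) (at x)" for x
   by (simp add: blinfun_compose.rep_eq o_def bounded_linear_Blinfun_apply[OF lin])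
 qed (use H in \<open>auto intro!: continuous_intros\<close>)
 then show ?thesis by (rule that)
qed

lemma C2GL_const: "C2GL (\<lambda>_. c) (\<lambda>_. 0) (\<lambda>_. 0)"
 unfolding C2GL_def
proof (rule exI[of _ "\<lambda>_. 0"], safe)
 show "((\<lambda>_. c) has_derivative (\<bullet>) 0) (at x)" for x :: 'a
  using has_derivative_const[of c "at x"] by (rule has_derivative_eq_rhs) (simp add: fun_eq_iff)
 show "((\<lambda>_. 0) has_derivative blinfun_apply (0::'a \<Rightarrow>\<^sub>L 'a)) (at x)" for x :: 'a
  using has_derivative_const[of 0 "at x"] by (rule has_derivative_eq_rhs) (simp add: fun_eq_iff)
qed auto

lemma C2GL_add:
 assumes "C2GL f1 g1 l1" "C2GL f2 g2 l2"
 shows "C2GL (\<lambda>x. f1 x + f2 x) (\<lambda>x. g1 x + g2 x) (\<lambda>x. l1 x + l2 x)"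
proof -
 obtain H1 where H1: "\<And>x. (f1 has_derivative (\<lambda>h. g1 x \<bullet> h)) (at x)"
   "\<And>x. (g1 has_derivative blinfun_apply (H1 x)) (at x)" "continuous_on UNIV H1"
   "\<And>x. l1 x = (\<Sum>b\<in>Basis. H1 x b \<bullet> b)"
  using assms unfolding C2GL_def by auto
 obtain H2 where H2: "\<And>x. (f2 has_derivative (\<lambda>h. g2 x \<bullet> h)) (at x)"
   "\<And>x. (g2 has_derivative blinfun_apply (H2 x)) (at x)" "continuous_on UNIV H2"
   "\<And>x. l2 x = (\<Sum>b\<in>Basis. H2 x b \<bullet> b)"
  using assms unfolding C2GL_def by auto
 show ?thesis unfolding C2GL_def
 proof (intro exI[of _ "\<lambda>x. H1 x + H2 x"] conjI allI)
  show "((\<lambda>x. f1 x + f2 x) has_derivative (\<bullet>) (g1 x + g2 x)) (at x)" for x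
   using has_derivative_add[OF H1(1) H2(1)]
   by (rule has_derivative_eq_rhs) (simp add: fun_eq_iff inner_add_left)
  show "((\<lambda>x. g1 x + g2 x) has_derivative blinfun_apply (H1 x + H2 x)) (at x)" for x
   using has_derivative_add[OF H1(2) H2(2)]
   by (rule has_derivative_eq_rhs) (simp add: fun_eq_iff blinfun.add_left)
 qed (auto intro!: continuous_intros H1 H2 simp: H1(4) H2(4) sum.distrib blinfun.add_left inner_add_left)
qed

text \<open>\<open>U\<close> only has to contain the range of \<open>f\<close>, which admits outer
  functions that are differentiable on part of the line, such as roots of shifted squares and
  reciprocals of positive functions.\<close>

lemma C2GL_compose:
 assumes f: "C2GL f g l" and U: "\<And>x. f x \<in> U"
  and d1: "\<And>s. s \<in> U \<Longrightarrow> (ph has_real_derivative ph1 s) (at s)"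
  and d2: "\<And>s. s \<in> U \<Longrightarrow> (ph1 has_real_derivative ph2 s) (at s)"
  and c: "continuous_on U ph2"
 shows "C2GL (\<lambda>x. ph (f x)) (\<lambda>x. ph1 (f x) *\<^sub>R g x) (\<lambda>x. ph1 (f x) * l x + ph2 (f x) * (g x \<bullet> g x))"
proof -
 obtain H where H: "\<And>x. (f has_derivative (\<lambda>h. g x \<bullet> h)) (at x)"
   "\<And>x. (g has_derivative blinfun_apply (H x)) (at x)" "continuous_on UNIV H"
   "\<And>x. l x = (\<Sum>b\<in>Basis. H x b \<bullet> b)"
  using f unfolding C2GL_def by auto
 \<comment> \<open>The Hessian of the composition: the old one scaled by \<open>ph1\<close>, plus
   \<open>ph2\<close> times the rank one form built from the gradient, whose trace is
   \<open>g \<bullet> g\<close>.\<close>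
 define K where "K x = ph1 (f x) *\<^sub>R H x + ph2 (f x) *\<^sub>R (blinfun_scaleR_left (g x) o\<^sub>L blinfun_inner_right (g x))" for x
 have cf: "continuous_on UNIV f" and cg: "continuous_on UNIV g" using C2GL_D[OF f] by auto
 have c1: "continuous_on U ph1" using d2
  by (meson DERIV_continuous continuous_at_imp_continuous_on)
 have cc: "continuous_on UNIV (\<lambda>x. ph1 (f x))" "continuous_on UNIV (\<lambda>x. ph2 (f x))"
  using continuous_on_compose2[OF c1 cf] continuous_on_compose2[OF c cf] U by auto
 have a1: "((\<lambda>x. ph (f x)) has_derivative (\<lambda>h. (ph1 (f x) *\<^sub>R g x) \<bullet> h)) (at x)" for x
  using DERIV_compose_FDERIV[OF d1[OF U] H(1)] by (rule has_derivative_eq_rhs) (simp add: fun_eq_iff)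
 have a2: "((\<lambda>x. ph1 (f x)) has_derivative (\<lambda>h. ph2 (f x) * (g x \<bullet> h))) (at x)" for x
  using DERIV_compose_FDERIV[OF d2[OF U] H(1)] by (rule has_derivative_eq_rhs) (simp add: fun_eq_iff)
 have a3: "((\<lambda>x. ph1 (f x) *\<^sub>R g x) has_derivative blinfun_apply (K x)) (at x)" for x
  using has_derivative_scaleR[OF a2 H(2)]
  by (rule has_derivative_eq_rhs) (simp add: fun_eq_iff K_def blinfun.add_left blinfun.scaleR_left)
 have K: "continuous_on UNIV K" unfolding K_def
  by (intro continuous_intros cc H cg)
 have "(\<Sum>b\<in>Basis. K x b \<bullet> b) = ph1 (f x) * l x + ph2 (f x) * (g x \<bullet> g x)" for x
 proof -
  have "(\<Sum>b\<in>Basis. K x b \<bullet> b) = (\<Sum>b\<in>Basis. ph1 (f x) * (H x b \<bullet> b) + ph2 (f x) * ((g x \<bullet> b) * (g x \<bullet> b)))"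
   unfolding K_def by (intro sum.cong refl)
    (simp add: blinfun.add_left blinfun.scaleR_left inner_add_left)
  then show ?thesis
   by (simp add: sum.distrib H(4) sum_distrib_left[symmetric] euclidean_inner[of "g x" "g x"])
 qed
 then show ?thesis unfolding C2GL_def
  by (intro exI[of _ K] conjI allI a1 a3 K) simp
qed

lemma C2GL_cmult:
 assumes "C2GL f g l"
 shows "C2GL (\<lambda>x. c * f x) (\<lambda>x. c *\<^sub>R g x) (\<lambda>x. c * l x)"
 by (rule C2GL_cong[OF C2GL_compose[OF assms, of UNIV "\<lambda>s. c * s" "\<lambda>s. c" "\<lambda>s. 0"]])
   (auto intro!: derivative_eq_intros)

text \<open>Polarisation: a product is a quarter of the difference of two squares, so the rule
  follows from those for sums and for composition with the square, without another look at the
  Hessian.\<close>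

lemma C2GL_mult:
 assumes 1: "C2GL f1 g1 l1" and 2: "C2GL f2 g2 l2"
 shows "C2GL (\<lambda>x. f1 x * f2 x) (\<lambda>x. f1 x *\<^sub>R g2 x + f2 x *\<^sub>R g1 x)
  (\<lambda>x. f1 x * l2 x + f2 x * l1 x + 2 * (g1 x \<bullet> g2 x))"
proof -
 have sq: "C2GL (\<lambda>x. f x * f x) (\<lambda>x. (2 * f x) *\<^sub>R g x) (\<lambda>x. 2 * f x * l x + 2 * (g x \<bullet> g x))"
  if "C2GL f g l" for f g l
  by (rule C2GL_cong[OF C2GL_compose[OF that, of UNIV "\<lambda>s. s * s" "\<lambda>s. 2 * s" "\<lambda>s. 2"]])
   (auto intro!: derivative_eq_intros)
 note 3 = sq[OF C2GL_add[OF 1 2]]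
 note 4 = sq[OF C2GL_add[OF 1 C2GL_cmult[OF 2, of "-1"]]]
 show ?thesis
 proof (rule C2GL_cong[OF C2GL_add[OF C2GL_cmult[OF 3, of "1/4"] C2GL_cmult[OF 4, of "-1/4"]]])
  fix x
  show "f1 x * f2 x = 1 / 4 * ((f1 x + f2 x) * (f1 x + f2 x)) + - 1 / 4 * ((f1 x + - 1 * f2 x) * (f1 x + - 1 * f2 x))"
   by (simp add: algebra_simps)
  have "(1 / 4) *\<^sub>R (2 * (a + b)) *\<^sub>R (u + v) + (- 1 / 4) *\<^sub>R (2 * (a + - 1 * b)) *\<^sub>R (u + - 1 *\<^sub>R v)
    = (a *\<^sub>R v + b *\<^sub>R u)" for a b :: real and u v :: 'a
  proof (rule euclidean_eqI)
   fix i :: 'a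
   show "((1 / 4) *\<^sub>R (2 * (a + b)) *\<^sub>R (u + v) + (- 1 / 4) *\<^sub>R (2 * (a + - 1 * b)) *\<^sub>R (u + - 1 *\<^sub>R v)) \<bullet> i
    = (a *\<^sub>R v + b *\<^sub>R u) \<bullet> i"
    by (simp only: inner_add_left inner_scaleR_left) (simp add: algebra_simps)
  qed
  then show "f1 x *\<^sub>R g2 x + f2 x *\<^sub>R g1 x = (1 / 4) *\<^sub>R (2 * (f1 x + f2 x)) *\<^sub>R (g1 x + g2 x) + (- 1 / 4) *\<^sub>R (2 * (f1 x + - 1 * f2 x)) *\<^sub>R (g1 x + - 1 *\<^sub>R g2 x)"
   by simp
  show "f1 x * l2 x + f2 x * l1 x + 2 * (g1 x \<bullet> g2 x) =
    1 / 4 * (2 * (f1 x + f2 x) * (l1 x + l2 x) + 2 * ((g1 x + g2 x) \<bullet> (g1 x + g2 x))) +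
    - 1 / 4 * (2 * (f1 x + - 1 * f2 x) * (l1 x + - 1 * l2 x) + 2 * ((g1 x + - 1 *\<^sub>R g2 x) \<bullet> (g1 x + - 1 *\<^sub>R g2 x)))"
   by (simp add: inner_add_left inner_add_right inner_diff_left inner_diff_right inner_commute)
     (simp add: field_simps)
 qed
qed

text \<open>The square of the distance is smooth also at the centre, in contrast to the distance
  itself. Bumps, regularised norms and kernels are obtained from it, or from its analogues for one
  component, by composition.\<close>

lemma C2GL_dist_sq:
 fixes y :: "'a::euclidean_space"
 shows "C2GL (\<lambda>x. (norm (x - y))^2) (\<lambda>x. 2 *\<^sub>R (x - y)) (\<lambda>x. 2 * real DIM('a))"
 unfolding C2GL_def
proof (rule exI[of _ "\<lambda>_. 2 *\<^sub>R id_blinfun"], safe)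
 show "((\<lambda>x. (norm (x - y))^2) has_derivative (\<bullet>) (2 *\<^sub>R (x - y))) (at x)" for x
  unfolding power2_norm_eq_inner
  by (auto intro!: derivative_eq_intros simp: inner_commute fun_eq_iff)
 show "((\<lambda>x. 2 *\<^sub>R (x - y)) has_derivative blinfun_apply (2 *\<^sub>R id_blinfun)) (at x)" for x
  by (auto intro!: derivative_eq_intros simp: fun_eq_iff blinfun.scaleR_left id_blinfun.rep_eq)
qed (auto simp: blinfun.scaleR_left id_blinfun.rep_eq inner_Basis)

lemma C2GL_fst_sq:
 shows "C2GL (\<lambda>x::'a::euclidean_space \<times> 'b::euclidean_space. (norm (fst x))^2)
   (\<lambda>x. (2 *\<^sub>R fst x, 0)) (\<lambda>x. 2 * real DIM('a))"
 unfolding C2GL_def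
proof (rule exI[of _ "\<lambda>_. Blinfun (\<lambda>h. (2 *\<^sub>R fst h, 0))"], safe)
 have bl: "bounded_linear (\<lambda>h::'a\<times>'b. (2 *\<^sub>R fst h, 0::'b))"
  by (intro bounded_linear_intros)
 show "((\<lambda>x. (norm (fst x))^2) has_derivative (\<bullet>) (2 *\<^sub>R fst x, 0::'b)) (at x)" for x :: "'a \<times> 'b"
  unfolding power2_norm_eq_inner
  by (auto intro!: derivative_eq_intros simp: inner_commute fun_eq_iff)
 show "((\<lambda>x. (2 *\<^sub>R fst x, 0)) has_derivative blinfun_apply (Blinfun (\<lambda>h. (2 *\<^sub>R fst h, 0::'b)))) (at x)" for x :: "'a \<times> 'b"
  unfolding bounded_linear_Blinfun_apply[OF bl] by (rule bounded_linear_imp_has_derivative[OF bl])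
 show "2 * real DIM('a) = (\<Sum>b\<in>Basis. blinfun_apply (Blinfun (\<lambda>h::'a\<times>'b. (2 *\<^sub>R fst h, 0::'b))) b \<bullet> b)"
  unfolding bounded_linear_Blinfun_apply[OF bl] Basis_prod_def
  by (subst sum.union_disjoint) (auto simp: sum.reindex inj_on_def inner_Basis)
qed auto

lemma C2GL_snd_sq:
 shows "C2GL (\<lambda>x::'a::euclidean_space \<times> 'b::euclidean_space. (norm (snd x))^2)
   (\<lambda>x. (0, 2 *\<^sub>R snd x)) (\<lambda>x. 2 * real DIM('b))"
 unfolding C2GL_def
proof (rule exI[of _ "\<lambda>_. Blinfun (\<lambda>h. (0, 2 *\<^sub>R snd h))"], safe)
 have bl: "bounded_linear (\<lambda>h::'a\<times>'b. (0::'a, 2 *\<^sub>R snd h))"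
  by (intro bounded_linear_intros)
 show "((\<lambda>x. (norm (snd x))^2) has_derivative (\<bullet>) (0::'a, 2 *\<^sub>R snd x)) (at x)" for x :: "'a \<times> 'b"
  unfolding power2_norm_eq_inner
  by (auto intro!: derivative_eq_intros simp: inner_commute fun_eq_iff)
 show "((\<lambda>x. (0, 2 *\<^sub>R snd x)) has_derivative blinfun_apply (Blinfun (\<lambda>h. (0::'a, 2 *\<^sub>R snd h)))) (at x)" for x :: "'a \<times> 'b"
  unfolding bounded_linear_Blinfun_apply[OF bl] by (rule bounded_linear_imp_has_derivative[OF bl])
 show "2 * real DIM('b) = (\<Sum>b\<in>Basis. blinfun_apply (Blinfun (\<lambda>h::'a\<times>'b. (0::'a, 2 *\<^sub>R snd h))) b \<bullet> b)"
  unfolding bounded_linear_Blinfun_apply[OF bl] Basis_prod_def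
  by (subst sum.union_disjoint) (auto simp: sum.reindex inj_on_def inner_Basis)
qed auto

section \<open>Integration by parts\<close>

lemma bounded_subset_cball_zero:
 fixes S :: "'a::real_normed_vector set"
 assumes "bounded S"
 shows "\<exists>r>0. S \<subseteq> cball 0 r"
 using assms unfolding bounded_pos by (auto simp: subset_iff)

lemma integrable_continuous_bounded_support:
 fixes f :: "'a::euclidean_space \<Rightarrow> real"
 assumes "continuous_on UNIV f" "bounded {x. f x \<noteq> 0}"
 shows "integrable lborel f"
proof -
 obtain R where R: "{x. f x \<noteq> 0} \<subseteq> cball 0 R" using bounded_subset_cball_zero[OF assms(2)] by blast
 have "integrable lborel (\<lambda>x. indicator (cball 0 R) x *\<^sub>R f x)"
  by (rule borel_integrable_compact) (auto intro: continuous_on_subset[OF assms(1)])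
 moreover have "(\<lambda>x. indicator (cball 0 R) x *\<^sub>R f x) = f"
  using R by (auto simp: fun_eq_iff indicator_def)
 ultimately show ?thesis by simp
qed

lemma integrable_lborel_translation:
 fixes f :: "'a::euclidean_space \<Rightarrow> real"
 assumes f: "f \<in> borel_measurable borel"
 shows "integrable lborel (\<lambda>x. f (x + a)) \<longleftrightarrow> integrable lborel f"
  "(LBINT x. f (x + a)) = (LBINT x. f x)"
proof -
 have "integrable (distr lborel borel ((+) a)) f \<longleftrightarrow> integrable lborel (\<lambda>x. f (a + x))"
  by (rule integrable_distr_eq) (use f in auto)
 then show "integrable lborel (\<lambda>x. f (x + a)) \<longleftrightarrow> integrable lborel f"
  by (simp add: lborel_distr_plus add.commute)
 have "(\<integral>x. f x \<partial>distr lborel borel ((+) a)) = (LBINT x. f (a + x))"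
  by (rule integral_distr) (use f in auto)
 then show "(LBINT x. f (x + a)) = (LBINT x. f x)"
  by (simp add: lborel_distr_plus add.commute)
qed

text \<open>Difference quotients of \<open>F\<close> integrate to zero by translation invariance,
  and dominated convergence carries this to the derivative. No iterated integrals appear, and
  differentiability in the single direction \<open>b\<close> suffices.\<close>

lemma integral_directional_derivative_zero:
 fixes F D :: "'a::euclidean_space \<Rightarrow> real"
 assumes cF: "continuous_on UNIV F" and cD: "continuous_on UNIV D"
  and bF: "bounded {x. F x \<noteq> 0}"
  and d: "\<And>x t. ((\<lambda>t. F (x + t *\<^sub>R b)) has_real_derivative D (x + t *\<^sub>R b)) (at t)"
 shows "(LBINT x. D x) = 0" "bounded {x. D x \<noteq> 0}"
proof -
 obtain R where R: "{x. F x \<noteq> 0} \<subseteq> cball 0 R" "R > 0" using bounded_subset_cball_zero[OF bF] by blast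
 have D0: "D x = 0" if "norm x > R" for x
 proof -
  have "eventually (\<lambda>t::real. norm (x + t *\<^sub>R b) > R) (at 0)"
  proof -
   have "((\<lambda>t::real. norm (x + t *\<^sub>R b)) \<longlongrightarrow> norm (x + 0 *\<^sub>R b)) (at 0)"
    by (intro tendsto_intros)
   then show ?thesis using that by (intro order_tendstoD) auto
  qed
  then have "eventually (\<lambda>t. F (x + t *\<^sub>R b) = 0) (at 0)"
   by eventually_elim (use R in force)
  moreover have "F x = 0" using that R by force
  ultimately have ev: "eventually (\<lambda>t. F (x + t *\<^sub>R b) = 0) (nhds 0)"
   unfolding eventually_nhds_conv_at by simp
  have "((\<lambda>t. F (x + t *\<^sub>R b)) has_real_derivative D x) (at 0)" using d[of x 0] by simp
  then have "((\<lambda>t. (0::real)) has_real_derivative D x) (at 0)"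
   using DERIV_cong_ev[OF refl ev refl] by blast
  then show ?thesis using DERIV_const DERIV_unique by blast
 qed
 show bD: "bounded {x. D x \<noteq> 0}"
  by (rule bounded_subset[OF bounded_cball[of 0 R]]) (use D0 in force)
 have "bounded (D ` cball 0 R)"
  by (intro compact_imp_bounded compact_continuous_image continuous_on_subset[OF cD]) auto
 then obtain C where C: "\<And>x. x \<in> cball 0 R \<Longrightarrow> \<bar>D x\<bar> \<le> C" "C > 0" unfolding bounded_pos by force
 have C': "\<bar>D x\<bar> \<le> C" for x using C D0[of x] by (cases "norm x > R") auto
 have iF: "integrable lborel F" by (rule integrable_continuous_bounded_support[OF cF bF])
 have mF: "F \<in> borel_measurable borel" and mD: "D \<in> borel_measurable borel"
  using cF cD by (auto intro: borel_measurable_continuous_onI)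
 define q where "q n x = (F (x + inverse (real (Suc n)) *\<^sub>R b) - F x) / inverse (real (Suc n))" for n x
 have q0: "(LBINT x. q n x) = 0" for n
 proof -
  have "integrable lborel (\<lambda>x. F (x + inverse (real (Suc n)) *\<^sub>R b))"
   using iF integrable_lborel_translation(1)[OF mF] by blast
  then show ?thesis unfolding q_def
   using iF integrable_lborel_translation(2)[OF mF] by (simp del: of_nat_Suc)
 qed
 \<comment> \<open>By the mean value theorem a quotient is a value of \<open>D\<close>, hence
   bounded by \<open>C\<close>. The step lengths are at most one, so the support grows by at most
   \<open>norm b\<close> beyond that of \<open>F\<close>.\<close>
 have "(\<lambda>n. LBINT x. q n x) \<longlonglongrightarrow> (LBINT x. D x)"
 proof (rule integral_dominated_convergence[where w="\<lambda>x. C * indicator (cball 0 (R + norm b)) x"])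
  show "integrable lborel (\<lambda>x::'a. C * indicator (cball 0 (R + norm b)) x)"
   using emeasure_bounded_finite[of "cball (0::'a) (R + norm b)"]
   by (intro integrable_mult_right integrable_real_indicator) auto
  show "AE x in lborel. (\<lambda>n. q n x) \<longlonglongrightarrow> D x"
  proof (rule AE_I2)
   fix x
   have "((\<lambda>h. (F (x + h *\<^sub>R b) - F x) / h) \<longlongrightarrow> D x) (at 0)"
    using d[of x 0] unfolding DERIV_def by simp
   moreover have "filterlim (\<lambda>n. inverse (real (Suc n))) (at 0) sequentially"
    unfolding filterlim_at using LIMSEQ_inverse_real_of_nat by auto
   ultimately show "(\<lambda>n. q n x) \<longlonglongrightarrow> D x" unfolding q_def by (rule filterlim_compose)
  qed
  show "AE x in lborel. norm (q n x) \<le> C * indicator (cball 0 (R + norm b)) x" for n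
  proof (rule AE_I2)
   fix x
   define h where "h = inverse (real (Suc n))"
   have h: "0 < h" "h \<le> 1" unfolding h_def by (auto simp: field_simps)
   obtain z where z: "F (x + h *\<^sub>R b) - F (x + 0 *\<^sub>R b) = (h - 0) * D (x + z *\<^sub>R b)"
    using MVT2[OF h(1), of "\<lambda>t. F (x + t *\<^sub>R b)" "\<lambda>t. D (x + t *\<^sub>R b)"] d by blast
   have "q n x = D (x + z *\<^sub>R b)" unfolding q_def h_def[symmetric] using z h by simp
   moreover have "q n x = 0" if "norm x > R + norm b"
   proof -
    have "norm (h *\<^sub>R b) \<le> norm b" using h by (simp add: mult_left_le_one_le)
    moreover have "norm x - norm (h *\<^sub>R b) \<le> norm (x + h *\<^sub>R b)" by (metis norm_diff_ineq)
    ultimately have "norm (x + h *\<^sub>R b) > R" using that by linarith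
    moreover have "norm x > R" using that norm_ge_zero[of b] by linarith
    ultimately have "F (x + h *\<^sub>R b) = 0" "F x = 0" using R(1) by force+
    then show ?thesis unfolding q_def h_def[symmetric] by simp
   qed
   ultimately show "norm (q n x) \<le> C * indicator (cball 0 (R + norm b)) x"
    using C'[of "x + z *\<^sub>R b"] by (cases "norm x > R + norm b") (auto simp: indicator_def)
  qed
  show "q n \<in> borel_measurable lborel" for n unfolding q_def using mF by measurable
 qed (use mD in auto)
 then show "(LBINT x. D x) = 0" unfolding q0 using LIMSEQ_const_iff by metis
qed

lemma C2GL_support:
 assumes f: "C2GL f g l" and b: "bounded {x. f x \<noteq> 0}"
 shows "bounded {x. g x \<noteq> 0}" "bounded {x. l x \<noteq> 0}"
proof -
 obtain H where H: "\<And>x. (f has_derivative (\<lambda>h. g x \<bullet> h)) (at x)"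
   "\<And>x. (g has_derivative blinfun_apply (H x)) (at x)" "continuous_on UNIV H"
   "\<And>x. l x = (\<Sum>b\<in>Basis. H x b \<bullet> b)"
  using f unfolding C2GL_def by auto
 obtain R where R: "{x. f x \<noteq> 0} \<subseteq> cball 0 R" using bounded_subset_cball_zero[OF b] by blast
 have op: "open (- cball (0::'a) R)" by auto
 have g0: "g x = 0" if x: "x \<in> - cball 0 R" for x
 proof -
  have "((\<lambda>_. 0) has_derivative (\<lambda>h. g x \<bullet> h)) (at x)"
   by (rule has_derivative_transform_within_open[OF H(1) op x]) (use R in auto)
  then have "(\<lambda>h. g x \<bullet> h) = (\<lambda>_. 0)"
   using has_derivative_unique has_derivative_const by blast
  then have "g x \<bullet> g x = 0" by metis
  then show ?thesis by simp
 qed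
 have l0: "l x = 0" if x: "x \<in> - cball 0 R" for x
 proof -
  have "((\<lambda>_. 0) has_derivative H x) (at x)"
   by (rule has_derivative_transform_within_open[OF H(2) op x]) (use g0 in auto)
  then have "blinfun_apply (H x) = (\<lambda>_. 0)"
   using has_derivative_unique has_derivative_const by blast
  then show ?thesis using H(4) by simp
 qed
 show "bounded {x. g x \<noteq> 0}" "bounded {x. l x \<noteq> 0}"
  by (rule bounded_subset[OF bounded_cball[of 0 R]], use g0 l0 in force)+
qed

text \<open>Each coordinate of the field \<open>f\<close> times the gradient of \<open>h\<close> has
  a derivative with integral zero. Bounded support of either factor makes this field compactly
  supported.\<close>

lemma Green_identity:
 fixes f h :: "'a::euclidean_space \<Rightarrow> real"
 assumes f: "C2GL f gf lf" and h: "C2GL h gh lh"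
  and b: "bounded {x. f x \<noteq> 0} \<or> bounded {x. h x \<noteq> 0}"
 shows "(LBINT x. f x * lh x + gf x \<bullet> gh x) = 0"
proof -
 obtain H where H: "\<And>x. (gh has_derivative blinfun_apply (H x)) (at x)" "continuous_on UNIV H"
   "\<And>x. lh x = (\<Sum>b\<in>Basis. H x b \<bullet> b)"
  using h unfolding C2GL_def by auto
 note cf = C2GL_D[OF f] and ch = C2GL_D[OF h]
 define D where "D b x = (gf x \<bullet> b) * (gh x \<bullet> b) + f x * (H x b \<bullet> b)" for b x
 have cD: "continuous_on UNIV (D b)" for b
  unfolding D_def by (intro continuous_intros cf ch H)
 have cF: "continuous_on UNIV (\<lambda>x. f x * (gh x \<bullet> b))" for b
  by (intro continuous_intros cf ch H)
 have bF: "bounded {x. f x * (gh x \<bullet> b) \<noteq> 0}" for b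
  using b C2GL_support(1)[OF h] by (elim disjE) (auto elim: bounded_subset)
 have d: "((\<lambda>t. f (x + t *\<^sub>R b) * (gh (x + t *\<^sub>R b) \<bullet> b)) has_real_derivative D b (x + t *\<^sub>R b)) (at t)" for x t b
 proof -
  have 1: "((\<lambda>t. x + t *\<^sub>R b) has_derivative (\<lambda>s. s *\<^sub>R b)) (at t)"
   by (auto intro!: derivative_eq_intros)
  have "((\<lambda>t. gh (x + t *\<^sub>R b) \<bullet> b) has_derivative (\<lambda>s. H (x + t *\<^sub>R b) (s *\<^sub>R b) \<bullet> b)) (at t)"
   by (rule has_derivative_inner_left[OF has_derivative_compose[OF 1 H(1)]])
  then have "((\<lambda>t. gh (x + t *\<^sub>R b) \<bullet> b) has_real_derivative (H (x + t *\<^sub>R b) b \<bullet> b)) (at t)"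
   unfolding has_field_derivative_def
   by (rule has_derivative_eq_rhs) (simp add: fun_eq_iff blinfun.scaleR_right)
  from DERIV_mult[OF has_derivative_grad_line[OF cf(1)] this]
  show ?thesis unfolding D_def by (simp add: algebra_simps)
 qed
 note z = integral_directional_derivative_zero[OF cF cD bF d]
 have iD: "integrable lborel (D b)" for b
  by (rule integrable_continuous_bounded_support[OF cD z(2)])
 have "f x * lh x + gf x \<bullet> gh x = (\<Sum>b\<in>Basis. D b x)" for x
  unfolding D_def H(3) by (simp add: sum.distrib sum_distrib_left euclidean_inner[of "gf x" "gh x"])
 then have "(LBINT x. f x * lh x + gf x \<bullet> gh x) = (LBINT x. (\<Sum>b\<in>Basis. D b x))" by simp
 also have "\<dots> = (\<Sum>b\<in>Basis. LBINT x. D b x)"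
  by (rule bintegral_sum) (rule iD)
 finally show ?thesis using z(1) by simp
qed

lemma integrable_continuous_support_mult:
 fixes f h :: "'a::euclidean_space \<Rightarrow> real"
 assumes "continuous_on UNIV f" "continuous_on UNIV h" "bounded {x. f x \<noteq> 0}"
 shows "integrable lborel (\<lambda>x. f x * h x)"
 by (rule integrable_continuous_bounded_support)
   (auto intro!: continuous_intros assms intro: bounded_subset[OF assms(3)])

section \<open>Mollification\<close>

lemma nn_integral_lborel_translation:
 fixes f :: "'a::euclidean_space \<Rightarrow> ennreal"
 assumes [measurable]: "f \<in> borel_measurable borel"
 shows "(\<integral>\<^sup>+x. f (x + a) \<partial>lborel) = (\<integral>\<^sup>+x. f x \<partial>lborel)"
proof -
 have "(\<integral>\<^sup>+x. f x \<partial>distr lborel borel ((+) a)) = (\<integral>\<^sup>+x. f (a + x) \<partial>lborel)"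
  by (rule nn_integral_distr) auto
 then show ?thesis by (simp add: lborel_distr_plus add.commute)
qed

text \<open>The L^1 modulus of continuity under translation. As a nonnegative integral it is defined
  and subadditive without integrability side conditions.\<close>

definition transl_diff :: "('a::euclidean_space \<Rightarrow> real) \<Rightarrow> 'a \<Rightarrow> ennreal" where
 "transl_diff f h = (\<integral>\<^sup>+x. ennreal \<bar>f (x + h) - f x\<bar> \<partial>lborel)"

text \<open>Translation preserves the L^1 distance, so a good approximant \<open>g\<close> stays
  good after the shift: two approximation errors and the modulus of \<open>g\<close> add up to three
  quarters of \<open>e\<close>.\<close>

lemma transl_diff_approx:
 fixes f :: "'a::euclidean_space \<Rightarrow> real"
 assumes [measurable]: "f \<in> borel_measurable borel"
  and ap: "\<And>e::real. e > 0 \<Longrightarrow> \<exists>g\<in>borel_measurable borel. (\<integral>\<^sup>+x. ennreal \<bar>f x - g x\<bar> \<partial>lborel) \<le> ennreal e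
    \<and> (\<forall>h. h \<longlonglongrightarrow> 0 \<longrightarrow> (\<lambda>n. transl_diff g (h n)) \<longlonglongrightarrow> 0)"
  and h: "h \<longlonglongrightarrow> 0"
 shows "(\<lambda>n. transl_diff f (h n)) \<longlonglongrightarrow> 0"
proof (rule tendsto_zero_ennreal)
 fix e :: real assume e: "e > 0"
 then obtain g where g[measurable]: "g \<in> borel_measurable borel"
  and fg: "(\<integral>\<^sup>+x. ennreal \<bar>f x - g x\<bar> \<partial>lborel) \<le> ennreal (e/4)"
  and gl: "(\<lambda>n. transl_diff g (h n)) \<longlonglongrightarrow> 0" using ap[of "e/4"] h by auto
 have "eventually (\<lambda>n. transl_diff g (h n) < ennreal (e/4)) sequentially"
  using gl e by (intro order_tendstoD) auto
 then show "eventually (\<lambda>n. transl_diff f (h n) < ennreal e) sequentially"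
 proof eventually_elim
  case (elim n)
  have "transl_diff f (h n) \<le> (\<integral>\<^sup>+x. ennreal \<bar>f (x + h n) - g (x + h n)\<bar> + (ennreal \<bar>g (x + h n) - g x\<bar> + ennreal \<bar>f x - g x\<bar>) \<partial>lborel)"
   unfolding transl_diff_def by (intro nn_integral_mono) (auto simp flip: ennreal_plus intro!: ennreal_leI)
  also have "\<dots> = (\<integral>\<^sup>+x. ennreal \<bar>f x - g x\<bar> \<partial>lborel) + (transl_diff g (h n) + (\<integral>\<^sup>+x. ennreal \<bar>f x - g x\<bar> \<partial>lborel))"
   unfolding transl_diff_def using nn_integral_lborel_translation[of "\<lambda>x. ennreal \<bar>f x - g x\<bar>" "h n"]
   by (simp add: nn_integral_add)
  also have "\<dots> \<le> ennreal (e/4) + (ennreal (e/4) + ennreal (e/4))"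
   by (intro add_mono fg) (use elim in simp)
  also have "\<dots> < ennreal e" using e by (simp flip: ennreal_plus add: ennreal_less_iff)
  finally show ?case .
 qed
qed

text \<open>The symmetric difference splits into the points that leave \<open>U\<close> and those
  that enter it. By openness each point of \<open>U\<close> stays inside under small shifts, which
  settles the first half; the second is the first for the opposite shift.\<close>

lemma transl_diff_open:
 fixes U :: "'a::euclidean_space set"
 assumes U: "open U" "emeasure lborel U < \<infinity>" and h: "h \<longlonglongrightarrow> 0"
 shows "(\<lambda>n. transl_diff (indicator U) (h n)) \<longlonglongrightarrow> 0"
proof -
 have [measurable]: "U \<in> sets borel" using U by auto
 define G :: "'a \<Rightarrow> ennreal" where "G k = (\<integral>\<^sup>+x. indicator U x * indicator (- U) (x + k) \<partial>lborel)" for k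
 have Gl: "(\<lambda>n. G (k n)) \<longlonglongrightarrow> 0" if k: "k \<longlonglongrightarrow> 0" for k :: "nat \<Rightarrow> 'a"
 proof -
  have "(\<lambda>n. G (k n)) \<longlonglongrightarrow> (\<integral>\<^sup>+x. 0 \<partial>(lborel :: 'a measure))"
   unfolding G_def
  proof (rule nn_integral_dominated_convergence[where w="indicator U"])
   show "(\<integral>\<^sup>+ x. indicator U x \<partial>lborel) < \<infinity>" using U by simp
   show "AE x in lborel. indicator U x * indicator (- U) (x + k j) \<le> (indicator U x :: ennreal)" for j
    by (auto simp: indicator_def)
   show "AE x in lborel. (\<lambda>i. indicator U x * indicator (- U) (x + k i) :: ennreal) \<longlonglongrightarrow> 0"
   proof (rule AE_I2)
    fix x
    have "eventually (\<lambda>i. x \<in> U \<longrightarrow> x + k i \<in> U) sequentially"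
    proof (cases "x \<in> U")
     case True
     have "(\<lambda>i. x + k i) \<longlonglongrightarrow> x + 0" by (intro tendsto_intros k)
     then show ?thesis using topological_tendstoD[OF _ U(1)] True by fastforce
    qed auto
    then have "eventually (\<lambda>i. (indicator U x * indicator (- U) (x + k i) :: ennreal) = 0) sequentially"
     by eventually_elim (auto simp: indicator_def)
    then show "(\<lambda>i. indicator U x * indicator (- U) (x + k i) :: ennreal) \<longlonglongrightarrow> 0"
     by (rule tendsto_eventually)
   qed
  qed auto
  then show ?thesis by simp
 qed
 have "transl_diff (indicator U) k = G k + G (- k)" for k
 proof -
  have "G (- k) = (\<integral>\<^sup>+x. indicator U (x + k) * indicator (- U) x \<partial>lborel)"
   unfolding G_def using nn_integral_lborel_translation[of "\<lambda>x. indicator U x * indicator (- U) (x + (- k))" k]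
   by simp
  then have "G k + G (- k) = (\<integral>\<^sup>+x. indicator U x * indicator (- U) (x + k) + indicator U (x + k) * indicator (- U) x \<partial>lborel)"
   unfolding G_def by (subst nn_integral_add) auto
  also have "\<dots> = transl_diff (indicator U) k"
   unfolding transl_diff_def by (intro nn_integral_cong) (auto simp: indicator_def)
  finally show ?thesis by simp
 qed
 moreover have "(\<lambda>n. G (h n) + G (- h n)) \<longlonglongrightarrow> 0 + 0"
  by (intro tendsto_add Gl h) (use tendsto_minus[OF h] in simp)
 ultimately show ?thesis by simp
qed

text \<open>Density argument: indicators are approximated by open sets through outer regularity, and
  the property survives sums and dominated limits.\<close>

lemma transl_diff_tendsto_seq:
 fixes f :: "'a::euclidean_space \<Rightarrow> real"
 assumes "integrable lborel f"
 shows "\<forall>h. h \<longlonglongrightarrow> 0 \<longrightarrow> (\<lambda>n. transl_diff f (h n)) \<longlonglongrightarrow> 0"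
 using assms
proof (induction rule: integrable_induct)
 case (base A c)
 have [measurable]: "A \<in> sets borel" using base by simp
 show ?case
 proof (intro allI impI)
  fix h :: "nat \<Rightarrow> 'a" assume h: "h \<longlonglongrightarrow> 0"
  show "(\<lambda>n. transl_diff (\<lambda>x. indicator A x *\<^sub>R c) (h n)) \<longlonglongrightarrow> 0"
  proof (rule transl_diff_approx[OF _ _ h])
   fix e :: real assume e: "e > 0"
   \<comment> \<open>The summand one keeps the quotient meaningful when
     \<open>c = 0\<close>.\<close>
   define d where "d = e / (\<bar>c\<bar> + 1)"
   have d: "d > 0" "\<bar>c\<bar> * d \<le> e" unfolding d_def using e by (auto simp: field_simps)
   obtain U where U: "open U" "A \<subseteq> U" "emeasure lborel (U - A) < d"
    using outer_regular_lborel[of A, OF _ d(1)] by auto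
   have [measurable]: "U \<in> sets borel" using U by auto
   have "emeasure lborel U \<le> emeasure lborel A + emeasure lborel (U - A)"
    by (rule order_trans[OF emeasure_mono emeasure_subadditive]) (use U in auto)
   also have "\<dots> < \<infinity>" using less_trans[OF U(3) ennreal_less_top] base(2) by (simp add: less_top)
   finally have fU: "emeasure lborel U < \<infinity>" .
   show "\<exists>g\<in>borel_measurable borel. (\<integral>\<^sup>+x. ennreal \<bar>indicator A x *\<^sub>R c - g x\<bar> \<partial>lborel) \<le> ennreal e
    \<and> (\<forall>h. h \<longlonglongrightarrow> 0 \<longrightarrow> (\<lambda>n. transl_diff g (h n)) \<longlonglongrightarrow> 0)"
   proof (rule bexI[of _ "\<lambda>x. indicator U x *\<^sub>R c"], intro conjI allI impI)
    have "(\<integral>\<^sup>+x. ennreal \<bar>indicator A x *\<^sub>R c - indicator U x *\<^sub>R c\<bar> \<partial>lborel) = (\<integral>\<^sup>+x. ennreal \<bar>c\<bar> * indicator (U - A) x \<partial>lborel)"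
     by (intro nn_integral_cong) (use U in \<open>auto simp: indicator_def\<close>)
    also have "\<dots> = ennreal \<bar>c\<bar> * emeasure lborel (U - A)"
     by (subst nn_integral_cmult_indicator) auto
    also have "\<dots> \<le> ennreal \<bar>c\<bar> * ennreal d" using U by (intro mult_left_mono) auto
    also have "\<dots> \<le> ennreal e" using d by (simp flip: ennreal_mult add: ennreal_leI)
    finally show "(\<integral>\<^sup>+x. ennreal \<bar>indicator A x *\<^sub>R c - indicator U x *\<^sub>R c\<bar> \<partial>lborel) \<le> ennreal e" .
    fix k :: "nat \<Rightarrow> 'a" assume k: "k \<longlonglongrightarrow> 0"
    have "transl_diff (\<lambda>x. indicator U x *\<^sub>R c) y = ennreal \<bar>c\<bar> * transl_diff (indicator U) y" for y
     unfolding transl_diff_def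
     by (subst nn_integral_cmult[symmetric])
       (auto intro!: nn_integral_cong simp flip: ennreal_mult simp: right_diff_distrib[symmetric] abs_mult mult.commute)
    moreover have "(\<lambda>n. ennreal \<bar>c\<bar> * transl_diff (indicator U) (k n)) \<longlonglongrightarrow> ennreal \<bar>c\<bar> * 0"
     by (intro ennreal_tendsto_cmult transl_diff_open[OF U(1) fU k]) auto
    ultimately show "(\<lambda>n. transl_diff (\<lambda>x. indicator U x *\<^sub>R c) (k n)) \<longlonglongrightarrow> 0" by simp
   qed auto
  qed auto
 qed
next
 case (add f g)
 have [measurable]: "f \<in> borel_measurable borel" "g \<in> borel_measurable borel" using add by auto
 show ?case
 proof (intro allI impI)
  fix h :: "nat \<Rightarrow> 'a" assume h: "h \<longlonglongrightarrow> 0"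
  have le: "transl_diff (\<lambda>x. f x + g x) y \<le> transl_diff f y + transl_diff g y" for y
   unfolding transl_diff_def
   by (subst nn_integral_add[symmetric])
     (auto intro!: nn_integral_mono ennreal_leI simp flip: ennreal_plus)
  have "(\<lambda>n. transl_diff f (h n) + transl_diff g (h n)) \<longlonglongrightarrow> 0 + 0"
   using add.IH(1)[rule_format, OF h] add.IH(2)[rule_format, OF h] by (rule tendsto_add)
  then have lim: "(\<lambda>n. transl_diff f (h n) + transl_diff g (h n)) \<longlonglongrightarrow> 0" by simp
  show "(\<lambda>n. transl_diff (\<lambda>x. f x + g x) (h n)) \<longlonglongrightarrow> 0"
  proof (rule tendsto_sandwich[OF _ _ tendsto_const lim])
   show "\<forall>\<^sub>F n in sequentially. transl_diff (\<lambda>x. f x + g x) (h n) \<le> transl_diff f (h n) + transl_diff g (h n)"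
    by (intro always_eventually allI le)
  qed simp
 qed
next
 case (lim f s)
 have [measurable]: "f \<in> borel_measurable borel" "\<And>i. s i \<in> borel_measurable borel" using lim by auto
 show ?case
 proof (intro allI impI)
  fix h :: "nat \<Rightarrow> 'a" assume h: "h \<longlonglongrightarrow> 0"
  show "(\<lambda>n. transl_diff f (h n)) \<longlonglongrightarrow> 0"
  proof (rule transl_diff_approx[OF _ _ h])
   fix e :: real assume e: "e > 0"
   \<comment> \<open>The approximants of the induction are dominated by
     \<open>2 * \<bar>f\<bar>\<close>, whence the majorant \<open>3 * \<bar>f\<bar>\<close> for the
     differences.\<close>
   have "(\<lambda>i. \<integral>\<^sup>+x. ennreal \<bar>f x - s i x\<bar> \<partial>lborel) \<longlonglongrightarrow> (\<integral>\<^sup>+x. 0 \<partial>(lborel :: 'a measure))"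
   proof (rule nn_integral_dominated_convergence[where w="\<lambda>x. ennreal (3 * \<bar>f x\<bar>)"])
    have "integrable lborel (\<lambda>x. 3 * \<bar>f x\<bar>)" using lim by auto
    from nn_integral_eq_integral[OF this]
    show "(\<integral>\<^sup>+x. ennreal (3 * \<bar>f x\<bar>) \<partial>lborel) < \<infinity>" by auto
    show "AE x in lborel. ennreal \<bar>f x - s j x\<bar> \<le> ennreal (3 * \<bar>f x\<bar>)" for j
    proof (rule AE_I2, rule ennreal_leI)
     fix x show "\<bar>f x - s j x\<bar> \<le> 3 * \<bar>f x\<bar>" using lim.hyps(3)[of x j] by simp
    qed
    show "AE x in lborel. (\<lambda>i. ennreal \<bar>f x - s i x\<bar>) \<longlonglongrightarrow> 0"
    proof (rule AE_I2)
     fix x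
     have "(\<lambda>i. s i x) \<longlonglongrightarrow> f x" using lim.hyps(2) by simp
     then have "(\<lambda>i. ennreal \<bar>f x - s i x\<bar>) \<longlonglongrightarrow> ennreal \<bar>f x - f x\<bar>"
      by (intro tendsto_intros)
     then show "(\<lambda>i. ennreal \<bar>f x - s i x\<bar>) \<longlonglongrightarrow> 0" by simp
    qed
   qed auto
   then have "eventually (\<lambda>i. (\<integral>\<^sup>+x. ennreal \<bar>f x - s i x\<bar> \<partial>lborel) < ennreal e) sequentially"
    using e by (intro order_tendstoD) auto
   then obtain i where "(\<integral>\<^sup>+x. ennreal \<bar>f x - s i x\<bar> \<partial>lborel) < ennreal e"
    by (auto simp: eventually_sequentially)
   then show "\<exists>g\<in>borel_measurable borel. (\<integral>\<^sup>+x. ennreal \<bar>f x - g x\<bar> \<partial>lborel) \<le> ennreal e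
    \<and> (\<forall>h. h \<longlonglongrightarrow> 0 \<longrightarrow> (\<lambda>n. transl_diff g (h n)) \<longlonglongrightarrow> 0)"
    using lim.IH[of i] by (intro bexI[of _ "s i"]) auto
  qed auto
 qed
qed

lemma transl_diff_small:
 fixes f :: "'a::euclidean_space \<Rightarrow> real"
 assumes "integrable lborel f" "e > 0"
 shows "\<exists>d>0. \<forall>h. norm h < d \<longrightarrow> transl_diff f h \<le> ennreal e"
proof (rule ccontr)
 assume "\<not> ?thesis"
 then have "\<forall>n. \<exists>h. norm h < inverse (real (Suc n)) \<and> transl_diff f h > ennreal e"
  by (metis inverse_positive_iff_positive linorder_not_le of_nat_0_less_iff zero_less_Suc)
 then obtain h where h: "\<And>n. norm (h n) < inverse (real (Suc n))" "\<And>n. transl_diff f (h n) > ennreal e"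
  by metis
 have "h \<longlonglongrightarrow> 0"
  by (rule tendsto_norm_zero_cancel, rule tendsto_sandwich[OF _ _ tendsto_const LIMSEQ_inverse_real_of_nat])
    (use h(1) in \<open>auto intro!: eventuallyI less_imp_le simp del: of_nat_Suc\<close>)
 then have "(\<lambda>n. transl_diff f (h n)) \<longlonglongrightarrow> 0" using transl_diff_tendsto_seq[OF assms(1)] by auto
 then have "eventually (\<lambda>n. transl_diff f (h n) < ennreal e) sequentially"
  using assms(2) by (intro order_tendstoD) auto
 then show False using h(2) by (auto simp: eventually_sequentially dest: less_asym)
qed

section \<open>A C^2 bump kernel and the L^1 convergence of mollifications\<close>

lemma has_derivative_pos_part_power:
 "((\<lambda>u::real. (max 0 u) ^ (n + 2)) has_real_derivative real (n + 2) * (max 0 u) ^ (n + 1)) (at u)"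
proof -
 consider "u > 0" | "u < 0" | "u = 0" by linarith
 then show ?thesis
 proof cases
  case 1
  have "((\<lambda>u::real. u ^ (n + 2)) has_real_derivative real (n + 2) * (max 0 u) ^ (n + 1)) (at u)"
   using DERIV_pow[of "n + 2" u] 1 by simp
  then show ?thesis
   by (rule has_field_derivative_transform_within_open[of _ _ _ "{0<..}"]) (use 1 in auto)
 next
  case 2
  have "((\<lambda>u::real. 0) has_real_derivative real (n + 2) * (max 0 u) ^ (n + 1)) (at u)"
   using 2 by (auto intro!: derivative_eq_intros)
  then show ?thesis
   by (rule has_field_derivative_transform_within_open[of _ _ _ "{..<0}"]) (use 2 in auto)
 next
  case 3
  have "((\<lambda>h. (max 0 h) ^ (n + 2) / h) \<longlongrightarrow> 0) (at (0::real))"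
  proof (rule tendsto_rabs_zero_cancel, rule tendsto_sandwich[of "\<lambda>_. 0" _ _ "\<lambda>h. \<bar>h\<bar> ^ (n + 1)"])
   show "((\<lambda>h::real. \<bar>h\<bar> ^ (n + 1)) \<longlongrightarrow> 0) (at 0)"
    by (auto intro!: tendsto_eq_intros)
   show "eventually (\<lambda>h. \<bar>(max 0 h) ^ (n + 2) / h\<bar> \<le> \<bar>h\<bar> ^ (n + 1)) (at (0::real))"
   proof (rule eventually_at_filter[THEN iffD2], rule always_eventually, intro allI impI)
    fix h :: real assume "h \<noteq> 0"
    then show "\<bar>(max 0 h) ^ (n + 2) / h\<bar> \<le> \<bar>h\<bar> ^ (n + 1)"
    proof (cases "h > 0")
     case False
     then have "(max 0 h) ^ (n + 2) / h = 0" by simp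
     then show ?thesis by (simp only: abs_zero) simp
    qed (auto simp: max_def)
   qed
  qed auto
  then show ?thesis using 3 unfolding DERIV_def by simp
 qed
qed

text \<open>The third power is the smallest integer one for which the truncated parabola is C^2, the
  regularity required of test functions. The kernel is not normalised: values in the unit interval
  suit its second role as a cut-off, and \<open>mollify\<close> divides by the mass.\<close>

definition bump :: "real \<Rightarrow> 'a::euclidean_space \<Rightarrow> 'a \<Rightarrow> real" where
 "bump e y x = (max 0 (1 - (norm (x - y))^2 / e^2)) ^ 3"

lemma C2GL_bump:
 "C2GL (bump e y) (\<lambda>x. (- 6 / e^2 * (max 0 (1 - (norm (x - y))^2 / e^2)) ^ 2) *\<^sub>R (x - y))
   (\<lambda>x. - 6 * real DIM('a) / e^2 * (max 0 (1 - (norm (x - y))^2 / e^2)) ^ 2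
    + 24 / e ^ 4 * (norm (x - y))^2 * max 0 (1 - (norm (x - y))^2 / e^2))"
 if e: "e > 0" for y :: "'a::euclidean_space"
proof -
 have d1: "((\<lambda>s. (max 0 (1 - s / e^2)) ^ 3) has_real_derivative (- 3 / e^2) * (max 0 (1 - s / e^2)) ^ 2) (at s)" for s
 proof -
  have "((\<lambda>u::real. (max 0 u) ^ 3) has_real_derivative 3 * (max 0 u) ^ 2) (at u)" for u
   using has_derivative_pos_part_power[of 1 u] by (simp add: numeral_3_eq_3 numeral_2_eq_2)
  moreover have "((\<lambda>s. 1 - s / e^2) has_real_derivative - 1 / e^2) (at s)"
   by (rule DERIV_cong[OF DERIV_diff[OF DERIV_const DERIV_cdivide[OF DERIV_ident]]]) simp
  ultimately have "((\<lambda>s. (max 0 (1 - s / e^2)) ^ 3) has_real_derivative 3 * (max 0 (1 - s / e^2)) ^ 2 * (- 1 / e^2)) (at s)"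
   by (rule DERIV_chain2)
  then show ?thesis by simp
 qed
 have d2: "((\<lambda>s. (- 3 / e^2) * (max 0 (1 - s / e^2)) ^ 2) has_real_derivative (6 / e ^ 4) * max 0 (1 - s / e^2)) (at s)" for s
 proof -
  have 1: "((\<lambda>u::real. (max 0 u) ^ 2) has_real_derivative 2 * max 0 u) (at u)" for u
   using has_derivative_pos_part_power[of 0 u] by (simp add: numeral_2_eq_2)
  have 2: "((\<lambda>s. 1 - s / e^2) has_real_derivative - 1 / e^2) (at s)"
   by (rule DERIV_cong[OF DERIV_diff[OF DERIV_const DERIV_cdivide[OF DERIV_ident]]]) simp
  have "(- 3 / e^2) * (2 * max 0 (1 - s / e^2) * (- 1 / e^2)) = (6 / e ^ 4) * max 0 (1 - s / e^2)"
   using e by (simp add: field_simps eval_nat_numeral)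
  then show ?thesis using DERIV_cmult[OF DERIV_chain2[OF 1 2], of "- 3 / e^2"] by metis
 qed
 show ?thesis
  unfolding bump_def
 proof (rule C2GL_cong[OF C2GL_compose[OF C2GL_dist_sq[of y], of UNIV "\<lambda>s. (max 0 (1 - s / e^2)) ^ 3"
    "\<lambda>s. (- 3 / e^2) * (max 0 (1 - s / e^2)) ^ 2" "\<lambda>s. (6 / e ^ 4) * max 0 (1 - s / e^2)"]])
  show "continuous_on UNIV (\<lambda>s. 6 / e ^ 4 * max 0 (1 - s / e^2))"
   using e by (auto intro!: continuous_intros)
  fix x
  have "(2 *\<^sub>R (x - y)) \<bullet> (2 *\<^sub>R (x - y)) = 4 * (norm (x - y))^2"
   by (simp only: power2_norm_eq_inner inner_scaleR_left inner_scaleR_right)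
  then show "- 6 * real DIM('a) / e^2 * (max 0 (1 - (norm (x - y))^2 / e^2))^2
    + 24 / e ^ 4 * (norm (x - y))^2 * max 0 (1 - (norm (x - y))^2 / e^2) =
    - 3 / e^2 * (max 0 (1 - (norm (x - y))^2 / e^2))^2 * (2 * real DIM('a)) +
     6 / e ^ 4 * max 0 (1 - (norm (x - y))^2 / e^2) * ((2 *\<^sub>R (x - y)) \<bullet> (2 *\<^sub>R (x - y)))"
   by (simp only:) (simp add: ac_simps)
 qed (use d1 d2 in auto)
qed

lemma bump_nonneg: "bump e y x \<ge> 0" unfolding bump_def by simp
lemma bump_le_1: "bump e y x \<le> 1" unfolding bump_def by (rule power_le_one) auto
lemma bump_commute: "bump e y x = bump e x y" unfolding bump_def by (simp add: norm_minus_commute)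
lemma bump_shift: "bump e y x = bump e 0 (x - y)" unfolding bump_def by simp
lemma bump_shift': "bump e y x = bump e 0 (y - x)" unfolding bump_def by (simp add: norm_minus_commute)
lemma bump_eq_0: "e > 0 \<Longrightarrow> norm (x - y) \<ge> e \<Longrightarrow> bump e y x = 0"
 unfolding bump_def by (simp add: power_mono field_simps)
lemma continuous_on_bump [continuous_intros]:
 assumes "continuous_on S f" "continuous_on S g"
 shows "continuous_on S (\<lambda>x. bump e (f x) (g x))"
 unfolding bump_def by (cases "e = 0") (auto intro!: continuous_intros assms)

lemma bump_measurable [measurable (raw)]:
 assumes [measurable]: "f \<in> borel_measurable M" "g \<in> borel_measurable M"
 shows "(\<lambda>x. bump e (f x) (g x)) \<in> borel_measurable M"
 unfolding bump_def by measurable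

lemma bounded_bump: assumes "e > 0" shows "bounded {x. bump e y x \<noteq> 0}"
proof (rule bounded_subset[OF bounded_ball[of y e]], safe)
 fix x assume "bump e y x \<noteq> 0"
 then have "\<not> norm (x - y) \<ge> e" using bump_eq_0[OF assms] by auto
 then show "x \<in> ball y e" by (simp add: dist_norm norm_minus_commute)
qed

lemma integrable_bump: "e > 0 \<Longrightarrow> integrable lborel (bump e y)"
 by (rule integrable_continuous_bounded_support[OF _ bounded_bump]) (auto intro!: continuous_intros)

definition bump_mass :: "'a::euclidean_space itself \<Rightarrow> real \<Rightarrow> real" where
 "bump_mass _ e = (LBINT x. bump e (0::'a) x)"

lemma bump_mass_shift:
 "(LBINT x. bump e y x) = bump_mass TYPE('a) e" "(LBINT y. bump e y x) = bump_mass TYPE('a) e"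
 for x y :: "'a::euclidean_space"
 using integrable_lborel_translation(2)[of "bump e 0" "- y"] integrable_lborel_translation(2)[of "bump e 0" "- x"]
 unfolding bump_mass_def by (simp_all add: bump_shift[of e y] bump_shift'[of e _ x] )

text \<open>At distance at most \<open>e / 2\<close> the bump is at least
  \<open>(3/4)^3 = 27/64\<close>, and by the l1 bound on the norm the cube with half side
  \<open>e / (2 n)\<close> lies in that ball. The order \<open>e ^ DIM\<close> is what the local
  mean value estimate needs.\<close>

lemma bump_mass_ge:
 assumes "e > 0"
 shows "bump_mass TYPE('a::euclidean_space) e \<ge> 27/64 * (e / real DIM('a)) ^ DIM('a)"
proof -
 define n where "n = real DIM('a)"
 have n: "n > 0" unfolding n_def by simp
 define v :: 'a where "v = (e / (2 * n)) *\<^sub>R One"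
 have "norm x \<le> e / 2" if x: "x \<in> cbox (- v) v" for x
 proof -
  have "norm x \<le> (\<Sum>b\<in>Basis. \<bar>x \<bullet> b\<bar>)" by (rule norm_le_l1)
  also have "\<dots> \<le> (\<Sum>b\<in>(Basis::'a set). e / (2 * n))"
   by (rule sum_mono) (use x in \<open>auto simp: v_def mem_box inner_Basis abs_le_iff\<close>)
  also have "\<dots> = e / 2" using n unfolding n_def by simp
  finally show ?thesis .
 qed
 then have b: "27/64 * indicator (cbox (- v) v) x \<le> bump e 0 x" for x
 proof (cases "x \<in> cbox (- v) v")
  case True
  then have "norm x \<le> e / 2" using \<open>\<And>x. x \<in> cbox (- v) v \<Longrightarrow> norm x \<le> e / 2\<close> by auto
  then have "(norm x)^2 \<le> (e/2)^2" by (intro power_mono) auto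
  then have "(norm x)^2 / e^2 \<le> 1/4" using assms by (simp add: field_simps power2_eq_square)
  then have "3/4 \<le> 1 - (norm x)^2 / e^2" by simp
  also have "\<dots> \<le> max 0 (1 - (norm x)^2 / e^2)" by simp
  finally have "(3/4) ^ 3 \<le> (max 0 (1 - (norm x)^2 / e^2)) ^ 3" by (rule power_mono) simp
  moreover have "(3/4) ^ 3 = (27/64 :: real)" by (simp add: power3_eq_cube)
  ultimately have "27/64 \<le> bump e 0 x" unfolding bump_def by (simp only: diff_0_right)
  then show ?thesis using True by simp
 qed (auto simp: bump_nonneg)
 have em: "emeasure lborel (cbox (- v) v) = ennreal ((e / n) ^ DIM('a))"
 proof (subst emeasure_lborel_cbox)
  fix b :: 'a assume b: "b \<in> Basis"
  show "- v \<bullet> b \<le> v \<bullet> b" using assms n b by (simp add: v_def)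
 next
  have "(\<Prod>b\<in>Basis. (v - - v) \<bullet> b) = (\<Prod>b\<in>(Basis :: 'a set). e / n)"
   by (rule prod.cong) (use n in \<open>auto simp: v_def inner_add_left field_simps\<close>)
  then show "ennreal (\<Prod>b\<in>Basis. (v - - v) \<bullet> b) = ennreal ((e / n) ^ DIM('a))" by simp
 qed
 have "(LBINT x. 27/64 * indicator (cbox (- v) v) x) \<le> (LBINT x. bump e (0::'a) x)"
  by (rule integral_mono) (use b em integrable_bump[OF assms] in auto)
 moreover have "measure lborel (cbox (- v) v) = (e / n) ^ DIM('a)"
  using em assms n by (simp add: measure_def)
 ultimately show ?thesis unfolding bump_mass_def n_def by simp
qed

lemma bump_mass_pos: "e > 0 \<Longrightarrow> bump_mass TYPE('a::euclidean_space) e > 0"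
 by (rule less_le_trans[OF _ bump_mass_ge]) auto

definition mollify :: "real \<Rightarrow> ('a::euclidean_space \<Rightarrow> real) \<Rightarrow> 'a \<Rightarrow> real" where
 "mollify e f x = (LBINT y. f y * bump e y x) / bump_mass TYPE('a) e"

lemma integrable_mult_bump:
 assumes "integrable lborel f"
 shows "integrable lborel (\<lambda>y. f y * bump e y x)"
proof (rule bintegrable_bound[OF assms])
 show "(\<lambda>y. f y * bump e y x) \<in> borel_measurable lborel" using assms by measurable
 show "AE y in lborel. norm (f y * bump e y x) \<le> norm (f y)"
  by (auto simp: abs_mult bump_nonneg bump_le_1 intro!: mult_left_le)
qed

lemma mollify_measurable [measurable]:
 assumes [measurable]: "f \<in> borel_measurable borel"
 shows "mollify e f \<in> borel_measurable borel"
 unfolding mollify_def by measurable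

text \<open>A mollification is an average of translates, so its distance to \<open>f\<close> is at
  most the average of \<open>transl_diff\<close> over shifts shorter than \<open>e\<close>;
  exchanging the two integrals makes this precise.\<close>

lemma mollify_L1:
 fixes f :: "'a::euclidean_space \<Rightarrow> real"
 assumes f: "integrable lborel f" and ep: "\<And>n. ep n > 0" "ep \<longlonglongrightarrow> 0"
 shows "(\<lambda>n. \<integral>\<^sup>+x. ennreal \<bar>mollify (ep n) f x - f x\<bar> \<partial>lborel) \<longlonglongrightarrow> 0"
proof (rule tendsto_zero_ennreal)
 fix r :: real assume r: "r > 0"
 have [measurable]: "f \<in> borel_measurable borel" using f by auto
 obtain d where d: "d > 0" "\<And>h. norm h < d \<Longrightarrow> transl_diff f h \<le> ennreal (r/2)"
  using transl_diff_small[OF f, of "r/2"] r by auto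
 have "eventually (\<lambda>n. ep n < d) sequentially" using ep d by (intro order_tendstoD) auto
 then show "eventually (\<lambda>n. (\<integral>\<^sup>+x. ennreal \<bar>mollify (ep n) f x - f x\<bar> \<partial>lborel) < ennreal r) sequentially"
 proof eventually_elim
  case (elim n)
  define e where "e = ep n"
  define m where "m = bump_mass TYPE('a) e"
  have e: "e > 0" "e < d" unfolding e_def using ep elim by auto
  have m: "m > 0" unfolding m_def by (rule bump_mass_pos[OF e(1)])
  have ibump: "integrable lborel (\<lambda>y. bump e y x)" for x :: 'a
   using integrable_bump[OF e(1), of x] by (simp add: bump_commute[of e _ x])
  have 1: "ennreal \<bar>mollify e f x - f x\<bar> \<le> ennreal (1/m) * (\<integral>\<^sup>+y. ennreal (bump e y x * \<bar>f y - f x\<bar>) \<partial>lborel)" for x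
  proof -
   have "mollify e f x - f x = (1/m) * (LBINT y. f y * bump e y x - f x * bump e y x)"
    unfolding mollify_def m_def[symmetric]
    using integrable_mult_bump[OF f, of e x] ibump[of x] m bump_mass_shift(2)[of e x, folded m_def]
    by (simp add: bintegral_diff field_simps)
   also have "(LBINT y. f y * bump e y x - f x * bump e y x) = (LBINT y. bump e y x * (f y - f x))"
    by (simp add: algebra_simps)
   finally have "ennreal \<bar>mollify e f x - f x\<bar> = ennreal (1/m) * ennreal (norm (LBINT y. bump e y x * (f y - f x)))"
    using m by (simp add: abs_mult ennreal_mult del: times_divide_eq_left)
   also have "ennreal (norm (LBINT y. bump e y x * (f y - f x))) \<le> (\<integral>\<^sup>+y. norm (bump e y x * (f y - f x)) \<partial>lborel)"
   proof (rule integral_norm_bound_ennreal)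
    have "integrable lborel (\<lambda>y. f y * bump e y x - f x * bump e y x)"
     using integrable_mult_bump[OF f, of e x] ibump[of x] by auto
    then show "integrable lborel (\<lambda>y. bump e y x * (f y - f x))" by (simp add: algebra_simps)
   qed
   finally show ?thesis by (simp add: abs_mult bump_nonneg mult_left_mono)
  qed
  have "(\<integral>\<^sup>+x. ennreal \<bar>mollify e f x - f x\<bar> \<partial>lborel) \<le> (\<integral>\<^sup>+x. ennreal (1/m) * (\<integral>\<^sup>+y. ennreal (bump e y x * \<bar>f y - f x\<bar>) \<partial>lborel) \<partial>lborel)"
   by (rule nn_integral_mono) (rule 1)
  also have "\<dots> = ennreal (1/m) * (\<integral>\<^sup>+x. (\<integral>\<^sup>+y. ennreal (bump e y x * \<bar>f y - f x\<bar>) \<partial>lborel) \<partial>lborel)"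
   by (rule nn_integral_cmult) measurable
  also have "(\<integral>\<^sup>+x. (\<integral>\<^sup>+y. ennreal (bump e y x * \<bar>f y - f x\<bar>) \<partial>lborel) \<partial>lborel)
    = (\<integral>\<^sup>+x. (\<integral>\<^sup>+h. ennreal (bump e 0 h * \<bar>f (x + h) - f x\<bar>) \<partial>lborel) \<partial>lborel)"
  proof (rule nn_integral_cong)
   fix x
   show "(\<integral>\<^sup>+y. ennreal (bump e y x * \<bar>f y - f x\<bar>) \<partial>lborel) = (\<integral>\<^sup>+h. ennreal (bump e 0 h * \<bar>f (x + h) - f x\<bar>) \<partial>lborel)"
    using nn_integral_lborel_translation[of "\<lambda>y. ennreal (bump e y x * \<bar>f y - f x\<bar>)" x]
    by (simp add: bump_shift'[of e "_ + x"] add.commute)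
  qed
  also have "\<dots> = (\<integral>\<^sup>+h. (\<integral>\<^sup>+x. ennreal (bump e 0 h * \<bar>f (x + h) - f x\<bar>) \<partial>lborel) \<partial>lborel)"
   by (rule lborel_pair.Fubini'[symmetric]) measurable
  also have "\<dots> = (\<integral>\<^sup>+h. ennreal (bump e 0 h) * transl_diff f h \<partial>lborel)"
   unfolding transl_diff_def
   by (intro nn_integral_cong) (simp add: ennreal_mult bump_nonneg nn_integral_cmult)
  also have "\<dots> \<le> (\<integral>\<^sup>+h. ennreal (bump e (0::'a) h) * ennreal (r/2) \<partial>lborel)"
  proof (rule nn_integral_mono)
   fix h :: 'a
   show "ennreal (bump e 0 h) * transl_diff f h \<le> ennreal (bump e 0 h) * ennreal (r/2)"
    using d(2)[of h] e bump_eq_0[OF e(1), of h 0] by (cases "norm h < e") (auto intro: mult_left_mono)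
  qed
  also have "\<dots> = ennreal m * ennreal (r/2)"
   unfolding m_def bump_mass_def
   by (simp add: nn_integral_multc nn_integral_eq_integral[OF integrable_bump[OF e(1)]] bump_nonneg)
  finally have "(\<integral>\<^sup>+x. ennreal \<bar>mollify e f x - f x\<bar> \<partial>lborel) \<le> ennreal (1/m) * (ennreal m * ennreal (r/2))"
   by (simp add: mult_left_mono)
  also have "\<dots> = ennreal (r/2)" using m r by (simp flip: ennreal_mult)
  also have "\<dots> < ennreal r" using r by (simp add: ennreal_less_iff)
  finally show ?case unfolding e_def .
 qed
qed

section \<open>Kato's inequality\<close>

lemma continuous_bounded_support_bound:
 fixes f :: "'a::euclidean_space \<Rightarrow> real"
 assumes "continuous_on UNIV f" "bounded {x. f x \<noteq> 0}"
 shows "\<exists>C>0. \<forall>x. \<bar>f x\<bar> \<le> C"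
proof -
 obtain R where R: "{x. f x \<noteq> 0} \<subseteq> cball 0 R" using bounded_subset_cball_zero[OF assms(2)] by blast
 have "bounded (f ` cball 0 R)"
  by (intro compact_imp_bounded compact_continuous_image continuous_on_subset[OF assms(1)]) auto
 then obtain C where C: "C > 0" "\<And>x. x \<in> cball 0 R \<Longrightarrow> \<bar>f x\<bar> \<le> C" unfolding bounded_pos by force
 have "\<bar>f x\<bar> \<le> C" for x
  using C R by (cases "x \<in> cball 0 R") force+
 then show ?thesis using C(1) by blast
qed

lemma norm_integral_le_integral:
 fixes f g :: "'a \<Rightarrow> real"
 assumes "integrable M f" "integrable M g" "\<And>x. norm (f x) \<le> g x"
 shows "norm (\<integral>x. f x \<partial>M) \<le> (\<integral>x. g x \<partial>M)"
 using order_trans[OF integral_norm_bound integral_mono[OF integrable_norm[OF assms(1)] assms(2,3)]] .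

lemma norm_mult_le_right: "\<bar>b::real\<bar> \<le> C \<Longrightarrow> norm (a * b) \<le> C * \<bar>a\<bar>"
 by (simp add: abs_mult mult.commute[of C] mult_left_mono)

lemma continuous_convolution:
 fixes v G :: "'a::euclidean_space \<Rightarrow> real"
 assumes v: "integrable lborel v" and G: "continuous_on UNIV G" "\<And>x. \<bar>G x\<bar> \<le> C"
 shows "continuous_on UNIV (\<lambda>x. LBINT y. v y * G (x - y))"
proof (rule continuous_on_sequentiallyI)
 fix u :: "nat \<Rightarrow> 'a" and a assume u: "u \<longlonglongrightarrow> a"
 have [measurable]: "G \<in> borel_measurable borel" using G(1) by (rule borel_measurable_continuous_onI)
 have [measurable]: "v \<in> borel_measurable borel" using v by auto
 show "(\<lambda>n. LBINT y. v y * G (u n - y)) \<longlonglongrightarrow> (LBINT y. v y * G (a - y))"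
 proof (rule integral_dominated_convergence[where w="\<lambda>y. C * \<bar>v y\<bar>"])
  show "integrable lborel (\<lambda>y. C * \<bar>v y\<bar>)" using v by auto
  show "AE y in lborel. norm (v y * G (u n - y)) \<le> C * \<bar>v y\<bar>" for n
   by (intro AE_I2 norm_mult_le_right G)
  show "AE y in lborel. (\<lambda>n. v y * G (u n - y)) \<longlonglongrightarrow> v y * G (a - y)"
  proof (rule AE_I2)
   fix y
   have "(\<lambda>n. G (u n - y)) \<longlonglongrightarrow> G (a - y)"
    by (rule continuous_on_tendsto_compose[OF G(1)]) (auto intro!: tendsto_intros u)
   then show "(\<lambda>n. v y * G (u n - y)) \<longlonglongrightarrow> v y * G (a - y)" by (intro tendsto_intros)
  qed
 qed auto
qed

text \<open>The derivative falls on the kernel. Quotients are bounded by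
  \<open>C * \<bar>v\<bar>\<close> through the mean value inequality, so mere integrability of
  \<open>v\<close> provides the majorant.\<close>

lemma has_derivative_convolution:
 fixes v F D :: "'a::euclidean_space \<Rightarrow> real"
 assumes v: "integrable lborel v" and F: "continuous_on UNIV F" "\<And>x. \<bar>F x\<bar> \<le> C0"
  and D: "continuous_on UNIV D" "\<And>x. \<bar>D x\<bar> \<le> C"
  and d: "\<And>x t. ((\<lambda>t. F (x + t *\<^sub>R b)) has_real_derivative D (x + t *\<^sub>R b)) (at t)"
 shows "((\<lambda>t. LBINT y. v y * F (x + t *\<^sub>R b - y)) has_real_derivative
   (LBINT y. v y * D (x + t *\<^sub>R b - y))) (at t)"
 unfolding DERIV_def tendsto_at_iff_sequentially
proof (intro allI impI)
 fix h :: "nat \<Rightarrow> real" assume h0: "\<forall>i. h i \<in> UNIV - {0}" and h: "h \<longlonglongrightarrow> 0"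
 have [measurable]: "F \<in> borel_measurable borel" "D \<in> borel_measurable borel"
  using F(1) D(1) by (auto intro: borel_measurable_continuous_onI)
 have [measurable]: "v \<in> borel_measurable borel" using v by auto
 have iF: "integrable lborel (\<lambda>y. v y * F (z - y))" for z
 proof (rule bintegrable_bound[of _ "\<lambda>y. C0 * \<bar>v y\<bar>"])
  show "AE y in lborel. norm (v y * F (z - y)) \<le> norm (C0 * \<bar>v y\<bar>)"
  proof (rule AE_I2)
   fix y show "norm (v y * F (z - y)) \<le> norm (C0 * \<bar>v y\<bar>)"
    using norm_mult_le_right[OF F(2), of "v y" "z - y"] by simp
  qed
 qed (use v in auto)
 define q where "q n y = v y * ((F (x + (t + h n) *\<^sub>R b - y) - F (x + t *\<^sub>R b - y)) / h n)" for n y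
 have e: "((LBINT y. v y * F (x + (t + h n) *\<^sub>R b - y)) - (LBINT y. v y * F (x + t *\<^sub>R b - y))) / h n
    = (LBINT y. q n y)" for n
  unfolding q_def using bintegral_diff[OF iF iF, symmetric]
  by (simp add: right_diff_distrib[symmetric])
 have "(\<lambda>n. LBINT y. q n y) \<longlonglongrightarrow> (LBINT y. v y * D (x + t *\<^sub>R b - y))"
 proof (rule integral_dominated_convergence[where w="\<lambda>y. C * \<bar>v y\<bar>"])
  show "integrable lborel (\<lambda>y. C * \<bar>v y\<bar>)" using v by auto
  show "AE y in lborel. norm (q n y) \<le> C * \<bar>v y\<bar>" for n
  proof (rule AE_I2)
   fix y
   have "\<bar>F ((x - y) + (t + h n) *\<^sub>R b) - F ((x - y) + t *\<^sub>R b)\<bar> \<le> C * \<bar>(t + h n) - t\<bar>"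
    using field_differentiable_bound[of UNIV "\<lambda>s. F ((x - y) + s *\<^sub>R b)" "\<lambda>s. D ((x - y) + s *\<^sub>R b)" C "t + h n" t]
     d D(2) by auto
   moreover have "(x - y) + s *\<^sub>R b = x + s *\<^sub>R b - y" for s by simp
   ultimately have "\<bar>F (x + (t + h n) *\<^sub>R b - y) - F (x + t *\<^sub>R b - y)\<bar> \<le> C * \<bar>h n\<bar>"
    by (simp only:) simp
   then have "\<bar>(F (x + (t + h n) *\<^sub>R b - y) - F (x + t *\<^sub>R b - y)) / h n\<bar> \<le> C"
    using h0 by (simp only: abs_divide) (simp add: pos_divide_le_eq)
   then show "norm (q n y) \<le> C * \<bar>v y\<bar>"
    unfolding q_def by (simp add: abs_mult mult.commute[of C] mult_left_mono del: times_divide_eq_right)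
  qed
  show "AE y in lborel. (\<lambda>n. q n y) \<longlonglongrightarrow> v y * D (x + t *\<^sub>R b - y)"
  proof (rule AE_I2)
   fix y
   have "((\<lambda>k. (F ((x - y) + (t + k) *\<^sub>R b) - F ((x - y) + t *\<^sub>R b)) / k) \<longlongrightarrow> D ((x - y) + t *\<^sub>R b)) (at 0)"
    using d[of "x - y" t] unfolding DERIV_def .
   then have "(\<lambda>n. (F ((x - y) + (t + h n) *\<^sub>R b) - F ((x - y) + t *\<^sub>R b)) / h n) \<longlonglongrightarrow> D ((x - y) + t *\<^sub>R b)"
    using h h0 unfolding tendsto_at_iff_sequentially comp_def by auto
   then show "(\<lambda>n. q n y) \<longlonglongrightarrow> v y * D (x + t *\<^sub>R b - y)"
    unfolding q_def by (intro tendsto_mult tendsto_const) (simp add: algebra_simps)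
  qed
  show "q n \<in> borel_measurable lborel" for n unfolding q_def by measurable
 qed auto
 then show "((\<lambda>h. ((LBINT y. v y * F (x + (t + h) *\<^sub>R b - y)) - (LBINT y. v y * F (x + t *\<^sub>R b - y))) / h) \<circ> h)
   \<longlonglongrightarrow> (LBINT y. v y * D (x + t *\<^sub>R b - y))"
  unfolding comp_def e .
qed

text \<open>Meant for functions known to be twice differentiable only along coordinate directions,
  the form in which mollifications are available. For each \<open>b\<close> the function
  \<open>f V1 - (gf \<bullet> b) v\<close> has as derivative the \<open>b\<close>-th summand of the
  difference of the two integrands, and that derivative integrates to zero.\<close>

lemma integral_laplacian_directional:
 fixes V1 V2 :: "'a::euclidean_space \<Rightarrow> 'a \<Rightarrow> real"
  and f v :: "'a \<Rightarrow> real"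
 assumes f: "C2GL f gf lf" and b: "bounded {x. f x \<noteq> 0}"
  and v: "continuous_on UNIV v" "\<And>b. b \<in> Basis \<Longrightarrow> continuous_on UNIV (V1 b)"
    "\<And>b. b \<in> Basis \<Longrightarrow> continuous_on UNIV (V2 b)"
  and d1: "\<And>b x t. b \<in> Basis \<Longrightarrow> ((\<lambda>t. v (x + t *\<^sub>R b)) has_real_derivative V1 b (x + t *\<^sub>R b)) (at t)"
  and d2: "\<And>b x t. b \<in> Basis \<Longrightarrow> ((\<lambda>t. V1 b (x + t *\<^sub>R b)) has_real_derivative V2 b (x + t *\<^sub>R b)) (at t)"
 shows "(LBINT x. f x * (\<Sum>b\<in>Basis. V2 b x)) = (LBINT x. lf x * v x)"
proof -
 obtain H where H: "\<And>x. (gf has_derivative blinfun_apply (H x)) (at x)" "continuous_on UNIV H"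
   "\<And>x. lf x = (\<Sum>b\<in>Basis. H x b \<bullet> b)"
  using f unfolding C2GL_def by auto
 note cf = C2GL_D[OF f] and s = C2GL_support[OF f b]
 have i1: "integrable lborel (\<lambda>x. f x * (\<Sum>b\<in>Basis. V2 b x))"
  by (rule integrable_continuous_support_mult[OF cf(2) _ b]) (auto intro!: continuous_intros v)
 have i2: "integrable lborel (\<lambda>x. lf x * v x)"
  by (rule integrable_continuous_support_mult[OF cf(4) v(1) s(2)])
 define D where "D b x = f x * V2 b x - (H x b \<bullet> b) * v x" for b x
 have D: "(LBINT x. D b x) = 0 \<and> bounded {x. D b x \<noteq> 0} \<and> continuous_on UNIV (D b)" if B: "b \<in> Basis" for b
 proof -
  have cF: "continuous_on UNIV (\<lambda>x. f x * V1 b x - (gf x \<bullet> b) * v x)"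
   by (intro continuous_intros cf v B)
  have cD: "continuous_on UNIV (D b)"
   unfolding D_def by (intro continuous_intros cf v B H)
  have bF: "bounded {x. f x * V1 b x - (gf x \<bullet> b) * v x \<noteq> 0}"
   by (rule bounded_subset[OF bounded_Un[THEN iffD2, OF conjI[OF b s(1)]]]) auto
  have d: "((\<lambda>t. f (x + t *\<^sub>R b) * V1 b (x + t *\<^sub>R b) - (gf (x + t *\<^sub>R b) \<bullet> b) * v (x + t *\<^sub>R b))
    has_real_derivative D b (x + t *\<^sub>R b)) (at t)" for x t
  proof -
   have 1: "((\<lambda>t. x + t *\<^sub>R b) has_derivative (\<lambda>s. s *\<^sub>R b)) (at t)"
    by (auto intro!: derivative_eq_intros)
   have "((\<lambda>t. gf (x + t *\<^sub>R b) \<bullet> b) has_derivative (\<lambda>s. H (x + t *\<^sub>R b) (s *\<^sub>R b) \<bullet> b)) (at t)"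
    by (rule has_derivative_inner_left[OF has_derivative_compose[OF 1 H(1)]])
   then have 2: "((\<lambda>t. gf (x + t *\<^sub>R b) \<bullet> b) has_real_derivative (H (x + t *\<^sub>R b) b \<bullet> b)) (at t)"
    unfolding has_field_derivative_def
    by (rule has_derivative_eq_rhs) (simp add: fun_eq_iff blinfun.scaleR_right)
   from DERIV_diff[OF DERIV_mult[OF has_derivative_grad_line[where x=x and t=t and b=b, OF cf(1)] d2[OF B, of x t]] DERIV_mult[OF 2 d1[OF B, of x t]]]
   show ?thesis unfolding D_def by (simp add: algebra_simps)
  qed
  show ?thesis using integral_directional_derivative_zero[OF cF cD bF d] cD by auto
 qed
 have iD: "integrable lborel (D b)" if "b \<in> Basis" for b
  using D[OF that] by (auto intro: integrable_continuous_bounded_support)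
 have "(LBINT x. f x * (\<Sum>b\<in>Basis. V2 b x) - lf x * v x) = (LBINT x. (\<Sum>b\<in>Basis. D b x))"
  unfolding D_def H(3) by (simp add: sum_subtractf sum_distrib_left sum_distrib_right)
 also have "\<dots> = 0" by (subst bintegral_sum[OF iD]) (use D in auto)
 finally show ?thesis using i1 i2 by (simp add: bintegral_diff)
qed

lemma integrable_loc_mult:
 fixes v c :: "'a::euclidean_space \<Rightarrow> real"
 assumes li: "\<And>R. integrable lborel (\<lambda>x. indicator (cball 0 R) x * v x)"
  and [measurable]: "c \<in> borel_measurable borel" and b: "bounded {x. c x \<noteq> 0}" and C: "\<And>x. \<bar>c x\<bar> \<le> C"
 shows "integrable lborel (\<lambda>x. v x * c x)"
proof -
 obtain R where R: "{x. c x \<noteq> 0} \<subseteq> cball 0 R" using bounded_subset_cball_zero[OF b] by blast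
 have [measurable]: "(\<lambda>x. indicator (cball 0 R) x * v x) \<in> borel_measurable lborel" using li by auto
 have e: "(\<lambda>x. v x * c x) = (\<lambda>x. c x * (indicator (cball 0 R) x * v x))"
  using R by (auto simp: fun_eq_iff indicator_def)
 show ?thesis unfolding e
 proof (rule bintegrable_bound[of _ "\<lambda>x. C * (indicator (cball 0 R) x * v x)"])
  show "integrable lborel (\<lambda>x. C * (indicator (cball 0 R) x * v x))" using li by auto
  show "AE x in lborel. norm (c x * (indicator (cball 0 R) x * v x)) \<le> norm (C * (indicator (cball 0 R) x * v x))"
   using C order_trans[OF abs_ge_zero C] by (intro AE_I2) (simp only: norm_mult, intro mult_right_mono, auto)
 qed measurable
qed

text \<open>Both derivatives are moved to the bump. The last clause is the point: the Laplacian of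
  the mollification at \<open>x\<close> is \<open>v\<close> tested with the Laplacian of the bump
  centred at \<open>x\<close>, so a weak equation for \<open>v\<close> becomes a pointwise
  one.\<close>

lemma mollify_directional:
 fixes v :: "'a::euclidean_space \<Rightarrow> real"
 assumes v: "integrable lborel v" and e: "e > 0"
 obtains D1 D2 where "continuous_on UNIV (mollify e v)" "\<And>b. continuous_on UNIV (D1 b)" "\<And>b. continuous_on UNIV (D2 b)"
  "\<And>b x t. ((\<lambda>t. mollify e v (x + t *\<^sub>R b)) has_real_derivative D1 b (x + t *\<^sub>R b)) (at t)"
  "\<And>b x t. ((\<lambda>t. D1 b (x + t *\<^sub>R b)) has_real_derivative D2 b (x + t *\<^sub>R b)) (at t)"
  "\<And>x. (\<Sum>b\<in>Basis. D2 b x) = (LBINT y. v y * laplacian (bump e x) y) / bump_mass TYPE('a) e"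
proof -
 define g where "g x = (- 6 / e^2 * (max 0 (1 - (norm x)^2 / e^2)) ^ 2) *\<^sub>R x" for x :: 'a
 define l where "l x = - 6 * real DIM('a) / e^2 * (max 0 (1 - (norm x)^2 / e^2)) ^ 2
    + 24 / e ^ 4 * (norm x)^2 * max 0 (1 - (norm x)^2 / e^2)" for x :: 'a
 have C: "C2GL (bump e y) (\<lambda>x. g (x - y)) (\<lambda>x. l (x - y))" for y
  using C2GL_bump[OF e, of y] unfolding g_def l_def .
 have C0: "C2GL (bump e 0) g l" using C[of 0] by simp
 have ln: "l (x - y) = l (y - x)" for x y unfolding l_def by (simp add: norm_minus_commute)
 obtain H where H: "\<And>x. (g has_derivative blinfun_apply (H x)) (at x)" "continuous_on UNIV H"
   "\<And>x. l x = (\<Sum>b\<in>Basis. H x b \<bullet> b)"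
  using C0 unfolding C2GL_def by auto
 define K0 where "K0 = bump e (0::'a)"
 define K1 where "K1 b x = g x \<bullet> b" for b x
 define K2 where "K2 b x = H x b \<bullet> b" for b x
 note c0 = C2GL_D[OF C0]
 have cK: "continuous_on UNIV K0" "continuous_on UNIV (K1 b)" "continuous_on UNIV (K2 b)" for b
  unfolding K0_def K1_def K2_def by (intro c0 continuous_intros H)+
 have dK1: "((\<lambda>t. K0 (x + t *\<^sub>R b)) has_real_derivative K1 b (x + t *\<^sub>R b)) (at t)" for x t b
  unfolding K0_def K1_def by (rule has_derivative_grad_line[OF c0(1)])
 have dK2: "((\<lambda>t. K1 b (x + t *\<^sub>R b)) has_real_derivative K2 b (x + t *\<^sub>R b)) (at t)" for x t b
 proof -
  have 1: "((\<lambda>t. x + t *\<^sub>R b) has_derivative (\<lambda>s. s *\<^sub>R b)) (at t)"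
   by (auto intro!: derivative_eq_intros)
  have "((\<lambda>t. g (x + t *\<^sub>R b) \<bullet> b) has_derivative (\<lambda>s. H (x + t *\<^sub>R b) (s *\<^sub>R b) \<bullet> b)) (at t)"
   by (rule has_derivative_inner_left[OF has_derivative_compose[OF 1 H(1)]])
  then show ?thesis
   unfolding has_field_derivative_def K1_def K2_def
   by (rule has_derivative_eq_rhs) (simp add: fun_eq_iff blinfun.scaleR_right)
 qed
 have b0: "bounded {x. K0 x \<noteq> 0}" unfolding K0_def by (rule bounded_bump[OF e])
 have b1: "bounded {x. K1 b x \<noteq> 0}" for b
  by (rule integral_directional_derivative_zero(2)[OF cK(1) cK(2) b0 dK1])
 have b2: "bounded {x. K2 b x \<noteq> 0}" for b
  by (rule integral_directional_derivative_zero(2)[OF cK(2) cK(3) b1 dK2])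
 obtain M0 where M0: "\<And>x. \<bar>K0 x\<bar> \<le> M0" using continuous_bounded_support_bound[OF cK(1) b0] by auto
 obtain M1 where M1: "\<And>b x. \<bar>K1 b x\<bar> \<le> M1 b" using continuous_bounded_support_bound[OF cK(2) b1] by metis
 obtain M2 where M2: "\<And>b x. \<bar>K2 b x\<bar> \<le> M2 b" using continuous_bounded_support_bound[OF cK(3) b2] by metis
 define m where "m = bump_mass TYPE('a) e"
 define I0 where "I0 x = (LBINT y. v y * K0 (x - y))" for x
 define I1 where "I1 b x = (LBINT y. v y * K1 b (x - y))" for b x
 define I2 where "I2 b x = (LBINT y. v y * K2 b (x - y))" for b x
 have e0: "mollify e v = (\<lambda>x. I0 x / m)"
 proof
  fix x
  show "mollify e v x = I0 x / m"
   unfolding mollify_def I0_def K0_def m_def by (simp only: bump_shift[of e _ x])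
 qed
 have i2: "integrable lborel (\<lambda>y. v y * K2 b (x - y))" for b x
 proof (rule bintegrable_bound[of _ "\<lambda>y. M2 b * \<bar>v y\<bar>"])
  show "AE y in lborel. norm (v y * K2 b (x - y)) \<le> norm (M2 b * \<bar>v y\<bar>)"
  proof (rule AE_I2)
   fix y show "norm (v y * K2 b (x - y)) \<le> norm (M2 b * \<bar>v y\<bar>)"
    using norm_mult_le_right[OF M2, of "v y" b "x - y"] by simp
  qed
  have [measurable]: "K2 b \<in> borel_measurable borel" using cK(3) by (rule borel_measurable_continuous_onI)
  show "(\<lambda>y. v y * K2 b (x - y)) \<in> borel_measurable lborel" using v by measurable
 qed (use v in auto)
 show ?thesis
 proof (rule that[of "\<lambda>b x. I1 b x / m" "\<lambda>b x. I2 b x / m"])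
  have c: "continuous_on UNIV I0" "continuous_on UNIV (I1 b)" "continuous_on UNIV (I2 b)" for b
   unfolding I0_def I1_def I2_def
   by (rule continuous_convolution[OF v cK(1) M0] continuous_convolution[OF v cK(2) M1] continuous_convolution[OF v cK(3) M2])+
  show "continuous_on UNIV (mollify e v)" "continuous_on UNIV (\<lambda>x. I1 b x / m)" "continuous_on UNIV (\<lambda>x. I2 b x / m)" for b
   unfolding e0 divide_inverse by (intro continuous_intros c)+
  show "((\<lambda>t. mollify e v (x + t *\<^sub>R b)) has_real_derivative I1 b (x + t *\<^sub>R b) / m) (at t)" for b x t
   unfolding e0 I0_def I1_def
   by (rule DERIV_cdivide[OF has_derivative_convolution[OF v cK(1) M0 cK(2) M1 dK1]])
  show "((\<lambda>t. I1 b (x + t *\<^sub>R b) / m) has_real_derivative I2 b (x + t *\<^sub>R b) / m) (at t)" for b x t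
   unfolding I1_def I2_def
   by (rule DERIV_cdivide[OF has_derivative_convolution[OF v cK(2) M1 cK(3) M2 dK2]])
  fix x
  have "(\<Sum>b\<in>Basis. I2 b x) = (LBINT y. (\<Sum>b\<in>Basis. v y * K2 b (x - y)))"
   unfolding I2_def by (rule bintegral_sum[symmetric]) (rule i2)
  also have "\<dots> = (LBINT y. v y * laplacian (bump e x) y)"
  proof -
   have "laplacian (bump e x) y = l (x - y)" for y
    unfolding C2GL_laplacian[OF C] by (rule ln)
   then show ?thesis unfolding H(3) K2_def by (simp add: sum_distrib_left)
  qed
  finally show "(\<Sum>b\<in>Basis. I2 b x / m) = (LBINT y. v y * laplacian (bump e x) y) / bump_mass TYPE('a) e"
   by (simp add: m_def sum_divide_distrib[symmetric])
 qed
qed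

section \<open>Kato's inequality through a convex regularisation of the modulus\<close>

definition smooth_abs :: "real \<Rightarrow> real \<Rightarrow> real" where
 "smooth_abs n s = sqrt (s^2 + n^2)"

text \<open>The second derivative is positive; this convexity is the sign on which Kato's inequality
  rests.\<close>

lemma smooth_abs_deriv:
 assumes "n > 0"
 shows "(smooth_abs n has_real_derivative s / smooth_abs n s) (at s)"
  "((\<lambda>s. s / smooth_abs n s) has_real_derivative n\<^sup>2 / smooth_abs n s ^ 3) (at s)"
proof -
 have p: "s^2 + n^2 > 0" using assms by (simp add: sum_power2_gt_zero_iff)
 have sp: "smooth_abs n s > 0" using p unfolding smooth_abs_def by simp
 have sq: "smooth_abs n s * smooth_abs n s = s^2 + n^2" using p unfolding smooth_abs_def by simp
 show 1: "(smooth_abs n has_real_derivative s / smooth_abs n s) (at s)"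
  unfolding smooth_abs_def[abs_def] using p
  by (auto intro!: derivative_eq_intros simp: field_simps)
 have "(smooth_abs n s * smooth_abs n s - s * s) = n^2" using sq by (simp add: power2_eq_square)
 then have "(1 * smooth_abs n s - s * (s / smooth_abs n s)) / (smooth_abs n s * smooth_abs n s) = n^2 / smooth_abs n s ^ 3"
  using sp by (simp add: field_simps power3_eq_cube)
 then show "((\<lambda>s. s / smooth_abs n s) has_real_derivative n\<^sup>2 / smooth_abs n s ^ 3) (at s)"
  using DERIV_divide[OF DERIV_ident 1] sp by simp
qed

lemma smooth_abs_bounds:
 assumes "n > 0"
 shows "smooth_abs n s > 0" "\<bar>s\<bar> \<le> smooth_abs n s" "smooth_abs n s \<le> \<bar>s\<bar> + n" "\<bar>s / smooth_abs n s\<bar> \<le> 1"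
proof -
 have p: "s^2 + n^2 > 0" using assms by (simp add: sum_power2_gt_zero_iff)
 show 1: "smooth_abs n s > 0" using p unfolding smooth_abs_def by simp
 show 2: "\<bar>s\<bar> \<le> smooth_abs n s" unfolding smooth_abs_def by (rule real_le_rsqrt) simp
 show "smooth_abs n s \<le> \<bar>s\<bar> + n" unfolding smooth_abs_def
  using sqrt_sum_squares_le_sum_abs[of s n] assms by simp
 show "\<bar>s / smooth_abs n s\<bar> \<le> 1" using 1 2 by simp
qed

lemma smooth_abs_lipschitz: "n > 0 \<Longrightarrow> \<bar>smooth_abs n s - smooth_abs n t\<bar> \<le> \<bar>s - t\<bar>"
 using field_differentiable_bound[of UNIV "smooth_abs n" "\<lambda>s. s / smooth_abs n s" 1 s t]
  smooth_abs_deriv(1) smooth_abs_bounds(4) by auto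

lemma smooth_abs_cont [continuous_intros]: "continuous_on S f \<Longrightarrow> continuous_on S (\<lambda>x. smooth_abs n (f x))"
 unfolding smooth_abs_def by (intro continuous_intros)

lemma smooth_abs_meas [measurable]: "smooth_abs n \<in> borel_measurable borel"
 unfolding smooth_abs_def[abs_def] by measurable

lemma integrable_mollify:
 fixes f :: "'a::euclidean_space \<Rightarrow> real"
 assumes f: "integrable lborel f" and e: "e > 0"
 shows "integrable lborel (mollify e f)"
proof (rule integrableI_bounded)
 have [measurable]: "f \<in> borel_measurable borel" using f by auto
 show "mollify e f \<in> borel_measurable lborel" by measurable
 define m where "m = bump_mass TYPE('a) e"
 have m: "m > 0" unfolding m_def by (rule bump_mass_pos[OF e])
 have "(\<integral>\<^sup>+x. ennreal (norm (mollify e f x)) \<partial>lborel) \<le> (\<integral>\<^sup>+x. ennreal (1/m) * (\<integral>\<^sup>+y. ennreal (\<bar>f y\<bar> * bump e y x) \<partial>lborel) \<partial>lborel)"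
 proof (rule nn_integral_mono)
  fix x
  have "ennreal (norm (mollify e f x)) = ennreal (1/m) * ennreal (norm (LBINT y. f y * bump e y x))"
   unfolding mollify_def m_def[symmetric] using m by (simp flip: ennreal_mult add: abs_mult)
  also have "\<dots> \<le> ennreal (1/m) * (\<integral>\<^sup>+y. norm (f y * bump e y x) \<partial>lborel)"
   by (intro mult_left_mono integral_norm_bound_ennreal integrable_mult_bump f) auto
  finally show "ennreal (norm (mollify e f x)) \<le> ennreal (1/m) * (\<integral>\<^sup>+y. ennreal (\<bar>f y\<bar> * bump e y x) \<partial>lborel)"
   by (simp add: abs_mult bump_nonneg)
 qed
 also have "\<dots> = ennreal (1/m) * (\<integral>\<^sup>+x. (\<integral>\<^sup>+y. ennreal (\<bar>f y\<bar> * bump e y x) \<partial>lborel) \<partial>lborel)"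
  by (rule nn_integral_cmult) measurable
 also have "(\<integral>\<^sup>+x. (\<integral>\<^sup>+y. ennreal (\<bar>f y\<bar> * bump e y x) \<partial>lborel) \<partial>lborel)
   = (\<integral>\<^sup>+y. (\<integral>\<^sup>+x. ennreal (\<bar>f y\<bar> * bump e y x) \<partial>lborel) \<partial>lborel)"
  by (rule lborel_pair.Fubini'[symmetric]) measurable
 also have "\<dots> = (\<integral>\<^sup>+y. ennreal \<bar>f y\<bar> * ennreal m \<partial>lborel)"
 proof (rule nn_integral_cong)
  fix y :: 'a
  have "(\<integral>\<^sup>+x. ennreal (bump e y x) \<partial>lborel) = ennreal m"
   using nn_integral_eq_integral[OF integrable_bump[OF e, of y]] bump_mass_shift(1)[of e y]
   by (simp add: bump_nonneg m_def)
  then show "(\<integral>\<^sup>+x. ennreal (\<bar>f y\<bar> * bump e y x) \<partial>lborel) = ennreal \<bar>f y\<bar> * ennreal m"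
   by (simp add: ennreal_mult bump_nonneg nn_integral_cmult)
 qed
 also have "\<dots> = (\<integral>\<^sup>+y. ennreal (norm (f y)) \<partial>lborel) * ennreal m" by (simp add: nn_integral_multc)
 also have "ennreal (1/m) * \<dots> < \<infinity>"
  using f unfolding integrable_iff_bounded by (simp add: ennreal_mult_less_top)
 finally show "(\<integral>\<^sup>+x. ennreal (norm (mollify e f x)) \<partial>lborel) < \<infinity>" by simp
qed

lemma mollify_L1_integral:
 fixes f :: "'a::euclidean_space \<Rightarrow> real"
 assumes f: "integrable lborel f" and ep: "\<And>n. ep n > 0" "ep \<longlonglongrightarrow> 0"
 shows "(\<lambda>n. LBINT x. \<bar>mollify (ep n) f x - f x\<bar>) \<longlonglongrightarrow> 0"
proof -
 have i: "integrable lborel (\<lambda>x. \<bar>mollify (ep n) f x - f x\<bar>)" for n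
  using f integrable_mollify[OF f ep(1)] by auto
 have "(\<lambda>n. ennreal (LBINT x. \<bar>mollify (ep n) f x - f x\<bar>)) \<longlonglongrightarrow> ennreal 0"
  using mollify_L1[OF f ep] by (simp add: nn_integral_eq_integral[OF i])
 then show ?thesis by (subst (asm) tendsto_ennreal_iff) auto
qed

text \<open>For smooth \<open>p\<close> and convex \<open>j\<close> the Laplacian of
  \<open>j (p)\<close> is \<open>j' (p)\<close> times that of \<open>p\<close> plus a nonnegative
  gradient term. This is applied to mollifications of \<open>v\<close>, whose Laplacian is the
  mollification of \<open>W v\<close>; the product \<open>W v\<close> is treated as a single locally
  integrable function, so \<open>W\<close> may be singular. Afterwards the mollification scale tends
  to zero.\<close>

lemma Kato_smooth:
 fixes v W :: "'a::euclidean_space \<Rightarrow> real"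
 assumes [measurable]: "v \<in> borel_measurable borel" "W \<in> borel_measurable borel"
  and li: "\<And>R. integrable lborel (\<lambda>x. indicator (cball 0 R) x * v x)"
  and liW: "\<And>R. integrable lborel (\<lambda>x. indicator (cball 0 R) x * (W x * v x))"
  and weak: "\<And>ph g l. C2GL ph g l \<Longrightarrow> bounded {x. ph x \<noteq> 0} \<Longrightarrow> (LBINT x. v x * (l x - W x * ph x)) = 0"
  and f: "C2GL f gf lf" "bounded {x. f x \<noteq> 0}" "\<And>x. f x \<ge> 0"
  and n: "n > 0"
 shows "(LBINT x. f x * (W x * v x) * (v x / smooth_abs n (v x))) \<le> (LBINT x. smooth_abs n (v x) * lf x)"
proof -
 note cf = C2GL_D[OF f(1)] and s = C2GL_support[OF f(1,2)]
 have [measurable]: "f \<in> borel_measurable borel" "lf \<in> borel_measurable borel" using C2GL_measurable[OF f(1)] by auto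
 obtain R0 where R0: "{x. f x \<noteq> 0} \<subseteq> cball 0 R0" "R0 > 0" using bounded_subset_cball_zero[OF f(2)] by blast
 obtain R1 where R1: "{x. lf x \<noteq> 0} \<subseteq> cball 0 R1" "R1 > 0" using bounded_subset_cball_zero[OF s(2)] by blast
 \<comment> \<open>Unit margin around the supports of \<open>f\<close> and \<open>lf\<close>:
   mollifiers of radius at most one do not see the cut-off by \<open>cball 0 R\<close>
   there.\<close>
 define R where "R = R0 + R1 + 1"
 define v1 where "v1 x = indicator (cball 0 R) x * v x" for x
 define th where "th x = indicator (cball 0 R) x * (W x * v x)" for x
 have [measurable]: "cball (0::'a) R \<in> sets borel" by simp
 have [measurable]: "v1 \<in> borel_measurable borel" "th \<in> borel_measurable borel"
  unfolding v1_def[abs_def] th_def[abs_def] by measurable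
 have iv: "integrable lborel v1" and ith: "integrable lborel th"
  using li[of R] liW[of R] unfolding v1_def[abs_def] th_def[abs_def] by auto
 obtain Cf where Cf: "Cf > 0" "\<And>x. \<bar>f x\<bar> \<le> Cf" using continuous_bounded_support_bound[OF cf(2) f(2)] by auto
 obtain Cl where Cl: "Cl > 0" "\<And>x. \<bar>lf x\<bar> \<le> Cl" using continuous_bounded_support_bound[OF cf(4) s(2)] by auto
 define j where "j = smooth_abs n"
 define j1 where "j1 s = s / smooth_abs n s" for s
 have [measurable]: "j \<in> borel_measurable borel" "j1 \<in> borel_measurable borel"
  unfolding j_def j1_def[abs_def] by measurable
 have j1b: "\<bar>j1 s\<bar> \<le> 1" for s unfolding j1_def using smooth_abs_bounds(4)[OF n] .
 have main: "(LBINT x. f x * (j1 (mollify e v1 x) * mollify e th x)) \<le> (LBINT x. lf x * j (mollify e v1 x))"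
  if e: "0 < e" "e \<le> 1" for e
 proof -
  obtain D1 D2 where D: "continuous_on UNIV (mollify e v1)" "\<And>b. continuous_on UNIV (D1 b)" "\<And>b. continuous_on UNIV (D2 b)"
   "\<And>b x t. ((\<lambda>t. mollify e v1 (x + t *\<^sub>R b)) has_real_derivative D1 b (x + t *\<^sub>R b)) (at t)"
   "\<And>b x t. ((\<lambda>t. D1 b (x + t *\<^sub>R b)) has_real_derivative D2 b (x + t *\<^sub>R b)) (at t)"
   and S: "\<And>x. (\<Sum>b\<in>Basis. D2 b x) = (LBINT y. v1 y * laplacian (bump e x) y) / bump_mass TYPE('a) e"
   using mollify_directional[OF iv e(1)] by blast
  define p where "p = mollify e v1"
  define V1 where "V1 b x = j1 (p x) * D1 b x" for b x
  define V2 where "V2 b x = n^2 / smooth_abs n (p x) ^ 3 * (D1 b x)^2 + j1 (p x) * D2 b x" for b x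
  have snz: "smooth_abs n s \<noteq> 0" for s using smooth_abs_bounds(1)[OF n, of s] by linarith
  have eq: "(LBINT x. f x * (\<Sum>b\<in>Basis. V2 b x)) = (LBINT x. lf x * j (p x))"
  proof (rule integral_laplacian_directional[OF f(1,2), of _ V1])
   show "continuous_on UNIV (\<lambda>x. j (p x))" unfolding j_def p_def by (intro continuous_intros D)
   show "continuous_on UNIV (V1 b)" "continuous_on UNIV (V2 b)" for b
    unfolding V1_def V2_def j1_def p_def by (intro continuous_intros D ballI snz; simp add: snz)+
   show "((\<lambda>t. j (p (x + t *\<^sub>R b))) has_real_derivative V1 b (x + t *\<^sub>R b)) (at t)" for b x t
    unfolding j_def V1_def j1_def p_def by (rule DERIV_chain2[OF smooth_abs_deriv(1)[OF n] D(4)])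
   show "((\<lambda>t. V1 b (x + t *\<^sub>R b)) has_real_derivative V2 b (x + t *\<^sub>R b)) (at t)" for b x t
   proof -
    have "((\<lambda>t. j1 (p (x + t *\<^sub>R b))) has_real_derivative n\<^sup>2 / smooth_abs n (p (x + t *\<^sub>R b)) ^ 3 * D1 b (x + t *\<^sub>R b)) (at t)"
     unfolding j1_def p_def by (rule DERIV_chain2[OF smooth_abs_deriv(2)[OF n] D(4)])
    from DERIV_mult[OF this D(5)] show ?thesis
     unfolding V1_def V2_def by (simp add: power2_eq_square algebra_simps)
   qed
  qed
  \<comment> \<open>On the support of \<open>f\<close> the bump centred at \<open>x\<close> lives
    inside \<open>cball 0 R\<close>, so the cut-off disappears and the weak equation with this bump
    as test function applies.\<close>
  have lap: "(\<Sum>b\<in>Basis. D2 b x) = mollify e th x" if x: "norm x \<le> R0" for x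
  proof -
   have sub: "y \<in> cball 0 R" if "bump e x y \<noteq> 0 \<or> laplacian (bump e x) y \<noteq> 0" for y
   proof (rule ccontr)
    assume "y \<notin> cball 0 R"
    then have "norm y > R0 + 1" unfolding R_def using R1 by simp
    then have "norm (y - x) > 1" using x norm_triangle_ineq2[of y x] by linarith
    then have "e < norm (y - x)" using e by simp
    then have "bump e x y = 0" "1 - (norm (y - x))^2 / e^2 \<le> 0"
     using bump_eq_0[OF e(1), of y x] e power_mono[of e "norm (y - x)" 2] by (auto simp: field_simps)
    moreover from this(2) have "max 0 (1 - (norm (y - x))^2 / e^2) = 0" by linarith
    ultimately show False using that unfolding C2GL_laplacian[OF C2GL_bump[OF e(1)]] by simp
   qed
   note Cb = C2GL_bump[OF e(1), of x, folded C2GL_laplacian[OF C2GL_bump[OF e(1), of x]]]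
   have Cb': "C2GL (bump e x) (\<lambda>y. (- 6 / e^2 * (max 0 (1 - (norm (y - x))^2 / e^2)) ^ 2) *\<^sub>R (y - x)) (laplacian (bump e x))"
    using C2GL_bump[OF e(1), of x] C2GL_laplacian[OF C2GL_bump[OF e(1), of x]] by simp
   note cb = C2GL_D[OF Cb'] and sb = C2GL_support[OF Cb' bounded_bump[OF e(1)]]
   obtain Cq where Cq: "\<And>y. \<bar>laplacian (bump e x) y\<bar> \<le> Cq" using continuous_bounded_support_bound[OF cb(4) sb(2)] by auto
   have i1: "integrable lborel (\<lambda>y. v y * laplacian (bump e x) y)"
    by (rule integrable_loc_mult[OF li _ sb(2) Cq]) (use C2GL_measurable[OF Cb'] in auto)
   have i2: "integrable lborel (\<lambda>y. (W y * v y) * bump e x y)"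
    by (rule integrable_loc_mult[OF liW _ bounded_bump[OF e(1)], of x 1])
      (auto simp: bump_nonneg bump_le_1)
   have "(LBINT y. v1 y * laplacian (bump e x) y) = (LBINT y. v y * laplacian (bump e x) y)"
    by (rule bintegral_cong[OF refl]) (use sub in \<open>auto simp: v1_def indicator_def\<close>)
   also have "\<dots> = (LBINT y. (W y * v y) * bump e x y)"
    using weak[OF Cb' bounded_bump[OF e(1)]] i1 i2
    by (simp add: right_diff_distrib mult.assoc mult.left_commute bintegral_diff)
   also have "\<dots> = (LBINT y. th y * bump e y x)"
    unfolding bump_commute[of e _ x]
    by (rule bintegral_cong[OF refl]) (use sub in \<open>auto simp: th_def indicator_def\<close>)
   finally show ?thesis unfolding S mollify_def by simp
  qed
  \<comment> \<open>Here the nonnegative gradient term is dropped.\<close>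
  have ge: "f x * (j1 (p x) * mollify e th x) \<le> f x * (\<Sum>b\<in>Basis. V2 b x)" for x
  proof (cases "f x = 0")
   case False
   then have x: "norm x \<le> R0" using R0 by auto
   have "(\<Sum>b\<in>Basis. V2 b x) = (\<Sum>b\<in>Basis. n^2 / smooth_abs n (p x) ^ 3 * (D1 b x)^2) + j1 (p x) * mollify e th x"
    unfolding V2_def lap[OF x, symmetric] by (simp add: sum.distrib sum_distrib_left)
   moreover have "(\<Sum>b\<in>Basis. n^2 / smooth_abs n (p x) ^ 3 * (D1 b x)^2) \<ge> 0"
    using smooth_abs_bounds(1)[OF n] by (intro sum_nonneg) (simp add: less_imp_le)
   ultimately show ?thesis using f(3) by (intro mult_left_mono) auto
  qed simp
  have "(LBINT x. f x * (j1 (p x) * mollify e th x)) \<le> (LBINT x. f x * (\<Sum>b\<in>Basis. V2 b x))"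
  proof (rule integral_mono[OF _ _ ge])
   show "integrable lborel (\<lambda>x. f x * (\<Sum>b\<in>Basis. V2 b x))"
    by (rule integrable_continuous_support_mult[OF cf(2) _ f(2)])
      (unfold V2_def j1_def p_def, intro continuous_intros D ballI snz; simp add: snz)
   have "continuous_on UNIV (mollify e th)" using mollify_directional[OF ith e(1)] by blast
   then show "integrable lborel (\<lambda>x. f x * (j1 (p x) * mollify e th x))"
    by (intro integrable_continuous_support_mult[OF cf(2) _ f(2)])
      (unfold j1_def p_def, intro continuous_intros D ballI snz; simp add: snz)
  qed
  then show ?thesis unfolding eq unfolding p_def .
 qed
 define ep where "ep k = inverse (real (Suc k))" for k
 have ep: "\<And>k. ep k > 0" "\<And>k. ep k \<le> 1" "ep \<longlonglongrightarrow> 0"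
  unfolding ep_def using LIMSEQ_inverse_real_of_nat by (auto simp: field_simps)
 have Lv: "(\<lambda>k. LBINT x. \<bar>mollify (ep k) v1 x - v1 x\<bar>) \<longlonglongrightarrow> 0" by (rule mollify_L1_integral[OF iv ep(1,3)])
 have Lth: "(\<lambda>k. LBINT x. \<bar>mollify (ep k) th x - th x\<bar>) \<longlonglongrightarrow> 0" by (rule mollify_L1_integral[OF ith ep(1,3)])
 have im: "integrable lborel (mollify (ep k) v1)" "integrable lborel (mollify (ep k) th)" for k
  using integrable_mollify[OF iv ep(1)] integrable_mollify[OF ith ep(1)] by auto
 \<comment> \<open>L^1 convergence is enough for the Lipschitz function \<open>smooth_abs\<close>.
   The factor \<open>j1\<close>, however, multiplies the fixed function \<open>th\<close>, and
   dominated convergence asks for convergence almost everywhere; hence the subsequence.\<close>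
 have "\<exists>r::nat\<Rightarrow>nat. strict_mono r \<and> (AE x in lborel. (\<lambda>k. mollify (ep (r k)) v1 x - v1 x) \<longlonglongrightarrow> 0)"
  by (rule tendsto_L1_AE_subseq) (use im iv Lv in auto)
 then obtain r :: "nat \<Rightarrow> nat" where r: "strict_mono r" "AE x in lborel. (\<lambda>k. mollify (ep (r k)) v1 x - v1 x) \<longlonglongrightarrow> 0"
  by blast
 have lfj: "integrable lborel (\<lambda>x. lf x * j (q x))" if q: "integrable lborel q" for q
 proof -
  have [measurable]: "q \<in> borel_measurable borel" using q by auto
  have "integrable lborel (\<lambda>x. Cl * \<bar>q x\<bar> + n * \<bar>lf x\<bar>)"
   using q integrable_continuous_bounded_support[OF cf(4) s(2)] by auto
  then show ?thesis
  proof (rule bintegrable_bound)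
   show "AE x in lborel. norm (lf x * j (q x)) \<le> norm (Cl * \<bar>q x\<bar> + n * \<bar>lf x\<bar>)"
   proof (rule AE_I2)
    fix x
    have "norm (lf x * j (q x)) \<le> \<bar>lf x\<bar> * (\<bar>q x\<bar> + n)"
     unfolding j_def using smooth_abs_bounds[OF n, of "q x"] by (simp add: abs_mult mult_left_mono)
    also have "\<dots> \<le> Cl * \<bar>q x\<bar> + n * \<bar>lf x\<bar>"
     using mult_right_mono[OF Cl(2)[of x], of "\<bar>q x\<bar>"] by (simp add: algebra_simps)
    finally show "norm (lf x * j (q x)) \<le> norm (Cl * \<bar>q x\<bar> + n * \<bar>lf x\<bar>)" by simp
   qed
  qed measurable
 qed
 \<comment> \<open>Here the Lipschitz bound turns L^1 convergence directly into convergence of the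
   integrals.\<close>
 have R: "(\<lambda>k. LBINT x. lf x * j (mollify (ep k) v1 x)) \<longlonglongrightarrow> (LBINT x. lf x * j (v1 x))"
 proof (rule LIM_zero_cancel, rule tendsto_rabs_zero_cancel, rule tendsto_sandwich[OF _ _ tendsto_const])
  show "(\<lambda>k. Cl * (LBINT x. \<bar>mollify (ep k) v1 x - v1 x\<bar>)) \<longlonglongrightarrow> 0"
   using tendsto_mult_right_zero[OF Lv] .
  have "\<bar>(LBINT x. lf x * j (mollify (ep k) v1 x)) - (LBINT x. lf x * j (v1 x))\<bar>
    \<le> Cl * (LBINT x. \<bar>mollify (ep k) v1 x - v1 x\<bar>)" for k
  proof -
   have "(LBINT x. lf x * j (mollify (ep k) v1 x)) - (LBINT x. lf x * j (v1 x))
    = (LBINT x. lf x * (j (mollify (ep k) v1 x) - j (v1 x)))"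
    using bintegral_diff[OF lfj[OF im(1)] lfj[OF iv], of k] by (simp add: right_diff_distrib)
   also have "norm \<dots> \<le> (LBINT x. Cl * \<bar>mollify (ep k) v1 x - v1 x\<bar>)"
   proof (rule norm_integral_le_integral)
    show "integrable lborel (\<lambda>x. lf x * (j (mollify (ep k) v1 x) - j (v1 x)))"
     using bintegrable_diff[OF lfj[OF im(1)] lfj[OF iv], of k] by (simp add: right_diff_distrib)
    show "integrable lborel (\<lambda>x. Cl * \<bar>mollify (ep k) v1 x - v1 x\<bar>)" using im iv by auto
    show "norm (lf x * (j (mollify (ep k) v1 x) - j (v1 x))) \<le> Cl * \<bar>mollify (ep k) v1 x - v1 x\<bar>" for x
     unfolding norm_mult j_def using Cl smooth_abs_lipschitz[OF n] by (intro mult_mono) auto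
   qed
   finally show ?thesis by simp
  qed
  then show "\<forall>\<^sub>F k in sequentially. \<bar>(LBINT x. lf x * j (mollify (ep k) v1 x)) - (LBINT x. lf x * j (v1 x))\<bar>
    \<le> Cl * (LBINT x. \<bar>mollify (ep k) v1 x - v1 x\<bar>)" by simp
 qed simp
 have fj: "integrable lborel (\<lambda>x. f x * (j1 (q x) * et x))" if [measurable]: "q \<in> borel_measurable borel" and et: "integrable lborel et" for q et
 proof (rule bintegrable_bound[of _ "\<lambda>x. Cf * \<bar>et x\<bar>"])
  have [measurable]: "et \<in> borel_measurable borel" using et by auto
  show "(\<lambda>x. f x * (j1 (q x) * et x)) \<in> borel_measurable lborel" by measurable
  show "AE x in lborel. norm (f x * (j1 (q x) * et x)) \<le> norm (Cf * \<bar>et x\<bar>)"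
  proof (rule AE_I2)
   fix x
   have "\<bar>f x\<bar> * (\<bar>j1 (q x)\<bar> * \<bar>et x\<bar>) \<le> Cf * (1 * \<bar>et x\<bar>)"
    using Cf j1b by (intro mult_mono) auto
   then show "norm (f x * (j1 (q x) * et x)) \<le> norm (Cf * \<bar>et x\<bar>)" using Cf by (simp add: abs_mult)
  qed
 qed (use et in auto)
 have L1: "(\<lambda>k. LBINT x. f x * (j1 (mollify (ep (r k)) v1 x) * th x)) \<longlonglongrightarrow> (LBINT x. f x * (j1 (v1 x) * th x))"
 proof (rule integral_dominated_convergence[where w="\<lambda>x. Cf * \<bar>th x\<bar>"])
  show "integrable lborel (\<lambda>x. Cf * \<bar>th x\<bar>)" using ith by auto
  show "AE x in lborel. norm (f x * (j1 (mollify (ep (r k)) v1 x) * th x)) \<le> Cf * \<bar>th x\<bar>" for k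
  proof (rule AE_I2)
   fix x
   have "\<bar>f x\<bar> * (\<bar>j1 (mollify (ep (r k)) v1 x)\<bar> * \<bar>th x\<bar>) \<le> Cf * (1 * \<bar>th x\<bar>)"
    using Cf j1b by (intro mult_mono) auto
   then show "norm (f x * (j1 (mollify (ep (r k)) v1 x) * th x)) \<le> Cf * \<bar>th x\<bar>" by (simp add: abs_mult)
  qed
  show "AE x in lborel. (\<lambda>k. f x * (j1 (mollify (ep (r k)) v1 x) * th x)) \<longlonglongrightarrow> f x * (j1 (v1 x) * th x)"
   using r(2)
  proof eventually_elim
   case (elim x)
   have "(\<lambda>k. mollify (ep (r k)) v1 x) \<longlonglongrightarrow> v1 x" using LIM_zero_cancel[OF elim] .
   moreover have "smooth_abs n (v1 x) \<noteq> 0" using smooth_abs_bounds(1)[OF n, of "v1 x"] by linarith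
   ultimately show ?case unfolding j1_def smooth_abs_def by (intro tendsto_intros) auto
  qed
 qed measurable
 have L2: "(\<lambda>k. LBINT x. f x * (j1 (mollify (ep (r k)) v1 x) * (mollify (ep (r k)) th x - th x))) \<longlonglongrightarrow> 0"
 proof (rule tendsto_rabs_zero_cancel, rule tendsto_sandwich[OF _ _ tendsto_const])
  have "(\<lambda>k. Cf * (LBINT x. \<bar>mollify (ep k) th x - th x\<bar>)) \<longlonglongrightarrow> 0"
   using tendsto_mult_right_zero[OF Lth] .
  then show "(\<lambda>k. Cf * (LBINT x. \<bar>mollify (ep (r k)) th x - th x\<bar>)) \<longlonglongrightarrow> 0"
   using LIMSEQ_subseq_LIMSEQ[OF _ r(1)] unfolding comp_def by blast
  have "norm (LBINT x. f x * (j1 (mollify (ep (r k)) v1 x) * (mollify (ep (r k)) th x - th x)))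
   \<le> (LBINT x. Cf * \<bar>mollify (ep (r k)) th x - th x\<bar>)" for k
  proof (rule norm_integral_le_integral)
   show "integrable lborel (\<lambda>x. f x * (j1 (mollify (ep (r k)) v1 x) * (mollify (ep (r k)) th x - th x)))"
    by (rule fj) (use im ith in auto)
   show "integrable lborel (\<lambda>x. Cf * \<bar>mollify (ep (r k)) th x - th x\<bar>)" using im ith by auto
   fix x
   have "\<bar>f x\<bar> * (\<bar>j1 (mollify (ep (r k)) v1 x)\<bar> * \<bar>mollify (ep (r k)) th x - th x\<bar>) \<le> Cf * (1 * \<bar>mollify (ep (r k)) th x - th x\<bar>)"
    using Cf j1b by (intro mult_mono) auto
   then show "norm (f x * (j1 (mollify (ep (r k)) v1 x) * (mollify (ep (r k)) th x - th x))) \<le> Cf * \<bar>mollify (ep (r k)) th x - th x\<bar>"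
    by (simp add: abs_mult)
  qed
  then show "\<forall>\<^sub>F k in sequentially. \<bar>LBINT x. f x * (j1 (mollify (ep (r k)) v1 x) * (mollify (ep (r k)) th x - th x))\<bar>
   \<le> Cf * (LBINT x. \<bar>mollify (ep (r k)) th x - th x\<bar>)" by simp
 qed simp
 have "(LBINT x. f x * (j1 (mollify (ep (r k)) v1 x) * mollify (ep (r k)) th x))
   = (LBINT x. f x * (j1 (mollify (ep (r k)) v1 x) * th x))
   + (LBINT x. f x * (j1 (mollify (ep (r k)) v1 x) * (mollify (ep (r k)) th x - th x)))" for k
 proof -
  have q: "mollify (ep (r k)) v1 \<in> borel_measurable borel" by measurable
  show ?thesis
   using bintegral_add[OF fj[OF q ith] fj[OF q bintegrable_diff[OF im(2)[of "r k"] ith]]]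
   by (simp add: distrib_left[symmetric])
 qed
 then have L: "(\<lambda>k. LBINT x. f x * (j1 (mollify (ep (r k)) v1 x) * mollify (ep (r k)) th x))
   \<longlonglongrightarrow> (LBINT x. f x * (j1 (v1 x) * th x))"
  using tendsto_add[OF L1 L2] by simp
 have "(LBINT x. f x * (j1 (v1 x) * th x)) \<le> (LBINT x. lf x * j (v1 x))"
  using LIMSEQ_le[OF L LIMSEQ_subseq_LIMSEQ[OF R r(1), unfolded comp_def]] main[OF ep(1,2)] by auto
 also have "(LBINT x. lf x * j (v1 x)) = (LBINT x. smooth_abs n (v x) * lf x)"
 proof (rule bintegral_cong[OF refl])
  fix x
  have "lf x = 0 \<or> x \<in> cball 0 R" using R1 R0 unfolding R_def by fastforce
  then show "lf x * j (v1 x) = smooth_abs n (v x) * lf x" unfolding j_def v1_def by auto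
 qed
 also have "(LBINT x. f x * (j1 (v1 x) * th x)) = (LBINT x. f x * (W x * v x) * (v x / smooth_abs n (v x)))"
 proof (rule bintegral_cong[OF refl])
  fix x
  have "f x = 0 \<or> x \<in> cball 0 R" using R1 R0 unfolding R_def by fastforce
  then show "f x * (j1 (v1 x) * th x) = f x * (W x * v x) * (v x / smooth_abs n (v x))"
   unfolding j1_def v1_def th_def by auto
 qed
 finally show ?thesis .
qed

text \<open>As the regularisation tends to zero, \<open>smooth_abs\<close> tends to the modulus and
  \<open>v * (v / smooth_abs)\<close> to \<open>\<bar>v\<bar>\<close>, also at zeros of
  \<open>v\<close>. Both integrands have integrable majorants because \<open>f\<close> and
  \<open>lf\<close> have bounded support.\<close>

lemma Kato_inequality:
 fixes v W :: "'a::euclidean_space \<Rightarrow> real"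
 assumes [measurable]: "v \<in> borel_measurable borel" "W \<in> borel_measurable borel"
  and li: "\<And>R. integrable lborel (\<lambda>x. indicator (cball 0 R) x * v x)"
  and liW: "\<And>R. integrable lborel (\<lambda>x. indicator (cball 0 R) x * (W x * v x))"
  and weak: "\<And>ph g l. C2GL ph g l \<Longrightarrow> bounded {x. ph x \<noteq> 0} \<Longrightarrow> (LBINT x. v x * (l x - W x * ph x)) = 0"
  and f: "C2GL f gf lf" "bounded {x. f x \<noteq> 0}" "\<And>x. f x \<ge> 0"
 shows "(LBINT x. \<bar>v x\<bar> * (lf x - W x * f x)) \<ge> 0"
proof -
 note cf = C2GL_D[OF f(1)] and s = C2GL_support[OF f(1,2)]
 have [measurable]: "f \<in> borel_measurable borel" "lf \<in> borel_measurable borel" using C2GL_measurable[OF f(1)] by auto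
 obtain Cf where Cf: "Cf > 0" "\<And>x. \<bar>f x\<bar> \<le> Cf" using continuous_bounded_support_bound[OF cf(2) f(2)] by auto
 obtain Cl where Cl: "Cl > 0" "\<And>x. \<bar>lf x\<bar> \<le> Cl" using continuous_bounded_support_bound[OF cf(4) s(2)] by auto
 have i1: "integrable lborel (\<lambda>x. v x * lf x)" by (rule integrable_loc_mult[OF li _ s(2) Cl(2)]) simp
 have i2: "integrable lborel (\<lambda>x. (W x * v x) * f x)" by (rule integrable_loc_mult[OF liW _ f(2) Cf(2)]) simp
 have i1': "integrable lborel (\<lambda>x. \<bar>v x\<bar> * lf x)"
  by (rule bintegrable_bound[OF i1]) (auto simp: abs_mult)
 have i2': "integrable lborel (\<lambda>x. \<bar>v x\<bar> * (W x * f x))"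
  by (rule bintegrable_bound[OF i2]) (auto simp: abs_mult)
 define n where "n k = inverse (real (Suc k))" for k
 have n: "\<And>k. n k > 0" "\<And>k. n k \<le> 1" "n \<longlonglongrightarrow> 0"
  unfolding n_def using LIMSEQ_inverse_real_of_nat by (auto simp: field_simps)
 have A: "(\<lambda>k. LBINT x. smooth_abs (n k) (v x) * lf x) \<longlonglongrightarrow> (LBINT x. \<bar>v x\<bar> * lf x)"
 proof (rule integral_dominated_convergence[where w="\<lambda>x. \<bar>v x * lf x\<bar> + \<bar>lf x\<bar>"])
  show "integrable lborel (\<lambda>x. \<bar>v x * lf x\<bar> + \<bar>lf x\<bar>)"
   using i1 integrable_continuous_bounded_support[OF cf(4) s(2)] by auto
  show "AE x in lborel. norm (smooth_abs (n k) (v x) * lf x) \<le> \<bar>v x * lf x\<bar> + \<bar>lf x\<bar>" for k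
  proof (rule AE_I2)
   fix x
   have "\<bar>smooth_abs (n k) (v x)\<bar> \<le> \<bar>v x\<bar> + 1"
    using smooth_abs_bounds[OF n(1)[of k], of "v x"] n(2)[of k] by linarith
   from mult_right_mono[OF this, of "\<bar>lf x\<bar>"]
   show "norm (smooth_abs (n k) (v x) * lf x) \<le> \<bar>v x * lf x\<bar> + \<bar>lf x\<bar>" by (simp add: abs_mult algebra_simps)
  qed
  show "AE x in lborel. (\<lambda>k. smooth_abs (n k) (v x) * lf x) \<longlonglongrightarrow> \<bar>v x\<bar> * lf x"
  proof (rule AE_I2)
   fix x
   have "(\<lambda>k. smooth_abs (n k) (v x) * lf x) \<longlonglongrightarrow> sqrt ((v x)^2 + 0^2) * lf x"
    unfolding smooth_abs_def by (intro tendsto_intros n(3))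
   then show "(\<lambda>k. smooth_abs (n k) (v x) * lf x) \<longlonglongrightarrow> \<bar>v x\<bar> * lf x" by simp
  qed
 qed measurable
 have B: "(\<lambda>k. LBINT x. f x * (W x * v x) * (v x / smooth_abs (n k) (v x))) \<longlonglongrightarrow> (LBINT x. \<bar>v x\<bar> * (W x * f x))"
 proof (rule integral_dominated_convergence[where w="\<lambda>x. \<bar>(W x * v x) * f x\<bar>"])
  show "integrable lborel (\<lambda>x. \<bar>(W x * v x) * f x\<bar>)" using i2 by auto
  show "AE x in lborel. norm (f x * (W x * v x) * (v x / smooth_abs (n k) (v x))) \<le> \<bar>(W x * v x) * f x\<bar>" for k
  proof (rule AE_I2)
   fix x
   show "norm (f x * (W x * v x) * (v x / smooth_abs (n k) (v x))) \<le> \<bar>(W x * v x) * f x\<bar>"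
    using mult_left_mono[OF smooth_abs_bounds(4)[OF n(1)[of k], of "v x"], of "\<bar>(W x * v x) * f x\<bar>"]
    by (simp only: norm_mult real_norm_def abs_mult mult.commute mult.left_commute mult_1_right abs_ge_zero) (simp add: ac_simps)
  qed
  show "AE x in lborel. (\<lambda>k. f x * (W x * v x) * (v x / smooth_abs (n k) (v x))) \<longlonglongrightarrow> \<bar>v x\<bar> * (W x * f x)"
  proof (rule AE_I2)
   fix x
   show "(\<lambda>k. f x * (W x * v x) * (v x / smooth_abs (n k) (v x))) \<longlonglongrightarrow> \<bar>v x\<bar> * (W x * f x)"
   proof (cases "v x = 0")
    case False
    have "(\<lambda>k. f x * (W x * v x) * (v x / smooth_abs (n k) (v x))) \<longlonglongrightarrow> f x * (W x * v x) * (v x / sqrt ((v x)^2 + 0^2))"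
     unfolding smooth_abs_def using False by (intro tendsto_intros n(3)) auto
    then show ?thesis using False by (simp add: abs_if ac_simps split: if_splits)
   qed simp
  qed
 qed measurable
 have "(LBINT x. \<bar>v x\<bar> * (W x * f x)) \<le> (LBINT x. \<bar>v x\<bar> * lf x)"
  by (rule LIMSEQ_le[OF B A], intro exI allI impI, rule Kato_smooth[OF assms(1,2) li liW weak f n(1)])
 then show ?thesis using i1' i2' by (simp add: right_diff_distrib bintegral_diff)
qed

section \<open>Gaussian integrals\<close>

lemma nn_integral_gaussian_real:
 assumes a: "a > 0"
 shows "(\<integral>\<^sup>+t. ennreal (exp (- a * (t - m)^2)) \<partial>lborel) = ennreal (sqrt (pi / a))"
proof -
 define s where "s = sqrt (1 / (2 * a))"
 have s: "s > 0" "s^2 = 1 / (2 * a)" unfolding s_def using a by auto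
 have e: "exp (- a * (t - m)^2) = sqrt (pi / a) * normal_density m s t" for t
 proof -
  have "sqrt (2 * pi * s^2) = sqrt (pi / a)" using s a by (simp add: field_simps)
  moreover have "(t - m)^2 / (2 * s^2) = a * (t - m)^2" using s a by (simp add: field_simps)
  ultimately show ?thesis unfolding normal_density_def using a by simp
 qed
 have "(\<integral>\<^sup>+t. ennreal (normal_density m s t) \<partial>lborel) = 1"
  using nn_integral_eq_integral[of lborel "normal_density m s"] integral_normal_density[OF s(1), of m]
   integrable_normal_density[OF s(1), of m] by simp
 then show ?thesis unfolding e
  using a by (simp add: ennreal_mult nn_integral_cmult)
qed

lemma nn_integral_gaussian:
 fixes v :: "'a::euclidean_space"
 assumes a: "a > 0"
 shows "(\<integral>\<^sup>+x. ennreal (exp (- a * (norm (x - v))^2)) \<partial>lborel) = ennreal (sqrt (pi / a) ^ DIM('a))"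
proof -
 have "exp (- a * (norm (x - v))^2) = (\<Prod>b\<in>Basis. exp (- a * (x \<bullet> b - v \<bullet> b)^2))" for x
 proof -
  have "(norm (x - v))^2 = (\<Sum>b\<in>Basis. (x \<bullet> b - v \<bullet> b)^2)"
   unfolding power2_norm_eq_inner euclidean_inner[of "x - v" "x - v"]
   by (simp add: inner_diff_left power2_eq_square)
  then show ?thesis by (simp add: exp_sum sum_distrib_left flip: sum_negf)
 qed
 then have "(\<integral>\<^sup>+x. ennreal (exp (- a * (norm (x - v))^2)) \<partial>lborel)
   = (\<integral>\<^sup>+x. (\<Prod>b\<in>Basis. ennreal (exp (- a * (x \<bullet> b - v \<bullet> b)^2))) \<partial>lborel)"
  by (simp add: prod_ennreal)
 also have "\<dots> = (\<Prod>b\<in>Basis. \<integral>\<^sup>+t. ennreal (exp (- a * (t - v \<bullet> b)^2)) \<partial>lborel)"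
  by (rule nn_integral_lborel_prod) auto
 also have "\<dots> = (\<Prod>b\<in>(Basis::'a set). ennreal (sqrt (pi / a)))"
  using nn_integral_gaussian_real[OF a] by simp
 finally show ?thesis using a by (simp add: ennreal_power)
qed

text \<open>The coupling \<open>g\<close> keeps the family closed under multiplication by Gaussians
  in any of the three distances, which is what the representation of Coulomb singularities by
  Gaussians needs.\<close>

definition gauss2 :: "real \<Rightarrow> real \<Rightarrow> real \<Rightarrow> conf2 \<Rightarrow> real" where
 "gauss2 a b g x = exp (- (a * (norm (fst x))^2 + b * (norm (snd x))^2 + g * (norm (fst x - snd x))^2))"

lemma gauss2_measurable [measurable]: "gauss2 a b g \<in> borel_measurable borel"
 unfolding gauss2_def[abs_def] by (intro borel_measurable_continuous_onI continuous_intros)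

lemma gauss2_pos: "gauss2 a b g x > 0" unfolding gauss2_def by simp

text \<open>Completing the square in the second variable leaves two three-dimensional Gaussian
  integrals; \<open>a b + a g + b g\<close> is the determinant of the quadratic form in one
  coordinate of each electron.\<close>

lemma nn_integral_gauss2:
 assumes a: "a > 0" and b: "b > 0" and g: "g \<ge> 0"
 shows "(\<integral>\<^sup>+x. ennreal (gauss2 a b g x) \<partial>lborel) = ennreal (pi ^ 3 / sqrt (a * b + a * g + b * g) ^ 3)"
proof -
 define c where "c = b + g"
 define d where "d = a + b * g / c"
 have c: "c > 0" unfolding c_def using b g by simp
 have d: "d > 0" unfolding d_def using a b g c by (simp add: add_pos_nonneg)
 have cd: "c * d = a * b + a * g + b * g" unfolding d_def using c by (simp add: field_simps c_def)
 have sq: "b * (norm y)^2 + g * (norm (x - y))^2 = c * (norm (y - (g / c) *\<^sub>R x))^2 + b * g / c * (norm x)^2" for x y :: "real^3"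
 proof -
  have "c * (norm (y - (g / c) *\<^sub>R x))^2 = c * (norm y)^2 - 2 * g * (x \<bullet> y) + g^2 / c * (norm x)^2"
   unfolding power2_norm_eq_inner using c
   by (simp add: inner_diff_left inner_diff_right inner_commute power2_eq_square field_simps)
  moreover have "g * (norm (x - y))^2 = g * (norm x)^2 - 2 * g * (x \<bullet> y) + g * (norm y)^2"
   unfolding power2_norm_eq_inner by (simp add: inner_diff_left inner_diff_right inner_commute algebra_simps)
  moreover have "g^2 + b * g = g * c" by (simp add: c_def power2_eq_square algebra_simps)
  then have "g^2 / c + b * g / c = g" using c by (simp flip: add_divide_distrib)
  then have "g^2 / c * (norm x)^2 + b * g / c * (norm x)^2 = g * (norm x)^2" by (metis distrib_right)
  ultimately show ?thesis by (simp add: c_def algebra_simps)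
 qed
 have split: "gauss2 a b g (x, y) = exp (- d * (norm (x - 0))^2) * exp (- c * (norm (y - (g / c) *\<^sub>R x))^2)" for x y
 proof -
  have "a * (norm x)^2 + b * (norm y)^2 + g * (norm (x - y))^2 = d * (norm x)^2 + c * (norm (y - (g / c) *\<^sub>R x))^2"
   using sq[of y x] unfolding d_def by (simp add: algebra_simps)
  then show ?thesis unfolding gauss2_def by (simp flip: exp_add)
 qed
 have m: "(\<lambda>x. ennreal (gauss2 a b g x)) \<in> borel_measurable (lborel \<Otimes>\<^sub>M lborel)"
  unfolding lborel_prod by measurable
 have "(\<integral>\<^sup>+x. ennreal (gauss2 a b g x) \<partial>lborel) = (\<integral>\<^sup>+x. \<integral>\<^sup>+y. ennreal (gauss2 a b g (x, y)) \<partial>lborel \<partial>lborel)"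
  using lborel.nn_integral_fst[OF m] unfolding lborel_prod by simp
 also have "\<dots> = (\<integral>\<^sup>+x. ennreal (exp (- d * (norm (x - 0))^2)) * ennreal (sqrt (pi / c) ^ 3) \<partial>(lborel :: (real^3) measure))"
  unfolding split using nn_integral_gaussian[OF c, where 'a = "real^3"]
  by (simp add: ennreal_mult nn_integral_cmult)
 also have "\<dots> = ennreal (sqrt (pi / d) ^ 3) * ennreal (sqrt (pi / c) ^ 3)"
  using nn_integral_gaussian[OF d, of "0 :: real^3"] by (simp add: nn_integral_multc)
 also have "\<dots> = ennreal ((sqrt (pi / d) * sqrt (pi / c)) ^ 3)"
  using c d by (simp add: power_mult_distrib flip: ennreal_mult)
 also have "sqrt (pi / d) * sqrt (pi / c) = pi / sqrt (c * d)"
  using c d by (simp add: real_sqrt_divide real_sqrt_mult field_simps)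
 finally show ?thesis unfolding cd by (simp add: power_divide)
qed

lemma has_integral_gauss2:
 assumes "a > 0" "b > 0" "g \<ge> 0"
 shows "integrable lborel (gauss2 a b g)" "(LBINT x. gauss2 a b g x) = pi ^ 3 / sqrt (a * b + a * g + b * g) ^ 3"
proof -
 show 1: "integrable lborel (gauss2 a b g)"
  by (rule integrableI_bounded) (use nn_integral_gauss2[OF assms] in \<open>auto simp: gauss2_pos less_imp_le\<close>)
 have "ennreal (LBINT x. gauss2 a b g x) = ennreal (pi ^ 3 / sqrt (a * b + a * g + b * g) ^ 3)"
  using nn_integral_eq_integral[OF 1] nn_integral_gauss2[OF assms] by (simp add: gauss2_pos less_imp_le)
 then show "(LBINT x. gauss2 a b g x) = pi ^ 3 / sqrt (a * b + a * g + b * g) ^ 3"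
  using assms by (subst (asm) ennreal_inj) (auto intro!: integral_nonneg simp: gauss2_pos less_imp_le)
qed

text \<open>Subordination \<open>1 / r^2 = \<integral>\<^sub>0\<^sup>\<infinity> exp (- t r\<^sup>2) dt\<close> reduces singular integrals to Gaussian ones.\<close>

lemma nn_integral_exp_subordination:
 assumes "s > (0::real)"
 shows "(\<integral>\<^sup>+t. ennreal (exp (- (t * s))) * indicator {0..} t \<partial>lborel) = ennreal (1 / s)"
proof -
 have "(\<integral>\<^sup>+t. ennreal (exp (- (t * s))) * indicator {0..} t \<partial>lborel) = ennreal (0 - (- (1 / s) * exp (- (0 * s))))"
 proof (rule nn_integral_FTC_atLeast)
  show "((\<lambda>t. - (1 / s) * exp (- (t * s))) \<longlongrightarrow> 0) at_top" using assms by real_asymp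
  show "DERIV (\<lambda>t. - (1 / s) * exp (- (t * s))) t :> exp (- (t * s))" for t
   using assms by (auto intro!: derivative_eq_intros)
 qed auto
 then show ?thesis by simp
qed

lemma nn_integral_subordination_finite:
 assumes "k \<ge> (1::real)"
 shows "(\<integral>\<^sup>+t. ennreal (1 / sqrt (1 + k * t) ^ 3) * indicator {0..} t \<partial>lborel) < \<infinity>"
proof -
 have "(\<integral>\<^sup>+t. ennreal (1 / sqrt (1 + k * t) ^ 3) * indicator {0..} t \<partial>lborel) = ennreal (0 - (- 2 / k / sqrt (1 + k * 0)))"
 proof (rule nn_integral_FTC_atLeast)
  show "((\<lambda>t. - 2 / k / sqrt (1 + k * t)) \<longlongrightarrow> 0) at_top" using assms by real_asymp
  fix t :: real assume t: "0 \<le> t"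
  have p: "1 + k * t > 0" using t assms by (simp add: add_pos_nonneg)
  have d: "((\<lambda>t. sqrt (1 + k * t)) has_real_derivative k / (2 * sqrt (1 + k * t))) (at t)"
   using p by (auto intro!: derivative_eq_intros simp: field_simps)
  have q: "sqrt (1 + k * t) > 0" using p by simp
  show "DERIV (\<lambda>t. - 2 / k / sqrt (1 + k * t)) t :> 1 / sqrt (1 + k * t) ^ 3"
   by (rule DERIV_cong[OF DERIV_divide[OF DERIV_const d]])
     (use q assms in \<open>auto simp: power3_eq_cube\<close>)
  show "0 \<le> 1 / sqrt (1 + k * t) ^ 3" using p by simp
 qed measurable
 then show ?thesis by simp
qed

text \<open>Subordination turns the singular factor into an exponent growing linearly in
  \<open>t\<close>. The determinant is then at least \<open>1 + k t\<close>, with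
  \<open>k = 1\<close> for the nucleus and \<open>k = 2\<close> for the pair, and its power
  \<open>- 3/2\<close> is integrable. Local square integrability of the singularities makes the
  Coulomb potential times an L^2 function locally integrable.\<close>

lemma inverse_square_gauss2_integrable:
 shows "integrable lborel (\<lambda>x::conf2. gauss2 1 1 0 x / (norm (fst x))^2)"
  "integrable lborel (\<lambda>x::conf2. gauss2 1 1 0 x / (norm (snd x))^2)"
  "integrable lborel (\<lambda>x::conf2. gauss2 1 1 0 x / (norm (fst x - snd x))^2)"
proof -
 have gen: "integrable lborel (\<lambda>x::conf2. gauss2 1 1 0 x / (norm (p x))^2)"
  if [measurable]: "p \<in> borel_measurable borel"
   and g: "\<And>t x. gauss2 1 1 0 x * exp (- (t * (norm (p x))^2)) = gauss2 (1 + ka * t) (1 + kb * t) (kg * t) x"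
   and k: "ka \<ge> 0" "kb \<ge> 0" "kg \<ge> 0" "k \<ge> 1"
    "\<And>t. (1 + ka * t) * (1 + kb * t) + (1 + ka * t) * (kg * t) + (1 + kb * t) * (kg * t) \<ge> 1 + k * t"
  for p :: "conf2 \<Rightarrow> real^3" and ka kb kg k
 proof (rule integrableI_bounded)
  have "(\<integral>\<^sup>+x. ennreal (norm (gauss2 1 1 0 x / (norm (p x))^2)) \<partial>lborel)
    \<le> (\<integral>\<^sup>+x. (\<integral>\<^sup>+t. ennreal (gauss2 (1 + ka * t) (1 + kb * t) (kg * t) x) * indicator {0..} t \<partial>lborel) \<partial>lborel)"
  proof (rule nn_integral_mono)
   fix x
   show "ennreal (norm (gauss2 1 1 0 x / (norm (p x))^2)) \<le> (\<integral>\<^sup>+t. ennreal (gauss2 (1 + ka * t) (1 + kb * t) (kg * t) x) * indicator {0..} t \<partial>lborel)"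
   proof (cases "p x = 0")
    case False
    then have s: "(norm (p x))^2 > 0" by simp
    have "ennreal (norm (gauss2 1 1 0 x / (norm (p x))^2)) = ennreal (gauss2 1 1 0 x) * ennreal (1 / (norm (p x))^2)"
     using gauss2_pos[of 1 1 0 x] by (simp flip: ennreal_mult)
    also have "\<dots> = (\<integral>\<^sup>+t. ennreal (gauss2 1 1 0 x) * (ennreal (exp (- (t * (norm (p x))^2))) * indicator {0..} t) \<partial>lborel)"
     unfolding nn_integral_exp_subordination[OF s, symmetric] by (rule nn_integral_cmult[symmetric]) measurable
    also have "\<dots> = (\<integral>\<^sup>+t. ennreal (gauss2 (1 + ka * t) (1 + kb * t) (kg * t) x) * indicator {0..} t \<partial>lborel)"
     by (intro nn_integral_cong) (simp add: g[symmetric] ennreal_mult gauss2_pos less_imp_le mult.assoc)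
    finally show ?thesis by simp
   qed simp
  qed
  also have "\<dots> = (\<integral>\<^sup>+t. (\<integral>\<^sup>+x. ennreal (gauss2 (1 + ka * t) (1 + kb * t) (kg * t) x) * indicator {0..} t \<partial>lborel) \<partial>lborel)"
  proof (rule lborel_pair.Fubini'[symmetric])
   have [measurable]: "(\<lambda>z::conf2 \<times> real. gauss2 (1 + ka * snd z) (1 + kb * snd z) (kg * snd z) (fst z)) \<in> borel_measurable borel"
    "(snd :: conf2 \<times> real \<Rightarrow> real) \<in> borel_measurable borel"
    unfolding gauss2_def by (intro borel_measurable_continuous_onI continuous_intros)+
   show "(\<lambda>(x, t). ennreal (gauss2 (1 + ka * t) (1 + kb * t) (kg * t) x) * indicator {0..} t) \<in> borel_measurable (lborel \<Otimes>\<^sub>M lborel)"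
    unfolding lborel_prod split_beta' by measurable
  qed
  also have "\<dots> \<le> (\<integral>\<^sup>+t. ennreal (pi ^ 3) * (ennreal (1 / sqrt (1 + k * t) ^ 3) * indicator {0..} t) \<partial>lborel)"
  proof (rule nn_integral_mono)
   fix t :: real
   show "(\<integral>\<^sup>+x. ennreal (gauss2 (1 + ka * t) (1 + kb * t) (kg * t) x) * indicator {0..} t \<partial>lborel)
    \<le> ennreal (pi ^ 3) * (ennreal (1 / sqrt (1 + k * t) ^ 3) * indicator {0..} t)"
   proof (cases "t \<ge> 0")
    case True
    have p: "1 + k * t > 0" using True k by (simp add: add_pos_nonneg)
    have "(\<integral>\<^sup>+x. ennreal (gauss2 (1 + ka * t) (1 + kb * t) (kg * t) x) \<partial>lborel) =
     ennreal (pi ^ 3 / sqrt ((1 + ka * t) * (1 + kb * t) + (1 + ka * t) * (kg * t) + (1 + kb * t) * (kg * t)) ^ 3)"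
     by (rule nn_integral_gauss2) (use True k in \<open>auto simp: add_pos_nonneg\<close>)
    also have "\<dots> \<le> ennreal (pi ^ 3 / sqrt (1 + k * t) ^ 3)"
     using k(5)[of t] p by (intro ennreal_leI divide_left_mono power_mono real_sqrt_le_mono mult_pos_pos) auto
    finally show ?thesis using True p by (simp flip: ennreal_mult)
   qed simp
  qed
  also have "\<dots> = ennreal (pi ^ 3) * (\<integral>\<^sup>+t. (ennreal (1 / sqrt (1 + k * t) ^ 3) * indicator {0..} t) \<partial>lborel)"
   by (rule nn_integral_cmult) measurable
  also have "\<dots> < \<infinity>" using nn_integral_subordination_finite[OF k(4)] by (simp add: ennreal_mult_less_top)
  finally show "(\<integral>\<^sup>+x. ennreal (norm (gauss2 1 1 0 x / (norm (p x))^2)) \<partial>lborel) < \<infinity>" .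
 qed measurable
 have mf: "(fst :: conf2 \<Rightarrow> _) \<in> borel_measurable borel" "(snd :: conf2 \<Rightarrow> _) \<in> borel_measurable borel"
  "(\<lambda>x::conf2. fst x - snd x) \<in> borel_measurable borel"
  by (intro borel_measurable_continuous_onI continuous_intros)+
 show "integrable lborel (\<lambda>x::conf2. gauss2 1 1 0 x / (norm (fst x))^2)"
  by (rule gen[OF mf(1), of 1 0 0 1]) (auto simp: gauss2_def algebra_simps simp flip: exp_add)
 show "integrable lborel (\<lambda>x::conf2. gauss2 1 1 0 x / (norm (snd x))^2)"
  by (rule gen[OF mf(2), of 0 1 0 1]) (auto simp: gauss2_def algebra_simps simp flip: exp_add)
 show "integrable lborel (\<lambda>x::conf2. gauss2 1 1 0 x / (norm (fst x - snd x))^2)"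
  by (rule gen[OF mf(3), of 0 0 1 2]) (auto simp: gauss2_def algebra_simps simp flip: exp_add)
qed

section \<open>The ground state transformation\<close>

text \<open>A regularised norm: smooth for \<open>n \<noteq> 0\<close>, above the norm, and tending
  to it as \<open>n\<close> tends to zero. The value \<open>n = 1\<close> serves as the radial
  variable of the supersolutions.\<close>

definition smr :: "real \<Rightarrow> 'a::euclidean_space \<Rightarrow> real" where
 "smr n z = sqrt ((norm z)^2 + n^2)"

abbreviation tt :: "'a::euclidean_space \<Rightarrow> real" where "tt \<equiv> smr 1"

lemma smr_pos: "n \<noteq> 0 \<Longrightarrow> smr n z > 0"
 unfolding smr_def by (simp add: add_nonneg_pos)

lemma smr_sq: "smr n z * smr n z = (norm z)^2 + n^2" "(smr n z)^2 = (norm z)^2 + n^2"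
 unfolding smr_def by simp_all

lemma norm_le_smr: "norm z \<le> smr n z"
 unfolding smr_def by (rule real_le_rsqrt) simp

lemma tt_ge_1: "tt z \<ge> 1" unfolding smr_def by simp

lemma tt_le: "tt z \<le> 1 + norm z"
 unfolding smr_def using sqrt_sum_squares_le_sum[of "norm z" 1] by simp

lemma continuous_on_smr [continuous_intros]: "continuous_on S f \<Longrightarrow> continuous_on S (\<lambda>x. smr n (f x))"
 unfolding smr_def by (intro continuous_intros)

lemma smr_measurable [measurable]: "smr n \<in> borel_measurable borel"
 by (intro borel_measurable_continuous_onI continuous_intros)

lemma sqrt_shift_deriv:
 assumes "n \<noteq> (0::real)" "s \<ge> 0"
 shows "((\<lambda>s. sqrt (s + n^2)) has_real_derivative 1 / (2 * sqrt (s + n^2))) (at s)"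
  "((\<lambda>s. 1 / (2 * sqrt (s + n^2))) has_real_derivative - 1 / (4 * sqrt (s + n^2) ^ 3)) (at s)"
proof -
 have p: "s + n^2 > 0" using assms by (simp add: add_nonneg_pos)
 have q: "sqrt (s + n^2) > 0" using p by simp
 show 1: "((\<lambda>s. sqrt (s + n^2)) has_real_derivative 1 / (2 * sqrt (s + n^2))) (at s)"
  using p by (auto intro!: derivative_eq_intros simp: field_simps)
 show "((\<lambda>s. 1 / (2 * sqrt (s + n^2))) has_real_derivative - 1 / (4 * sqrt (s + n^2) ^ 3)) (at s)"
  by (rule DERIV_cong[OF DERIV_divide[OF DERIV_const DERIV_cmult[OF 1]]])
    (use q in \<open>auto simp: power3_eq_cube field_simps\<close>)
qed

lemma continuous_on_sqrt_shift:
 assumes "n \<noteq> (0::real)"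
 shows "continuous_on {0..} (\<lambda>s. - 1 / (4 * sqrt (s + n^2) ^ 3))"
proof (intro continuous_intros ballI)
 fix s :: real assume "s \<in> {0..}"
 then have "s + n^2 > 0" using assms by (simp add: add_nonneg_pos)
 then show "4 * sqrt (s + n^2) ^ 3 \<noteq> 0" by simp
qed

lemma C2GL_smr_fst:
 assumes n: "n \<noteq> 0"
 shows "C2GL (\<lambda>x::conf2. smr n (fst x)) (\<lambda>x. ((1 / smr n (fst x)) *\<^sub>R fst x, 0))
   (\<lambda>x. 3 / smr n (fst x) - (norm (fst x))^2 / smr n (fst x) ^ 3)"
proof (rule C2GL_cong[OF C2GL_compose[OF C2GL_fst_sq, of "{0..}" "\<lambda>s. sqrt (s + n^2)"
    "\<lambda>s. 1 / (2 * sqrt (s + n^2))" "\<lambda>s. - 1 / (4 * sqrt (s + n^2) ^ 3)"]])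
 fix x :: conf2
 have "(2 *\<^sub>R fst x, 0::real^3) \<bullet> (2 *\<^sub>R fst x, 0::real^3) = 4 * (norm (fst x))^2"
  by (simp add: inner_prod_def power2_norm_eq_inner)
 then show "3 / smr n (fst x) - (norm (fst x))^2 / smr n (fst x) ^ 3 =
   1 / (2 * sqrt ((norm (fst x))^2 + n^2)) * (2 * real DIM(real^3))
   + - 1 / (4 * sqrt ((norm (fst x))^2 + n^2) ^ 3) * ((2 *\<^sub>R fst x, 0::real^3) \<bullet> (2 *\<^sub>R fst x, 0::real^3))"
  unfolding smr_def by (simp only:) simp
qed (use sqrt_shift_deriv[OF n] continuous_on_sqrt_shift[OF n] in \<open>auto simp: smr_def\<close>)

lemma C2GL_smr_snd:
 assumes n: "n \<noteq> 0"
 shows "C2GL (\<lambda>x::conf2. smr n (snd x)) (\<lambda>x. (0, (1 / smr n (snd x)) *\<^sub>R snd x))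
   (\<lambda>x. 3 / smr n (snd x) - (norm (snd x))^2 / smr n (snd x) ^ 3)"
proof (rule C2GL_cong[OF C2GL_compose[OF C2GL_snd_sq, of "{0..}" "\<lambda>s. sqrt (s + n^2)"
    "\<lambda>s. 1 / (2 * sqrt (s + n^2))" "\<lambda>s. - 1 / (4 * sqrt (s + n^2) ^ 3)"]])
 fix x :: conf2
 have "(0::real^3, 2 *\<^sub>R snd x) \<bullet> (0::real^3, 2 *\<^sub>R snd x) = 4 * (norm (snd x))^2"
  by (simp add: inner_prod_def power2_norm_eq_inner)
 then show "3 / smr n (snd x) - (norm (snd x))^2 / smr n (snd x) ^ 3 =
   1 / (2 * sqrt ((norm (snd x))^2 + n^2)) * (2 * real DIM(real^3))
   + - 1 / (4 * sqrt ((norm (snd x))^2 + n^2) ^ 3) * ((0::real^3, 2 *\<^sub>R snd x) \<bullet> (0::real^3, 2 *\<^sub>R snd x))"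
  unfolding smr_def by (simp only:) simp
qed (use sqrt_shift_deriv[OF n] continuous_on_sqrt_shift[OF n] in \<open>auto simp: smr_def\<close>)

lemma C2GL_exp:
 assumes "C2GL f g l"
 shows "C2GL (\<lambda>x. exp (f x)) (\<lambda>x. exp (f x) *\<^sub>R g x) (\<lambda>x. exp (f x) * (l x + g x \<bullet> g x))"
 by (rule C2GL_cong[OF C2GL_compose[OF assms, of UNIV exp exp exp]])
   (auto intro!: derivative_eq_intros continuous_intros simp: algebra_simps)

section \<open>The transformed operator and its weak inequality\<close>

lemma AE_conf2_nonzero:
 "AE x in (lborel :: conf2 measure). fst x \<noteq> 0 \<and> snd x \<noteq> 0 \<and> fst x \<noteq> snd x"
proof -
 have mf: "(fst :: conf2 \<Rightarrow> _) \<in> borel_measurable borel" "(snd :: conf2 \<Rightarrow> _) \<in> borel_measurable borel"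
  by (intro borel_measurable_continuous_onI continuous_intros)+
 have "AE x in (lborel \<Otimes>\<^sub>M lborel :: conf2 measure). fst x \<noteq> 0 \<and> snd x \<noteq> 0 \<and> fst x \<noteq> snd x"
 proof (rule lborel_pair.AE_pair_measure)
  have "{x::conf2. fst x \<noteq> 0 \<and> snd x \<noteq> 0 \<and> fst x \<noteq> snd x} \<in> sets borel"
   using mf by measurable
  then show "{x \<in> space (lborel \<Otimes>\<^sub>M lborel :: conf2 measure). fst x \<noteq> 0 \<and> snd x \<noteq> 0 \<and> fst x \<noteq> snd x} \<in> sets (lborel \<Otimes>\<^sub>M lborel)"
   unfolding lborel_prod by simp
  show "AE x in lborel. AE y in lborel. fst (x, y) \<noteq> (0::real^3) \<and> snd (x, y) \<noteq> 0 \<and> fst (x, y) \<noteq> snd (x, y)"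
   using AE_lborel_singleton[of "0::real^3"]
  proof eventually_elim
   case (elim x)
   show ?case using AE_lborel_singleton[of "0::real^3"] AE_lborel_singleton[of x]
    by eventually_elim (use elim in auto)
  qed
 qed
 then show ?thesis unfolding lborel_prod .
qed

text \<open>The operator that acts on \<open>f\<close> when \<open>exp (- Z (|x1| + |x2|)) f\<close>
  is the test function. Differentiating the exponential produces the drift with the unit vectors
  \<open>sgn\<close>; the constant is \<open>- Z^2\<close> from the two exponentials plus the
  threshold \<open>Z^2 / 2\<close>. The repulsion appears only through its bounded minorant.\<close>

definition Lop :: "real \<Rightarrow> (conf2 \<Rightarrow> real) \<Rightarrow> (conf2 \<Rightarrow> conf2) \<Rightarrow> (conf2 \<Rightarrow> real) \<Rightarrow> conf2 \<Rightarrow> real" where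
 "Lop Z f g l x = - (1/2) * l x + Z * (sgn (fst x) \<bullet> fst (g x) + sgn (snd x) \<bullet> snd (g x))
   + (1 / (tt (fst x) + tt (snd x)) - Z^2 / 2) * f x"

text \<open>Inside the ball the Gaussian is at least \<open>exp (- R^2)\<close>, and
  \<open>a b \<le> a^2 + b^2\<close> separates \<open>v\<close> from the singularity.\<close>

lemma integrable_ball_div_norm:
 fixes p :: "conf2 \<Rightarrow> real^3" and v :: "conf2 \<Rightarrow> real"
 assumes i: "integrable lborel (\<lambda>x. gauss2 1 1 0 x / (norm (p x))^2)" and [measurable]: "p \<in> borel_measurable borel"
  and [measurable]: "v \<in> borel_measurable borel" and v2: "integrable lborel (\<lambda>x. (v x)^2)"
 shows "integrable lborel (\<lambda>x. indicator (cball 0 R) x * (v x / norm (p x)))"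
proof (rule bintegrable_bound)
 show "integrable lborel (\<lambda>x. (v x)^2 + exp (R^2) * (gauss2 1 1 0 x / (norm (p x))^2))"
  by (intro bintegrable_add integrable_mult_right i v2)
 have [measurable]: "cball (0::conf2) R \<in> sets borel" by simp
 show "(\<lambda>x. indicator (cball 0 R) x * (v x / norm (p x))) \<in> borel_measurable lborel" by measurable
 show "AE x in lborel. norm (indicator (cball 0 R) x * (v x / norm (p x))) \<le> norm ((v x)^2 + exp (R^2) * (gauss2 1 1 0 x / (norm (p x))^2))"
 proof (rule AE_I2)
  fix x :: conf2
  show "norm (indicator (cball 0 R) x * (v x / norm (p x))) \<le> norm ((v x)^2 + exp (R^2) * (gauss2 1 1 0 x / (norm (p x))^2))"
  proof (cases "norm x \<le> R")
   case True
   have "(norm (fst x))^2 + (norm (snd x))^2 = (norm x)^2" by (simp add: norm_prod_def)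
   also have "\<dots> \<le> R^2" using True by (simp add: power_mono)
   finally have "1 \<le> exp (R^2) * gauss2 1 1 0 x" unfolding gauss2_def by (simp flip: exp_add)
   then have "1 * (1 / (norm (p x))^2) \<le> (exp (R^2) * gauss2 1 1 0 x) * (1 / (norm (p x))^2)"
    by (intro mult_right_mono) auto
   moreover have "0 \<le> \<bar>v x\<bar> * (1 / norm (p x))" by simp
   then have "\<bar>v x\<bar> * (1 / norm (p x)) \<le> (v x)^2 + (1 / norm (p x))^2"
    using sum_squares_bound[of "\<bar>v x\<bar>" "1 / norm (p x)"] by (simp only: mult.assoc power2_abs)
   ultimately show ?thesis using gauss2_pos[of 1 1 0 x] True by (simp add: power_divide abs_mult)
  qed (use gauss2_pos[of 1 1 0 x] in simp)
 qed
qed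

lemma integrable_ball_of_square:
 fixes v :: "'a::euclidean_space \<Rightarrow> real"
 assumes [measurable]: "v \<in> borel_measurable borel" and v2: "integrable lborel (\<lambda>x. (v x)^2)"
 shows "integrable lborel (\<lambda>x. indicator (cball 0 R) x * v x)"
proof (rule bintegrable_bound)
 have [measurable]: "cball (0::'a) R \<in> sets borel" by simp
 show "integrable lborel (\<lambda>x. (v x)^2 + indicator (cball (0::'a) R) x)"
  using v2 emeasure_bounded_finite[of "cball (0::'a) R"] by (intro bintegrable_add integrable_real_indicator) auto
 show "(\<lambda>x. indicator (cball 0 R) x * v x) \<in> borel_measurable lborel" by measurable
 show "AE x in lborel. norm (indicator (cball 0 R) x * v x) \<le> norm ((v x)^2 + indicator (cball (0::'a) R) x)"
 proof (rule AE_I2)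
  fix x
  have "2 * \<bar>v x\<bar> \<le> (v x)^2 + 1" using sum_squares_bound[of "\<bar>v x\<bar>" 1] by simp
  then have "\<bar>v x\<bar> \<le> (v x)^2 + 1" using abs_ge_zero[of "v x"] by linarith
  then show "norm (indicator (cball 0 R) x * v x) \<le> norm ((v x)^2 + indicator (cball (0::'a) R) x)"
   by (auto simp: indicator_def)
 qed
qed

text \<open>The information on \<open>u\<close> is recorded only as an inequality against
  nonnegative test functions. No gradient of \<open>u\<close> is ever formed, so nothing has to be
  known about its regularity.\<close>

locale coulomb_subsolution =
 fixes Z :: real and u :: "conf2 \<Rightarrow> real"
 assumes Zpos: "Z > 0"
  and u_meas [measurable]: "u \<in> borel_measurable borel"
  and u_nonneg: "\<And>x. u x \<ge> 0"
  and u_sq: "integrable lborel (\<lambda>x. (u x)^2)"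
  and sub: "\<And>f g l. C2GL f g l \<Longrightarrow> bounded {x. f x \<noteq> 0} \<Longrightarrow> (\<And>x. f x \<ge> 0) \<Longrightarrow>
    (LBINT x. u x * (- (1/2) * l x + (V2 Z x + Z^2 / 2) * f x)) \<le> 0"
begin

definition w :: "conf2 \<Rightarrow> real" where
 "w x = u x * exp (- Z * (norm (fst x) + norm (snd x)))"

lemma fst_snd_meas [measurable]:
 "(fst :: conf2 \<Rightarrow> _) \<in> borel_measurable borel" "(snd :: conf2 \<Rightarrow> _) \<in> borel_measurable borel"
 by (intro borel_measurable_continuous_onI continuous_intros)+

lemma w_meas [measurable]: "w \<in> borel_measurable borel"
 unfolding w_def[abs_def] by measurable

lemma w_nonneg: "w x \<ge> 0" unfolding w_def using u_nonneg by simp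

lemma u_div_integrable:
 fixes p :: "conf2 \<Rightarrow> real^3"
 assumes "integrable lborel (\<lambda>x. gauss2 1 1 0 x / (norm (p x))^2)" "p \<in> borel_measurable borel"
 shows "integrable lborel (\<lambda>x. indicator (cball 0 R) x * (u x / norm (p x)))"
 by (rule integrable_ball_div_norm[OF assms u_meas u_sq])

lemma u_loc_integrable: "integrable lborel (\<lambda>x. indicator (cball 0 R) x * u x)"
 by (rule integrable_ball_of_square[OF u_meas u_sq])

lemma w_loc_integrable: "integrable lborel (\<lambda>x. indicator (cball 0 R) x * w x)"
proof (rule bintegrable_bound[OF u_loc_integrable[of R]])
 have [measurable]: "cball (0::conf2) R \<in> sets borel" by simp
 show "(\<lambda>x. indicator (cball 0 R) x * w x) \<in> borel_measurable lborel" by measurable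
 show "AE x in lborel. norm (indicator (cball 0 R) x * w x) \<le> norm (indicator (cball 0 R) x * u x)"
  unfolding w_def using u_nonneg Zpos by (intro AE_I2) (auto simp: indicator_def abs_mult intro!: mult_left_le)
qed

text \<open>The exponential of the distances is not C^2 at the nucleus, so the test functions are
  built with the regularised distances \<open>smr (n k)\<close>. In the limit the Coulomb
  singularities are the only unbounded terms, and they are integrable against \<open>u\<close> on
  balls.\<close>

lemma transformed_inequality:
 assumes et: "C2GL et g l" "bounded {x. et x \<noteq> 0}" "\<And>x. et x \<ge> 0"
 shows "(LBINT x. w x * Lop Z et g l x) \<le> 0" "integrable lborel (\<lambda>x. w x * Lop Z et g l x)"
proof -
 note c = C2GL_D[OF et(1)] and s = C2GL_support[OF et(1,2)]
 have [measurable]: "et \<in> borel_measurable borel" "g \<in> borel_measurable borel" "l \<in> borel_measurable borel"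
  using C2GL_measurable[OF et(1)] by auto
 obtain C1 where C1: "C1 > 0" "\<And>x. \<bar>et x\<bar> \<le> C1" using continuous_bounded_support_bound[OF c(2) et(2)] by auto
 obtain C3 where C3: "C3 > 0" "\<And>x. \<bar>l x\<bar> \<le> C3" using continuous_bounded_support_bound[OF c(4) s(2)] by auto
 have "\<exists>C>0. \<forall>x. \<bar>norm (g x)\<bar> \<le> C"
  by (rule continuous_bounded_support_bound) (use s(1) in \<open>auto intro!: continuous_intros c\<close>)
 then obtain C2 where C2: "C2 > 0" "\<And>x. norm (g x) \<le> C2" by auto
 obtain R where R: "{x. et x \<noteq> 0} \<union> {x. g x \<noteq> 0} \<union> {x. l x \<noteq> 0} \<subseteq> cball 0 R"
  using bounded_subset_cball_zero[of "{x. et x \<noteq> 0} \<union> {x. g x \<noteq> 0} \<union> {x. l x \<noteq> 0}"] et(2) s by auto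
 have [measurable]: "cball (0::conf2) R \<in> sets borel" by simp
 define r12 where "r12 x = norm (fst x - snd x)" for x :: conf2
 define n where "n k = inverse (real (Suc k))" for k
 have n: "\<And>k. n k > 0" "\<And>k. n k \<noteq> 0" "\<And>k. n k \<le> 1" "n \<longlonglongrightarrow> 0"
  unfolding n_def using LIMSEQ_inverse_real_of_nat by (auto simp: field_simps)
 define s1 where "s1 k x = smr (n k) (fst x)" for k and x :: conf2
 define s2 where "s2 k x = smr (n k) (snd x)" for k and x :: conf2
 have sp: "s1 k x > 0" "s2 k x > 0" for k x unfolding s1_def s2_def by (rule smr_pos[OF n(2)])+
 define P where "P k x = exp (- Z * (s1 k x + s2 k x))" for k x
 define A where "A k x = 3 / s1 k x - (norm (fst x))^2 / s1 k x ^ 3 + (3 / s2 k x - (norm (snd x))^2 / s2 k x ^ 3)" for k x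
 define B where "B k x = ((norm (fst x)) / s1 k x)^2 + ((norm (snd x)) / s2 k x)^2" for k x
 define D where "D k x = (1 / s1 k x) * (fst x \<bullet> fst (g x)) + (1 / s2 k x) * (snd x \<bullet> snd (g x))" for k x
 define T where "T k x = P k x * (- (1/2) * l x + Z * D k x + et x * (Z / 2 * A k x - Z^2 / 2 * B k x + (V2 Z x + Z^2 / 2)))" for k x
 have le0: "(LBINT x. u x * T k x) \<le> 0" for k
 proof -
  have CS: "C2GL (\<lambda>x. - Z * (s1 k x + s2 k x)) (\<lambda>x. (- Z) *\<^sub>R (((1 / s1 k x) *\<^sub>R fst x, 0) + (0, (1 / s2 k x) *\<^sub>R snd x))) (\<lambda>x. - Z * A k x)"
   unfolding s1_def s2_def A_def by (rule C2GL_cmult[OF C2GL_add[OF C2GL_smr_fst[OF n(2)] C2GL_smr_snd[OF n(2)]]])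
  note C = C2GL_mult[OF C2GL_exp[OF CS] et(1), folded P_def]
  have b: "bounded {x. P k x * et x \<noteq> 0}" by (rule bounded_subset[OF et(2)]) auto
  have nn: "P k x * et x \<ge> 0" for x unfolding P_def using et(3) by simp
  show ?thesis
  proof (rule order_trans[OF eq_refl sub[OF C b nn]], rule bintegral_cong[OF refl])
   fix x
   define G where "G = (- Z) *\<^sub>R (((1 / s1 k x) *\<^sub>R fst x, 0) + (0, (1 / s2 k x) *\<^sub>R snd x))"
   have GG: "G \<bullet> G = Z^2 * B k x"
    unfolding G_def B_def using sp[of k x]
    by (simp add: inner_prod_def power2_norm_eq_inner[symmetric] power_divide power2_eq_square field_simps)
   have Gg: "(P k x *\<^sub>R G) \<bullet> g x = - Z * D k x * P k x"
    unfolding G_def D_def by (cases "g x") (simp add: inner_prod_def algebra_simps)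
   show "u x * T k x = u x * (- (1/2) * (P k x * l x + et x * (P k x * (- Z * A k x + G \<bullet> G)) + 2 * ((P k x *\<^sub>R G) \<bullet> g x))
     + (V2 Z x + Z^2 / 2) * (P k x * et x))"
    unfolding T_def GG Gg by (simp add: algebra_simps)
  qed
 qed
 define T0 where "T0 x = exp (- Z * (norm (fst x) + norm (snd x))) * (- (1/2) * l x
   + Z * (sgn (fst x) \<bullet> fst (g x) + sgn (snd x) \<bullet> snd (g x)) + et x * (1 / r12 x - Z^2 / 2))" for x
 \<comment> \<open>Majorant for all \<open>k\<close> at once: the Laplacian of a regularised
   distance is at most three times the inverse distance, and \<open>P k\<close> is at most
   one.\<close>
 define M where "M x = C3 + 2 * Z * C2 + C1 * (2 * Z^2 + 1 + Z + 3 * Z * (1 / norm (fst x) + 1 / norm (snd x)) + 1 / r12 x)" for x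
 have uM: "integrable lborel (\<lambda>x. indicator (cball 0 R) x * (u x * M x))"
 proof -
  have m3: "(\<lambda>x::conf2. fst x - snd x) \<in> borel_measurable borel" by measurable
  have e: "indicator (cball 0 R) x * (u x * M x) = (C3 + 2 * Z * C2 + C1 * (2 * Z^2 + 1 + Z)) * (indicator (cball 0 R) x * u x)
    + (C1 * 3 * Z) * (indicator (cball 0 R) x * (u x / norm (fst x))) + (C1 * 3 * Z) * (indicator (cball 0 R) x * (u x / norm (snd x)))
    + C1 * (indicator (cball 0 R) x * (u x / norm (fst x - snd x)))" for x
   unfolding M_def r12_def by (simp add: algebra_simps)
  show ?thesis unfolding e
   by (intro bintegrable_add integrable_mult_right u_loc_integrable u_div_integrable
     inverse_square_gauss2_integrable fst_snd_meas m3)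
 qed
 have dom: "AE x in lborel. norm (u x * T k x) \<le> indicator (cball 0 R) x * (u x * M x)" for k
  using AE_conf2_nonzero
 proof eventually_elim
  case (elim x)
  show ?case
  proof (cases "x \<in> cball 0 R")
   case False
   then have "et x = 0" "g x = 0" "l x = 0" using R by blast+
   then show ?thesis using False unfolding T_def D_def by simp
  next
   case True
   have rp: "norm (fst x) > 0" "norm (snd x) > 0" using elim by auto
   have r_s: "norm (fst x) \<le> s1 k x" "norm (snd x) \<le> s2 k x" unfolding s1_def s2_def by (rule norm_le_smr)+
   have bnd: "0 \<le> 3 / ss - rr^2 / ss ^ 3 \<and> 3 / ss - rr^2 / ss ^ 3 \<le> 3 * (1 / rr) \<and> (rr / ss)^2 \<le> 1" if "0 < rr" "rr \<le> ss" for rr ss :: real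
   proof (intro conjI)
    have "rr^2 \<le> ss^2" using that by (simp add: power_mono)
    then have "rr^2 / ss ^ 3 \<le> ss^2 / ss ^ 3" using that by (intro divide_right_mono) auto
    also have "\<dots> = 1 / ss" using that by (simp add: power2_eq_square power3_eq_cube)
    also have "\<dots> \<le> 3 / ss" using that by (intro divide_right_mono) auto
    finally show "0 \<le> 3 / ss - rr^2 / ss ^ 3" by simp
    have "3 / ss \<le> 3 / rr" using that by (intro divide_left_mono) auto
    moreover have "0 \<le> rr^2 / ss ^ 3" using that by simp
    ultimately show "3 / ss - rr^2 / ss ^ 3 \<le> 3 * (1 / rr)" by simp
    show "(rr / ss)^2 \<le> 1" using that by (intro power_le_one) auto
   qed
   note b1 = bnd[OF rp(1) r_s(1)] and b2 = bnd[OF rp(2) r_s(2)]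
   have A: "0 \<le> A k x" "A k x \<le> 3 * (1 / norm (fst x) + 1 / norm (snd x))" using b1 b2 unfolding A_def by auto
   have B: "0 \<le> B k x" "B k x \<le> 2" using b1 b2 unfolding B_def by (auto simp: add_nonneg_nonneg)
   have P: "0 \<le> P k x" "P k x \<le> 1" unfolding P_def using sp[of k x] Zpos by auto
   have D: "\<bar>D k x\<bar> \<le> 2 * C2"
   proof -
    have "\<bar>(1 / s1 k x) * (fst x \<bullet> fst (g x))\<bar> \<le> 1 * C2"
    proof -
     have "\<bar>fst x \<bullet> fst (g x)\<bar> \<le> norm (fst x) * norm (fst (g x))" by (rule Cauchy_Schwarz_ineq2)
     also have "\<dots> \<le> s1 k x * C2" using r_s(1) C2(2)[of x] norm_fst_le[of "fst (g x)" "snd (g x)"] sp[of k x]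
      by (intro mult_mono) auto
     finally show ?thesis using sp[of k x] by (simp add: abs_mult field_simps)
    qed
    moreover have "\<bar>(1 / s2 k x) * (snd x \<bullet> snd (g x))\<bar> \<le> 1 * C2"
    proof -
     have "\<bar>snd x \<bullet> snd (g x)\<bar> \<le> norm (snd x) * norm (snd (g x))" by (rule Cauchy_Schwarz_ineq2)
     also have "\<dots> \<le> s2 k x * C2" using r_s(2) C2(2)[of x] norm_snd_le[of "snd (g x)" "fst (g x)"] sp[of k x]
      by (intro mult_mono) auto
     finally show ?thesis using sp[of k x] by (simp add: abs_mult field_simps)
    qed
    ultimately show ?thesis unfolding D_def by linarith
   qed
   define h where "h = 1 / norm (fst x) + 1 / norm (snd x)"
   have h: "h \<ge> 0" unfolding h_def by simp
   have r12: "1 / r12 x \<ge> 0" unfolding r12_def by simp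
   have V: "V2 Z x = - Z * h + 1 / r12 x" unfolding V2_def h_def r12_def by (simp add: algebra_simps)
   have ZA: "Z / 2 * A k x \<le> Z * (2 * h)" "0 \<le> Z / 2 * A k x"
   proof -
    have "Z * A k x \<le> Z * (3 * h)" using A Zpos unfolding h_def by (intro mult_left_mono) auto
    moreover have "0 \<le> Z * h" using Zpos h by simp
    ultimately show "Z / 2 * A k x \<le> Z * (2 * h)" by simp
    show "0 \<le> Z / 2 * A k x" using A Zpos by simp
   qed
   have ZB: "0 \<le> Z^2 / 2 * B k x" "Z^2 / 2 * B k x \<le> Z^2"
    using mult_left_mono[OF B(2), of "Z^2 / 2"] B by auto
   have Zh: "0 \<le> Z * h" using Zpos h by simp
   have e1: "\<bar>Z / 2 * A k x - Z^2 / 2 * B k x + (V2 Z x + Z^2 / 2)\<bar> \<le> 2 * Z^2 + 1 + Z + 3 * Z * h + 1 / r12 x"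
    by (rule abs_leI) (use ZA ZB Zh r12 Zpos zero_le_power2[of Z] V in linarith)+
   have e2: "\<bar>et x * (Z / 2 * A k x - Z^2 / 2 * B k x + (V2 Z x + Z^2 / 2))\<bar> \<le> C1 * (2 * Z^2 + 1 + Z + 3 * Z * h + 1 / r12 x)"
    unfolding abs_mult using C1 e1 by (intro mult_mono) auto
   have e3: "\<bar>Z * D k x\<bar> \<le> 2 * Z * C2" using mult_left_mono[OF D, of Z] Zpos by (simp add: abs_mult)
   have e4: "\<bar>- (1/2) * l x\<bar> \<le> C3" using C3(2)[of x] by simp
   have "\<bar>- (1/2) * l x + Z * D k x + et x * (Z / 2 * A k x - Z^2 / 2 * B k x + (V2 Z x + Z^2 / 2))\<bar> \<le> M x"
    using e2 e3 e4 unfolding M_def h_def[symmetric] by linarith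
   then have "\<bar>T k x\<bar> \<le> 1 * M x" unfolding T_def abs_mult using P by (intro mult_mono) auto
   then show ?thesis using True u_nonneg[of x] by (simp add: abs_mult mult_left_mono)
  qed
 qed
 have lim: "AE x in lborel. (\<lambda>k. u x * T k x) \<longlonglongrightarrow> u x * T0 x"
  using AE_conf2_nonzero
 proof eventually_elim
  case (elim x)
  have sl: "(\<lambda>k. s1 k x) \<longlonglongrightarrow> norm (fst x)" "(\<lambda>k. s2 k x) \<longlonglongrightarrow> norm (snd x)"
  proof -
   have "(\<lambda>k. sqrt ((norm z)^2 + (n k)^2)) \<longlonglongrightarrow> sqrt ((norm z)^2 + 0^2)" for z :: "real^3"
    by (intro tendsto_intros n)
   then show "(\<lambda>k. s1 k x) \<longlonglongrightarrow> norm (fst x)" "(\<lambda>k. s2 k x) \<longlonglongrightarrow> norm (snd x)"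
    unfolding s1_def s2_def smr_def by simp_all
  qed
  have nz: "norm (fst x) \<noteq> 0" "norm (snd x) \<noteq> 0" using elim by auto
  define a1 where "a1 = norm (fst x)"
  define a2 where "a2 = norm (snd x)"
  have "(\<lambda>k. T k x) \<longlonglongrightarrow> exp (- Z * (a1 + a2)) * (- (1/2) * l x + Z * ((1 / a1) * (fst x \<bullet> fst (g x)) + (1 / a2) * (snd x \<bullet> snd (g x)))
    + et x * (Z / 2 * (3 / a1 - (norm (fst x))^2 / a1 ^ 3 + (3 / a2 - (norm (snd x))^2 / a2 ^ 3))
     - Z\<^sup>2 / 2 * ((norm (fst x) / a1)^2 + (norm (snd x) / a2)^2) + (V2 Z x + Z^2 / 2)))"
   (is "filterlim _ (nhds ?L) _")
   unfolding T_def P_def A_def B_def D_def a1_def a2_def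
   by (intro tendsto_intros sl nz) (use nz in auto)
  moreover have "?L = T0 x"
  proof -
   have e: "3 / a - a^2 / a ^ 3 = 2 / a" if "a \<noteq> 0" for a :: real
    using that by (simp add: power2_eq_square power3_eq_cube field_simps)
   have "Z / 2 * (2 / a1 + 2 / a2) - Z^2 / 2 * (1 + 1) + (V2 Z x + Z^2 / 2) = 1 / r12 x - Z^2 / 2"
    unfolding V2_def r12_def a1_def a2_def by (simp add: algebra_simps)
   moreover have "3 / a1 - (norm (fst x))^2 / a1 ^ 3 = 2 / a1" "3 / a2 - (norm (snd x))^2 / a2 ^ 3 = 2 / a2"
    using e[OF nz(1)] e[OF nz(2)] unfolding a1_def a2_def by auto
   moreover have "(norm (fst x) / a1)^2 = 1" "(norm (snd x) / a2)^2 = 1" using nz unfolding a1_def a2_def by auto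
   moreover have "sgn z \<bullet> y = (1 / norm z) * (z \<bullet> y)" for z y :: "real^3"
    by (simp add: sgn_div_norm divide_inverse)
   ultimately show ?thesis unfolding T0_def by (simp only: a1_def[symmetric] a2_def[symmetric])
  qed
  ultimately show ?case by (intro tendsto_mult tendsto_const) simp
 qed
 have mT[measurable]: "T k \<in> borel_measurable borel" for k
  unfolding T_def[abs_def] P_def A_def B_def D_def s1_def s2_def V2_def by measurable
 have mT0[measurable]: "T0 \<in> borel_measurable borel"
  unfolding T0_def[abs_def] r12_def sgn_div_norm by measurable
 have iT: "integrable lborel (\<lambda>x. u x * T0 x)" and cT: "(\<lambda>k. LBINT x. u x * T k x) \<longlonglongrightarrow> (LBINT x. u x * T0 x)"
  using integrable_dominated_convergence[OF _ _ uM lim dom] integral_dominated_convergence[OF _ _ uM lim dom] by auto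
 have T0le: "(LBINT x. u x * T0 x) \<le> 0"
  by (rule LIMSEQ_le_const2[OF cT]) (use le0 in auto)
 have mL[measurable]: "Lop Z et g l \<in> borel_measurable borel"
  unfolding Lop_def[abs_def] sgn_div_norm by measurable
 \<comment> \<open>Only here is the repulsion weakened, through
   \<open>|x1 - x2| \<le> t1 + t2\<close>; the sign of \<open>et\<close> decides the direction of
   the inequality.\<close>
 have ptw: "AE x in lborel. w x * Lop Z et g l x \<le> u x * T0 x"
  using AE_conf2_nonzero
 proof eventually_elim
  case (elim x)
  have "r12 x > 0" using elim unfolding r12_def by simp
  moreover have "r12 x \<le> tt (fst x) + tt (snd x)"
   unfolding r12_def using norm_triangle_ineq4[of "fst x" "snd x"] norm_le_smr[of "fst x" 1] norm_le_smr[of "snd x" 1] by linarith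
  ultimately have "1 / (tt (fst x) + tt (snd x)) \<le> 1 / r12 x" by (intro divide_left_mono) auto
  then have "1 / (tt (fst x) + tt (snd x)) - Z^2 / 2 \<le> 1 / r12 x - Z^2 / 2" by simp
  from mult_right_mono[OF this et(3)[of x]]
  have "(1 / (tt (fst x) + tt (snd x)) - Z^2 / 2) * et x \<le> et x * (1 / r12 x - Z^2 / 2)"
   by (simp add: mult.commute)
  then show ?case unfolding w_def T0_def Lop_def mult.assoc
   by (intro mult_left_mono u_nonneg) auto
 qed
 show iL: "integrable lborel (\<lambda>x. w x * Lop Z et g l x)"
 proof (rule bintegrable_bound)
  show "integrable lborel (\<lambda>x. (C3 + 2 * Z * C2 + (1 + Z^2) * C1) * (indicator (cball 0 R) x * w x))"
   by (intro integrable_mult_right w_loc_integrable)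
  show "AE x in lborel. norm (w x * Lop Z et g l x) \<le> norm ((C3 + 2 * Z * C2 + (1 + Z^2) * C1) * (indicator (cball 0 R) x * w x))"
  proof (rule AE_I2)
   fix x
   show "norm (w x * Lop Z et g l x) \<le> norm ((C3 + 2 * Z * C2 + (1 + Z^2) * C1) * (indicator (cball 0 R) x * w x))"
   proof (cases "x \<in> cball 0 R")
    case False
    then have "et x = 0" "g x = 0" "l x = 0" using R by blast+
    then show ?thesis unfolding Lop_def by simp
   next
    case True
    have sg: "\<bar>sgn z \<bullet> y\<bar> \<le> norm y" for z y :: "real^3"
     using Cauchy_Schwarz_ineq2[of "sgn z" y] by (simp add: norm_sgn split: if_splits)
    have "\<bar>sgn (fst x) \<bullet> fst (g x) + sgn (snd x) \<bullet> snd (g x)\<bar> \<le> 2 * C2"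
     using sg[of "fst x" "fst (g x)"] sg[of "snd x" "snd (g x)"] C2(2)[of x]
      norm_fst_le[of "fst (g x)" "snd (g x)"] norm_snd_le[of "snd (g x)" "fst (g x)"] by simp
    from mult_left_mono[OF this, of Z]
    have e1: "\<bar>Z * (sgn (fst x) \<bullet> fst (g x) + sgn (snd x) \<bullet> snd (g x))\<bar> \<le> 2 * Z * C2" using Zpos by (simp add: abs_mult)
    have "0 \<le> 1 / (tt (fst x) + tt (snd x))" "1 / (tt (fst x) + tt (snd x)) \<le> 1"
     using tt_ge_1[of "fst x"] tt_ge_1[of "snd x"] by (auto simp: field_simps)
    then have "\<bar>1 / (tt (fst x) + tt (snd x)) - Z^2 / 2\<bar> \<le> 1 + Z^2" using zero_le_power2[of Z] by linarith
    then have "\<bar>(1 / (tt (fst x) + tt (snd x)) - Z^2 / 2) * et x\<bar> \<le> (1 + Z^2) * C1"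
     unfolding abs_mult using C1 by (intro mult_mono) auto
    then have "\<bar>Lop Z et g l x\<bar> \<le> C3 + 2 * Z * C2 + (1 + Z^2) * C1"
     unfolding Lop_def using e1 C3(2)[of x] by linarith
    then show ?thesis using True w_nonneg[of x] by (simp add: abs_mult mult.commute mult_left_mono order_trans[OF _ abs_ge_self])
   qed
  qed
 qed measurable
 show "(LBINT x. w x * Lop Z et g l x) \<le> 0"
  using order_trans[OF integral_mono_AE[OF iL iT ptw] T0le] .
qed

end

section \<open>Admissible test functions and their harmonic means\<close>

lemma Lop_add: "Lop Z (\<lambda>x. f1 x + f2 x) (\<lambda>x. g1 x + g2 x) (\<lambda>x. l1 x + l2 x) x = Lop Z f1 g1 l1 x + Lop Z f2 g2 l2 x"
 unfolding Lop_def by (simp add: algebra_simps inner_add_right add_divide_distrib)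

lemma Lop_cmult: "Lop Z (\<lambda>x. c * f x) (\<lambda>x. c *\<^sub>R g x) (\<lambda>x. c * l x) x = c * Lop Z f g l x"
 unfolding Lop_def by (simp add: algebra_simps)

lemma sgn_inner_bound: "\<bar>sgn z \<bullet> y\<bar> \<le> norm y" for z y :: "'a::real_inner"
proof -
 have "\<bar>sgn z \<bullet> y\<bar> \<le> norm (sgn z) * norm y" by (rule Cauchy_Schwarz_ineq2)
 also have "\<dots> \<le> 1 * norm y" by (intro mult_right_mono) (auto simp: norm_sgn)
 finally show ?thesis by simp
qed

lemma drift_bound: "\<bar>sgn (fst x) \<bullet> fst v + sgn (snd x) \<bullet> snd v\<bar> \<le> 2 * norm v" for x v :: conf2
 using sgn_inner_bound[of "fst x" "fst v"] sgn_inner_bound[of "snd x" "snd v"]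
  norm_fst_le[of "fst v" "snd v"] norm_snd_le[of "snd v" "fst v"] by simp

lemma inverse_tt_sum: "0 \<le> 1 / (tt (fst x) + tt (snd x))" "1 / (tt (fst x) + tt (snd x)) \<le> 1" for x :: conf2
 using tt_ge_1[of "fst x"] tt_ge_1[of "snd x"] by (auto simp: field_simps)

text \<open>Exponentials of functions with bounded derivatives satisfy such bounds however fast they
  grow. The bounds control \<open>Lop\<close> and all cut-off errors by multiples of
  \<open>f\<close>, so that integrability of \<open>w f\<close> becomes the only condition at
  infinity.\<close>

definition adm :: "real \<Rightarrow> (conf2 \<Rightarrow> real) \<Rightarrow> (conf2 \<Rightarrow> conf2) \<Rightarrow> (conf2 \<Rightarrow> real) \<Rightarrow> bool" where
 "adm C f g l \<longleftrightarrow> C2GL f g l \<and> (\<forall>x. f x > 0) \<and> (\<forall>x. norm (g x) \<le> C * f x) \<and> (\<forall>x. \<bar>l x\<bar> \<le> C * f x)"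

lemma admD:
 assumes "adm C f g l"
 shows "C2GL f g l" "f x > 0" "norm (g x) \<le> C * f x" "\<bar>l x\<bar> \<le> C * f x" "C \<ge> 0"
proof -
 show *: "C2GL f g l" "f x > 0" "norm (g x) \<le> C * f x" "\<bar>l x\<bar> \<le> C * f x" for x
  using assms unfolding adm_def by blast+
 have "0 \<le> C * f 0" using order_trans[OF norm_ge_zero *(3)[of 0]] .
 then show "C \<ge> 0" using *(2)[of 0] by (simp add: zero_le_mult_iff)
qed

lemma adm_mono: "adm C f g l \<Longrightarrow> C \<le> C' \<Longrightarrow> adm C' f g l"
 unfolding adm_def by (meson mult_right_mono order_trans less_imp_le)

lemma adm_add:
 assumes "adm C1 f1 g1 l1" "adm C2 f2 g2 l2"
 shows "adm (C1 + C2) (\<lambda>x. f1 x + f2 x) (\<lambda>x. g1 x + g2 x) (\<lambda>x. l1 x + l2 x)"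
proof -
 note 1 = admD[OF assms(1)] and 2 = admD[OF assms(2)]
 have e: "C1 * f1 x + C2 * f2 x \<le> (C1 + C2) * (f1 x + f2 x)" for x
  using mult_nonneg_nonneg[OF 1(5) less_imp_le[OF 2(2)[of x]]] mult_nonneg_nonneg[OF 2(5) less_imp_le[OF 1(2)[of x]]]
  by (simp add: algebra_simps)
 have "norm (g1 x + g2 x) \<le> (C1 + C2) * (f1 x + f2 x)" for x
  using norm_triangle_ineq[of "g1 x" "g2 x"] 1(3)[of x] 2(3)[of x] e[of x] by linarith
 moreover have "\<bar>l1 x + l2 x\<bar> \<le> (C1 + C2) * (f1 x + f2 x)" for x
  using 1(4)[of x] 2(4)[of x] e[of x] by linarith
 ultimately show ?thesis unfolding adm_def using C2GL_add[OF 1(1) 2(1)] 1(2) 2(2) by (auto intro: add_pos_pos)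
qed

lemma adm_cmult:
 assumes "adm C f g l" "c > 0"
 shows "adm C (\<lambda>x. c * f x) (\<lambda>x. c *\<^sub>R g x) (\<lambda>x. c * l x)"
proof -
 note 1 = admD[OF assms(1)]
 have "norm (c *\<^sub>R g x) \<le> C * (c * f x)" "\<bar>c * l x\<bar> \<le> C * (c * f x)" for x
  using mult_left_mono[OF 1(3), of c x] mult_left_mono[OF 1(4), of c x] assms(2) by (simp_all add: abs_mult ac_simps)
 then show ?thesis unfolding adm_def using C2GL_cmult[OF 1(1)] 1(2) assms(2) by simp
qed

lemma Lop_bound:
 assumes "adm C f g l" "Z > 0"
 shows "\<bar>Lop Z f g l x\<bar> \<le> (C + 2 * Z * C + 1 + Z^2) * f x"
proof -
 note 0 = admD[OF assms(1)]
 note 1 = 0(1) 0(2)[of x] 0(3)[of x] 0(4)[of x]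
 have a: "\<bar>- (1/2) * l x\<bar> \<le> C * f x" using 1(2,4) by simp
 have b: "\<bar>Z * (sgn (fst x) \<bullet> fst (g x) + sgn (snd x) \<bullet> snd (g x))\<bar> \<le> 2 * Z * C * f x"
 proof -
  have "\<bar>sgn (fst x) \<bullet> fst (g x) + sgn (snd x) \<bullet> snd (g x)\<bar> \<le> 2 * (C * f x)"
   using drift_bound[of x "g x"] 1(3) by linarith
  from mult_left_mono[OF this, of Z] show ?thesis using assms(2) by (simp add: abs_mult ac_simps)
 qed
 have "\<bar>1 / (tt (fst x) + tt (snd x)) - Z^2 / 2\<bar> \<le> 1 + Z^2"
  using inverse_tt_sum[of x] zero_le_power2[of Z] by linarith
 from mult_right_mono[OF this, of "f x"]
 have c: "\<bar>(1 / (tt (fst x) + tt (snd x)) - Z^2 / 2) * f x\<bar> \<le> (1 + Z^2) * f x" using 1(2) by (simp add: abs_mult)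
 have "(C + 2 * Z * C + 1 + Z^2) * f x = C * f x + 2 * Z * C * f x + (1 + Z^2) * f x" by (simp add: algebra_simps)
 then show ?thesis unfolding Lop_def using a b c by linarith
qed

text \<open>The harmonic mean is a concave function of degree one, so it preserves supersolutions.\<close>

definition hm :: "real \<Rightarrow> real \<Rightarrow> real" where "hm a b = a * b / (a + b)"

lemma hm_bounds:
 assumes "a > 0" "b > 0"
 shows "hm a b > 0" "hm a b \<le> a" "hm a b \<le> b" "(b / (a + b))^2 * a + (a / (a + b))^2 * b = hm a b"
  "(b / (a + b))^2 \<le> 1"
proof -
 show "hm a b > 0" "hm a b \<le> a" "hm a b \<le> b" unfolding hm_def using assms by (auto simp: field_simps)
 have "(b / (a + b))^2 * a + (a / (a + b))^2 * b = (a * b * (a + b)) / (a + b)^2"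
  by (simp add: power_divide power2_eq_square add_divide_distrib[symmetric] algebra_simps)
 then show "(b / (a + b))^2 * a + (a / (a + b))^2 * b = hm a b"
  unfolding hm_def using assms by (simp add: power2_eq_square)
 show "(b / (a + b))^2 \<le> 1" using assms by (intro power_le_one) auto
qed

text \<open>The squared fractions are the partial derivatives of \<open>hm\<close>. By homogeneity
  of degree one \<open>hm\<close> is recovered from them, which takes care of the zeroth order part.
  The second derivatives add \<open>- 2 e\<close> to the Laplacian, with \<open>e\<close> the
  squared norm of \<open>f2 g1 - f1 g2\<close> over the cube of \<open>f1 + f2\<close>; in
  \<open>Lop\<close> this has the favourable sign and is discarded.\<close>

lemma adm_hm:
 assumes 1: "adm C f1 g1 l1" and 2: "adm C f2 g2 l2"
 obtains g l where "adm (C + 8 * C^2) (\<lambda>x. hm (f1 x) (f2 x)) g l"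
  "\<And>Z x. Lop Z (\<lambda>x. hm (f1 x) (f2 x)) g l x \<ge> (f2 x / (f1 x + f2 x))^2 * Lop Z f1 g1 l1 x + (f1 x / (f1 x + f2 x))^2 * Lop Z f2 g2 l2 x"
proof -
 note 1 = admD[OF 1] and 2 = admD[OF 2]
 define s where "s x = f1 x + f2 x" for x
 have sp: "s x > 0" for x unfolding s_def using 1(2) 2(2) by (simp add: add_pos_pos)
 have snz: "s x \<noteq> 0" for x using sp[of x] by simp
 define g where "g x = (f2 x / s x)^2 *\<^sub>R g1 x + (f1 x / s x)^2 *\<^sub>R g2 x" for x
 define e where "e x = (norm (f2 x *\<^sub>R g1 x - f1 x *\<^sub>R g2 x))^2 / s x ^ 3" for x
 define l where "l x = (f2 x / s x)^2 * l1 x + (f1 x / s x)^2 * l2 x - 2 * e x" for x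
 have ep: "e x \<ge> 0" for x unfolding e_def using sp[of x] by simp
 have Cs: "C2GL s (\<lambda>x. g1 x + g2 x) (\<lambda>x. l1 x + l2 x)" unfolding s_def by (rule C2GL_add[OF 1(1) 2(1)])
 have Ci: "C2GL (\<lambda>x. 1 / s x) (\<lambda>x. (- 1 / (s x)^2) *\<^sub>R (g1 x + g2 x))
   (\<lambda>x. - 1 / (s x)^2 * (l1 x + l2 x) + 2 / s x ^ 3 * ((g1 x + g2 x) \<bullet> (g1 x + g2 x)))"
 proof (rule C2GL_compose[OF Cs, of "{0<..}" "\<lambda>s. 1 / s" "\<lambda>s. - 1 / s^2" "\<lambda>s. 2 / s ^ 3"])
  fix y :: real assume y: "y \<in> {0<..}"
  show "((\<lambda>s. 1 / s) has_real_derivative - 1 / y^2) (at y)"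
   by (rule DERIV_cong[OF DERIV_divide[OF DERIV_const DERIV_ident]]) (use y in \<open>auto simp: power2_eq_square\<close>)
  show "((\<lambda>s. - 1 / s^2) has_real_derivative 2 / y ^ 3) (at y)"
   by (rule DERIV_cong[OF DERIV_divide[OF DERIV_const DERIV_pow[of 2 y]]])
     (use y in \<open>auto simp: power2_eq_square power3_eq_cube\<close>)
 qed (use sp in \<open>auto intro!: continuous_intros\<close>)
 have CM: "C2GL (\<lambda>x. hm (f1 x) (f2 x)) g l"
 proof (rule C2GL_cong[OF C2GL_mult[OF C2GL_mult[OF 1(1) 2(1)] Ci]])
  fix x
  define F1 F2 S where "F1 = f1 x" and "F2 = f2 x" and "S = s x"
  have S: "S \<noteq> 0" "F1 = S - F2" using snz[of x] unfolding S_def F1_def F2_def s_def by auto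
  show "hm (f1 x) (f2 x) = f1 x * f2 x * (1 / s x)" unfolding hm_def s_def by simp
  have c1: "F1 * F2 * (- 1 / S^2) + 1 / S * F2 = (F2 / S)^2" and c2: "F1 * F2 * (- 1 / S^2) + 1 / S * F1 = (F1 / S)^2"
   unfolding S(2) using S(1) by (simp_all add: field_simps power2_eq_square)
  have "(F1 * F2) *\<^sub>R (- 1 / S^2) *\<^sub>R (g1 x + g2 x) + (1 / S) *\<^sub>R (F1 *\<^sub>R g2 x + F2 *\<^sub>R g1 x)
    = (F1 * F2 * (- 1 / S^2) + 1 / S * F2) *\<^sub>R g1 x + (F1 * F2 * (- 1 / S^2) + 1 / S * F1) *\<^sub>R g2 x"
   by (simp only: scaleR_add_right scaleR_scaleR scaleR_add_left) simp
  from this[unfolded c1 c2, unfolded F1_def F2_def S_def]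
  show "g x = (f1 x * f2 x) *\<^sub>R (- 1 / (s x)^2) *\<^sub>R (g1 x + g2 x) + (1 / s x) *\<^sub>R (f1 x *\<^sub>R g2 x + f2 x *\<^sub>R g1 x)"
   unfolding g_def by (rule sym)
  define p q r where "p = g1 x \<bullet> g1 x" and "q = g2 x \<bullet> g2 x" and "r = g1 x \<bullet> g2 x"
  have i1: "(g1 x + g2 x) \<bullet> (g1 x + g2 x) = p + q + 2 * r"
   unfolding p_def q_def r_def by (simp add: inner_add_left inner_add_right inner_commute)
  have i2: "(F1 *\<^sub>R g2 x + F2 *\<^sub>R g1 x) \<bullet> ((- 1 / S^2) *\<^sub>R (g1 x + g2 x)) = (- 1 / S^2) * (F1 * r + F1 * q + F2 * p + F2 * r)"
   unfolding p_def q_def r_def inner_scaleR_right inner_add_right inner_add_left inner_scaleR_left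
   by (simp add: inner_commute algebra_simps)
  have i3: "e x = (F2^2 * p + F1^2 * q - 2 * F1 * F2 * r) / S ^ 3"
   unfolding e_def power2_norm_eq_inner p_def q_def r_def F1_def[symmetric] F2_def[symmetric] S_def[symmetric]
   by (simp add: inner_diff_left inner_diff_right inner_commute power2_eq_square algebra_simps)
  show "l x = f1 x * f2 x * (- 1 / (s x)^2 * (l1 x + l2 x) + 2 / s x ^ 3 * ((g1 x + g2 x) \<bullet> (g1 x + g2 x)))
    + 1 / s x * (f1 x * l2 x + f2 x * l1 x + 2 * (g1 x \<bullet> g2 x))
    + 2 * ((f1 x *\<^sub>R g2 x + f2 x *\<^sub>R g1 x) \<bullet> ((- 1 / (s x)^2) *\<^sub>R (g1 x + g2 x)))"
   unfolding l_def i1 i2[unfolded F1_def F2_def S_def] i3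
   unfolding F1_def[symmetric] F2_def[symmetric] S_def[symmetric] r_def[symmetric] c1[symmetric] c2[symmetric]
   unfolding S(2) using S(1) by (simp add: field_simps power2_eq_square power3_eq_cube)
 qed
 have M: "hm (f1 x) (f2 x) = (f2 x / s x)^2 * f1 x + (f1 x / s x)^2 * f2 x" for x
  using hm_bounds(4)[OF 1(2) 2(2), of x] unfolding s_def by simp
 have CMe: "C * hm (f1 x) (f2 x) = (f2 x / s x)^2 * (C * f1 x) + (f1 x / s x)^2 * (C * f2 x)" for x
  unfolding M by (simp add: algebra_simps)
 have gb: "norm (g x) \<le> C * hm (f1 x) (f2 x)" for x
 proof -
  have "norm (g x) \<le> (f2 x / s x)^2 * norm (g1 x) + (f1 x / s x)^2 * norm (g2 x)"
   unfolding g_def by (rule order_trans[OF norm_triangle_ineq]) simp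
  also have "\<dots> \<le> (f2 x / s x)^2 * (C * f1 x) + (f1 x / s x)^2 * (C * f2 x)"
   by (intro add_mono mult_left_mono 1 2) auto
  finally show ?thesis unfolding CMe .
 qed
 have eb: "e x \<le> 4 * C^2 * hm (f1 x) (f2 x)" for x
 proof -
  have "norm (f2 x *\<^sub>R g1 x - f1 x *\<^sub>R g2 x) \<le> f2 x * norm (g1 x) + f1 x * norm (g2 x)"
   using norm_triangle_ineq4[of "f2 x *\<^sub>R g1 x" "f1 x *\<^sub>R g2 x"] 1(2)[of x] 2(2)[of x] by simp
  also have "\<dots> \<le> f2 x * (C * f1 x) + f1 x * (C * f2 x)"
   using 1(2)[of x] 2(2)[of x] by (intro add_mono mult_left_mono 1 2) auto
  finally have "norm (f2 x *\<^sub>R g1 x - f1 x *\<^sub>R g2 x) \<le> 2 * C * (f1 x * f2 x)" by (simp add: algebra_simps)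
  then have "(norm (f2 x *\<^sub>R g1 x - f1 x *\<^sub>R g2 x))^2 \<le> (2 * C * (f1 x * f2 x))^2" by (intro power_mono) auto
  then have "e x \<le> (2 * C * (f1 x * f2 x))^2 / s x ^ 3" unfolding e_def using sp[of x] by (intro divide_right_mono) auto
  also have "\<dots> = 4 * C^2 * (f1 x * f2 x / s x) * ((f1 x / s x) * (f2 x / s x))"
   by (simp add: power2_eq_square power3_eq_cube ac_simps)
  also have "\<dots> \<le> 4 * C^2 * (f1 x * f2 x / s x) * (1 * 1)"
   using 1(2)[of x] 2(2)[of x] sp[of x] by (intro mult_left_mono mult_mono) (auto simp: s_def)
  finally show ?thesis unfolding hm_def s_def by simp
 qed
 have lb: "\<bar>l x\<bar> \<le> (C + 8 * C^2) * hm (f1 x) (f2 x)" for x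
 proof -
  have a: "\<bar>(f2 x / s x)\<^sup>2 * l1 x\<bar> \<le> (f2 x / s x)^2 * (C * f1 x)" "\<bar>(f1 x / s x)\<^sup>2 * l2 x\<bar> \<le> (f1 x / s x)^2 * (C * f2 x)"
   unfolding abs_mult using 1(4)[of x] 2(4)[of x] by (auto intro!: mult_left_mono)
  have "(C + 8 * C^2) * hm (f1 x) (f2 x) = C * hm (f1 x) (f2 x) + 2 * (4 * C^2 * hm (f1 x) (f2 x))" by (simp add: algebra_simps)
  then show ?thesis unfolding l_def using a eb[of x] ep[of x] CMe[of x] by linarith
 qed
 have hp: "hm (f1 x) (f2 x) > 0" for x by (rule hm_bounds(1)[OF 1(2) 2(2)])
 have "adm (C + 8 * C^2) (\<lambda>x. hm (f1 x) (f2 x)) g l"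
  unfolding adm_def
 proof (intro conjI allI CM hp lb)
  fix x
  have "C * hm (f1 x) (f2 x) \<le> (C + 8 * C^2) * hm (f1 x) (f2 x)" using hp[of x] by (intro mult_right_mono) auto
  then show "norm (g x) \<le> (C + 8 * C^2) * hm (f1 x) (f2 x)" using gb[of x] by linarith
 qed
 moreover have "Lop Z (\<lambda>x. hm (f1 x) (f2 x)) g l x \<ge> (f2 x / (f1 x + f2 x))^2 * Lop Z f1 g1 l1 x + (f1 x / (f1 x + f2 x))^2 * Lop Z f2 g2 l2 x" for Z x
 proof -
  have "Lop Z (\<lambda>x. hm (f1 x) (f2 x)) g l x = (f2 x / s x)^2 * Lop Z f1 g1 l1 x + (f1 x / s x)^2 * Lop Z f2 g2 l2 x + e x"
   unfolding Lop_def l_def g_def M by (simp add: algebra_simps inner_add_right)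
  then show ?thesis using ep[of x] unfolding s_def by simp
 qed
 ultimately show ?thesis by (rule that)
qed

section \<open>Cut-offs and test functions of unbounded support\<close>

lemma bump_derivative_bounds:
 fixes x y :: conf2
 assumes e: "e > 0"
 shows "norm ((- 6 / e^2 * (max 0 (1 - (norm (x - y))^2 / e^2)) ^ 2) *\<^sub>R (x - y)) \<le> 6 / e^2 * norm (x - y)"
  "norm ((- 6 / e^2 * (max 0 (1 - (norm (x - y))^2 / e^2)) ^ 2) *\<^sub>R (x - y)) \<le> 6 / e"
  "\<bar>- 6 * real DIM(conf2) / e^2 * (max 0 (1 - (norm (x - y))^2 / e^2)) ^ 2
    + 24 / e ^ 4 * (norm (x - y))^2 * max 0 (1 - (norm (x - y))^2 / e^2)\<bar> \<le> 60 / e^2"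
proof -
 define m where "m = max 0 (1 - (norm (x - y))^2 / e^2)"
 have m: "0 \<le> m" "m \<le> 1" unfolding m_def by auto
 have m2: "0 \<le> m^2" "m^2 \<le> 1" using m by (auto intro: power_le_one)
 have n: "norm ((- 6 / e^2 * m ^ 2) *\<^sub>R (x - y)) = 6 / e^2 * m^2 * norm (x - y)"
  using e by (simp add: abs_mult)
 have "6 / e^2 * m^2 * norm (x - y) \<le> 6 / e^2 * 1 * norm (x - y)"
  using m2 by (intro mult_right_mono mult_left_mono) auto
 then show a: "norm ((- 6 / e^2 * (max 0 (1 - (norm (x - y))^2 / e^2)) ^ 2) *\<^sub>R (x - y)) \<le> 6 / e^2 * norm (x - y)"
  unfolding m_def[symmetric] n by simp
 have m0: "m = 0" if "norm (x - y) > e"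
 proof -
  have "e^2 \<le> (norm (x - y))^2" using that e by (intro power_mono) auto
  then show ?thesis unfolding m_def using e by (simp add: field_simps)
 qed
 show "norm ((- 6 / e^2 * (max 0 (1 - (norm (x - y))^2 / e^2)) ^ 2) *\<^sub>R (x - y)) \<le> 6 / e"
 proof (cases "norm (x - y) > e")
  case True then show ?thesis unfolding m_def[symmetric] using m0 e by simp
 next
  case False
  then have "6 / e^2 * norm (x - y) \<le> 6 / e^2 * e" by (intro mult_left_mono) auto
  also have "\<dots> = 6 / e" using e by (simp add: power2_eq_square)
  finally show ?thesis using a by linarith
 qed
 have D: "real DIM(conf2) = 6" by simp
 have A: "\<bar>- 6 * real DIM(conf2) / e^2 * m\<^sup>2\<bar> \<le> 36 / e^2"
 proof -
  have "36 / e^2 * m^2 \<le> 36 / e^2 * 1" using m2 by (intro mult_left_mono) auto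
  then show ?thesis unfolding D by (simp add: abs_mult)
 qed
 have B: "\<bar>24 / e ^ 4 * (norm (x - y))^2 * m\<bar> \<le> 24 / e^2"
 proof (cases "norm (x - y) > e")
  case True then show ?thesis using m0 by simp
 next
  case False
  then have "(norm (x - y))^2 * m \<le> e^2 * 1" using m by (intro mult_mono power_mono) auto
  then have "24 / e ^ 4 * ((norm (x - y))^2 * m) \<le> 24 / e ^ 4 * (e^2 * 1)" by (intro mult_left_mono) auto
  also have "\<dots> = 24 / e^2" using e by (simp add: power2_eq_square power4_eq_xxxx)
  finally show ?thesis using m by (simp add: abs_mult mult.assoc)
 qed
 show "\<bar>- 6 * real DIM(conf2) / e^2 * (max 0 (1 - (norm (x - y))^2 / e^2)) ^ 2
    + 24 / e ^ 4 * (norm (x - y))^2 * max 0 (1 - (norm (x - y))^2 / e^2)\<bar> \<le> 60 / e^2"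
  unfolding m_def[symmetric] using abs_triangle_ineq[of "- 6 * real DIM(conf2) / e^2 * m^2" "24 / e ^ 4 * (norm (x - y))^2 * m"] A B
  by (simp add: add_divide_distrib[symmetric])
qed

lemma Lop_mult:
 "Lop Z (\<lambda>x. f1 x * f2 x) (\<lambda>x. f1 x *\<^sub>R g2 x + f2 x *\<^sub>R g1 x) (\<lambda>x. f1 x * l2 x + f2 x * l1 x + 2 * (g1 x \<bullet> g2 x)) x
  = f2 x * Lop Z f1 g1 l1 x + f1 x * (- (1/2) * l2 x + Z * (sgn (fst x) \<bullet> fst (g2 x) + sgn (snd x) \<bullet> snd (g2 x))) - g1 x \<bullet> g2 x"
 unfolding Lop_def by (simp add: algebra_simps inner_add_right)

text \<open>One bump rescaled to radius \<open>n = k + 1\<close>: gradients are of order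
  \<open>1 / n\<close> and Laplacians of order \<open>1 / n^2\<close>, so both are uniformly bounded
  and tend to zero.\<close>

lemma exhausting_cutoffs:
 obtains B :: "nat \<Rightarrow> 'a::euclidean_space \<Rightarrow> real" and GB LB where
  "\<And>k. C2GL (B k) (GB k) (LB k)" "\<And>k. bounded {x. B k x \<noteq> 0}" "\<And>k x. 0 \<le> B k x" "\<And>k x. B k x \<le> 1"
  "\<And>k x. norm (GB k x) \<le> 6" "\<And>k x. \<bar>LB k x\<bar> \<le> 6 * real DIM('a) + 24"
  "\<And>x. (\<lambda>k. B k x) \<longlonglongrightarrow> 1" "\<And>x. (\<lambda>k. GB k x) \<longlonglongrightarrow> 0" "\<And>x. (\<lambda>k. LB k x) \<longlonglongrightarrow> 0"
proof -
 define n where "n k = real (Suc k)" for k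
 have n: "n k \<ge> 1" "n k > 0" for k unfolding n_def by auto
 define m where "m k x = max 0 (1 - (norm x)^2 / (n k)^2)" for k and x :: 'a
 have m: "0 \<le> m k x" "m k x \<le> 1" for k x unfolding m_def by auto
 have m2: "0 \<le> (m k x)^2" "(m k x)^2 \<le> 1" for k x using m[of k x] by (auto intro: power_le_one)
 define GB where "GB k x = (- 6 / (n k)^2 * (m k x)^2) *\<^sub>R x" for k x
 define LB where "LB k x = - 6 * real DIM('a) / (n k)^2 * (m k x)^2 + 24 / (n k) ^ 4 * (norm x)^2 * m k x" for k x
 have C: "C2GL (bump (n k) 0) (GB k) (LB k)" for k
  using C2GL_bump[OF n(2)[of k], of 0] unfolding GB_def LB_def m_def by simp
 have mz: "m k x = 0" if "\<not> norm x \<le> n k" for k x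
 proof -
  have "(n k)^2 \<le> (norm x)^2" using that n(2)[of k] by (intro power_mono) auto
  then show ?thesis unfolding m_def using n(2)[of k] by (simp add: field_simps)
 qed
 have Gn: "norm (GB k x) \<le> 6 * (1 / n k)" for k x
 proof (cases "norm x \<le> n k")
  case True
  have "norm (GB k x) = 6 / (n k)^2 * ((m k x)^2 * norm x)" unfolding GB_def using n(2)[of k] by simp
  also have "\<dots> \<le> 6 / (n k)^2 * (1 * n k)" using m2[of k x] True n(2)[of k] by (intro mult_left_mono mult_mono) auto
  also have "\<dots> = 6 * (1 / n k)" using n(2)[of k] by (simp add: power2_eq_square)
  finally show ?thesis .
 qed (use n(2)[of k] mz in \<open>simp add: GB_def\<close>)
 have Ln: "\<bar>LB k x\<bar> \<le> (6 * real DIM('a) + 24) * ((1 / n k) * (1 / n k))" for k x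
 proof (cases "norm x \<le> n k")
  case True
  have 1: "6 * real DIM('a) / (n k)^2 * (m k x)^2 \<le> 6 * real DIM('a) / (n k)^2 * 1" using m2[of k x] by (intro mult_left_mono) auto
  have "(norm x)^2 * m k x \<le> (n k)^2 * 1" using True m[of k x] by (intro mult_mono power_mono) auto
  then have "24 / (n k) ^ 4 * ((norm x)^2 * m k x) \<le> 24 / (n k) ^ 4 * ((n k)^2 * 1)" using n(2)[of k] by (intro mult_left_mono) auto
  also have "\<dots> = 24 * ((1 / n k) * (1 / n k))" using n(2)[of k] by (simp add: power2_eq_square power4_eq_xxxx)
  finally have 2: "24 / (n k) ^ 4 * (norm x)^2 * m k x \<le> 24 * ((1 / n k) * (1 / n k))" by simp
  have 3: "6 * real DIM('a) / (n k)^2 * 1 = 6 * real DIM('a) * ((1 / n k) * (1 / n k))" by (simp add: power2_eq_square)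
  have 4: "0 \<le> 6 * real DIM('a) / (n k)^2 * (m k x)^2" "0 \<le> 24 / (n k) ^ 4 * (norm x)^2 * m k x" using m n(2)[of k] by auto
  have "LB k x = 24 / (n k) ^ 4 * (norm x)^2 * m k x - 6 * real DIM('a) / (n k)^2 * (m k x)^2" unfolding LB_def by simp
  then show ?thesis using 1 2 4 unfolding 3 distrib_right by linarith
 qed (use n(2)[of k] mz in \<open>simp add: LB_def\<close>)
 have inv: "(\<lambda>k. 1 / n k) \<longlonglongrightarrow> 0" unfolding n_def using LIMSEQ_inverse_real_of_nat by (simp add: inverse_eq_divide)
 have inv2: "(\<lambda>k. c * (1 / n k)) \<longlonglongrightarrow> 0" "(\<lambda>k. c * ((1 / n k) * (1 / n k))) \<longlonglongrightarrow> 0" for c :: real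
  using tendsto_mult[OF tendsto_const inv, of c] tendsto_mult[OF tendsto_const tendsto_mult[OF inv inv], of c] by simp_all
 have le1: "1 / n k \<le> 1" "0 \<le> 1 / n k" for k using n[of k] by auto
 show thesis
 proof (rule that[of "\<lambda>k. bump (n k) 0" GB LB])
  show "C2GL (bump (n k) 0) (GB k) (LB k)" for k by (rule C)
  show "bounded {x. bump (n k) 0 x \<noteq> 0}" for k by (rule bounded_bump[OF n(2)])
  show "0 \<le> bump (n k) 0 x" "bump (n k) 0 x \<le> 1" for k and x :: 'a by (rule bump_nonneg bump_le_1)+
  show "norm (GB k x) \<le> 6" for k x using Gn[of k x] le1[of k] by linarith
  show "\<bar>LB k x\<bar> \<le> 6 * real DIM('a) + 24" for k x
  proof -
   have "(1 / n k) * (1 / n k) \<le> 1" using mult_mono[OF le1(1) le1(1) _ le1(2), of k k] by simp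
   from mult_left_mono[OF this, of "6 * real DIM('a) + 24"] show ?thesis using Ln[of k x] by simp
  qed
  show "(\<lambda>k. bump (n k) 0 x) \<longlonglongrightarrow> 1" for x :: 'a
  proof -
   have "(\<lambda>k. (max 0 (1 - (norm x)^2 * ((1 / n k) * (1 / n k)))) ^ 3) \<longlonglongrightarrow> (max 0 (1 - 0)) ^ 3"
    by (intro tendsto_intros inv2)
   then show ?thesis unfolding bump_def by (simp add: power2_eq_square)
  qed
  show "(\<lambda>k. GB k x) \<longlonglongrightarrow> 0" for x
   by (rule Lim_null_comparison[OF always_eventually inv2(1)[of 6]]) (use Gn[of _ x] in simp)
  show "(\<lambda>k. LB k x) \<longlonglongrightarrow> 0" for x
   by (rule Lim_null_comparison[OF always_eventually inv2(2)[of "6 * real DIM('a) + 24"]]) (use Ln[of _ x] in simp)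
 qed
qed

context coulomb_subsolution
begin

text \<open>Cutting \<open>f\<close> off with the exhausting functions produces errors that are
  bounded by a multiple of \<open>f\<close> and tend to zero pointwise, so dominated convergence
  removes the restriction to bounded support.\<close>

lemma Lop_integral_nonpos:
 assumes a: "adm C f g l" and i: "integrable lborel (\<lambda>x. w x * f x)"
 shows "integrable lborel (\<lambda>x. w x * Lop Z f g l x)" "(LBINT x. w x * Lop Z f g l x) \<le> 0"
proof -
 note A = admD[OF a]
 have [measurable]: "f \<in> borel_measurable borel" "g \<in> borel_measurable borel" "l \<in> borel_measurable borel"
  using C2GL_measurable[OF A(1)] by auto
 have mL[measurable]: "Lop Z f g l \<in> borel_measurable borel"
  unfolding Lop_def[abs_def] sgn_div_norm by measurable
 define K where "K = C + 2 * Z * C + 1 + Z^2"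
 have K: "\<bar>Lop Z f g l x\<bar> \<le> K * f x" for x unfolding K_def by (rule Lop_bound[OF a Zpos])
 show iL: "integrable lborel (\<lambda>x. w x * Lop Z f g l x)"
 proof (rule bintegrable_bound[OF integrable_mult_right[OF i, of K]])
  show "AE x in lborel. norm (w x * Lop Z f g l x) \<le> norm (K * (w x * f x))"
  proof (rule AE_I2)
   fix x
   have "w x * \<bar>Lop Z f g l x\<bar> \<le> w x * (K * f x)" by (intro mult_left_mono K w_nonneg)
   then have "norm (w x * Lop Z f g l x) \<le> K * (w x * f x)"
    using w_nonneg[of x] by (simp add: abs_mult ac_simps)
   then show "norm (w x * Lop Z f g l x) \<le> norm (K * (w x * f x))"
    unfolding real_norm_def by (rule order_trans[OF _ abs_ge_self])
  qed
 qed measurable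
 obtain B :: "nat \<Rightarrow> conf2 \<Rightarrow> real" and GB LB where
  CB: "\<And>k. C2GL (B k) (GB k) (LB k)" and bB: "\<And>k. bounded {x. B k x \<noteq> 0}" and B01: "\<And>k x. 0 \<le> B k x" "\<And>k x. B k x \<le> 1"
  and GB6: "\<And>k x. norm (GB k x) \<le> 6" and LB: "\<And>k x. \<bar>LB k x\<bar> \<le> 6 * real DIM(conf2) + 24"
  and Bl: "\<And>x. (\<lambda>k. B k x) \<longlonglongrightarrow> 1" and GBl: "\<And>x. (\<lambda>k. GB k x) \<longlonglongrightarrow> 0" and LBl: "\<And>x. (\<lambda>k. LB k x) \<longlonglongrightarrow> 0"
  using exhausting_cutoffs[where 'a=conf2] by blast
 have LB60: "\<bar>LB k x\<bar> \<le> 60" for k x using LB[of k x] by simp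
 define E where "E k x = f x * (- (1/2) * LB k x + Z * (sgn (fst x) \<bullet> fst (GB k x) + sgn (snd x) \<bullet> snd (GB k x))) - g x \<bullet> GB k x" for k x
 define T where "T k x = B k x * Lop Z f g l x + E k x" for k x
 have Tle: "(LBINT x. w x * T k x) \<le> 0" for k
 proof -
  note CC = C2GL_mult[OF A(1) CB]
  have "(LBINT x. w x * Lop Z (\<lambda>x. f x * B k x) (\<lambda>x. f x *\<^sub>R GB k x + B k x *\<^sub>R g x) (\<lambda>x. f x * LB k x + B k x * l x + 2 * (g x \<bullet> GB k x)) x) \<le> 0"
  proof (rule transformed_inequality(1)[OF CC])
   show "bounded {x. f x * B k x \<noteq> 0}"
    by (rule bounded_subset[OF bB[of k]]) auto
   show "f x * B k x \<ge> 0" for x using A(2)[of x] B01(1)[of k x] by simp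
  qed
  then show ?thesis unfolding Lop_mult T_def E_def add_diff_eq .
 qed
 have Eb: "\<bar>E k x\<bar> \<le> (30 + 12 * Z + 6 * C) * f x" for k x
 proof -
  have 1: "\<bar>- (1/2) * LB k x\<bar> \<le> 30" using LB60[of k x] by simp
  have "\<bar>sgn (fst x) \<bullet> fst (GB k x) + sgn (snd x) \<bullet> snd (GB k x)\<bar> \<le> 12"
   using drift_bound[of x "GB k x"] GB6[of k x] by linarith
  from mult_left_mono[OF this, of Z]
  have 2: "\<bar>Z * (sgn (fst x) \<bullet> fst (GB k x) + sgn (snd x) \<bullet> snd (GB k x))\<bar> \<le> 12 * Z" using Zpos by (simp add: abs_mult)
  have "\<bar>- (1/2) * LB k x + Z * (sgn (fst x) \<bullet> fst (GB k x) + sgn (snd x) \<bullet> snd (GB k x))\<bar> \<le> 30 + 12 * Z"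
   using 1 2 by linarith
  from mult_left_mono[OF this, of "f x"]
  have 3: "\<bar>f x * (- (1/2) * LB k x + Z * (sgn (fst x) \<bullet> fst (GB k x) + sgn (snd x) \<bullet> snd (GB k x)))\<bar> \<le> f x * (30 + 12 * Z)"
   using A(2)[of x] by (simp add: abs_mult)
  have "\<bar>g x \<bullet> GB k x\<bar> \<le> norm (g x) * norm (GB k x)" by (rule Cauchy_Schwarz_ineq2)
  also have "\<dots> \<le> (C * f x) * 6"
   using A(3)[of x] GB6[of k x] order_trans[OF norm_ge_zero A(3)[of x]] by (intro mult_mono) auto
  finally have 4: "\<bar>g x \<bullet> GB k x\<bar> \<le> C * f x * 6" .
  have "(30 + 12 * Z + 6 * C) * f x = f x * (30 + 12 * Z) + C * f x * 6" by (simp add: algebra_simps)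
  then show ?thesis unfolding E_def using 3 4 by linarith
 qed
 have lim: "(\<lambda>k. T k x) \<longlonglongrightarrow> Lop Z f g l x" for x
 proof -
  have "(\<lambda>k. T k x) \<longlonglongrightarrow> 1 * Lop Z f g l x + (f x * (- (1/2) * 0 + Z * (sgn (fst x) \<bullet> fst (0::conf2) + sgn (snd x) \<bullet> snd (0::conf2))) - g x \<bullet> 0)"
   unfolding T_def E_def by (intro tendsto_intros Bl LBl GBl)
  then show ?thesis by simp
 qed
 have "(\<lambda>k. LBINT x. w x * T k x) \<longlonglongrightarrow> (LBINT x. w x * Lop Z f g l x)"
 proof (rule integral_dominated_convergence[where w="\<lambda>x. (K + (30 + 12 * Z + 6 * C)) * (w x * f x)"])
  have [measurable]: "B k \<in> borel_measurable borel" "GB k \<in> borel_measurable borel" "LB k \<in> borel_measurable borel" for k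
   using C2GL_measurable[OF CB] by auto
  show "(\<lambda>x. w x * T k x) \<in> borel_measurable lborel" for k
   unfolding T_def E_def sgn_div_norm by measurable
  show "integrable lborel (\<lambda>x. (K + (30 + 12 * Z + 6 * C)) * (w x * f x))" using i by (rule integrable_mult_right)
  show "AE x in lborel. (\<lambda>k. w x * T k x) \<longlonglongrightarrow> w x * Lop Z f g l x"
   by (intro AE_I2 tendsto_mult tendsto_const lim)
  show "AE x in lborel. norm (w x * T k x) \<le> (K + (30 + 12 * Z + 6 * C)) * (w x * f x)" for k
  proof (rule AE_I2)
   fix x
   have "\<bar>B k x * Lop Z f g l x\<bar> \<le> 1 * (K * f x)"
    unfolding abs_mult using B01[of k x] K[of x]
    by (intro mult_mono) (simp_all add: abs_of_nonneg)
   then have "\<bar>T k x\<bar> \<le> (K + (30 + 12 * Z + 6 * C)) * f x"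
    unfolding T_def using Eb[of k x] abs_triangle_ineq[of "B k x * Lop Z f g l x" "E k x"] by (simp add: algebra_simps)
   from mult_left_mono[OF this w_nonneg[of x]]
   show "norm (w x * T k x) \<le> (K + (30 + 12 * Z + 6 * C)) * (w x * f x)"
    using w_nonneg[of x] by (simp add: abs_mult ac_simps)
  qed
 qed measurable
 then show "(LBINT x. w x * Lop Z f g l x) \<le> 0"
  by (rule LIMSEQ_le_const2) (use Tle in auto)
qed

end

section \<open>Local boundedness\<close>

lemma inverse_power_sqrt_deriv:
 assumes "n \<noteq> (0::real)" "s \<ge> 0"
 shows "((\<lambda>s. 1 / sqrt (s + n^2) ^ m) has_real_derivative - (real m / 2) / sqrt (s + n^2) ^ (m + 2)) (at s)"
proof -
 have p: "s + n^2 > 0" using assms by (simp add: add_nonneg_pos)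
 have q: "sqrt (s + n^2) > 0" using p by simp
 have d: "((\<lambda>s. sqrt (s + n^2) ^ m) has_real_derivative real m * sqrt (s + n^2) ^ (m - 1) * (1 / (2 * sqrt (s + n^2)))) (at s)"
  using DERIV_chain2[OF DERIV_pow[of m] sqrt_shift_deriv(1)[OF assms]] by simp
 show ?thesis
 proof (cases m)
  case 0 then show ?thesis by simp
 next
  case (Suc k)
  show ?thesis
   by (rule DERIV_cong[OF DERIV_divide[OF DERIV_const d]]) (use q Suc in \<open>auto simp: field_simps\<close>)
 qed
qed

text \<open>In dimension six the function \<open>r^(- 4)\<close> is harmonic away from its pole, so
  the regularised Laplacian of the main term is \<open>- 24 n^2 / q^8\<close> alone: an approximate
  delta function of width \<open>n\<close>.\<close>

lemma C2GL_kernel: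
 fixes y :: conf2 and k :: real
 assumes n: "n \<noteq> 0"
 defines "q \<equiv> \<lambda>x. smr n (x - y)"
 shows "C2GL (\<lambda>x. 1 / q x ^ 4 + k / q x ^ 3) (\<lambda>x. (- 4 / q x ^ 6 - 3 * k / q x ^ 5) *\<^sub>R (x - y))
   (\<lambda>x. - 24 * n^2 / q x ^ 8 - 3 * k / q x ^ 5 - 15 * k * n^2 / q x ^ 7)"
proof -
 define Q where "Q s = sqrt (s + n^2)" for s
 have Qp: "Q s > 0" if "s \<ge> 0" for s unfolding Q_def using that n by (simp add: add_nonneg_pos)
 note D = inverse_power_sqrt_deriv[OF n, folded Q_def]
 have d1: "((\<lambda>s. 1 / Q s ^ 4 + k * (1 / Q s ^ 3)) has_real_derivative - 2 * (1 / Q s ^ 6) - (3 / 2) * k * (1 / Q s ^ 5)) (at s)" if "s \<ge> 0" for s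
  by (rule DERIV_cong[OF DERIV_add[OF D[of s 4] DERIV_cmult[OF D[of s 3]]]]) (use that in auto)
 have d2: "((\<lambda>s. - 2 * (1 / Q s ^ 6) - (3 / 2) * k * (1 / Q s ^ 5)) has_real_derivative 6 * (1 / Q s ^ 8) + (15 / 4) * k * (1 / Q s ^ 7)) (at s)" if "s \<ge> 0" for s
  by (rule DERIV_cong[OF DERIV_diff[OF DERIV_cmult[OF D[of s 6]] DERIV_cmult[OF D[of s 5]]]]) (use that in auto)
 show ?thesis
 proof (rule C2GL_cong[OF C2GL_compose[OF C2GL_dist_sq[of y], of "{0..}" "\<lambda>s. 1 / Q s ^ 4 + k * (1 / Q s ^ 3)"
    "\<lambda>s. - 2 * (1 / Q s ^ 6) - (3 / 2) * k * (1 / Q s ^ 5)" "\<lambda>s. 6 * (1 / Q s ^ 8) + (15 / 4) * k * (1 / Q s ^ 7)"]])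
  show "continuous_on {0..} (\<lambda>s. 6 * (1 / Q s ^ 8) + (15 / 4) * k * (1 / Q s ^ 7))"
  proof -
   have "Q s \<noteq> 0" if "s \<in> {0..}" for s using Qp[of s] that by simp
   moreover have "continuous_on {0..} Q" unfolding Q_def by (intro continuous_intros)
   ultimately show ?thesis by (intro continuous_intros) auto
  qed
  fix x
  have qQ: "q x = Q ((norm (x - y))^2)" unfolding q_def Q_def smr_def ..
  have qp: "q x > 0" unfolding q_def using n by (rule smr_pos)
  have r2: "(norm (x - y))^2 = q x * q x - n^2" unfolding q_def smr_sq(1) by simp
  show "1 / q x ^ 4 + k / q x ^ 3 = 1 / Q ((norm (x - y))^2) ^ 4 + k * (1 / Q ((norm (x - y))^2) ^ 3)" unfolding qQ by simp
  show "(- 4 / q x ^ 6 - 3 * k / q x ^ 5) *\<^sub>R (x - y) = (- 2 * (1 / Q ((norm (x - y))^2) ^ 6) - (3 / 2) * k * (1 / Q ((norm (x - y))^2) ^ 5)) *\<^sub>R 2 *\<^sub>R (x - y)"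
   unfolding qQ[symmetric] scaleR_scaleR by (rule arg_cong2[where f="(*\<^sub>R)"]) (simp_all add: algebra_simps)
  have "(2 *\<^sub>R (x - y)) \<bullet> (2 *\<^sub>R (x - y)) = 4 * (q x * q x - n^2)"
   unfolding r2[symmetric] by (simp only: power2_norm_eq_inner inner_scaleR_left inner_scaleR_right)
  moreover have "real DIM(conf2) = 6" by simp
  moreover have "- 24 * n^2 / a ^ 8 - 3 * k / a ^ 5 - 15 * k * n^2 / a ^ 7
    = (- 2 * (1 / a ^ 6) - (3 / 2) * k * (1 / a ^ 5)) * (2 * 6) + (6 * (1 / a ^ 8) + (15 / 4) * k * (1 / a ^ 7)) * (4 * (a * a - n^2))" if "a > 0" for a
   using that by (simp add: field_simps eval_nat_numeral)
  ultimately show "- 24 * n^2 / q x ^ 8 - 3 * k / q x ^ 5 - 15 * k * n^2 / q x ^ 7 =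
    (- 2 * (1 / Q ((norm (x - y))^2) ^ 6) - (3 / 2) * k * (1 / Q ((norm (x - y))^2) ^ 5)) * (2 * real DIM(conf2))
    + (6 * (1 / Q ((norm (x - y))^2) ^ 8) + (15 / 4) * k * (1 / Q ((norm (x - y))^2) ^ 7)) * ((2 *\<^sub>R (x - y)) \<bullet> (2 *\<^sub>R (x - y)))"
   unfolding qQ[symmetric] using qp by (simp only:)
 qed (use d1 d2 in auto)
qed

text \<open>The cut-off fundamental solution \<open>r\<^sup>-\<^sup>4\<close>, regularised at scale \<open>n\<close>; its perturbation \<open>k r\<^sup>-\<^sup>3\<close>
 has a Laplacian singular enough to absorb the drift term.\<close>

lemma Lop_kernel_lower_bound:
 assumes Z: "Z > 0"
 shows "\<exists>C. \<forall>y n. 0 < n \<and> n \<le> 1/2 \<longrightarrow> (\<exists>f g l. C2GL f g l \<and> bounded {x. f x \<noteq> 0} \<and> (\<forall>x. f x \<ge> 0) \<and>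
   (\<forall>x. Lop Z f g l x \<ge> bump n y x / (4 * n ^ 6) - C * indicator (cball y 1) x))"
proof -
 \<comment> \<open>Large enough for \<open>27/64 * (3/2 * k)\<close> to exceed \<open>12 Z\<close>,
   which is the cost of the drift, \<open>8 Z\<close>, and of the lower order terms,
   \<open>4 Z\<close>, close to the pole.\<close>
 define k where "k = 32 * Z + 1"
 have k: "k > 0" unfolding k_def using Z by simp
 define D where "D = 6 * Z * k + Z^2 / 2 * (1 + k) + 6 * (4 + 3 * k) + (1 + k) * (30 + 12 * Z)"
 have D: "D > 0" unfolding D_def using Z k by (simp add: add_pos_pos)
 \<comment> \<open>Below \<open>s1\<close> the lower order terms cost at most \<open>4 Z\<close>;
   above \<open>s1\<close> the kernel and its gradient are bounded independently of \<open>n\<close>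
   and go into \<open>C\<close>.\<close>
 define s1 where "s1 = min (1/2) (4 * Z / D)"
 have s1: "0 < s1" "s1 \<le> 1/2" "D * s1 \<le> 4 * Z" unfolding s1_def using D Z by (auto simp: field_simps min_def)
 define G where "G = 4 / s1 ^ 5 + 3 * k / s1 ^ 4"
 define F where "F = 1 / s1 ^ 4 + k / s1 ^ 3"
 have GF: "G \<ge> 0" "F \<ge> 0" unfolding G_def F_def using s1 k by auto
 define C where "C = 2 * Z * G + Z^2 / 2 * F + (30 + 12 * Z) * F + 6 * G"
 have C: "C \<ge> 0" unfolding C_def using GF Z by simp
 show ?thesis
 proof (intro exI[of _ C] allI impI)
  fix y :: conf2 and n :: real
  assume n: "0 < n \<and> n \<le> 1/2"
  then have n0: "n \<noteq> 0" by simp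
  define q where "q x = smr n (x - y)" for x :: conf2
  define f1 where "f1 x = 1 / q x ^ 4 + k / q x ^ 3" for x
  define g1 where "g1 x = (- 4 / q x ^ 6 - 3 * k / q x ^ 5) *\<^sub>R (x - y)" for x
  define l1 where "l1 x = - 24 * n^2 / q x ^ 8 - 3 * k / q x ^ 5 - 15 * k * n^2 / q x ^ 7" for x
  have C1: "C2GL f1 g1 l1" unfolding f1_def g1_def l1_def q_def by (rule C2GL_kernel[OF n0])
  define f2 where "f2 = bump 1 y"
  define g2 where "g2 x = (- 6 / 1^2 * (max 0 (1 - (norm (x - y))^2 / 1^2)) ^ 2) *\<^sub>R (x - y)" for x
  define l2 where "l2 x = - 6 * real DIM(conf2) / 1^2 * (max 0 (1 - (norm (x - y))^2 / 1^2)) ^ 2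
    + 24 / 1 ^ 4 * (norm (x - y))^2 * max 0 (1 - (norm (x - y))^2 / 1^2)" for x :: conf2
  have C2: "C2GL f2 g2 l2" unfolding f2_def g2_def l2_def by (rule C2GL_bump) simp
  have g2b: "norm (g2 x) \<le> 6 * norm (x - y)" "norm (g2 x) \<le> 6" and l2b: "\<bar>l2 x\<bar> \<le> 60" for x
   using bump_derivative_bounds[of 1 x y] unfolding g2_def l2_def by auto
  have f2b: "0 \<le> f2 x" "f2 x \<le> 1" for x unfolding f2_def using bump_nonneg bump_le_1 by auto
  define f g l where "f x = f1 x * f2 x" and "g x = f1 x *\<^sub>R g2 x + f2 x *\<^sub>R g1 x"
   and "l x = f1 x * l2 x + f2 x * l1 x + 2 * (g1 x \<bullet> g2 x)" for x
  have CC: "C2GL f g l" unfolding f_def g_def l_def by (rule C2GL_mult[OF C1 C2])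
  have qp: "q x > 0" for x unfolding q_def using n0 by (rule smr_pos)
  have rq: "norm (x - y) \<le> q x" for x unfolding q_def by (rule norm_le_smr)
  have f1p: "f1 x > 0" for x unfolding f1_def using qp[of x] k by (simp add: add_pos_pos)
  have main: "Lop Z f g l x \<ge> bump n y x / (4 * n ^ 6) - C * indicator (cball y 1) x" for x
  proof (cases "norm (x - y) \<ge> 1")
   case True
   then have z: "f2 x = 0" "bump n y x = 0" unfolding f2_def using bump_eq_0[of 1 x y] bump_eq_0[of n x y] n by auto
   have "(1::real) \<le> (norm (x - y))^2" using True by simp
   then have "max 0 (1 - (norm (x - y))^2 / 1^2) = 0" by simp
   then have "g2 x = 0" "l2 x = 0" unfolding g2_def l2_def by simp_all
   then have "Lop Z f g l x = 0" unfolding Lop_def f_def g_def l_def z by simp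
   then show ?thesis using z C by (simp add: indicator_def)
  next
   case False
   then have xin: "x \<in> cball y 1" by (simp add: dist_norm norm_minus_commute)
   define sg where "sg = q x"
   have sg: "sg > 0" unfolding sg_def by (rule qp)
   define r where "r = norm (x - y)"
   have r: "0 \<le> r" "r \<le> sg" "r < 1" unfolding r_def sg_def using rq False by auto
   define G1 where "G1 = 4 / sg ^ 5 + 3 * k / sg ^ 4"
   define N1 where "N1 = 12 * n^2 / sg ^ 8 + 3 / 2 * k / sg ^ 5"
   have G1: "norm (g1 x) \<le> G1"
   proof -
    have "norm (g1 x) = (4 / sg ^ 6 + 3 * k / sg ^ 5) * r"
    proof -
     have "- 4 / q x ^ 6 - 3 * k / q x ^ 5 = - (4 / sg ^ 6 + 3 * k / sg ^ 5)" unfolding sg_def by simp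
     moreover have "4 / sg ^ 6 + 3 * k / sg ^ 5 \<ge> 0" using sg k by simp
     ultimately show ?thesis unfolding g1_def norm_scaleR r_def by (simp only: abs_minus_cancel abs_of_nonneg)
    qed
    also have "\<dots> \<le> (4 / sg ^ 6 + 3 * k / sg ^ 5) * sg" using r sg k by (intro mult_left_mono) auto
    also have "\<dots> = G1" unfolding G1_def using sg by (simp add: field_simps eval_nat_numeral)
    finally show ?thesis .
   qed
   have G10: "G1 \<ge> 0" unfolding G1_def using sg k by simp
   have f1e: "f1 x = 1 / sg ^ 4 + k / sg ^ 3" unfolding f1_def sg_def ..
   have N1: "- (1/2) * l1 x \<ge> N1" unfolding l1_def N1_def sg_def[symmetric] using sg k by (simp add: field_simps)
   have L1: "Lop Z f1 g1 l1 x \<ge> N1 - 2 * Z * G1 - Z^2 / 2 * f1 x"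
   proof -
    have "\<bar>sgn (fst x) \<bullet> fst (g1 x) + sgn (snd x) \<bullet> snd (g1 x)\<bar> \<le> 2 * G1"
     using drift_bound[of x "g1 x"] G1 by linarith
    from mult_left_mono[OF this, of Z]
    have 1: "\<bar>Z * (sgn (fst x) \<bullet> fst (g1 x) + sgn (snd x) \<bullet> snd (g1 x))\<bar> \<le> 2 * Z * G1" using Z by (simp add: abs_mult)
    have "(- (Z^2 / 2)) * f1 x \<le> (1 / (tt (fst x) + tt (snd x)) - Z^2 / 2) * f1 x"
     using inverse_tt_sum[of x] f1p[of x] by (intro mult_right_mono) auto
    then show ?thesis unfolding Lop_def using 1 N1 by linarith
   qed
   have E: "\<bar>- (1/2) * l2 x + Z * (sgn (fst x) \<bullet> fst (g2 x) + sgn (snd x) \<bullet> snd (g2 x))\<bar> \<le> 30 + 12 * Z"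
   proof -
    have "\<bar>sgn (fst x) \<bullet> fst (g2 x) + sgn (snd x) \<bullet> snd (g2 x)\<bar> \<le> 12"
     using drift_bound[of x "g2 x"] g2b(2)[of x] by linarith
    from mult_left_mono[OF this, of Z]
    have 1: "\<bar>Z * (sgn (fst x) \<bullet> fst (g2 x) + sgn (snd x) \<bullet> snd (g2 x))\<bar> \<le> 12 * Z" using Z by (simp add: abs_mult)
    show ?thesis using 1 l2b[of x] by linarith
   qed
   have E1: "f1 x * (- (1/2) * l2 x + Z * (sgn (fst x) \<bullet> fst (g2 x) + sgn (snd x) \<bullet> snd (g2 x))) \<ge> - (f1 x * (30 + 12 * Z))"
   proof -
    have "f1 x * (- (30 + 12 * Z)) \<le> f1 x * (- (1/2) * l2 x + Z * (sgn (fst x) \<bullet> fst (g2 x) + sgn (snd x) \<bullet> snd (g2 x)))"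
     using E f1p[of x] by (intro mult_left_mono) (auto simp: abs_le_iff)
    then show ?thesis by (simp only: mult_minus_right)
   qed
   have Lg: "Lop Z f g l x = f2 x * Lop Z f1 g1 l1 x + f1 x * (- (1/2) * l2 x + Z * (sgn (fst x) \<bullet> fst (g2 x) + sgn (snd x) \<bullet> snd (g2 x))) - g1 x \<bullet> g2 x"
    using Lop_mult[of Z f1 f2 g2 g1 l2 l1 x] unfolding f_def g_def l_def .
   have P0: "f2 x * Lop Z f1 g1 l1 x \<ge> f2 x * N1 - (2 * Z * G1 + Z^2 / 2 * f1 x)"
   proof -
    have "f2 x * (N1 - 2 * Z * G1 - Z^2 / 2 * f1 x) \<le> f2 x * Lop Z f1 g1 l1 x" by (intro mult_left_mono L1 f2b)
    moreover have "f2 x * (2 * Z * G1 + Z^2 / 2 * f1 x) \<le> 1 * (2 * Z * G1 + Z^2 / 2 * f1 x)"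
     using f2b[of x] Z G10 f1p[of x] by (intro mult_right_mono) auto
    ultimately show ?thesis by (simp add: algebra_simps)
   qed
   have cs: "g1 x \<bullet> g2 x \<le> G1 * norm (g2 x)"
    using norm_cauchy_schwarz[of "g1 x" "g2 x"] mult_right_mono[OF G1, of "norm (g2 x)"] by simp
   \<comment> \<open>Within distance \<open>n\<close> of the pole \<open>q^2 \<le> 2 n^2\<close>
     holds, so the approximate delta is at least of order \<open>n^(- 6)\<close>;
     \<open>27/64\<close> bounds the cut-off from below up to distance one half.\<close>
   have kern: "f2 x * (12 * n^2 / sg ^ 8) \<ge> bump n y x / (4 * n ^ 6)"
   proof (cases "r < n")
    case False
    then have "bump n y x = 0" using bump_eq_0[of n x y] n unfolding r_def by auto
    then show ?thesis using f2b(1)[of x] sg by simp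
   next
    case True
    have "sg * sg = r^2 + n^2" unfolding sg_def q_def r_def by (rule smr_sq)
    also have "\<dots> \<le> n^2 + n^2" using True r by (intro add_mono power_mono) auto
    finally have "sg\<^sup>2 \<le> 2 * n^2" by (simp add: power2_eq_square)
    then have "(sg\<^sup>2) ^ 4 \<le> (2 * n^2) ^ 4" by (intro power_mono) auto
    then have s8: "sg ^ 8 \<le> 16 * n ^ 8" by (simp add: power_mult_distrib flip: power_mult)
    have "r^2 \<le> (1/2)^2" using True n r by (intro power_mono) auto
    then have "(3/4) ^ 3 \<le> (max 0 (1 - r^2 / 1^2)) ^ 3" by (intro power_mono) (auto simp: power2_eq_square)
    then have f2l: "27/64 \<le> f2 x" unfolding f2_def bump_def r_def by (simp add: power3_eq_cube)
    have "bump n y x / (4 * n ^ 6) \<le> 1 / (4 * n ^ 6)" using n bump_le_1 by (intro divide_right_mono) auto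
    also have "\<dots> \<le> 27/64 * (12 * n^2 / (16 * n ^ 8))" using n by (simp add: field_simps eval_nat_numeral)
    also have "\<dots> \<le> f2 x * (12 * n^2 / sg ^ 8)"
     using f2l s8 sg n by (intro mult_mono divide_left_mono) auto
    finally show ?thesis .
   qed
   have N1s: "f2 x * N1 = f2 x * (12 * n^2 / sg ^ 8) + f2 x * (3 / 2 * k / sg ^ 5)" unfolding N1_def by (simp add: algebra_simps)
   show ?thesis
   proof (cases "sg \<ge> s1")
    case True
    have pw: "s1 ^ m \<le> sg ^ m" for m using True s1 by (intro power_mono) auto
    have "G1 \<le> G" unfolding G1_def G_def using pw s1 sg k by (intro add_mono divide_left_mono) auto
    moreover have "f1 x \<le> F" unfolding f1e F_def using pw s1 sg k by (intro add_mono divide_left_mono) auto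
    ultimately have "2 * Z * G1 + Z^2 / 2 * f1 x + f1 x * (30 + 12 * Z) + G1 * 6 \<le> C"
     unfolding C_def using Z by (intro add_mono mult_left_mono order_trans[OF eq_refl[OF mult.commute] mult_left_mono]) auto
    moreover have "g1 x \<bullet> g2 x \<le> G1 * 6" using cs mult_left_mono[OF g2b(2)[of x] G10] by linarith
    moreover have "f2 x * (3 / 2 * k / sg ^ 5) \<ge> 0" using f2b sg k by simp
    ultimately show ?thesis using P0 E1 N1s kern xin unfolding Lg by simp
   next
    case False
    then have s: "sg \<le> s1" "sg \<le> 1/2" "r \<le> 1/2" using s1 r by auto
    have "r^2 \<le> (1/2)^2" using s r by (intro power_mono) auto
    then have "(3/4) ^ 3 \<le> (max 0 (1 - r^2 / 1^2)) ^ 3" by (intro power_mono) (auto simp: power2_eq_square)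
    then have f2l: "27/64 \<le> f2 x" unfolding f2_def bump_def r_def by (simp add: power3_eq_cube)
    have a1: "f2 x * (3 / 2 * k / sg ^ 5) \<ge> 27/64 * (3 / 2 * k / sg ^ 5)"
     using f2l sg k by (intro mult_right_mono) auto
    have "g1 x \<bullet> g2 x \<le> G1 * (6 * sg)" using cs mult_left_mono[OF order_trans[OF g2b(1)[of x] mult_left_mono[OF rq[of x]]] G10] unfolding sg_def by simp
    moreover have "2 * Z * G1 + Z^2 / 2 * f1 x + f1 x * (30 + 12 * Z) + G1 * (6 * sg) \<le> 27/64 * (3 / 2 * k / sg ^ 5)"
    proof -
     have ss: "sg * sg \<le> sg" using s sg by (simp add: mult_left_le_one_le)
     have "(2 * Z * G1 + Z^2 / 2 * f1 x + f1 x * (30 + 12 * Z) + G1 * (6 * sg)) * sg ^ 5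
      = 2 * Z * (4 + 3 * k * sg) + Z^2 / 2 * (sg + k * (sg * sg)) + (sg + k * (sg * sg)) * (30 + 12 * Z) + 6 * (4 * sg + 3 * k * (sg * sg))"
      unfolding G1_def f1e using sg by (simp add: field_simps eval_nat_numeral)
     also have "\<dots> \<le> 2 * Z * (4 + 3 * k * sg) + Z^2 / 2 * (sg + k * sg) + (sg + k * sg) * (30 + 12 * Z) + 6 * (4 * sg + 3 * k * sg)"
      using ss k Z by (intro add_mono mult_left_mono mult_right_mono order_refl) auto
     also have "\<dots> = 8 * Z + D * sg" unfolding D_def by (simp add: algebra_simps)
     also have "\<dots> \<le> 8 * Z + D * s1" using s D by simp
     also have "\<dots> \<le> 12 * Z" using s1 by simp
     also have "\<dots> \<le> 27/64 * (3 / 2 * k)" unfolding k_def using Z by simp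
     finally have "2 * Z * G1 + Z^2 / 2 * f1 x + f1 x * (30 + 12 * Z) + G1 * (6 * sg) \<le> 27/64 * (3 / 2 * k) / sg ^ 5"
      using sg by (subst pos_le_divide_eq) auto
     then show ?thesis by simp
    qed
    ultimately have "Lop Z f g l x \<ge> bump n y x / (4 * n ^ 6)" using P0 E1 N1s kern a1 unfolding Lg by linarith
    then show ?thesis using xin C by simp
   qed
  qed
  show "\<exists>f g l. C2GL f g l \<and> bounded {x. f x \<noteq> 0} \<and> (\<forall>x. f x \<ge> 0) \<and>
   (\<forall>x. Lop Z f g l x \<ge> bump n y x / (4 * n ^ 6) - C * indicator (cball y 1) x)"
  proof (intro exI conjI allI)
   show "C2GL f g l" by (rule CC)
   show "bounded {x. f x \<noteq> 0}" by (rule bounded_subset[OF bounded_bump[of 1 y]]) (auto simp: f_def f2_def)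
   show "f x \<ge> 0" for x unfolding f_def using f1p[of x] f2b(1)[of x] by simp
   show "Lop Z f g l x \<ge> bump n y x / (4 * n ^ 6) - C * indicator (cball y 1) x" for x by (rule main)
  qed
 qed
qed

context coulomb_subsolution
begin

lemma w_integrable_cball: "integrable lborel (\<lambda>x. indicator (cball y 1) x * w x)"
proof (rule bintegrable_bound[OF w_loc_integrable[of "norm y + 1"]])
 have [measurable]: "cball y 1 \<in> sets borel" by simp
 show "(\<lambda>x. indicator (cball y 1) x * w x) \<in> borel_measurable lborel" by measurable
 show "AE x in lborel. norm (indicator (cball y 1) x * w x) \<le> norm (indicator (cball 0 (norm y + 1)) x * w x)"
 proof (rule AE_I2)
  fix x
  have "x \<in> cball 0 (norm y + 1)" if "x \<in> cball y 1"
   using that norm_triangle_ineq2[of x y] by (simp add: dist_norm norm_minus_commute)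
  then show "norm (indicator (cball y 1) x * w x) \<le> norm (indicator (cball 0 (norm y + 1)) x * w x)"
   by (auto simp: indicator_def)
 qed
qed

text \<open>Testing \<open>w\<close> with the kernel bounds its mollifications at \<open>y\<close>
  by a multiple of the mass of \<open>w\<close> in the unit ball, uniformly in the scale. Letting
  the scale shrink gives the bound almost everywhere.\<close>

lemma local_bound_w:
 "\<exists>C\<ge>0. AE y in lborel. w y \<le> C * (LBINT x. indicator (cball y 1) x * w x)"
proof -
 obtain C where C: "\<And>y n. 0 < n \<and> n \<le> 1/2 \<Longrightarrow> \<exists>f g l. C2GL f g l \<and> bounded {x. f x \<noteq> 0} \<and> (\<forall>x. f x \<ge> 0) \<and>
   (\<forall>x. Lop Z f g l x \<ge> bump n y x / (4 * n ^ 6) - C * indicator (cball y 1) x)"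
  using Lop_kernel_lower_bound[OF Zpos] by blast
 \<comment> \<open>The bump mass in dimension six is at least \<open>27/64 * (n/6)^6\<close>; the
   factor four is that of the kernel estimate.\<close>
 define c where "c = 27 / 64 / 6 ^ 6 / (4::real)"
 have c: "c > 0" unfolding c_def by simp
 define I where "I y = (LBINT x. indicator (cball y 1) x * w x)" for y

 \<comment> \<open>The L^1 convergence of mollifications is available for integrable functions,
   hence the truncation to balls; countably many radii exhaust the space.\<close>
 define w1 where "w1 R x = indicator (cball 0 R) x * w x" for R :: real and x
 have iw1: "integrable lborel (w1 R)" for R unfolding w1_def[abs_def] by (rule w_loc_integrable)
 have w1: "0 \<le> w1 R x" "w1 R x \<le> w x" for R x unfolding w1_def using w_nonneg[of x] by (auto simp: indicator_def)
 have key: "mollify n (w1 R) y \<le> (\<bar>C\<bar> / c) * I y" if n: "0 < n" "n \<le> 1/2" for n R y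
 proof -
  obtain f g l where f: "C2GL f g l" "bounded {x. f x \<noteq> 0}" "\<And>x. f x \<ge> 0"
   "\<And>x. Lop Z f g l x \<ge> bump n y x / (4 * n ^ 6) - C * indicator (cball y 1) x"
   using C[of n y] n by blast
  define m where "m = bump_mass TYPE(conf2) n"
  have m: "m > 0" unfolding m_def by (rule bump_mass_pos[OF n(1)])
  have "27/64 * (n / 6) ^ 6 \<le> m" using bump_mass_ge[OF n(1), where 'a=conf2] unfolding m_def by simp
  then have "c * (4 * n ^ 6) \<le> m" unfolding c_def by (simp add: power_divide)
  then have cm: "c / m \<le> 1 / (4 * n ^ 6)" using m n by (simp add: field_simps)
  have ib: "integrable lborel (\<lambda>x. w1 R x * bump n x y)" by (rule integrable_mult_bump[OF iw1])
  have ptw: "(c / m) * (w1 R x * bump n x y) - \<bar>C\<bar> * (indicator (cball y 1) x * w x) \<le> w x * Lop Z f g l x" for x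
  proof -
   have "(c / m) * (w1 R x * bump n x y) \<le> 1 / (4 * n ^ 6) * (w x * bump n x y)"
    using cm w1[of R x] bump_nonneg[of n x y] n by (intro mult_mono) auto
   moreover have "w x * (bump n y x / (4 * n ^ 6) - C * indicator (cball y 1) x) \<le> w x * Lop Z f g l x"
    by (intro mult_left_mono f(4) w_nonneg)
   moreover have "C * (indicator (cball y 1) x * w x) \<le> \<bar>C\<bar> * (indicator (cball y 1) x * w x)"
    using w_nonneg[of x] by (intro mult_right_mono) auto
   moreover have "bump n y x = bump n x y" by (rule bump_commute)
   ultimately show ?thesis by (simp add: algebra_simps)
  qed
  have "(LBINT x. (c / m) * (w1 R x * bump n x y) - \<bar>C\<bar> * (indicator (cball y 1) x * w x)) \<le> (LBINT x. w x * Lop Z f g l x)"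
   by (intro integral_mono ptw bintegrable_diff integrable_mult_right ib w_integrable_cball transformed_inequality(2)[OF f(1-3)])
  also have "\<dots> \<le> 0" by (rule transformed_inequality(1)[OF f(1-3)])
  finally have "(c / m) * (LBINT x. w1 R x * bump n x y) \<le> \<bar>C\<bar> * I y"
   unfolding I_def by (subst (asm) bintegral_diff) (use ib w_integrable_cball in auto)
  then have "c * mollify n (w1 R) y \<le> \<bar>C\<bar> * I y" unfolding mollify_def m_def by simp
  then show ?thesis using c by (simp add: field_simps)
 qed
 have "AE y in lborel. w1 (real R) y \<le> (\<bar>C\<bar> / c) * I y" for R :: nat
 proof -
  define ep where "ep j = inverse (real (Suc (Suc j)))" for j
  have ep: "\<And>j. ep j > 0" "\<And>j. ep j \<le> 1/2" "ep \<longlonglongrightarrow> 0"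
   unfolding ep_def using LIMSEQ_Suc[OF LIMSEQ_inverse_real_of_nat] by (auto simp: field_simps)
  have im: "integrable lborel (mollify (ep j) (w1 (real R)))" for j by (rule integrable_mollify[OF iw1 ep(1)])
  have "\<exists>r::nat\<Rightarrow>nat. strict_mono r \<and> (AE x in lborel. (\<lambda>j. mollify (ep (r j)) (w1 (real R)) x - w1 (real R) x) \<longlonglongrightarrow> 0)"
   by (rule tendsto_L1_AE_subseq) (use im iw1 mollify_L1_integral[OF iw1 ep(1,3)] in auto)
  then obtain r :: "nat \<Rightarrow> nat" where r: "AE x in lborel. (\<lambda>j. mollify (ep (r j)) (w1 (real R)) x - w1 (real R) x) \<longlonglongrightarrow> 0"
   by blast
  show ?thesis using r
  proof eventually_elim
   case (elim y)
   have "(\<lambda>j. mollify (ep (r j)) (w1 (real R)) y) \<longlonglongrightarrow> w1 (real R) y" using LIM_zero_cancel[OF elim] .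
   then show ?case by (rule LIMSEQ_le_const2) (use key ep in auto)
  qed
 qed
 then have "AE y in lborel. \<forall>R::nat. w1 (real R) y \<le> (\<bar>C\<bar> / c) * I y" by (simp add: AE_all_countable)
 then have "AE y in lborel. w y \<le> (\<bar>C\<bar> / c) * I y"
 proof eventually_elim
  case (elim y)
  obtain R :: nat where "norm y \<le> real R" using real_arch_simple by blast
  then show ?case using elim[rule_format, of R] unfolding w1_def by simp
 qed
 then show ?thesis unfolding I_def using c by (intro exI[of _ "\<bar>C\<bar> / c"]) auto
qed

end

section \<open>Radial supersolutions\<close>

definition Ex :: "(real \<Rightarrow> real) \<Rightarrow> (real \<Rightarrow> real) \<Rightarrow> conf2 \<Rightarrow> real" where
 "Ex p h x = exp (p (tt (fst x)) + h (tt (snd x)))"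

text \<open>What one electron contributes to \<open>Lop\<close> of an exponential, divided by that
  exponential: \<open>m\<close> and \<open>m2\<close> are the first two derivatives of its exponent
  at \<open>t\<close>. The weights come from \<open>1 - 1 / t^2\<close>, the squared length of the
  gradient of \<open>t\<close>, and from the Laplacian \<open>2 / t + 1 / t^3\<close> of
  \<open>t\<close> in three dimensions.\<close>

definition Br :: "real \<Rightarrow> real \<Rightarrow> real \<Rightarrow> real \<Rightarrow> real" where
 "Br Z m m2 t = - (1/2) * (m2 * (1 - 1 / t^2) + m * (2 / t + 1 / t ^ 3) + m^2 * (1 - 1 / t^2)) + Z * m * sqrt (1 - 1 / t^2)"

lemma Br_zero [simp]: "Br Z 0 0 t = 0" unfolding Br_def by simp

lemma Br_weight_bounds:
 assumes "t \<ge> (1::real)"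
 shows "0 \<le> 1 - 1 / t^2" "1 - 1 / t^2 \<le> 1" "0 \<le> 2 / t + 1 / t ^ 3" "2 / t + 1 / t ^ 3 \<le> 3"
  "1 - 1 / t^2 \<le> sqrt (1 - 1 / t^2)" "sqrt (1 - 1 / t^2) \<le> 1"
proof -
 have "1 \<le> t^2" "1 \<le> t ^ 3" using assms by (auto intro: one_le_power)
 then have a: "1 / t^2 \<le> 1" "1 / t ^ 3 \<le> 1" "1 / t \<le> 1" using assms by (auto simp: field_simps)
 show 1: "0 \<le> 1 - 1 / t^2" and 2: "1 - 1 / t^2 \<le> 1" using a by auto
 show "0 \<le> 2 / t + 1 / t ^ 3" using assms by simp
 show "2 / t + 1 / t ^ 3 \<le> 3" using a by simp
 show "sqrt (1 - 1 / t^2) \<le> 1" using 2 by simp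
 have "(1 - 1 / t^2)^2 \<le> 1 - 1 / t^2" using 1 2 by (simp add: power2_eq_square mult_left_le_one_le)
 then show "1 - 1 / t^2 \<le> sqrt (1 - 1 / t^2)" by (rule real_le_rsqrt)
qed

lemma Br_lower_crude:
 assumes "t \<ge> 1" "\<bar>m\<bar> \<le> B" "\<bar>m2\<bar> \<le> B" "Z > 0"
 shows "Br Z m m2 t \<ge> - (2 * B + B^2 + Z * B)"
proof -
 note w = Br_weight_bounds[OF assms(1)]
 have B: "B \<ge> 0" using assms(2) by linarith
 have 1: "m2 * (1 - 1 / t^2) \<le> B * 1" using assms w B by (intro mult_mono) auto
 have 2: "m * (2 / t + 1 / t ^ 3) \<le> B * 3" using assms w B by (intro mult_mono) auto
 have "m^2 \<le> B^2" using assms(2) by (simp add: abs_le_square_iff[symmetric] B)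
 then have 3: "m^2 * (1 - 1 / t^2) \<le> B^2 * 1" using w by (intro mult_mono) auto
 have "\<bar>m * sqrt (1 - 1 / t^2)\<bar> \<le> B * 1" unfolding abs_mult using assms w B by (intro mult_mono) auto
 then have "\<bar>Z * (m * sqrt (1 - 1 / t^2))\<bar> \<le> Z * B" using assms(4) by (simp add: abs_mult)
 then have "Z * m * sqrt (1 - 1 / t^2) \<ge> - (Z * B)" by (simp add: mult.assoc abs_le_iff)
 moreover define X Y W V where "X = m2 * (1 - 1 / t^2)" and "Y = m * (2 / t + 1 / t ^ 3)"
  and "W = m^2 * (1 - 1 / t^2)" and "V = Z * m * sqrt (1 - 1 / t^2)"
 ultimately have "X \<le> B" "Y \<le> B * 3" "W \<le> B^2" "V \<ge> - (Z * B)" using 1 2 3 by auto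
 moreover have "Br Z m m2 t = - (1/2) * (X + Y + W) + V" unfolding Br_def X_def Y_def W_def V_def ..
 then have "Br Z m m2 t = - X / 2 - Y / 2 - W / 2 + V" by (simp add: distrib_left)
 ultimately show ?thesis using zero_le_power2[of B] by linarith
qed

text \<open>Isolates \<open>Z m - m^2 / 2\<close> and the loss \<open>m / t\<close> due to the
  three-dimensional Laplacian. The root is replaced by the smaller \<open>1 - 1 / t^2\<close>; the
  price is the term of order \<open>m / t^2\<close>.\<close>

lemma Br_lower:
 assumes "t \<ge> 1" "m \<ge> 0" "Z > 0"
 shows "Br Z m m2 t \<ge> Z * m - m^2 / 2 - \<bar>m2\<bar> / 2 - m / t - (Z + 1) * m / t^2"
proof -
 note w = Br_weight_bounds[OF assms(1)]
 have 1: "m2 * (1 - 1 / t^2) \<le> \<bar>m2\<bar> * 1" using w by (intro mult_mono) auto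
 have "t^2 \<le> t ^ 3" using assms(1) by (intro power_increasing) auto
 then have t3: "1 / t ^ 3 \<le> 1 / t^2" using assms(1) by (intro divide_left_mono) auto
 have 2: "m * (2 / t + 1 / t ^ 3) \<le> 2 * (m / t) + m / t^2"
  using mult_left_mono[OF t3 assms(2)] by (simp add: algebra_simps)
 have 3: "m^2 * (1 - 1 / t^2) \<le> m^2" using w by (simp add: mult_left_le)
 have 4: "Z * m * (1 - 1 / t^2) \<le> Z * m * sqrt (1 - 1 / t^2)" using assms w by (intro mult_left_mono) auto
 have 5: "Z * m * (1 - 1 / t^2) = Z * m - Z * m / t^2" by (simp add: algebra_simps)
 have 6: "m / t^2 \<ge> 0" using assms by simp
 have 7: "(Z + 1) * m / t^2 = Z * m / t^2 + m / t^2" by (simp add: algebra_simps add_divide_distrib)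
 define X Y W V where "X = m2 * (1 - 1 / t^2)" and "Y = m * (2 / t + 1 / t ^ 3)"
  and "W = m^2 * (1 - 1 / t^2)" and "V = Z * m * sqrt (1 - 1 / t^2)"
 define i j k where "i = m / t" and "j = m / t^2" and "k = Z * m / t^2"
 have "X \<le> \<bar>m2\<bar>" "Y \<le> 2 * i + j" "W \<le> m^2" "V \<ge> Z * m - k" "j \<ge> 0"
  using 1 2 3 4 6 unfolding 5 X_def Y_def W_def V_def i_def j_def k_def by auto
 moreover have "Br Z m m2 t = - (1/2) * (X + Y + W) + V" unfolding Br_def X_def Y_def W_def V_def ..
 ultimately show ?thesis unfolding 7 i_def[symmetric] j_def[symmetric] k_def[symmetric] by (simp add: distrib_left)
qed

text \<open>Bounded derivatives of the exponents give admissibility, however fast the exponential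
  grows. The value of \<open>Lop\<close> splits into one \<open>Br\<close> per electron because the
  exponent is a sum of functions of the two radii.\<close>

lemma adm_Ex:
 assumes p: "\<And>t. t \<ge> 1 \<Longrightarrow> (p has_real_derivative p1 t) (at t)" "\<And>t. t \<ge> 1 \<Longrightarrow> (p1 has_real_derivative p2 t) (at t)"
   "continuous_on {1..} p2" "\<And>t. t \<ge> 1 \<Longrightarrow> \<bar>p1 t\<bar> \<le> B" "\<And>t. t \<ge> 1 \<Longrightarrow> \<bar>p2 t\<bar> \<le> B"
  and h: "\<And>t. t \<ge> 1 \<Longrightarrow> (h has_real_derivative h1 t) (at t)" "\<And>t. t \<ge> 1 \<Longrightarrow> (h1 has_real_derivative h2 t) (at t)"
   "continuous_on {1..} h2" "\<And>t. t \<ge> 1 \<Longrightarrow> \<bar>h1 t\<bar> \<le> B" "\<And>t. t \<ge> 1 \<Longrightarrow> \<bar>h2 t\<bar> \<le> B"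
 obtains g l where "adm (10 * B + 2 * B^2) (Ex p h) g l"
  "\<And>Z x. Lop Z (Ex p h) g l x = Ex p h x * (Br Z (p1 (tt (fst x))) (p2 (tt (fst x))) (tt (fst x))
    + Br Z (h1 (tt (snd x))) (h2 (tt (snd x))) (tt (snd x)) + 1 / (tt (fst x) + tt (snd x)) - Z^2 / 2)"
proof -
 have B: "B \<ge> 0" using p(4)[of 1] by simp
 define T1 T2 where "T1 x = tt (fst x)" and "T2 x = tt (snd x)" for x :: conf2
 have T: "T1 x \<ge> 1" "T2 x \<ge> 1" for x unfolding T1_def T2_def by (rule tt_ge_1)+
 define L where "L r t q1 q2 = q1 * (3 / t - r^2 / t ^ 3) + q2 * (r / t)^2" for r t q1 q2 :: real
 have C1: "C2GL (\<lambda>x. p (T1 x)) (\<lambda>x. ((p1 (T1 x) / T1 x) *\<^sub>R fst x, 0)) (\<lambda>x. L (norm (fst x)) (T1 x) (p1 (T1 x)) (p2 (T1 x)))"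
 proof (rule C2GL_cong[OF C2GL_compose[OF C2GL_smr_fst[of 1, folded T1_def], of "{1..}" p p1 p2]])
  fix x :: conf2
  show "L (norm (fst x)) (T1 x) (p1 (T1 x)) (p2 (T1 x)) = p1 (T1 x) * (3 / T1 x - (norm (fst x))^2 / T1 x ^ 3)
   + p2 (T1 x) * (((1 / T1 x) *\<^sub>R fst x, 0) \<bullet> ((1 / T1 x) *\<^sub>R fst x, 0::real^3))"
   unfolding L_def by (simp add: inner_prod_def power2_norm_eq_inner[symmetric] power_divide power2_eq_square)
 qed (use T p in auto)
 have C2: "C2GL (\<lambda>x. h (T2 x)) (\<lambda>x. (0, (h1 (T2 x) / T2 x) *\<^sub>R snd x)) (\<lambda>x. L (norm (snd x)) (T2 x) (h1 (T2 x)) (h2 (T2 x)))"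
 proof (rule C2GL_cong[OF C2GL_compose[OF C2GL_smr_snd[of 1, folded T2_def], of "{1..}" h h1 h2]])
  fix x :: conf2
  show "L (norm (snd x)) (T2 x) (h1 (T2 x)) (h2 (T2 x)) = h1 (T2 x) * (3 / T2 x - (norm (snd x))^2 / T2 x ^ 3)
   + h2 (T2 x) * ((0::real^3, (1 / T2 x) *\<^sub>R snd x) \<bullet> (0, (1 / T2 x) *\<^sub>R snd x))"
   unfolding L_def by (simp add: inner_prod_def power2_norm_eq_inner[symmetric] power_divide power2_eq_square)
 qed (use T h in auto)
 define gS where "gS x = ((p1 (T1 x) / T1 x) *\<^sub>R fst x, 0) + (0, (h1 (T2 x) / T2 x) *\<^sub>R snd x)" for x :: conf2
 define lS where "lS x = L (norm (fst x)) (T1 x) (p1 (T1 x)) (p2 (T1 x)) + L (norm (snd x)) (T2 x) (h1 (T2 x)) (h2 (T2 x))" for x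
 have CE: "C2GL (Ex p h) (\<lambda>x. Ex p h x *\<^sub>R gS x) (\<lambda>x. Ex p h x * (lS x + gS x \<bullet> gS x))"
  using C2GL_exp[OF C2GL_add[OF C1 C2]] unfolding Ex_def[abs_def] T1_def[symmetric] T2_def[symmetric] gS_def lS_def .
 have gSe: "gS x = ((p1 (T1 x) / T1 x) *\<^sub>R fst x, (h1 (T2 x) / T2 x) *\<^sub>R snd x)" for x unfolding gS_def by simp
 have r: "norm (fst x) / T1 x \<le> 1" "norm (snd x) / T2 x \<le> 1" for x
  using norm_le_smr[of "fst x" 1] norm_le_smr[of "snd x" 1] T[of x] unfolding T1_def T2_def by (auto simp: field_simps)
 have gg: "gS x \<bullet> gS x = (p1 (T1 x))^2 * (norm (fst x) / T1 x)^2 + (h1 (T2 x))^2 * (norm (snd x) / T2 x)^2" for x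
  unfolding gSe by (simp add: inner_prod_def power2_norm_eq_inner[symmetric] power_divide power_mult_distrib)
 have q: "\<bar>(r / t)\<^sup>2\<bar> \<le> 1" "\<bar>3 / t - r^2 / t ^ 3\<bar> \<le> 3" if "r \<ge> 0" "t \<ge> 1" "r / t \<le> 1" for r t :: real
 proof -
  show 1: "\<bar>(r / t)\<^sup>2\<bar> \<le> 1" using that by (simp add: power_le_one)
  have "r^2 / t ^ 3 = (r / t)^2 * (1 / t)" by (simp add: power_divide power2_eq_square power3_eq_cube)
  moreover have "(r / t)^2 * (1 / t) \<le> 1 * (1 / t)" using 1 that by (intro mult_right_mono) auto
  moreover have "0 \<le> (r / t)^2 * (1 / t)" using that by simp
  moreover have "1 / t \<le> 1" "0 \<le> 1 / t" using that by auto
  moreover have "3 / t = 3 * (1 / t)" by simp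
  ultimately show "\<bar>3 / t - r^2 / t ^ 3\<bar> \<le> 3" by (simp only: abs_le_iff) linarith
 qed
 have Lb: "\<bar>L r t q1 q2\<bar> \<le> 4 * B" if "r \<ge> 0" "t \<ge> 1" "r / t \<le> 1" "\<bar>q1\<bar> \<le> B" "\<bar>q2\<bar> \<le> B" for r t q1 q2
 proof -
  have "\<bar>q1 * (3 / t - r^2 / t ^ 3)\<bar> \<le> B * 3" unfolding abs_mult using q[OF that(1-3)] that B by (intro mult_mono) auto
  moreover have "\<bar>q2 * (r / t)\<^sup>2\<bar> \<le> B * 1" unfolding abs_mult using q[OF that(1-3)] that B by (intro mult_mono) auto
  ultimately show ?thesis unfolding L_def
   using abs_triangle_ineq[of "q1 * (3 / t - r^2 / t ^ 3)" "q2 * (r / t)^2"] by simp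
 qed
 have lSb: "\<bar>lS x\<bar> \<le> 8 * B" for x
  unfolding lS_def using Lb[OF _ T(1) r(1) p(4)[OF T(1)] p(5)[OF T(1)], of x x x] Lb[OF _ T(2) r(2) h(4)[OF T(2)] h(5)[OF T(2)], of x x x]
   abs_triangle_ineq[of "L (norm (fst x)) (T1 x) (p1 (T1 x)) (p2 (T1 x))" "L (norm (snd x)) (T2 x) (h1 (T2 x)) (h2 (T2 x))"] by simp
 have ggb: "gS x \<bullet> gS x \<le> 2 * B^2" for x
 proof -
  have "(p1 (T1 x))^2 \<le> B^2" "(h1 (T2 x))^2 \<le> B^2"
   using p(4)[OF T(1)] h(4)[OF T(2)] B by (simp_all add: abs_le_square_iff[symmetric])
  then have "(p1 (T1 x))^2 * (norm (fst x) / T1 x)^2 \<le> B^2 * 1" "(h1 (T2 x))^2 * (norm (snd x) / T2 x)^2 \<le> B^2 * 1"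
   using q(1)[OF _ T(1) r(1), of x] q(1)[OF _ T(2) r(2), of x] by (intro mult_mono; simp)+
  then show ?thesis unfolding gg by simp
 qed
 have gb: "norm (gS x) \<le> 2 * B" for x
 proof (rule power2_le_imp_le)
  have "(norm (gS x))^2 \<le> 2 * B^2" using ggb[of x] unfolding power2_norm_eq_inner .
  moreover have "(2 * B)^2 = 4 * B^2" by (simp add: power_mult_distrib)
  ultimately show "(norm (gS x))^2 \<le> (2 * B)^2" using zero_le_power2[of B] by linarith
 qed (use B in simp)
 have Ep: "Ex p h x > 0" for x unfolding Ex_def by simp
 show ?thesis
 proof (rule that)
  show "adm (10 * B + 2 * B^2) (Ex p h) (\<lambda>x. Ex p h x *\<^sub>R gS x) (\<lambda>x. Ex p h x * (lS x + gS x \<bullet> gS x))"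
   unfolding adm_def
  proof (intro conjI allI CE Ep)
   fix x
   have "norm (gS x) \<le> 10 * B + 2 * B^2" using gb[of x] B zero_le_power2[of B] by linarith
   from mult_left_mono[OF this, of "Ex p h x"] show "norm (Ex p h x *\<^sub>R gS x) \<le> (10 * B + 2 * B^2) * Ex p h x"
    using Ep[of x] by (simp add: mult.commute)
   have "\<bar>lS x + gS x \<bullet> gS x\<bar> \<le> 10 * B + 2 * B^2" using lSb[of x] ggb[of x] inner_ge_zero[of "gS x"] B by linarith
   from mult_left_mono[OF this, of "Ex p h x"] show "\<bar>Ex p h x * (lS x + gS x \<bullet> gS x)\<bar> \<le> (10 * B + 2 * B^2) * Ex p h x"
    using Ep[of x] by (simp add: abs_mult mult.commute)
  qed
  fix Z and x :: conf2
  have s: "norm z / tt z = sqrt (1 - 1 / (tt z)^2)" "(norm z / tt z)^2 = 1 - 1 / (tt z)^2"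
   "3 / tt z - (norm z)^2 / tt z ^ 3 = 2 / tt z + 1 / tt z ^ 3" for z :: "real^3"
  proof -
   have t: "tt z \<ge> 1" by (rule tt_ge_1)
   have n2: "(norm z)^2 = (tt z)^2 - 1" using smr_sq(2)[of 1 z] by simp
   show 2: "(norm z / tt z)^2 = 1 - 1 / (tt z)^2" unfolding power_divide n2 using t by (simp add: diff_divide_distrib)
   show "norm z / tt z = sqrt (1 - 1 / (tt z)^2)" unfolding 2[symmetric] using t by simp
   show "3 / tt z - (norm z)^2 / tt z ^ 3 = 2 / tt z + 1 / tt z ^ 3" unfolding n2 using t
    by (simp add: field_simps power2_eq_square power3_eq_cube)
  qed
  have dr: "sgn (fst x) \<bullet> fst (gS x) = p1 (T1 x) * (norm (fst x) / T1 x)" "sgn (snd x) \<bullet> snd (gS x) = h1 (T2 x) * (norm (snd x) / T2 x)"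
  proof -
   have "sgn z \<bullet> z = norm z" for z :: "real^3"
    by (cases "z = 0") (simp_all add: sgn_div_norm power2_norm_eq_inner[symmetric] power2_eq_square)
   then show "sgn (fst x) \<bullet> fst (gS x) = p1 (T1 x) * (norm (fst x) / T1 x)" "sgn (snd x) \<bullet> snd (gS x) = h1 (T2 x) * (norm (snd x) / T2 x)"
    unfolding gSe by simp_all
  qed
  have "Lop Z (Ex p h) (\<lambda>x. Ex p h x *\<^sub>R gS x) (\<lambda>x. Ex p h x * (lS x + gS x \<bullet> gS x)) x
   = Ex p h x * (- (1/2) * (lS x + gS x \<bullet> gS x) + Z * (sgn (fst x) \<bullet> fst (gS x) + sgn (snd x) \<bullet> snd (gS x))
     + 1 / (tt (fst x) + tt (snd x)) - Z^2 / 2)"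
   unfolding Lop_def by (simp add: algebra_simps)
  also have "- (1/2) * (lS x + gS x \<bullet> gS x) + Z * (sgn (fst x) \<bullet> fst (gS x) + sgn (snd x) \<bullet> snd (gS x))
   = Br Z (p1 (T1 x)) (p2 (T1 x)) (T1 x) + Br Z (h1 (T2 x)) (h2 (T2 x)) (T2 x)"
   unfolding dr gg lS_def L_def Br_def T1_def T2_def s(2,3) unfolding s(1) by (simp add: algebra_simps add_divide_distrib diff_divide_distrib)
  finally show "Lop Z (Ex p h) (\<lambda>x. Ex p h x *\<^sub>R gS x) (\<lambda>x. Ex p h x * (lS x + gS x \<bullet> gS x)) x = Ex p h x * (Br Z (p1 (tt (fst x))) (p2 (tt (fst x))) (tt (fst x))
    + Br Z (h1 (tt (snd x))) (h2 (tt (snd x))) (tt (snd x)) + 1 / (tt (fst x) + tt (snd x)) - Z^2 / 2)"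
   unfolding T1_def T2_def .
 qed
qed

text \<open>Logarithms of the building blocks: \<open>hT\<close> for an electron carrying the factor \<open>exp (d sqrt t)\<close>, and \<open>pA\<close>, \<open>hA\<close> for the inner and
 the outer electron of a term that also decays in the inner variable. \<open>BT\<close>, \<open>BH\<close>, \<open>BP\<close> are the corresponding values of \<open>Br\<close>.\<close>

definition hT :: "real \<Rightarrow> real \<Rightarrow> real \<Rightarrow> real" where "hT Z d t = Z * t + d * sqrt t"
definition hA :: "real \<Rightarrow> real \<Rightarrow> real \<Rightarrow> real" where "hA Z c t = Z * t + c * sqrt t - ln t"
definition pA :: "real \<Rightarrow> real \<Rightarrow> real" where "pA Z t = 2 * Z * t - t powr (3/4)"

definition BT :: "real \<Rightarrow> real \<Rightarrow> real \<Rightarrow> real" where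
 "BT Z d t = Br Z (Z + d / (2 * sqrt t)) (- d / (4 * sqrt t ^ 3)) t"
definition BH :: "real \<Rightarrow> real \<Rightarrow> real \<Rightarrow> real" where
 "BH Z c t = Br Z (Z + c / (2 * sqrt t) - 1 / t) (- c / (4 * sqrt t ^ 3) + 1 / t^2) t"
definition BP :: "real \<Rightarrow> real \<Rightarrow> real" where
 "BP Z t = Br Z (2 * Z - 3/4 * t powr (-1/4)) (3/16 * t powr (-5/4)) t"

lemma complete_square_identity: "Z * (Z + e) - (Z + e)^2 / 2 = Z^2 / 2 - e^2 / 2" for Z e :: real
proof -
 have "(Z + e)^2 = Z * Z + 2 * (Z * e) + e^2" "Z * (Z + e) = Z * Z + Z * e" "Z^2 = Z * Z"
  by (simp_all add: power2_eq_square algebra_simps)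
 then show ?thesis by linarith
qed

lemma abs_divide_le: "y \<ge> 1 \<Longrightarrow> \<bar>d\<bar> / y \<le> \<bar>d :: real\<bar>"
 using divide_left_mono[of 1 y "\<bar>d\<bar>"] by simp

lemma sqrt_deriv2:
 assumes "t > (0::real)"
 shows "((\<lambda>t. d / (2 * sqrt t)) has_real_derivative - d / (4 * sqrt t ^ 3)) (at t)"
proof -
 have q: "sqrt t > 0" using assms by simp
 have d: "(sqrt has_real_derivative 1 / (2 * sqrt t)) (at t)"
  using assms by (auto intro!: derivative_eq_intros simp: field_simps)
 show ?thesis
  by (rule DERIV_cong[OF DERIV_divide[OF DERIV_const DERIV_cmult[OF d]]])
    (use q in \<open>auto simp: power3_eq_cube field_simps\<close>)
qed

lemma hT_deriv:
 assumes "t \<ge> 1"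
 shows "(hT Z d has_real_derivative Z + d / (2 * sqrt t)) (at t)"
  "((\<lambda>t. Z + d / (2 * sqrt t)) has_real_derivative - d / (4 * sqrt t ^ 3)) (at t)"
  "\<bar>Z + d / (2 * sqrt t)\<bar> \<le> \<bar>Z\<bar> + \<bar>d\<bar>" "\<bar>- d / (4 * sqrt t ^ 3)\<bar> \<le> \<bar>Z\<bar> + \<bar>d\<bar>"
proof -
 show "(hT Z d has_real_derivative Z + d / (2 * sqrt t)) (at t)"
  unfolding hT_def[abs_def] using assms by (auto intro!: derivative_eq_intros simp: field_simps)
 show "((\<lambda>t. Z + d / (2 * sqrt t)) has_real_derivative - d / (4 * sqrt t ^ 3)) (at t)"
  using DERIV_add[OF DERIV_const sqrt_deriv2[of t d]] assms by simp
 have s: "sqrt t \<ge> 1" "sqrt t ^ 3 \<ge> 1" using assms by (auto intro: one_le_power)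
 have s': "2 * sqrt t \<ge> 1" "4 * sqrt t ^ 3 \<ge> 1" using s by linarith+
 have "\<bar>d / (2 * sqrt t)\<bar> \<le> \<bar>d\<bar>" using abs_divide_le[OF s'(1), of d] s by (simp add: abs_mult)
 then show "\<bar>Z + d / (2 * sqrt t)\<bar> \<le> \<bar>Z\<bar> + \<bar>d\<bar>" by linarith
 have "\<bar>d\<bar> / (4 * sqrt t ^ 3) \<le> \<bar>d\<bar>" by (rule abs_divide_le[OF s'(2)])
 moreover have "\<bar>- d / (4 * sqrt t ^ 3)\<bar> = \<bar>d\<bar> / (4 * sqrt t ^ 3)" using s by (simp add: abs_mult)
 ultimately show "\<bar>- d / (4 * sqrt t ^ 3)\<bar> \<le> \<bar>Z\<bar> + \<bar>d\<bar>" by linarith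
qed

lemma hA_deriv:
 assumes "t \<ge> 1"
 shows "(hA Z c has_real_derivative Z + c / (2 * sqrt t) - 1 / t) (at t)"
  "((\<lambda>t. Z + c / (2 * sqrt t) - 1 / t) has_real_derivative - c / (4 * sqrt t ^ 3) + 1 / t^2) (at t)"
  "\<bar>Z + c / (2 * sqrt t) - 1 / t\<bar> \<le> \<bar>Z\<bar> + \<bar>c\<bar> + 1" "\<bar>- c / (4 * sqrt t ^ 3) + 1 / t\<^sup>2\<bar> \<le> \<bar>Z\<bar> + \<bar>c\<bar> + 1"
proof -
 have e: "hA Z c = (\<lambda>t. hT Z c t - ln t)" unfolding hA_def hT_def by auto
 have "(ln has_real_derivative 1 / t) (at t)" using assms by (auto intro!: derivative_eq_intros)
 from DERIV_diff[OF hT_deriv(1)[OF assms, of Z c] this]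
 show "(hA Z c has_real_derivative Z + c / (2 * sqrt t) - 1 / t) (at t)" unfolding e .
 have "((\<lambda>t. 1 / t) has_real_derivative - 1 / t^2) (at t)"
  by (rule DERIV_cong[OF DERIV_divide[OF DERIV_const DERIV_ident]]) (use assms in \<open>auto simp: power2_eq_square\<close>)
 from DERIV_diff[OF hT_deriv(2)[OF assms, of Z c] this]
 show "((\<lambda>t. Z + c / (2 * sqrt t) - 1 / t) has_real_derivative - c / (4 * sqrt t ^ 3) + 1 / t^2) (at t)" by simp
 have "0 \<le> 1 / t" "1 / t \<le> 1" "0 \<le> 1 / t^2" "1 / t^2 \<le> 1" using assms one_le_power[OF assms, of 2] by auto
 then have i: "\<bar>1 / t\<bar> \<le> 1" "\<bar>1 / t\<^sup>2\<bar> \<le> 1" by (simp_all only: abs_of_nonneg)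
 show "\<bar>Z + c / (2 * sqrt t) - 1 / t\<bar> \<le> \<bar>Z\<bar> + \<bar>c\<bar> + 1"
  using hT_deriv(3)[OF assms, of Z c] i(1) abs_triangle_ineq4[of "Z + c / (2 * sqrt t)" "1 / t"] by linarith
 show "\<bar>- c / (4 * sqrt t ^ 3) + 1 / t\<^sup>2\<bar> \<le> \<bar>Z\<bar> + \<bar>c\<bar> + 1"
  using order_trans[OF abs_triangle_ineq add_mono[OF hT_deriv(4)[OF assms, of c Z] i(2)]] .
qed

lemma pA_deriv:
 assumes "t \<ge> 1"
 shows "(pA Z has_real_derivative 2 * Z - 3/4 * t powr (-1/4)) (at t)"
  "((\<lambda>t. 2 * Z - 3/4 * t powr (-1/4)) has_real_derivative 3/16 * t powr (-5/4)) (at t)"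
  "\<bar>2 * Z - 3/4 * t powr (-1/4)\<bar> \<le> 2 * \<bar>Z\<bar> + 1" "\<bar>3/16 * t powr (-5/4)\<bar> \<le> 2 * \<bar>Z\<bar> + 1"
proof -
 have t: "t > 0" using assms by simp
 have "((\<lambda>z. z powr (3/4)) has_real_derivative (3/4) * t powr (3/4 - 1)) (at t)" by (rule has_real_derivative_powr[OF t])
 from DERIV_diff[OF DERIV_cmult[OF DERIV_ident, of "2 * Z"] this]
 show "(pA Z has_real_derivative 2 * Z - 3/4 * t powr (-1/4)) (at t)" unfolding pA_def[abs_def] by simp
 have "((\<lambda>z. z powr (-1/4)) has_real_derivative (-1/4) * t powr (-1/4 - 1)) (at t)" by (rule has_real_derivative_powr[OF t])
 from DERIV_diff[OF DERIV_const DERIV_cmult[OF this, of "3/4"]]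
 show "((\<lambda>t. 2 * Z - 3/4 * t powr (-1/4)) has_real_derivative 3/16 * t powr (-5/4)) (at t)" by simp
 have "t powr (-1/4) \<le> 1" "t powr (-5/4) \<le> 1" using powr_mono[of "-1/4" 0 t] powr_mono[of "-5/4" 0 t] assms by auto
 moreover have "0 \<le> t powr (-1/4)" "0 \<le> t powr (-5/4)" by simp_all
 ultimately show "\<bar>2 * Z - 3/4 * t powr (-1/4)\<bar> \<le> 2 * \<bar>Z\<bar> + 1" "\<bar>3/16 * t powr (-5/4)\<bar> \<le> 2 * \<bar>Z\<bar> + 1"
  by linarith+
qed

text \<open>With \<open>m = Z + d / (2 sqrt t)\<close> the square completes to
  \<open>Z^2 / 2 - d^2 / (8 t)\<close>, and \<open>m / t\<close> costs \<open>Z / t\<close> to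
  leading order. The total loss is \<open>(Z + d^2 / 8) / t\<close> up to smaller terms, and the
  bound on \<open>d^2\<close> keeps this constant strictly below \<open>(1 + Z) / 2\<close>, the
  midpoint between \<open>Z\<close> and one.\<close>

lemma BT_eventually:
 assumes Z: "0 < Z" "Z < 1" and d: "\<bar>d\<bar> \<le> Z" "d^2 \<le> 2 * (1 - Z)"
 shows "eventually (\<lambda>t. BT Z d t - Z^2 / 2 \<ge> - ((1 + Z) / 2) / t) at_top"
proof -
 have "((\<lambda>t. d^2 / 8 + Z + \<bar>d\<bar> / (8 * sqrt t) + \<bar>d\<bar> / (2 * sqrt t) + (Z + 1) * (Z + \<bar>d\<bar>) / t) \<longlongrightarrow> d^2 / 8 + Z) at_top"
  by real_asymp
 moreover have "d^2 / 8 + Z < (1 + Z) / 2" using d Z by simp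
 ultimately have "eventually (\<lambda>t. d^2 / 8 + Z + \<bar>d\<bar> / (8 * sqrt t) + \<bar>d\<bar> / (2 * sqrt t) + (Z + 1) * (Z + \<bar>d\<bar>) / t < (1 + Z) / 2) at_top"
  by (rule order_tendstoD)
 then show ?thesis using eventually_ge_at_top[of 1]
 proof eventually_elim
  case (elim t)
  have s: "sqrt t \<ge> 1" "sqrt t * sqrt t = t" using elim by auto
  define m where "m = Z + d / (2 * sqrt t)"
  have dd: "\<bar>d / (2 * sqrt t)\<bar> = \<bar>d\<bar> / (2 * sqrt t)" using s by (simp add: abs_mult)
  have ds: "\<bar>d\<bar> / (2 * sqrt t) \<le> \<bar>d\<bar>" using divide_left_mono[of 1 "2 * sqrt t" "\<bar>d\<bar>"] s by simp
  have m: "m \<ge> 0" "m \<le> Z + \<bar>d\<bar> / (2 * sqrt t)" "m \<le> Z + \<bar>d\<bar>" unfolding m_def using dd ds d by linarith+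
  have 1: "Z * m - m^2 / 2 = Z^2 / 2 - d^2 / 8 / t"
  proof -
   have "Z * m - m^2 / 2 = Z^2 / 2 - (d / (2 * sqrt t))^2 / 2" unfolding m_def by (rule complete_square_identity)
   also have "(d / (2 * sqrt t))^2 = d^2 / 4 / t" using elim by (simp add: power_divide power_mult_distrib)
   finally show ?thesis by simp
  qed
  have 2: "\<bar>- d / (4 * sqrt t ^ 3)\<bar> / 2 = \<bar>d\<bar> / (8 * sqrt t) / t"
   using s by (simp add: abs_mult power3_eq_cube)
  have 3: "m / t \<le> (Z + \<bar>d\<bar> / (2 * sqrt t)) / t" using m elim by (intro divide_right_mono) auto
  have 4: "(Z + 1) * m / t^2 \<le> (Z + 1) * (Z + \<bar>d\<bar>) / t / t"
   using m Z elim by (simp add: power2_eq_square divide_right_mono mult_left_mono)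
  have "BT Z d t \<ge> Z * m - m^2 / 2 - \<bar>- d / (4 * sqrt t ^ 3)\<bar> / 2 - m / t - (Z + 1) * m / t^2"
   unfolding BT_def m_def[symmetric] by (rule Br_lower[OF elim(2) m(1) Z(1)])
  then have "BT Z d t - Z^2 / 2 \<ge> - (d^2 / 8 / t + \<bar>d\<bar> / (8 * sqrt t) / t + (Z + \<bar>d\<bar> / (2 * sqrt t)) / t + (Z + 1) * (Z + \<bar>d\<bar>) / t / t)"
   using 1 2 3 4 by linarith
  also have "d^2 / 8 / t + \<bar>d\<bar> / (8 * sqrt t) / t + (Z + \<bar>d\<bar> / (2 * sqrt t)) / t + (Z + 1) * (Z + \<bar>d\<bar>) / t / t
   = (d^2 / 8 + Z + \<bar>d\<bar> / (8 * sqrt t) + \<bar>d\<bar> / (2 * sqrt t) + (Z + 1) * (Z + \<bar>d\<bar>) / t) / t" by (simp only: add_divide_distrib)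
  finally have "BT Z d t - Z^2 / 2 \<ge> - ((d^2 / 8 + Z + \<bar>d\<bar> / (8 * sqrt t) + \<bar>d\<bar> / (2 * sqrt t) + (Z + 1) * (Z + \<bar>d\<bar>) / t) / t)" .
  moreover have "(d^2 / 8 + Z + \<bar>d\<bar> / (8 * sqrt t) + \<bar>d\<bar> / (2 * sqrt t) + (Z + 1) * (Z + \<bar>d\<bar>) / t) / t \<le> ((1 + Z) / 2) / t"
   using elim by (intro divide_right_mono) auto
  ultimately show ?case by simp
 qed
qed

text \<open>Completing the square leaves an error of order \<open>1 / t\<close> with some constant
  \<open>K\<close>. Its size is immaterial, as it is compared with the gain of order
  \<open>t powr (- 1/4)\<close> from \<open>BP\<close>.\<close>

lemma BH_eventually:
 assumes Z: "0 < Z" and c: "c > 0"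
 shows "\<exists>K>0. eventually (\<lambda>t. BH Z c t - Z^2 / 2 \<ge> - K / t) at_top"
proof (intro exI conjI)
 define K where "K = (c + 1)^2 / 2 + (c + 1) / 2 + (Z + c) + (Z + 1) * (Z + c)"
 show "K > 0" unfolding K_def using Z c by (intro add_pos_pos) auto
 show "eventually (\<lambda>t. BH Z c t - Z^2 / 2 \<ge> - K / t) at_top"
  using eventually_ge_at_top[of 1] eventually_ge_at_top[of "1 / Z"]
 proof eventually_elim
  case (elim t)
  have s: "sqrt t \<ge> 1" "sqrt t * sqrt t = t" using elim by auto
  define e where "e = c / (2 * sqrt t) - 1 / t"
  define m where "m = Z + c / (2 * sqrt t) - 1 / t"
  have cs: "0 \<le> c / (2 * sqrt t)" "c / (2 * sqrt t) \<le> c / sqrt t" using s c by (auto simp: field_simps)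
  have cc: "c / sqrt t \<le> c" using divide_left_mono[of 1 "sqrt t" c] s c by simp
  have it: "0 \<le> 1 / t" "1 / t \<le> 1 / sqrt t" "1 / t \<le> Z"
  proof -
   have "sqrt t * 1 \<le> sqrt t * sqrt t" using s by (intro mult_left_mono) auto
   then show "1 / t \<le> 1 / sqrt t" using s by (intro divide_left_mono) auto
   show "1 / t \<le> Z" using elim Z by (simp add: field_simps)
  qed (use elim in simp)
  have eb: "\<bar>e\<bar> \<le> (c + 1) / sqrt t" unfolding e_def add_divide_distrib using cs it by linarith
  have m: "m \<ge> 0" "m \<le> Z + c" unfolding m_def using cs cc it by linarith+
  have "e^2 \<le> ((c + 1) / sqrt t)^2" using power_mono[OF eb, of 2] by simp
  also have "\<dots> = (c + 1)^2 / t" using elim by (simp add: power_divide)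
  finally have e2: "e^2 / 2 \<le> (c + 1)^2 / 2 / t" by simp
  have "m = Z + e" unfolding m_def e_def by simp
  then have 1: "Z * m - m^2 / 2 = Z^2 / 2 - e^2 / 2" by (simp only: complete_square_identity)
  have 2: "\<bar>- c / (4 * sqrt t ^ 3) + 1 / t\<^sup>2\<bar> \<le> (c + 1) / t"
  proof -
   have "1 \<le> 4 * sqrt t" using s by linarith
   then have "t * 1 \<le> t * (4 * sqrt t)" using elim by (intro mult_left_mono) auto
   then have "t * 1 \<le> 4 * (t * sqrt t)" by (simp add: ac_simps)
   moreover have "4 * sqrt t ^ 3 = 4 * (t * sqrt t)" using s by (simp add: power3_eq_cube)
   ultimately have "t \<le> 4 * sqrt t ^ 3" by linarith
   moreover have "0 < 4 * sqrt t ^ 3 * t" using elim by simp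
   ultimately
   have "c / (4 * sqrt t ^ 3) \<le> c / t" using c by (intro divide_left_mono) simp_all
   moreover have "0 \<le> c / (4 * sqrt t ^ 3)" using c s by simp
   moreover have "1 / t^2 \<le> 1 / t" "0 \<le> 1 / t^2" using elim by (auto intro!: divide_left_mono simp: power2_eq_square)
   moreover have "- c / (4 * sqrt t ^ 3) = - (c / (4 * sqrt t ^ 3))" by simp
   ultimately show ?thesis unfolding add_divide_distrib using it(1) by linarith
  qed
  have 3: "m / t \<le> (Z + c) / t" using m elim by (intro divide_right_mono) auto
  have 4: "(Z + 1) * m / t^2 \<le> (Z + 1) * (Z + c) / t"
   using m Z elim by (intro frac_le mult_left_mono mult_nonneg_nonneg) (auto simp: power2_eq_square)
  have "BH Z c t \<ge> Z * m - m^2 / 2 - \<bar>- c / (4 * sqrt t ^ 3) + 1 / t\<^sup>2\<bar> / 2 - m / t - (Z + 1) * m / t^2"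
   unfolding BH_def m_def[symmetric] by (rule Br_lower[OF elim(1) m(1) Z(1)])
  moreover have "K / t = (c + 1)^2 / 2 / t + (c + 1) / t / 2 + (Z + c) / t + (Z + 1) * (Z + c) / t"
   unfolding K_def by (simp add: add_divide_distrib)
  ultimately show ?case using 1 2 3 4 e2 by simp
 qed
qed

text \<open>\<open>m = 2 Z\<close> is the nonzero root of \<open>Z m - m^2 / 2\<close>, where the
  slope is \<open>- Z\<close>. Lowering \<open>m\<close> by \<open>3/4 t powr (- 1/4)\<close>
  therefore gains \<open>3/4 Z t powr (- 1/4)\<close>, of which the smaller errors, among them the
  loss \<open>m / t\<close>, consume at most a third.\<close>

lemma BP_eventually:
 assumes Z: "0 < Z"
 shows "eventually (\<lambda>t. BP Z t \<ge> Z / 2 * t powr (-1/4)) at_top"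
proof -
 have "((\<lambda>t. 9/32 * t powr (-1/4) + 3/32 * t powr (-1) + 2 * Z * t powr (-3/4) + (Z + 1) * (2 * Z) * t powr (-7/4)) \<longlongrightarrow> 0) at_top"
  using Z by real_asymp
 then have "eventually (\<lambda>t. 9/32 * t powr (-1/4) + 3/32 * t powr (-1) + 2 * Z * t powr (-3/4) + (Z + 1) * (2 * Z) * t powr (-7/4) < Z / 4) at_top"
  using Z by (intro order_tendstoD) auto
 moreover have "((\<lambda>t::real. 3/4 * t powr (-1/4)) \<longlongrightarrow> 0) at_top" by real_asymp
 then have "eventually (\<lambda>t. 3/4 * t powr (-1/4) < 2 * Z) at_top" using Z by (intro order_tendstoD) auto
 ultimately show ?thesis using eventually_ge_at_top[of 1]
 proof eventually_elim
  case (elim t)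
  define v where "v = t powr (-1/4)"
  have t: "t > 0" using elim by simp
  have v: "v > 0" unfolding v_def using t by simp
  define m where "m = 2 * Z - 3/4 * v"
  have m: "m \<ge> 0" "m \<le> 2 * Z" unfolding m_def using elim v unfolding v_def by auto
  have "BP Z t \<ge> Z * m - m^2 / 2 - \<bar>3/16 * t powr (-5/4)\<bar> / 2 - m / t - (Z + 1) * m / t^2"
   unfolding BP_def v_def[symmetric] m_def[symmetric] by (rule Br_lower[OF elim(3) m(1) Z])
  moreover have "Z * m - m^2 / 2 = 3/4 * Z * v - v * (9/32 * v)"
  proof -
   have "m = Z + (Z - 3/4 * v)" unfolding m_def by simp
   then have "Z * m - m^2 / 2 = Z^2 / 2 - (Z - 3/4 * v)^2 / 2" by (simp only: complete_square_identity)
   moreover have "(Z - 3/4 * v)^2 = Z^2 - 3/2 * (Z * v) + 9/16 * (v * v)" by (simp add: power2_eq_square algebra_simps)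
   moreover have "3/4 * Z * v = 3/4 * (Z * v)" "v * (9/32 * v) = 9/32 * (v * v)" by simp_all
   ultimately show ?thesis by linarith
  qed
  moreover have "t powr (-5/4) = v * t powr (-1)" "1 / t = v * t powr (-3/4)" "1 / t^2 = v * t powr (-7/4)"
  proof -
   have "v * t powr (-1) = t powr (-1/4 + (-1))" unfolding v_def by (rule powr_add[symmetric])
   moreover have "(-1/4 + (-1) :: real) = -5/4" by simp
   ultimately show "t powr (-5/4) = v * t powr (-1)" by (simp only:)
   have "v * t powr (-3/4) = t powr (-1)" unfolding v_def by (simp flip: powr_add)
   then show "1 / t = v * t powr (-3/4)" using t by (simp add: powr_minus inverse_eq_divide)
   have "v * t powr (-7/4) = t powr (- real 2)" unfolding v_def by (simp flip: powr_add)
   also have "\<dots> = 1 / t^2" using t by (simp only: powr_minus powr_realpow inverse_eq_divide)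
   finally show "1 / t^2 = v * t powr (-7/4)" by simp
  qed
  note e = this
  moreover have "m / t \<le> v * (2 * Z * t powr (-3/4))"
  proof -
   have "m / t \<le> 2 * Z * (1 / t)" using mult_right_mono[OF m(2), of "1 / t"] t by simp
   also have "\<dots> = v * (2 * Z * t powr (-3/4))" unfolding e(2) by (simp only: ac_simps)
   finally show ?thesis .
  qed
  moreover have "(Z + 1) * m / t^2 \<le> v * ((Z + 1) * (2 * Z) * t powr (-7/4))"
  proof -
   have "(Z + 1) * m * (1 / t^2) \<le> (Z + 1) * (2 * Z) * (1 / t^2)" using m t Z by (intro mult_right_mono mult_left_mono) auto
   then have "(Z + 1) * m / t^2 \<le> (Z + 1) * (2 * Z) * (1 / t^2)" by simp
   also have "\<dots> = v * ((Z + 1) * (2 * Z) * t powr (-7/4))" unfolding e(3) by (simp only: ac_simps)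
   finally show ?thesis .
  qed
  moreover have "\<bar>3/16 * t powr (-5/4)\<bar> / 2 = v * (3/32 * t powr (-1))" unfolding e(1) using v by (simp add: abs_mult)
  ultimately have "BP Z t \<ge> 3/4 * Z * v - v * (9/32 * v) - v * (3/32 * t powr (-1)) - v * (2 * Z * t powr (-3/4)) - v * ((Z + 1) * (2 * Z) * t powr (-7/4))"
   by linarith
  moreover have "v * (9/32 * v + 3/32 * t powr (-1) + 2 * Z * t powr (-3/4) + (Z + 1) * (2 * Z) * t powr (-7/4)) \<le> v * (Z / 4)"
   using elim(1) v unfolding v_def by (intro mult_left_mono) auto
  ultimately show ?case unfolding v_def[symmetric] by (simp only: distrib_left) (simp add: algebra_simps)
 qed
qed

text \<open>Each electron with slope near \<open>Z\<close> contributes nearly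
  \<open>Z^2 / 2\<close>, so two of them together exceed the threshold by an amount of order
  one.\<close>

lemma Br_linear_eventually:
 assumes Z: "0 < Z" and b: "0 \<le> b" "b \<le> Z / 4"
 shows "eventually (\<lambda>t. Br Z (Z - b) 0 t \<ge> 3/8 * Z^2) at_top"
proof -
 have "((\<lambda>t. (Z - b) / t + (Z + 1) * (Z - b) / t^2) \<longlongrightarrow> 0) at_top" by real_asymp
 then have "eventually (\<lambda>t. (Z - b) / t + (Z + 1) * (Z - b) / t^2 < Z^2 / 16) at_top"
  using Z by (intro order_tendstoD) auto
 then show ?thesis using eventually_ge_at_top[of 1]
 proof eventually_elim
  case (elim t)
  have "Br Z (Z - b) 0 t \<ge> Z * (Z - b) - (Z - b)^2 / 2 - \<bar>0\<bar> / 2 - (Z - b) / t - (Z + 1) * (Z - b) / t^2"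
   by (rule Br_lower) (use elim b Z in auto)
  moreover have "Z * (Z - b) - (Z - b)^2 / 2 = Z^2 / 2 - b^2 / 2" using complete_square_identity[of Z "- b"] by simp
  moreover have "b^2 \<le> Z^2 / 16" using power_mono[OF b(2,1), of 2] by (simp add: power_divide)
  ultimately show ?case using elim zero_le_power2[of Z] by linarith
 qed
qed

section \<open>Positivity of the supersolutions at large distance\<close>

lemma eventually_at_topD:
 fixes P :: "real \<Rightarrow> bool"
 assumes "eventually P at_top"
 shows "\<exists>R\<ge>1. \<forall>t\<ge>R. P t"
proof -
 obtain N where "\<forall>t\<ge>N. P t" using assms unfolding eventually_at_top_linorder by blast
 then show ?thesis by (intro exI[of _ "max 1 N"]) auto
qed

text \<open>For an inner radius \<open>s\<close> much smaller than \<open>t\<close> the repulsion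
  keeps the fraction \<open>1 - k\<close> of its full value \<open>1 / t\<close>.\<close>

lemma inverse_sum_lower:
 assumes "0 < s" "s \<le> k * t" "0 < t" "k > (0::real)"
 shows "1 / (s + t) \<ge> (1 - k) / t"
proof -
 have "s + t \<le> (1 + k) * t" using assms by (simp add: algebra_simps)
 then have "1 / (s + t) \<ge> 1 / ((1 + k) * t)" using assms by (intro divide_left_mono mult_pos_pos) auto
 moreover have "(1 - k) / t \<le> 1 / ((1 + k) * t)"
 proof -
  have "(1 - k) * (1 + k) \<le> 1" by (simp add: algebra_simps)
  then have "1 - k \<le> 1 / (1 + k)" using assms by (simp add: field_simps)
  then have "(1 - k) / t \<le> 1 / (1 + k) / t" using assms by (intro divide_right_mono) auto
  then show ?thesis by simp
 qed
 ultimately show ?thesis by linarith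
qed

lemma powr_quarter_ge:
 assumes "1 \<le> s" "s \<le> (t::real)"
 shows "1 / t \<le> s powr (-1/4)"
proof -
 have "1 / t \<le> 1 / s" using assms by (intro divide_left_mono) auto
 also have "\<dots> = s powr (-1)" using assms by (simp add: powr_minus inverse_eq_divide)
 also have "\<dots> \<le> s powr (-1/4)" using assms by (intro powr_mono) auto
 finally show ?thesis .
qed

text \<open>\<open>s\<close> and \<open>t\<close> are the inner and the outer radius,
  \<open>a\<close> and \<open>b\<close> the products with the two assignments of roles. For large
  \<open>s\<close> the correct one, \<open>a\<close>, is the smaller one; a minimum would select it,
  and the harmonic mean does so smoothly and symmetrically. While \<open>s\<close> is bounded, the
  surplus of order \<open>1 / t\<close> in the term \<open>E t\<close> pays for everything. For
  large \<open>s\<close> the gain \<open>s powr (- 1/4)\<close> of the product does, thanks to its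
  additional exponential factor.\<close>

lemma Psi_lower_bound:
 assumes Z: "0 < Z" "Z < 1" and c: "0 < c" "c \<le> Z" "c^2 \<le> 2 * (1 - Z)"
 defines "E \<equiv> \<lambda>t. exp (hT Z c t)"
 shows "\<exists>A>0. \<exists>R\<ge>1. \<exists>k>0. \<forall>s t. 1 \<le> s \<longrightarrow> s \<le> t \<longrightarrow> R \<le> t \<longrightarrow>
   (let a = exp (pA Z s + hA Z c t); b = exp (pA Z t + hA Z c s); r = 1 / (s + t) - Z^2 / 2 in
   A * (E t * (BT Z c t + r) + E s * (BT Z c s + r))
   + ((b / (a + b))^2 * (a * (BP Z s + BH Z c t + r)) + (a / (a + b))^2 * (b * (BP Z t + BH Z c s + r)))
   \<ge> k * (exp (pA Z s) * E t / t^2))"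
proof -
 obtain K where K: "K > 0" "eventually (\<lambda>t. BH Z c t - Z^2 / 2 \<ge> - K / t) at_top" using BH_eventually[OF Z(1) c(1)] by blast
 define th where "th = (1 + Z) / 2"
 define ka where "ka = (1 - Z) / 4"
 have th: "0 < th" "th < 1" and ka: "0 < ka" "ka < 1" unfolding th_def ka_def using Z by auto
 have ka3: "1 - ka - th = ka" unfolding th_def ka_def add_divide_distrib diff_divide_distrib by simp
 note ka = ka ka3
 define v where "v t = t powr (-1/4)" for t :: real
 define ph where "ph t = Z * t - t powr (3/4) - c * sqrt t" for t
 have ev4: "eventually (\<lambda>t. Z / 2 * v t - 2 * K / t \<ge> Z / 4 * v t) at_top"
  unfolding v_def using Z K(1) by real_asymp
 have ev5: "eventually (\<lambda>t. Z - 3/4 * v t - c / (2 * sqrt t) \<ge> 0) at_top"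
  unfolding v_def using Z c by real_asymp
 have ev6: "eventually (\<lambda>t. E t \<le> exp (pA Z t) * v t) at_top"
  unfolding E_def hT_def pA_def v_def using Z c by real_asymp
 have "eventually (\<lambda>t. BT Z c t - Z^2 / 2 \<ge> - th / t \<and> BP Z t \<ge> Z / 2 * v t \<and> BH Z c t - Z^2 / 2 \<ge> - K / t
   \<and> Z / 2 * v t - 2 * K / t \<ge> Z / 4 * v t \<and> Z - 3/4 * v t - c / (2 * sqrt t) \<ge> 0 \<and> E t \<le> exp (pA Z t) * v t) at_top"
  using BT_eventually[OF Z, of c] c BP_eventually[OF Z(1)] K(2) ev4 ev5 ev6
  unfolding th_def v_def by (simp add: eventually_conj_iff)
 from eventually_at_topD[OF this]
 obtain R0 where R00: "R0 \<ge> 1" "\<forall>t\<ge>R0. BT Z c t - Z^2 / 2 \<ge> - th / t \<and> BP Z t \<ge> Z / 2 * v t \<and> BH Z c t - Z^2 / 2 \<ge> - K / t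
   \<and> Z / 2 * v t - 2 * K / t \<ge> Z / 4 * v t \<and> Z - 3/4 * v t - c / (2 * sqrt t) \<ge> 0 \<and> E t \<le> exp (pA Z t) * v t" by (elim exE conjE)
 have R0: "R0 \<ge> 1" "\<And>t. t \<ge> R0 \<Longrightarrow> BT Z c t - Z^2 / 2 \<ge> - th / t"
   "\<And>t. t \<ge> R0 \<Longrightarrow> BP Z t \<ge> Z / 2 * v t" "\<And>t. t \<ge> R0 \<Longrightarrow> BH Z c t - Z^2 / 2 \<ge> - K / t"
   "\<And>t. t \<ge> R0 \<Longrightarrow> Z / 2 * v t - 2 * K / t \<ge> Z / 4 * v t" "\<And>t. t \<ge> R0 \<Longrightarrow> Z - 3/4 * v t - c / (2 * sqrt t) \<ge> 0"
   "\<And>t. t \<ge> R0 \<Longrightarrow> E t \<le> exp (pA Z t) * v t"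
  using R00 by simp_all
 \<comment> \<open>The exponents of \<open>b\<close> and \<open>a\<close> differ by the increment of
   \<open>pA Z - hA Z c\<close>, which is \<open>ph\<close> plus a logarithm; its monotonicity puts
   \<open>a\<close> below \<open>b\<close>.\<close>
 have ph: "ph s \<le> ph t" if "R0 \<le> s" "s \<le> t" for s t
 proof (rule DERIV_nonneg_imp_nondecreasing[OF that(2)])
  fix x assume x: "s \<le> x" "x \<le> t"
  have x1: "x > 0" using x that R0(1) by linarith
  have "(ph has_real_derivative Z - 3/4 * v x - c / (2 * sqrt x)) (at x)"
  proof -
   have "((\<lambda>z. z powr (3/4)) has_real_derivative (3/4) * x powr (3/4 - 1)) (at x)" by (rule has_real_derivative_powr[OF x1])
   moreover have "((\<lambda>z. c * sqrt z) has_real_derivative c / (2 * sqrt x)) (at x)"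
    using x1 by (auto intro!: derivative_eq_intros simp: field_simps)
   ultimately show ?thesis unfolding ph_def[abs_def] v_def
    using DERIV_diff[OF DERIV_diff[OF DERIV_cmult[OF DERIV_ident, of Z x]]] by fastforce
  qed
  then show "\<exists>y. (ph has_real_derivative y) (at x) \<and> 0 \<le> y" using R0(6)[of x] x that by auto
 qed
 define B where "B = 2 * Z + c + 2"
 define K0 where "K0 = 2 * B + B^2 + Z * B"
 have K0: "K0 \<ge> 0" unfolding K0_def B_def using Z c by simp
 have crude: "BT Z c t \<ge> - K0" "BP Z t \<ge> - K0" "BH Z c t \<ge> - K0" if "t \<ge> 1" for t
 proof -
  have B: "\<bar>Z\<bar> + \<bar>c\<bar> \<le> B" "2 * \<bar>Z\<bar> + 1 \<le> B" "\<bar>Z\<bar> + \<bar>c\<bar> + 1 \<le> B" unfolding B_def using Z c by simp_all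
  show "BT Z c t \<ge> - K0" unfolding BT_def K0_def
   by (rule Br_lower_crude[OF that order_trans[OF hT_deriv(3)[OF that] B(1)] order_trans[OF hT_deriv(4)[OF that] B(1)] Z(1)])
  show "BP Z t \<ge> - K0" unfolding BP_def K0_def
   by (rule Br_lower_crude[OF that order_trans[OF pA_deriv(3)[OF that] B(2)] order_trans[OF pA_deriv(4)[OF that] B(2)] Z(1)])
  show "BH Z c t \<ge> - K0" unfolding BH_def K0_def
   by (rule Br_lower_crude[OF that order_trans[OF hA_deriv(3)[OF that] B(3)] order_trans[OF hA_deriv(4)[OF that] B(3)] Z(1)])
 qed
 define K2 where "K2 = 2 * K0 + Z^2 / 2"
 have K2: "K2 \<ge> 0" unfolding K2_def using K0 by simp
 define K3 where "K3 = K2 * exp (2 * Z * R0)"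
 have K3: "K3 \<ge> 0" unfolding K3_def using K2 by simp
 \<comment> \<open>In units of \<open>E t / t\<close>: \<open>K3\<close> covers the harmonic mean,
   one unit the term \<open>E s\<close>, and one unit remains as lower bound.\<close>
 define A where "A = (K3 + 2) / ka"
 have A: "A > 0" "A * ka = K3 + 2" unfolding A_def using K3 ka by auto
 have ev7: "eventually (\<lambda>t. C \<le> E t / t) at_top" for C
 proof -
  have "filterlim (\<lambda>t. E t / t) at_top at_top" unfolding E_def hT_def using Z c by real_asymp
  then show ?thesis by (simp add: filterlim_at_top)
 qed
 have ev8: "eventually (\<lambda>t. C \<le> exp (pA Z t) * v t) at_top" for C
 proof -
  have "filterlim (\<lambda>t. exp (pA Z t) * v t) at_top at_top" unfolding pA_def v_def using Z by real_asymp
  then show ?thesis by (simp add: filterlim_at_top)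
 qed
 obtain S0 where S0: "S0 \<ge> 1" "\<And>s. s \<ge> S0 \<Longrightarrow> 64 * A / Z \<le> exp (pA Z s) * v s" using eventually_at_topD[OF ev8[of "64 * A / Z"]] by blast
 obtain R2 where R2: "R2 \<ge> 1" "\<And>t. t \<ge> R2 \<Longrightarrow> A * K2 * E R0 \<le> E t / t" using eventually_at_topD[OF ev7[of "A * K2 * E R0"]] by blast
 obtain R3 where R3: "R3 \<ge> 1" "\<And>t. t \<ge> R3 \<Longrightarrow> 64 * A / Z \<le> E t / t" using eventually_at_topD[OF ev7[of "64 * A / Z"]] by blast
 \<comment> \<open>For \<open>t \<ge> R\<close> the summand \<open>R0 / ka\<close> makes
   \<open>s \<le> R0\<close> imply \<open>s \<le> ka * t\<close>, and \<open>S0 / ka\<close> makes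
   \<open>s > ka * t\<close> imply \<open>s \<ge> S0\<close>.\<close>
 define R where "R = R0 + R0 / ka + S0 / ka + R2 + R3"
 have R0k: "R0 / ka > 0" "S0 / ka > 0" using R0(1) S0(1) ka by auto
 have R: "R \<ge> 1" "R \<ge> R0" "R0 \<le> ka * R" "S0 \<le> ka * R" "R \<ge> R2" "R \<ge> R3"
 proof -
  show "R \<ge> 1" "R \<ge> R0" "R \<ge> R2" "R \<ge> R3" unfolding R_def using R0(1) S0(1) R2(1) R3(1) R0k by linarith+
  have "R \<ge> R0 / ka" "R \<ge> S0 / ka" unfolding R_def using R0(1) S0(1) R2(1) R3(1) R0k by linarith+
  then show "R0 \<le> ka * R" "S0 \<le> ka * R" using ka by (auto simp: field_simps)
 qed
 define k where "k = min (Z / 32) (exp (- (2 * Z * R0)))"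
 have k: "k > 0" "k \<le> Z / 32" "k \<le> exp (- (2 * Z * R0))" unfolding k_def using Z by auto
 have Epos: "E t > 0" for t unfolding E_def by simp
 have Emono: "E s \<le> E t" if "0 \<le> s" "s \<le> t" for s t unfolding E_def hT_def using that Z c by (auto intro!: add_mono mult_left_mono)
 have ehA: "exp (p + hA Z c t) = exp p * E t / t" if "t \<ge> 1" for p t
  unfolding E_def hA_def hT_def using that by (simp add: exp_add exp_diff)
 show ?thesis
 proof (rule exI[of _ A], rule conjI[OF A(1)], rule exI[of _ R], rule conjI[OF R(1)], rule exI[of _ k], rule conjI[OF k(1)], intro allI impI)
  fix s t assume st: "1 \<le> s" "s \<le> t" "R \<le> t"
  have t1: "t \<ge> 1" "t > 0" "s > 0" using st by auto
  define a where "a = exp (pA Z s + hA Z c t)"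
  define b where "b = exp (pA Z t + hA Z c s)"
  define r where "r = 1 / (s + t) - Z^2 / 2"
  define X where "X = BP Z s + BH Z c t + r"
  define Y where "Y = BP Z t + BH Z c s + r"
  define M1 where "M1 = (b / (a + b))^2 * a"
  define M2 where "M2 = (a / (a + b))^2 * b"
  define H where "H = (b / (a + b))^2 * (a * X) + (a / (a + b))^2 * (b * Y)"
  have H: "H = M1 * X + M2 * Y" unfolding H_def M1_def M2_def by (simp add: mult.assoc)
  have ab: "a > 0" "b > 0" unfolding a_def b_def by auto
  have ae: "a = exp (pA Z s) * E t / t" unfolding a_def by (rule ehA[OF t1(1)])
  have M: "M1 \<ge> 0" "M2 \<ge> 0" "M1 + M2 = hm a b" unfolding M1_def M2_def using ab hm_bounds(4)[OF ab] by auto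
  have r: "r \<ge> - Z\<^sup>2 / 2" unfolding r_def using t1 by simp
  have BTt: "BT Z c t + r \<ge> - th / t + 1 / (s + t)" using R0(2)[of t] st R unfolding r_def by simp
  have T1small: "E t * (BT Z c t + r) \<ge> ka * (E t / t)" if "s \<le> ka * t"
  proof -
   have "(1 - ka) / t - th / t \<le> BT Z c t + r" using BTt inverse_sum_lower[OF t1(3) that t1(2) ka(1)] by simp
   then have "ka / t \<le> BT Z c t + r" unfolding diff_divide_distrib[symmetric] ka(3) .
   from mult_left_mono[OF this less_imp_le[OF Epos[of t]]] show ?thesis by (simp add: mult.commute)
  qed
  have "k * (exp (pA Z s) * E t / t^2) \<le> A * (E t * (BT Z c t + r) + E s * (BT Z c s + r)) + H"
  proof (cases "s \<le> R0")
   case True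
   have skt: "s \<le> ka * t" using True R(3) st ka mult_left_mono[OF st(3), of ka] by linarith
   have XY: "X \<ge> - K2" "Y \<ge> - K2" using crude[OF st(1)] crude[OF t1(1)] r unfolding X_def Y_def K2_def by linarith+
   have "H \<ge> M1 * (- K2) + M2 * (- K2)" unfolding H by (intro add_mono mult_left_mono XY M)
   then have "H \<ge> - (K2 * hm a b)" unfolding M(3)[symmetric] by (simp add: algebra_simps)
   moreover have "K2 * hm a b \<le> K2 * a" by (intro mult_left_mono hm_bounds ab K2)
   moreover have eps: "exp (pA Z s) \<le> exp (2 * Z * R0)"
   proof -
    have "2 * Z * s \<le> 2 * Z * R0" using True Z by (intro mult_left_mono) auto
    moreover have "0 \<le> s powr (3/4)" by simp
    ultimately show ?thesis unfolding pA_def exp_le_cancel_iff by linarith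
   qed
   have "a \<le> exp (2 * Z * R0) * (E t / t)" unfolding ae using mult_right_mono[OF eps, of "E t / t"] Epos[of t] t1 by simp
   from mult_left_mono[OF this K2] have "K2 * a \<le> K3 * (E t / t)" unfolding K3_def by (simp only: mult.assoc)
   ultimately have H1: "H \<ge> - (K3 * (E t / t))" by linarith
   have "BT Z c s + r \<ge> - K2" using crude(1)[OF st(1)] r K0 unfolding K2_def by linarith
   then have "E s * (BT Z c s + r) \<ge> E s * (- K2)" using Epos[of s] by (intro mult_left_mono) auto
   moreover have "E s * K2 \<le> E R0 * K2" using Emono[of s R0] True t1 K2 by (intro mult_right_mono) auto
   ultimately have "E s * (BT Z c s + r) \<ge> - (K2 * E R0)" by (simp add: mult.commute)
   from mult_left_mono[OF this less_imp_le[OF A(1)]]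
   have T2: "A * (E s * (BT Z c s + r)) \<ge> - (E t / t)" using R2(2)[of t] st R by (simp add: mult.assoc)
   have T1: "A * (E t * (BT Z c t + r)) \<ge> (K3 + 2) * (E t / t)"
    using mult_left_mono[OF T1small[OF skt] less_imp_le[OF A(1)]] unfolding A(2)[symmetric] by (simp add: mult.assoc)
   have "(K3 + 2) * (E t / t) = K3 * (E t / t) + 2 * (E t / t)" by (simp add: algebra_simps)
   then have "E t / t \<le> A * (E t * (BT Z c t + r) + E s * (BT Z c s + r)) + H"
    unfolding distrib_left[of A] using T1 T2 H1 by linarith
   moreover have "k * (exp (pA Z s) * E t / t^2) \<le> E t / t"
   proof -
    have "k * exp (pA Z s) \<le> exp (- (2 * Z * R0)) * exp (2 * Z * R0)" using k eps by (intro mult_mono) auto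
    then have "k * exp (pA Z s) \<le> 1" by (simp flip: exp_add)
    then have "k * exp (pA Z s) * (E t / t^2) \<le> 1 * (E t / t^2)" using Epos[of t] by (intro mult_right_mono) auto
    also have "\<dots> \<le> E t / t" using Epos[of t] t1 by (simp add: power2_eq_square divide_left_mono)
    finally show ?thesis by simp
   qed
   ultimately show ?thesis by linarith
  next
   case False
   then have s0: "s \<ge> R0" "t \<ge> R0" using st by auto
   have vp: "v x > 0" if "x > 0" for x unfolding v_def using that by simp
   have rp: "1 / (s + t) \<ge> 0" using t1 by simp
   have ba: "a \<le> b"
   proof -
    have "ln s \<le> ln t" using t1 st by simp
    then have "pA Z s + hA Z c t \<le> pA Z t + hA Z c s" using ph[OF s0(1) st(2)] unfolding ph_def pA_def hA_def by linarith
    then show ?thesis unfolding a_def b_def by simp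
   qed
   \<comment> \<open>The correct assignment dominates in the harmonic mean, so a loss in the wrong
     one can be charged to it.\<close>
   have M21: "M2 \<le> M1"
   proof -
    have "(a * b) * a \<le> (a * b) * b" using ba ab by (intro mult_left_mono) auto
    then have "(a * b) * a / (a + b)^2 \<le> (a * b) * b / (a + b)^2" using ab by (intro divide_right_mono) auto
    moreover have "M2 = (a * b) * a / (a + b)^2" "M1 = (a * b) * b / (a + b)^2"
     unfolding M1_def M2_def by (simp_all add: power_divide power2_eq_square)
    ultimately show ?thesis by simp
   qed
   have M1a: "M1 \<ge> a / 4"
   proof -
    have "1/2 \<le> b / (a + b)" using ba ab by (simp add: field_simps)
    then have "(1/2)^2 \<le> (b / (a + b))^2" by (intro power_mono) auto
    then have "1/4 * a \<le> (b / (a + b))^2 * a" using ab by (intro mult_right_mono) (auto simp: power2_eq_square)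
    then show ?thesis unfolding M1_def by simp
   qed
   have Kst: "K / t \<le> K / s" using st t1 K by (intro divide_left_mono) auto
   have X: "X \<ge> Z / 2 * v s - K / s"
    unfolding X_def r_def using R0(3)[OF s0(1)] R0(4)[OF s0(2)] rp Kst by linarith
   have "Z / 2 * v t \<ge> 0" using vp[of t] Z t1 by simp
   then have Y: "Y \<ge> - (K / s)"
    unfolding Y_def r_def using R0(3)[OF s0(2)] R0(4)[OF s0(1)] rp unfolding minus_divide_left[symmetric] by linarith
   have "M2 * Y \<ge> M2 * (- (K / s))" by (intro mult_left_mono Y M)
   moreover have "M2 * (K / s) \<le> M1 * (K / s)" using M21 K t1 by (intro mult_right_mono) auto
   ultimately have "M2 * Y \<ge> M1 * (- (K / s))" by simp
   moreover have "M1 * X \<ge> M1 * (Z / 2 * v s - K / s)" by (intro mult_left_mono X M)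
   ultimately have "H \<ge> M1 * (Z / 2 * v s - K / s) + M1 * (- (K / s))" unfolding H by linarith
   then have "H \<ge> M1 * (Z / 2 * v s - 2 * K / s)" by (simp add: algebra_simps)
   moreover have "M1 * (Z / 4 * v s) \<le> M1 * (Z / 2 * v s - 2 * K / s)" by (intro mult_left_mono R0(5)[OF s0(1)] M)
   moreover have "a / 4 * (Z / 4 * v s) \<le> M1 * (Z / 4 * v s)" using vp[of s] Z t1 by (intro mult_right_mono M1a) auto
   ultimately have H1: "H \<ge> Z / 16 * v s * a" by (simp add: algebra_simps)
   define e where "e = exp (pA Z s) * v s"
   define f where "f = E t / t"
   have f: "f > 0" unfolding f_def using Epos[of t] t1 by simp
   have e: "e > 0" unfolding e_def using vp[of s] t1 by simp
   have va: "v s * a = e * f" unfolding ae e_def f_def by simp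
   have ft: "f \<ge> 64 * A / Z" unfolding f_def using R3(2)[of t] R st by simp
   have T2: "A * (E s * (BT Z c s + r)) \<ge> - (Z / 64 * (e * f))"
   proof -
    have "BT Z c s + r \<ge> - th / s" using R0(2)[OF s0(1)] rp unfolding r_def by linarith
    moreover have "th / s \<le> 1" using th st by (simp add: field_simps)
    ultimately have "BT Z c s + r \<ge> - 1" by simp
    then have "E s * (BT Z c s + r) \<ge> E s * (- 1)" using Epos[of s] by (intro mult_left_mono) auto
    moreover have "E s \<le> e" unfolding e_def by (rule R0(7)[OF s0(1)])
    ultimately have "E s * (BT Z c s + r) \<ge> - e" by simp
    then have "A * (E s * (BT Z c s + r)) \<ge> A * (- e)" using A by (intro mult_left_mono) auto
    moreover have "A * e \<le> Z / 64 * (e * f)"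
    proof -
     have "A \<le> Z / 64 * f" using ft Z by (simp add: field_simps)
     then have "A * e \<le> Z / 64 * f * e" using e by (intro mult_right_mono) auto
     then show ?thesis by (simp add: ac_simps)
    qed
    ultimately show ?thesis by simp
   qed
   \<comment> \<open>Either the outer electron is far enough for the surplus, and the term is
     nonnegative, or \<open>s\<close> is itself large and the factor \<open>e\<close>, exponentially
     large in \<open>s\<close>, absorbs it.\<close>
   have T1: "A * (E t * (BT Z c t + r)) \<ge> - (Z / 64 * (e * f))"
   proof (cases "s \<le> ka * t")
    case True
    have "0 \<le> ka * (E t / t)" using ka Epos[of t] t1 by simp
    then have "0 \<le> A * (E t * (BT Z c t + r))" using T1small[OF True] A by simp
    moreover have "0 \<le> Z / 64 * (e * f)" using Z e f by simp
    ultimately show ?thesis by linarith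
   next
    case False
    have "BT Z c t + r \<ge> - th / t" using BTt rp by linarith
    moreover have "th / t \<le> 1 / t" using th t1 by (intro divide_right_mono) auto
    ultimately have "BT Z c t + r \<ge> - (1 / t)" by simp
    then have "E t * (BT Z c t + r) \<ge> E t * (- (1 / t))" using Epos[of t] by (intro mult_left_mono) auto
    then have "E t * (BT Z c t + r) \<ge> - f" unfolding f_def by simp
    then have "A * (E t * (BT Z c t + r)) \<ge> A * (- f)" using A by (intro mult_left_mono) auto
    moreover have "A * f \<le> Z / 64 * (e * f)"
    proof -
     have "s \<ge> S0" using False R(4) st(3) ka mult_left_mono[OF st(3), of ka] by linarith
     from S0(2)[OF this] have "A \<le> Z / 64 * e" unfolding e_def using Z by (simp add: field_simps)
     then have "A * f \<le> Z / 64 * e * f" using f by (intro mult_right_mono) auto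
     then show ?thesis by simp
    qed
    ultimately show ?thesis by simp
   qed
   have "Z / 32 * (e * f) \<le> A * (E t * (BT Z c t + r) + E s * (BT Z c s + r)) + H"
   proof -
    have "H \<ge> Z / 16 * (e * f)" using H1 va by (simp add: mult.assoc)
    then show ?thesis using T1 T2 by (simp add: distrib_left)
   qed
   moreover have "k * (exp (pA Z s) * E t / t^2) \<le> Z / 32 * (e * f)"
   proof -
    have "exp (pA Z s) * (1 / t) \<le> e" unfolding e_def v_def by (intro mult_left_mono powr_quarter_ge st) auto
    then have "exp (pA Z s) * (1 / t) * f \<le> e * f" using f by (intro mult_right_mono) auto
    moreover have "exp (pA Z s) * E t / t^2 = exp (pA Z s) * (1 / t) * f" unfolding f_def by (simp add: power2_eq_square)
    ultimately show ?thesis using k e f t1 by (intro mult_mono) auto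
   qed
   ultimately show ?thesis by linarith
  qed
  then show "let a = exp (pA Z s + hA Z c t); b = exp (pA Z t + hA Z c s); r = 1 / (s + t) - Z^2 / 2 in
   A * (E t * (BT Z c t + r) + E s * (BT Z c s + r))
   + ((b / (a + b))^2 * (a * (BP Z s + BH Z c t + r)) + (a / (a + b))^2 * (b * (BP Z t + BH Z c s + r)))
   \<ge> k * (exp (pA Z s) * E t / t^2)"
   unfolding Let_def H_def X_def Y_def a_def b_def r_def .
 qed
qed

text \<open>Nonnegativity is all that is asked of \<open>Theta\<close>, but its growth has to stay
  integrable against \<open>w\<close>; hence \<open>- c\<close> and the reduced slope
  \<open>Z - be\<close>. Where \<open>s\<close> is large, the product \<open>G s * G t\<close> takes
  over, since its two contributions exceed the threshold by an amount of order one. For bounded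
  \<open>s\<close> it is negligible against the surplus of \<open>E t\<close>, having the smaller
  slope in \<open>t\<close>.\<close>

lemma Theta_lower_bound:
 assumes Z: "0 < Z" "Z < 1" and c: "0 < c" "c \<le> Z" "c^2 \<le> 2 * (1 - Z)"
  and be: "be = Z * ((1 - Z) / 4) / 4"
 defines "E \<equiv> \<lambda>t. exp (hT Z (- c) t)" and "G \<equiv> \<lambda>t. exp ((Z - be) * t)"
 shows "\<exists>R\<ge>1. \<forall>s t. 1 \<le> s \<longrightarrow> s \<le> t \<longrightarrow> R \<le> t \<longrightarrow>
   (let r = 1 / (s + t) - Z^2 / 2 in
   0 \<le> E t * (BT Z (- c) t + r) + E s * (BT Z (- c) s + r) + G s * G t * (Br Z (Z - be) 0 s + Br Z (Z - be) 0 t + r))"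
proof -
 define th where "th = (1 + Z) / 2"
 define ka where "ka = (1 - Z) / 4"
 have th: "0 < th" "th < 1" and ka: "0 < ka" "ka < 1" unfolding th_def ka_def using Z by auto
 have ka3: "1 - ka - th = ka" unfolding th_def ka_def add_divide_distrib diff_divide_distrib by simp
 have bee: "be = Z * ka / 4" unfolding be ka_def ..
 have "Z * ka \<le> Z * 1" using Z ka by (intro mult_left_mono) auto
 then have beb: "0 < be" "be \<le> Z / 4" unfolding bee using Z ka by auto
 have "eventually (\<lambda>t. BT Z (- c) t - Z^2 / 2 \<ge> - th / t \<and> Br Z (Z - be) 0 t \<ge> 3/8 * Z^2) at_top"
  using BT_eventually[OF Z, of "- c"] c Br_linear_eventually[OF Z(1), of be] beb
  unfolding th_def by (simp add: eventually_conj_iff)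
 from eventually_at_topD[OF this]
 obtain R0 where R00: "R0 \<ge> 1" "\<forall>t\<ge>R0. BT Z (- c) t - Z^2 / 2 \<ge> - th / t \<and> Br Z (Z - be) 0 t \<ge> 3/8 * Z^2"
  by (elim exE conjE)
 have R0: "R0 \<ge> 1" "\<And>t. t \<ge> R0 \<Longrightarrow> BT Z (- c) t - Z^2 / 2 \<ge> - th / t" "\<And>t. t \<ge> R0 \<Longrightarrow> Br Z (Z - be) 0 t \<ge> 3/8 * Z^2"
  using R00 by simp_all
 define B where "B = \<bar>Z\<bar> + \<bar>- c\<bar>"
 define K0 where "K0 = 2 * B + B^2 + Z * B"
 have K0: "K0 \<ge> 0" unfolding K0_def B_def using Z c by simp
 have crude1: "BT Z (- c) t \<ge> - K0" if "t \<ge> 1" for t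
  unfolding BT_def K0_def B_def by (rule Br_lower_crude[OF that hT_deriv(3)[OF that] hT_deriv(4)[OF that] Z(1)])
 have crude2: "Br Z (Z - be) 0 t \<ge> - K0" if "t \<ge> 1" for t
  unfolding K0_def by (rule Br_lower_crude[OF that _ _ Z(1)]) (use Z c beb in \<open>auto simp: B_def\<close>)
 define K2 where "K2 = 2 * K0 + Z^2 / 2"
 have K2: "K2 \<ge> 0" unfolding K2_def using K0 by simp
 have ev1: "eventually (\<lambda>t. C \<le> ka / 2 * (E t / t)) at_top" for C
 proof -
  have "filterlim (\<lambda>t. ka / 2 * (E t / t)) at_top at_top" unfolding E_def hT_def using Z c ka by real_asymp
  then show ?thesis by (simp add: filterlim_at_top)
 qed
 have ev2: "eventually (\<lambda>t. K2 * G R0 * G t \<le> ka / 2 * (E t / t)) at_top"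
 proof -
  have "((\<lambda>t. t * exp (c * sqrt t - be * t)) \<longlongrightarrow> 0) at_top" using c beb by real_asymp
  moreover have "ka / 2 / (K2 * G R0 + 1) > 0" using ka K2 unfolding G_def by (simp add: add_nonneg_pos)
  ultimately have "eventually (\<lambda>t. t * exp (c * sqrt t - be * t) < ka / 2 / (K2 * G R0 + 1)) at_top" by (intro order_tendstoD) auto
  then show ?thesis using eventually_ge_at_top[of 1]
  proof eventually_elim
   case (elim t)
   have p: "K2 * G R0 \<ge> 0" using K2 unfolding G_def by simp
   have "K2 * G R0 * (t * exp (c * sqrt t - be * t)) \<le> (K2 * G R0 + 1) * (t * exp (c * sqrt t - be * t))"
    using elim by (intro mult_right_mono) auto
   also have "\<dots> \<le> ka / 2" using elim(1) p by (simp add: field_simps)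
   finally have "K2 * G R0 * (t * exp (c * sqrt t - be * t)) * (E t / t) \<le> ka / 2 * (E t / t)"
    using elim unfolding E_def by (intro mult_right_mono) auto
   moreover have "t * exp (c * sqrt t - be * t) * (E t / t) = G t"
    unfolding E_def G_def hT_def using elim by (simp add: algebra_simps flip: exp_add)
   ultimately show ?case by (simp only: mult.assoc)
  qed
 qed
 \<comment> \<open>Rate by which the product term outgrows \<open>exp (Z * t)\<close> when
   \<open>s > ka * t\<close>: the choice \<open>be = Z * ka / 4\<close> leaves
   \<open>(Z - be) * (1 + ka) \<ge> Z + \<delta>\<close>.\<close>
 define \<delta> where "\<delta> = Z * ka / 2"
 have \<delta>: "\<delta> > 0" unfolding \<delta>_def using Z ka by simp
 have ev3: "eventually (\<lambda>t. 8 / Z^2 \<le> exp ((Z - 2 * be) * t)) at_top"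
 proof -
  have "Z - 2 * be > 0" using beb Z by linarith
  then have "filterlim (\<lambda>t. exp ((Z - 2 * be) * t)) at_top at_top" by real_asymp
  then show ?thesis by (simp add: filterlim_at_top)
 qed
 have ev4: "eventually (\<lambda>t. 8 / Z^2 \<le> exp (\<delta> * t)) at_top"
 proof -
  have "filterlim (\<lambda>t. exp (\<delta> * t)) at_top at_top" using \<delta> by real_asymp
  then show ?thesis by (simp add: filterlim_at_top)
 qed
 have "eventually (\<lambda>t. K2 * exp (Z * R0) \<le> ka / 2 * (E t / t) \<and> K2 * G R0 * G t \<le> ka / 2 * (E t / t)
   \<and> 8 / Z^2 \<le> exp ((Z - 2 * be) * t) \<and> 8 / Z^2 \<le> exp (\<delta> * t)) at_top"
  using ev1[of "K2 * exp (Z * R0)"] ev2 ev3 ev4 by (simp add: eventually_conj_iff)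
 from eventually_at_topD[OF this]
 obtain R1 where R1: "R1 \<ge> 1" "\<forall>t\<ge>R1. K2 * exp (Z * R0) \<le> ka / 2 * (E t / t) \<and> K2 * G R0 * G t \<le> ka / 2 * (E t / t)
   \<and> 8 / Z^2 \<le> exp ((Z - 2 * be) * t) \<and> 8 / Z^2 \<le> exp (\<delta> * t)" by (elim exE conjE)
 define R where "R = R1 + R0 + R0 / ka"
 have R0k: "R0 / ka > 0" using R0(1) ka by simp
 have R: "R \<ge> 1" "R \<ge> R1" "R \<ge> R0" "R0 \<le> ka * R"
 proof -
  show "R \<ge> 1" "R \<ge> R1" "R \<ge> R0" unfolding R_def using R0(1) R1(1) R0k by linarith+
  have "R \<ge> R0 / ka" unfolding R_def using R0(1) R1(1) by linarith
  then show "R0 \<le> ka * R" using ka by (simp add: field_simps)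
 qed
 have Gpos: "G t > 0" and Epos: "E t > 0" for t unfolding G_def E_def by simp_all
 have EZ: "E t \<le> exp (Z * t)" if "t \<ge> 0" for t unfolding E_def hT_def using that c by simp
 have Gmono: "G s \<le> G t" if "s \<le> t" for s t unfolding G_def using that beb Z by (simp add: mult_left_mono)
 show ?thesis
 proof (intro exI[of _ R] conjI allI impI)
  fix s t assume st: "1 \<le> s" "s \<le> t" "R \<le> t"
  have t1: "t \<ge> 1" "t > 0" "s > 0" using st by auto
  define r where "r = 1 / (s + t) - Z^2 / 2"
  define Q where "Q = Br Z (Z - be) 0 s + Br Z (Z - be) 0 t + r"
  have rp: "1 / (s + t) \<ge> 0" using t1 by simp
  have r: "r \<ge> - Z\<^sup>2 / 2" unfolding r_def using rp by simp
  have t0: "t \<ge> R0" "t \<ge> R1" using st R by linarith+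
  have R1t: "K2 * exp (Z * R0) \<le> ka / 2 * (E t / t)" "K2 * G R0 * G t \<le> ka / 2 * (E t / t)"
    "8 / Z^2 \<le> exp ((Z - 2 * be) * t)" "8 / Z^2 \<le> exp (\<delta> * t)" using R1(2) t0(2) by simp_all
  have BTt: "BT Z (- c) t + r \<ge> - th / t + 1 / (s + t)" using R0(2)[OF t0(1)] unfolding r_def by linarith
  have T1small: "E t * (BT Z (- c) t + r) \<ge> ka * (E t / t)" if "s \<le> ka * t"
  proof -
   have "(1 - ka) / t - th / t \<le> BT Z (- c) t + r" using BTt inverse_sum_lower[OF t1(3) that t1(2) ka(1)] by simp
   then have "ka / t \<le> BT Z (- c) t + r" unfolding diff_divide_distrib[symmetric] ka3 .
   from mult_left_mono[OF this less_imp_le[OF Epos[of t]]] show ?thesis by (simp add: mult.commute)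
  qed
  have "0 \<le> E t * (BT Z (- c) t + r) + E s * (BT Z (- c) s + r) + G s * G t * Q"
  proof (cases "s \<le> R0")
   case True
   have skt: "s \<le> ka * t" using True R(4) st(3) ka mult_left_mono[OF st(3), of ka] by linarith
   have "BT Z (- c) s + r \<ge> - K2" using crude1[OF st(1)] r K0 unfolding K2_def by linarith
   then have "E s * (BT Z (- c) s + r) \<ge> E s * (- K2)" using Epos[of s] by (intro mult_left_mono) auto
   moreover have "E s \<le> exp (Z * R0)"
   proof -
    have "exp (Z * s) \<le> exp (Z * R0)" using True Z by (simp add: mult_left_mono)
    then show ?thesis using EZ[of s] t1 by linarith
   qed
   then have "E s * K2 \<le> exp (Z * R0) * K2" using K2 by (intro mult_right_mono)
   ultimately have T2: "E s * (BT Z (- c) s + r) \<ge> - (ka / 2 * (E t / t))" using R1t(1) by (simp add: mult.commute)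
   have "Q \<ge> - K2" unfolding Q_def K2_def using crude2[OF st(1)] crude2[OF t1(1)] r by linarith
   then have "G s * G t * Q \<ge> G s * G t * (- K2)" using Gpos[of s] Gpos[of t] by (intro mult_left_mono) auto
   moreover have "K2 * G s * G t \<le> K2 * G R0 * G t" using Gmono[OF True] K2 Gpos[of t] by (intro mult_right_mono mult_left_mono) auto
   ultimately have T3: "G s * G t * Q \<ge> - (ka / 2 * (E t / t))" using R1t(2) by (simp add: ac_simps)
   show ?thesis using T1small[OF skt] T2 T3 by linarith
  next
   case False
   then have s0: "s \<ge> R0" by simp
   define g where "g = G s * G t"
   have g: "g > 0" unfolding g_def using Gpos by simp
   have ge: "g = exp ((Z - be) * (s + t))" unfolding g_def G_def by (simp add: algebra_simps flip: exp_add)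
   have "Q \<ge> Z^2 / 4" unfolding Q_def r_def using R0(3)[OF s0] R0(3)[OF t0(1)] rp by linarith
   then have T3: "g * Q \<ge> g * (Z^2 / 4)" using g by (intro mult_left_mono) auto
   have E1: "E x * (BT Z (- c) x + r) \<ge> - exp (Z * x)" if "x \<ge> R0" "x \<ge> 1" for x
   proof -
    have "BT Z (- c) x + r \<ge> - th / x" using R0(2)[OF that(1)] rp unfolding r_def by linarith
    moreover have "th / x \<le> 1" using th that by (simp add: field_simps)
    ultimately have "BT Z (- c) x + r \<ge> - 1" by simp
    then have "E x * (BT Z (- c) x + r) \<ge> E x * (- 1)" using Epos[of x] by (intro mult_left_mono) auto
    then show ?thesis using EZ[of x] that by simp
   qed
   have scale: "exp y \<le> g * (Z^2 / 8)" if "8 / Z^2 \<le> exp z" "y + z \<le> (Z - be) * (s + t)" for y z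
   proof -
    have "exp y * (8 / Z^2) \<le> exp y * exp z" using that by (intro mult_left_mono) auto
    also have "\<dots> \<le> g" unfolding ge using that by (simp flip: exp_add)
    finally show ?thesis using Z by (simp add: field_simps)
   qed
   have ss: "exp (Z * s) \<le> g * (Z^2 / 8)"
   proof (rule scale[OF R1t(3)])
    have "be * s \<le> be * t" using st beb by (intro mult_left_mono) auto
    then show "Z * s + (Z - 2 * be) * t \<le> (Z - be) * (s + t)" by (simp add: algebra_simps)
   qed
   have T2: "E s * (BT Z (- c) s + r) \<ge> - (g * (Z^2 / 8))" using E1[OF s0 st(1)] ss by linarith
   have T1: "E t * (BT Z (- c) t + r) \<ge> - (g * (Z^2 / 8))"
   proof (cases "s \<le> ka * t")
    case True
    have "0 \<le> ka * (E t / t)" using ka Epos[of t] t1 by simp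
    moreover have "0 \<le> g * (Z^2 / 8)" using g by simp
    ultimately show ?thesis using T1small[OF True] by linarith
   next
    case False
    have "exp (Z * t) \<le> g * (Z^2 / 8)"
    proof (rule scale[OF R1t(4)])
     have "Z + \<delta> \<le> (Z - be) * (1 + ka)"
     proof -
      have "Z * ka * ka \<le> Z * ka * 1" using Z ka by (intro mult_left_mono) auto
      then show ?thesis unfolding \<delta>_def bee by (simp add: field_simps)
     qed
     then have "(Z + \<delta>) * t \<le> (Z - be) * (1 + ka) * t" using t1 by (intro mult_right_mono) auto
     also have "\<dots> = (Z - be) * (ka * t + t)" by (simp add: algebra_simps)
     also have "\<dots> \<le> (Z - be) * (s + t)" using False beb Z by (intro mult_left_mono) auto
     finally show "Z * t + \<delta> * t \<le> (Z - be) * (s + t)" by (simp add: algebra_simps)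
    qed
    then show ?thesis using E1[OF t0(1) t1(1)] by linarith
   qed
   have "g * (Z^2 / 4) = g * (Z^2 / 8) + g * (Z^2 / 8)" by simp
   then show ?thesis using T1 T2 T3 unfolding g_def[symmetric] by linarith
  qed
  then show "let r = 1 / (s + t) - Z^2 / 2 in
   0 \<le> E t * (BT Z (- c) t + r) + E s * (BT Z (- c) s + r) + G s * G t * (Br Z (Z - be) 0 s + Br Z (Z - be) 0 t + r)"
   unfolding Let_def Q_def r_def .
 qed (use R in auto)
qed

section \<open>Decay of subsolutions\<close>

definition tmin :: "conf2 \<Rightarrow> real" where "tmin x = min (tt (fst x)) (tt (snd x))"
definition tmax :: "conf2 \<Rightarrow> real" where "tmax x = max (tt (fst x)) (tt (snd x))"

lemma tmin_tmax: "1 \<le> tmin x" "tmin x \<le> tmax x" "1 \<le> tmax x" "tmin x + tmax x = tt (fst x) + tt (snd x)"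
 unfolding tmin_def tmax_def using tt_ge_1[of "fst x"] tt_ge_1[of "snd x"] by auto

lemma tmin_tmax_measurable [measurable]: "tmin \<in> borel_measurable borel" "tmax \<in> borel_measurable borel"
 unfolding tmin_def[abs_def] tmax_def[abs_def]
 by (intro borel_measurable_continuous_onI continuous_intros)+

lemma zero_exponent:
 "\<And>t. t \<ge> 1 \<Longrightarrow> ((\<lambda>_. 0) has_real_derivative 0) (at (t::real))" "continuous_on {1..} (\<lambda>_::real. 0::real)"
 by auto

lemma continuous_exponents:
 "continuous_on {1..} (\<lambda>t::real. - d / (4 * sqrt t ^ 3))"
 "continuous_on {1..} (\<lambda>t::real. - c / (4 * sqrt t ^ 3) + 1 / t^2)"
 "continuous_on {1..} (\<lambda>t::real. 3/16 * t powr (-5/4))"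
 by (auto intro!: continuous_intros)

text \<open>The sum of \<open>E\<close> over both variables plus the harmonic mean is symmetric
  under exchange of the electrons, so the bound for \<open>s \<le> t\<close> also covers the
  opposite order.\<close>

lemma Psi_exists:
 assumes Z: "0 < Z" "Z < 1" and c: "0 < c" "c \<le> Z" "c^2 \<le> 2 * (1 - Z)"
 shows "\<exists>C f g l R k. adm C f g l \<and> R \<ge> 1 \<and> k > 0 \<and>
   (\<forall>x. tmax x \<ge> R \<longrightarrow> Lop Z f g l x \<ge> k * (exp (pA Z (tmin x)) * exp (hT Z c (tmax x)) / (tmax x)^2))"
proof -
 define B where "B = 2 * Z + c + 2"
 define C where "C = 10 * B + 2 * B^2"
 have Bb: "\<bar>Z\<bar> + \<bar>c\<bar> \<le> B" "2 * \<bar>Z\<bar> + 1 \<le> B" "\<bar>Z\<bar> + \<bar>c\<bar> + 1 \<le> B" "\<bar>0\<bar> \<le> B" unfolding B_def using Z c by simp_all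
 note T = hT_deriv(1,2)[where Z=Z and d=c] continuous_exponents(1)[of c]
  order_trans[OF hT_deriv(3)[where Z=Z and d=c] Bb(1)] order_trans[OF hT_deriv(4)[where Z=Z and d=c] Bb(1)]
 note H = hA_deriv(1,2)[where Z=Z and c=c] continuous_exponents(2)[of c]
  order_trans[OF hA_deriv(3)[where Z=Z and c=c] Bb(3)] order_trans[OF hA_deriv(4)[where Z=Z and c=c] Bb(3)]
 note P = pA_deriv(1,2)[where Z=Z] continuous_exponents(3)
  order_trans[OF pA_deriv(3)[where Z=Z] Bb(2)] order_trans[OF pA_deriv(4)[where Z=Z] Bb(2)]
 note O = zero_exponent(1,1,2) Bb(4) Bb(4)
 obtain g1 l1 where 1: "adm C (Ex (\<lambda>_. 0) (hT Z c)) g1 l1"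
  "\<And>Z' x. Lop Z' (Ex (\<lambda>_. 0) (hT Z c)) g1 l1 x = Ex (\<lambda>_. 0) (hT Z c) x * (Br Z' 0 0 (tt (fst x))
    + Br Z' (Z + c / (2 * sqrt (tt (snd x)))) (- c / (4 * sqrt (tt (snd x)) ^ 3)) (tt (snd x)) + 1 / (tt (fst x) + tt (snd x)) - Z'^2 / 2)"
  by (rule adm_Ex[OF O T, folded C_def]) (assumption | rule that)+
 obtain g2 l2 where 2: "adm C (Ex (hT Z c) (\<lambda>_. 0)) g2 l2"
  "\<And>Z' x. Lop Z' (Ex (hT Z c) (\<lambda>_. 0)) g2 l2 x = Ex (hT Z c) (\<lambda>_. 0) x * (
    Br Z' (Z + c / (2 * sqrt (tt (fst x)))) (- c / (4 * sqrt (tt (fst x)) ^ 3)) (tt (fst x)) + Br Z' 0 0 (tt (snd x)) + 1 / (tt (fst x) + tt (snd x)) - Z'^2 / 2)"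
  by (rule adm_Ex[OF T O, folded C_def]) (assumption | rule that)+
 obtain g3 l3 where 3: "adm C (Ex (pA Z) (hA Z c)) g3 l3"
  "\<And>Z' x. Lop Z' (Ex (pA Z) (hA Z c)) g3 l3 x = Ex (pA Z) (hA Z c) x * (
    Br Z' (2 * Z - 3/4 * tt (fst x) powr (-1/4)) (3/16 * tt (fst x) powr (-5/4)) (tt (fst x))
    + Br Z' (Z + c / (2 * sqrt (tt (snd x))) - 1 / tt (snd x)) (- c / (4 * sqrt (tt (snd x)) ^ 3) + 1 / (tt (snd x))^2) (tt (snd x)) + 1 / (tt (fst x) + tt (snd x)) - Z'^2 / 2)"
  by (rule adm_Ex[OF P H, folded C_def]) (assumption | rule that)+
 obtain g4 l4 where 4: "adm C (Ex (hA Z c) (pA Z)) g4 l4"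
  "\<And>Z' x. Lop Z' (Ex (hA Z c) (pA Z)) g4 l4 x = Ex (hA Z c) (pA Z) x * (
    Br Z' (Z + c / (2 * sqrt (tt (fst x))) - 1 / tt (fst x)) (- c / (4 * sqrt (tt (fst x)) ^ 3) + 1 / (tt (fst x))^2) (tt (fst x))
    + Br Z' (2 * Z - 3/4 * tt (snd x) powr (-1/4)) (3/16 * tt (snd x) powr (-5/4)) (tt (snd x)) + 1 / (tt (fst x) + tt (snd x)) - Z'^2 / 2)"
  by (rule adm_Ex[OF H P, folded C_def]) (assumption | rule that)+
 define a where "a = Ex (pA Z) (hA Z c)"
 define b where "b = Ex (hA Z c) (pA Z)"
 obtain gm lm where M: "adm (C + 8 * C^2) (\<lambda>x. hm (a x) (b x)) gm lm"
  "\<And>Z x. Lop Z (\<lambda>x. hm (a x) (b x)) gm lm x \<ge> (b x / (a x + b x))^2 * Lop Z a g3 l3 x + (a x / (a x + b x))^2 * Lop Z b g4 l4 x"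
  using adm_hm[OF 3(1) 4(1)] unfolding a_def b_def by blast
 obtain A R k where AR: "A > 0" "R \<ge> 1" "k > 0" and low: "\<forall>s t. 1 \<le> s \<longrightarrow> s \<le> t \<longrightarrow> R \<le> t \<longrightarrow>
   (let a = exp (pA Z s + hA Z c t); b = exp (pA Z t + hA Z c s); r = 1 / (s + t) - Z^2 / 2 in
   A * (exp (hT Z c t) * (BT Z c t + r) + exp (hT Z c s) * (BT Z c s + r))
   + ((b / (a + b))^2 * (a * (BP Z s + BH Z c t + r)) + (a / (a + b))^2 * (b * (BP Z t + BH Z c s + r)))
   \<ge> k * (exp (pA Z s) * exp (hT Z c t) / t^2))"
  using Psi_lower_bound[OF Z c] by blast
 note N = adm_add[OF adm_cmult[OF adm_add[OF 1(1) 2(1)] AR(1)] M(1)]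
 show ?thesis
 proof (intro exI conjI allI impI)
  show "adm (C + C + (C + 8 * C^2))
   (\<lambda>x. A * (Ex (\<lambda>_. 0) (hT Z c) x + Ex (hT Z c) (\<lambda>_. 0) x) + hm (a x) (b x))
   (\<lambda>x. A *\<^sub>R (g1 x + g2 x) + gm x) (\<lambda>x. A * (l1 x + l2 x) + lm x)" by (rule N)
  show "R \<ge> 1" "k > 0" by (rule AR)+
  fix x :: conf2 assume R: "tmax x \<ge> R"
  define s where "s = tt (fst x)"
  define t where "t = tt (snd x)"
  have st: "1 \<le> s" "1 \<le> t" unfolding s_def t_def by (rule tt_ge_1)+
  define r where "r = 1 / (s + t) - Z^2 / 2"
  define E where "E t = exp (hT Z c t)" for t
  define L where "L = A * (E t * (BT Z c t + r) + E s * (BT Z c s + r))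
   + ((b x / (a x + b x))^2 * (a x * (BP Z s + BH Z c t + r)) + (a x / (a x + b x))^2 * (b x * (BH Z c s + BP Z t + r)))"
  have "Lop Z (\<lambda>x. A * (Ex (\<lambda>_. 0) (hT Z c) x + Ex (hT Z c) (\<lambda>_. 0) x) + hm (a x) (b x))
   (\<lambda>x. A *\<^sub>R (g1 x + g2 x) + gm x) (\<lambda>x. A * (l1 x + l2 x) + lm x) x
   = A * (Lop Z (Ex (\<lambda>_. 0) (hT Z c)) g1 l1 x + Lop Z (Ex (hT Z c) (\<lambda>_. 0)) g2 l2 x) + Lop Z (\<lambda>x. hm (a x) (b x)) gm lm x"
   unfolding Lop_add Lop_cmult ..
  also have "\<dots> \<ge> L"
  proof -
   have e1: "Lop Z (Ex (\<lambda>_. 0) (hT Z c)) g1 l1 x = E t * (BT Z c t + r)"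
    unfolding 1(2) BT_def E_def Ex_def r_def s_def t_def by (simp add: add_diff_eq)
   have e2: "Lop Z (Ex (hT Z c) (\<lambda>_. 0)) g2 l2 x = E s * (BT Z c s + r)"
    unfolding 2(2) BT_def E_def Ex_def r_def s_def t_def by (simp add: add_diff_eq)
   have e3: "Lop Z a g3 l3 x = a x * (BP Z s + BH Z c t + r)"
    unfolding a_def 3(2) BP_def BH_def r_def s_def t_def by (simp only: add_diff_eq)
   have e4: "Lop Z b g4 l4 x = b x * (BH Z c s + BP Z t + r)"
    unfolding b_def 4(2) BP_def BH_def r_def s_def t_def by (simp only: add_diff_eq)
   show ?thesis unfolding L_def e1 e2 using M(2)[where Z=Z and x=x] unfolding e3 e4 by linarith
  qed
  also have "L \<ge> k * (exp (pA Z (tmin x)) * exp (hT Z c (tmax x)) / (tmax x)^2)"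
  proof (cases "s \<le> t")
   case True
   then have tm: "tmin x = s" "tmax x = t" unfolding tmin_def tmax_def s_def t_def by auto
   have ab: "a x = exp (pA Z s + hA Z c t)" "b x = exp (pA Z t + hA Z c s)"
    unfolding a_def b_def Ex_def s_def t_def by (simp_all add: add.commute)
   have "k * (exp (pA Z s) * exp (hT Z c t) / t^2) \<le> L"
    using low[rule_format, OF st(1) True] R unfolding tm Let_def L_def ab r_def E_def by (simp add: add.commute[of "BH Z c s"])
   then show ?thesis unfolding tm by simp
  next
   case False
   then have ts: "t \<le> s" by simp
   then have tm: "tmin x = t" "tmax x = s" unfolding tmin_def tmax_def s_def t_def by auto
   have ab: "b x = exp (pA Z t + hA Z c s)" "a x = exp (pA Z s + hA Z c t)"
    unfolding a_def b_def Ex_def s_def t_def by (simp_all add: add.commute)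
   have "k * (exp (pA Z t) * exp (hT Z c s) / s^2) \<le> A * (E s * (BT Z c s + r) + E t * (BT Z c t + r))
    + ((a x / (b x + a x))^2 * (b x * (BP Z t + BH Z c s + r)) + (b x / (b x + a x))^2 * (a x * (BP Z s + BH Z c t + r)))"
    using low[rule_format, OF st(2) ts] R unfolding tm Let_def ab r_def E_def by (simp add: add.commute[of t s])
   also have "\<dots> = L" unfolding L_def
    by (simp only: add.commute[of "b x" "a x"] add.commute[of "BH Z c s"] add.commute[of "E s * (BT Z c s + r)"]
      add.commute[of "(a x / (a x + b x))^2 * (b x * (BP Z t + BH Z c s + r))"])
   finally show ?thesis unfolding tm by simp
  qed
  finally show "Lop Z (\<lambda>x. A * (Ex (\<lambda>_. 0) (hT Z c) x + Ex (hT Z c) (\<lambda>_. 0) x) + hm (a x) (b x))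
   (\<lambda>x. A *\<^sub>R (g1 x + g2 x) + gm x) (\<lambda>x. A * (l1 x + l2 x) + lm x) x \<ge> k * (exp (pA Z (tmin x)) * exp (hT Z c (tmax x)) / (tmax x)^2)"
   by simp
 qed
qed

text \<open>The function stays explicit in the statement because its integrability against
  \<open>w\<close> is shown separately.\<close>

lemma Theta_exists:
 assumes Z: "0 < Z" "Z < 1" and c: "0 < c" "c \<le> Z" "c^2 \<le> 2 * (1 - Z)"
  and be: "be = Z * ((1 - Z) / 4) / 4"
 shows "\<exists>C g l R. adm C (\<lambda>x. Ex (\<lambda>_. 0) (hT Z (- c)) x + Ex (hT Z (- c)) (\<lambda>_. 0) x + Ex (\<lambda>t. (Z - be) * t) (\<lambda>t. (Z - be) * t) x) g l \<and> R \<ge> 1 \<and>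
   (\<forall>x. tmax x \<ge> R \<longrightarrow> Lop Z (\<lambda>x. Ex (\<lambda>_. 0) (hT Z (- c)) x + Ex (hT Z (- c)) (\<lambda>_. 0) x + Ex (\<lambda>t. (Z - be) * t) (\<lambda>t. (Z - be) * t) x) g l x \<ge> 0)"
proof -
 define B where "B = Z + c"
 define C where "C = 10 * B + 2 * B^2"
 have "Z * ((1 - Z) / 4) \<le> Z * 1" using Z by (intro mult_left_mono) auto
 then have beb: "0 < be" "be \<le> Z / 4" unfolding be using Z by auto
 have Bb: "\<bar>Z\<bar> + \<bar>- c\<bar> \<le> B" "\<bar>Z - be\<bar> \<le> B" "\<bar>0\<bar> \<le> B" unfolding B_def using Z c beb by simp_all
 note T = hT_deriv(1,2)[where Z=Z and d="- c"] continuous_exponents(1)[of "- c"]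
  order_trans[OF hT_deriv(3)[where Z=Z and d="- c"] Bb(1)] order_trans[OF hT_deriv(4)[where Z=Z and d="- c"] Bb(1)]
 note O = zero_exponent(1,1,2) Bb(3) Bb(3)
 have l1: "((\<lambda>t. (Z - be) * t) has_real_derivative (Z - be)) (at t)" for t
  by (auto intro!: derivative_eq_intros)
 have l2: "((\<lambda>t. (Z - be)) has_real_derivative 0) (at t)" for t :: real by simp
 note L = l1 l2 zero_exponent(2) Bb(2) Bb(3)
 obtain g1 l1 where 1: "adm C (Ex (\<lambda>_. 0) (hT Z (- c))) g1 l1"
  "\<And>Z' x. Lop Z' (Ex (\<lambda>_. 0) (hT Z (- c))) g1 l1 x = Ex (\<lambda>_. 0) (hT Z (- c)) x * (Br Z' 0 0 (tt (fst x))
    + Br Z' (Z + - c / (2 * sqrt (tt (snd x)))) (- (- c) / (4 * sqrt (tt (snd x)) ^ 3)) (tt (snd x)) + 1 / (tt (fst x) + tt (snd x)) - Z'^2 / 2)"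
  by (rule adm_Ex[OF O T, folded C_def]) (assumption | rule that)+
 obtain g2 l2 where 2: "adm C (Ex (hT Z (- c)) (\<lambda>_. 0)) g2 l2"
  "\<And>Z' x. Lop Z' (Ex (hT Z (- c)) (\<lambda>_. 0)) g2 l2 x = Ex (hT Z (- c)) (\<lambda>_. 0) x * (
    Br Z' (Z + - c / (2 * sqrt (tt (fst x)))) (- (- c) / (4 * sqrt (tt (fst x)) ^ 3)) (tt (fst x)) + Br Z' 0 0 (tt (snd x)) + 1 / (tt (fst x) + tt (snd x)) - Z'^2 / 2)"
  by (rule adm_Ex[OF T O, folded C_def]) (assumption | rule that)+
 obtain g3 l3 where 3: "adm C (Ex (\<lambda>t. (Z - be) * t) (\<lambda>t. (Z - be) * t)) g3 l3"
  "\<And>Z' x. Lop Z' (Ex (\<lambda>t. (Z - be) * t) (\<lambda>t. (Z - be) * t)) g3 l3 x = Ex (\<lambda>t. (Z - be) * t) (\<lambda>t. (Z - be) * t) x * (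
    Br Z' (Z - be) 0 (tt (fst x)) + Br Z' (Z - be) 0 (tt (snd x)) + 1 / (tt (fst x) + tt (snd x)) - Z'^2 / 2)"
  by (rule adm_Ex[OF L L, folded C_def]) (assumption | rule that)+
 obtain R where R: "R \<ge> 1" and low: "\<forall>s t. 1 \<le> s \<longrightarrow> s \<le> t \<longrightarrow> R \<le> t \<longrightarrow>
   (let r = 1 / (s + t) - Z^2 / 2 in
   0 \<le> exp (hT Z (- c) t) * (BT Z (- c) t + r) + exp (hT Z (- c) s) * (BT Z (- c) s + r)
    + exp ((Z - be) * s) * exp ((Z - be) * t) * (Br Z (Z - be) 0 s + Br Z (Z - be) 0 t + r))"
  using Theta_lower_bound[OF Z c be] by blast
 show ?thesis
 proof (intro exI conjI allI impI)
  show "adm (C + C + C) (\<lambda>x. Ex (\<lambda>_. 0) (hT Z (- c)) x + Ex (hT Z (- c)) (\<lambda>_. 0) x + Ex (\<lambda>t. (Z - be) * t) (\<lambda>t. (Z - be) * t) x)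
    (\<lambda>x. g1 x + g2 x + g3 x) (\<lambda>x. l1 x + l2 x + l3 x)"
   by (rule adm_add[OF adm_add[OF 1(1) 2(1)] 3(1)])
  show "R \<ge> 1" by (rule R)
  fix x :: conf2 assume R: "tmax x \<ge> R"
  define s where "s = tt (fst x)"
  define t where "t = tt (snd x)"
  have st: "1 \<le> s" "1 \<le> t" unfolding s_def t_def by (rule tt_ge_1)+
  define r where "r = 1 / (s + t) - Z^2 / 2"
  define E where "E t = exp (hT Z (- c) t)" for t
  define L where "L = E t * (BT Z (- c) t + r) + E s * (BT Z (- c) s + r)
    + exp ((Z - be) * s) * exp ((Z - be) * t) * (Br Z (Z - be) 0 s + Br Z (Z - be) 0 t + r)"
  have "Lop Z (\<lambda>x. Ex (\<lambda>_. 0) (hT Z (- c)) x + Ex (hT Z (- c)) (\<lambda>_. 0) x + Ex (\<lambda>t. (Z - be) * t) (\<lambda>t. (Z - be) * t) x)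
    (\<lambda>x. g1 x + g2 x + g3 x) (\<lambda>x. l1 x + l2 x + l3 x) x = L"
  proof -
   have e1: "Lop Z (Ex (\<lambda>_. 0) (hT Z (- c))) g1 l1 x = E t * (BT Z (- c) t + r)"
    unfolding 1(2) BT_def E_def Ex_def r_def s_def t_def by (simp add: add_diff_eq)
   have e2: "Lop Z (Ex (hT Z (- c)) (\<lambda>_. 0)) g2 l2 x = E s * (BT Z (- c) s + r)"
    unfolding 2(2) BT_def E_def Ex_def r_def s_def t_def by (simp add: add_diff_eq)
   have e3: "Lop Z (Ex (\<lambda>t. (Z - be) * t) (\<lambda>t. (Z - be) * t)) g3 l3 x = exp ((Z - be) * s) * exp ((Z - be) * t) * (Br Z (Z - be) 0 s + Br Z (Z - be) 0 t + r)"
    unfolding 3(2) Ex_def r_def s_def t_def by (simp only: add_diff_eq exp_add)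
   show ?thesis unfolding Lop_add L_def e1 e2 e3 ..
  qed
  moreover have "L \<ge> 0"
  proof (cases "s \<le> t")
   case True
   then have tm: "tmax x = t" unfolding tmax_def s_def t_def by auto
   show ?thesis using low[rule_format, OF st(1) True] R unfolding tm Let_def L_def r_def E_def by simp
  next
   case False
   then have ts: "t \<le> s" by simp
   then have tm: "tmax x = s" unfolding tmax_def s_def t_def by auto
   have "0 \<le> E s * (BT Z (- c) s + r) + E t * (BT Z (- c) t + r)
    + exp ((Z - be) * t) * exp ((Z - be) * s) * (Br Z (Z - be) 0 t + Br Z (Z - be) 0 s + r)"
    using low[rule_format, OF st(2) ts] R unfolding tm Let_def r_def E_def by (simp only: add.commute[of t s])
   also have "\<dots> = L" unfolding L_def
    by (simp only: add.commute[of "E s * (BT Z (- c) s + r)"] mult.commute[of "exp ((Z - be) * t)"] add.commute[of "Br Z (Z - be) 0 t"])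
   finally show ?thesis .
  qed
  ultimately show "Lop Z (\<lambda>x. Ex (\<lambda>_. 0) (hT Z (- c)) x + Ex (hT Z (- c)) (\<lambda>_. 0) x + Ex (\<lambda>t. (Z - be) * t) (\<lambda>t. (Z - be) * t) x)
    (\<lambda>x. g1 x + g2 x + g3 x) (\<lambda>x. l1 x + l2 x + l3 x) x \<ge> 0" by simp
 qed
qed

section \<open>Integrability and Lipschitz estimates for the weights\<close>

lemma power_le_exp:
 assumes "x \<ge> (0::real)" "n > 0"
 shows "(x / real n) ^ n \<le> exp x"
proof -
 have "(x / real n) ^ n \<le> (1 + x / real n) ^ n" using assms by (intro power_mono) auto
 also have "\<dots> \<le> exp x" using assms by (intro exp_ge_one_plus_x_over_n_power_n) auto
 finally show ?thesis .
qed

text \<open>Every factor \<open>1 + (x \<bullet> b)^2\<close> is at most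
  \<open>1 + (norm x)^2\<close>, so the function lies below a product of one-dimensional integrable
  functions.\<close>

lemma inverse_polynomial_integrable:
 "integrable lborel (\<lambda>x::'a::euclidean_space. 1 / (1 + (norm x)^2) ^ DIM('a))"
proof (rule integrableI_bounded)
 define P where "P x = (\<Prod>b\<in>Basis. inverse (1 + (x \<bullet> b)^2))" for x :: 'a
 have P: "1 / (1 + (norm x)^2) ^ DIM('a) \<le> P x" for x
 proof -
  have "(\<Prod>b\<in>Basis. 1 + (x \<bullet> b)^2) \<le> (\<Prod>b\<in>(Basis::'a set). 1 + (norm x)^2)"
   by (intro prod_mono) (auto simp: Basis_le_norm abs_le_square_iff[symmetric])
  moreover have "(\<Prod>b\<in>Basis. 1 + (x \<bullet> b)^2) > 0" by (intro prod_pos) (auto simp: add_pos_nonneg)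
  ultimately have "1 / (\<Prod>b\<in>(Basis::'a set). 1 + (norm x)^2) \<le> 1 / (\<Prod>b\<in>Basis. 1 + (x \<bullet> b)^2)"
   by (intro divide_left_mono) auto
  then show ?thesis unfolding P_def inverse_eq_divide by (simp add: prod_dividef)
 qed
 have i: "integrable lborel (\<lambda>t::real. inverse (1 + t^2))"
  using integrable_inverse_1_plus_square unfolding set_integrable_def by simp
 have fin: "(\<integral>\<^sup>+t. ennreal (inverse (1 + (t::real)^2)) \<partial>lborel) < \<infinity>"
  using nn_integral_eq_integral[OF i] by (simp add: add_nonneg_nonneg)
 have "(\<integral>\<^sup>+x. ennreal (norm (1 / (1 + (norm x)^2) ^ DIM('a))) \<partial>(lborel::'a measure)) \<le> (\<integral>\<^sup>+x. (\<Prod>b\<in>(Basis::'a set). ennreal (inverse (1 + (x \<bullet> b)^2))) \<partial>lborel)"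
 proof (rule nn_integral_mono)
  fix x :: 'a
  have "norm (1 / (1 + (norm x)^2) ^ DIM('a)) \<le> P x" using P[of x] by (simp add: add_nonneg_nonneg)
  moreover have "(\<Prod>b\<in>Basis. ennreal (inverse (1 + (x \<bullet> b)^2))) = ennreal (P x)"
   unfolding P_def by (rule prod_ennreal) simp
  ultimately show "ennreal (norm (1 / (1 + (norm x)^2) ^ DIM('a))) \<le> (\<Prod>b\<in>Basis. ennreal (inverse (1 + (x \<bullet> b)^2)))"
   by (simp add: ennreal_leI)
 qed
 also have "\<dots> = (\<Prod>b\<in>(Basis::'a set). \<integral>\<^sup>+t. ennreal (inverse (1 + t^2)) \<partial>lborel)"
  by (rule nn_integral_lborel_prod) auto
 also have "\<dots> < \<infinity>" using fin by (simp add: power_less_top_ennreal)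
 finally show "(\<integral>\<^sup>+x. ennreal (norm (1 / (1 + (norm x)^2) ^ DIM('a))) \<partial>(lborel::'a measure)) < \<infinity>" .
qed auto

lemma tt_lipschitz: "\<bar>tt x - tt y\<bar> \<le> norm (x - y)"
proof -
 have "\<bar>smooth_abs 1 (norm x) - smooth_abs 1 (norm y)\<bar> \<le> \<bar>norm x - norm y\<bar>" by (rule smooth_abs_lipschitz) simp
 then show ?thesis unfolding smooth_abs_def smr_def[symmetric] using norm_triangle_ineq3[of x y] by linarith
qed

lemma norm_fst_snd_diff_le: "norm (fst x - fst y) \<le> norm (x - y)" "norm (snd x - snd y) \<le> norm (x - y)"
 for x y :: "'a::real_normed_vector \<times> 'b::real_normed_vector"
 by (metis fst_diff norm_fst_le prod.collapse, metis snd_diff norm_snd_le prod.collapse)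

lemma tmin_tmax_lipschitz: "\<bar>tmin x - tmin y\<bar> \<le> norm (x - y)" "\<bar>tmax x - tmax y\<bar> \<le> norm (x - y)"
 using norm_fst_snd_diff_le[of x y] tt_lipschitz[of "fst x" "fst y"] tt_lipschitz[of "snd x" "snd y"]
 unfolding tmin_def tmax_def min_def max_def by auto

lemma powr_lipschitz:
 assumes "s \<ge> 1" "t \<ge> (1::real)" "0 < p" "p \<le> 1"
 shows "\<bar>s powr p - t powr p\<bar> \<le> \<bar>s - t\<bar>"
proof -
 have "norm (s powr p - t powr p) \<le> 1 * norm (s - t)"
 proof (rule field_differentiable_bound[of "{1..}" "\<lambda>s. s powr p" "\<lambda>s. p * s powr (p - 1)"])
  show "convex {1::real..}" by simp
  fix z :: real assume z: "z \<in> {1..}"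
  then show "((\<lambda>s. s powr p) has_field_derivative p * z powr (p - 1)) (at z within {1..})"
   using has_real_derivative_powr[of z p] has_field_derivative_at_within by force
  have "z powr (p - 1) \<le> z powr 0" using z assms by (intro powr_mono) auto
  then have "z powr (p - 1) \<le> 1" using z by simp
  then show "norm (p * z powr (p - 1)) \<le> 1" using assms by (simp add: abs_mult mult_le_one)
 qed (use assms in auto)
 then show ?thesis by simp
qed

lemma tmax_inner_ball: "tmax x \<le> R \<Longrightarrow> x \<in> cball 0 (2 * R)"
proof -
 assume "tmax x \<le> R"
 then have "norm (fst x) \<le> R" "norm (snd x) \<le> R"
  using norm_le_smr[of "fst x" 1] norm_le_smr[of "snd x" 1] unfolding tmax_def by auto
 then show "x \<in> cball 0 (2 * R)" using norm_Pair_le[of "fst x" "snd x"] by simp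
qed

text \<open>Logarithm of the weight that is actually proved to be integrable. In the smoothed radii
  it is Lipschitz, so its values in a unit ball differ by a bounded amount, which the local mean
  value inequality requires.\<close>

definition decay_exponent :: "real \<Rightarrow> real \<Rightarrow> conf2 \<Rightarrow> real" where
 "decay_exponent Z c x = Z * tmin x - tmin x powr (3/4) + c * sqrt (tmax x)"

lemma decay_exponent_measurable [measurable]: "decay_exponent Z c \<in> borel_measurable borel"
 unfolding decay_exponent_def[abs_def] by measurable

lemma decay_exponent_lipschitz:
 assumes "norm (x - y) \<le> 1" "Z > 0" "c > 0"
 shows "decay_exponent Z c y \<le> decay_exponent Z c x + (Z + 1 + c)"
proof -
 have m: "\<bar>tmin x - tmin y\<bar> \<le> 1" "\<bar>tmax x - tmax y\<bar> \<le> 1" using tmin_tmax_lipschitz[of x y] assms(1) by linarith+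
 have "\<bar>tmin x powr (3/4) - tmin y powr (3/4)\<bar> \<le> 1"
  using powr_lipschitz[of "tmin x" "tmin y" "3/4"] tmin_tmax(1)[of x] tmin_tmax(1)[of y] m by linarith
 moreover have "\<bar>tmax x powr (1/2) - tmax y powr (1/2)\<bar> \<le> 1"
  using powr_lipschitz[of "tmax x" "tmax y" "1/2"] tmin_tmax(3)[of x] tmin_tmax(3)[of y] m by linarith
 then have "sqrt (tmax y) \<le> sqrt (tmax x) + 1"
  using tmin_tmax(3)[of x] tmin_tmax(3)[of y] by (simp add: powr_half_sqrt)
 then have "c * sqrt (tmax y) \<le> c * (sqrt (tmax x) + 1)" using assms by (intro mult_left_mono) auto
 moreover have "Z * tmin y \<le> Z * (tmin x + 1)" using m assms by (intro mult_left_mono) auto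
 ultimately show ?thesis unfolding decay_exponent_def distrib_left by linarith
qed

text \<open>\<open>exp (2 c sqrt T)\<close> dominates the power \<open>4 n\<close> of
  \<open>sqrt T\<close>, that is the power \<open>n\<close> of \<open>T^2\<close>. Since
  \<open>1 + (norm x)^2 \<le> 2 T^2\<close>, an integrable inverse polynomial is a majorant.\<close>

lemma exp_sqrt_square_integrable:
 assumes c: "c > 0"
 shows "integrable lborel (\<lambda>x::conf2. (exp (- c * (sqrt (tt (fst x)) + sqrt (tt (snd x)))))^2)"
proof (rule bintegrable_bound)
 define n where "n = DIM(conf2)"
 have n: "n > 0" unfolding n_def by simp
 define K where "K = 2 ^ n * (real (4 * n) / (2 * c)) ^ (4 * n)"
 show "integrable lborel (\<lambda>x::conf2. K * (1 / (1 + (norm x)^2) ^ n))"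
  unfolding n_def by (intro integrable_mult_right inverse_polynomial_integrable)
 have [measurable]: "(fst :: conf2 \<Rightarrow> _) \<in> borel_measurable borel" "(snd :: conf2 \<Rightarrow> _) \<in> borel_measurable borel"
  by (intro borel_measurable_continuous_onI continuous_intros)+
 show "(\<lambda>x::conf2. (exp (- c * (sqrt (tt (fst x)) + sqrt (tt (snd x)))))^2) \<in> borel_measurable lborel"
  by measurable
 show "AE x::conf2 in lborel. norm ((exp (- c * (sqrt (tt (fst x)) + sqrt (tt (snd x)))))^2) \<le> norm (K * (1 / (1 + (norm x)^2) ^ n))"
 proof (rule AE_I2)
  fix x :: conf2
  define T where "T = tmax x"
  have T: "T \<ge> 1" unfolding T_def by (rule tmin_tmax)
  define E where "E = exp (2 * c * sqrt T)"
  have le: "(exp (- c * (sqrt (tt (fst x)) + sqrt (tt (snd x)))))^2 \<le> 1 / E"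
  proof -
   have "sqrt T \<le> sqrt (tt (fst x)) + sqrt (tt (snd x))"
    unfolding T_def tmax_def max_def using tt_ge_1[of "fst x"] tt_ge_1[of "snd x"] by simp
   then have "2 * c * sqrt T \<le> 2 * c * (sqrt (tt (fst x)) + sqrt (tt (snd x)))" using c by (intro mult_left_mono) auto
   then have "exp (- (2 * c * (sqrt (tt (fst x)) + sqrt (tt (snd x))))) \<le> exp (- (2 * c * sqrt T))" by simp
   moreover have "(exp (- c * (sqrt (tt (fst x)) + sqrt (tt (snd x)))))^2 = exp (- (2 * c * (sqrt (tt (fst x)) + sqrt (tt (snd x)))))"
    by (simp only: exp_double[symmetric]) simp
   moreover have "exp (- (2 * c * sqrt T)) = 1 / E" unfolding E_def by (simp add: exp_minus inverse_eq_divide)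
   ultimately show ?thesis by linarith
  qed
  have x2: "1 + (norm x)^2 \<le> 2 * T^2"
  proof -
   have s: "(norm x)^2 = (norm (fst x))^2 + (norm (snd x))^2" by (simp add: norm_prod_def)
   have "(tt (fst x))^2 \<le> T^2" "(tt (snd x))^2 \<le> T^2"
    unfolding T_def tmax_def using tt_ge_1[of "fst x"] tt_ge_1[of "snd x"] by (auto intro!: power_mono)
   then show ?thesis unfolding s smr_sq by simp
  qed
  have "(1 + (norm x)^2) ^ n \<le> (2 * T^2) ^ n" by (intro power_mono x2) simp
  also have "\<dots> = 2 ^ n * sqrt T ^ (4 * n)"
  proof -
   have "T^2 = sqrt T ^ 4" using T by (simp add: power4_eq_xxxx power2_eq_square)
   then show ?thesis by (simp add: power_mult_distrib power_mult)
  qed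
  also have "\<dots> \<le> K * E"
  proof -
   have "(2 * c * sqrt T / real (4 * n)) ^ (4 * n) \<le> E"
    unfolding E_def using c T n by (intro power_le_exp) auto
   then have "(real (4 * n) / (2 * c)) ^ (4 * n) * (2 * c * sqrt T / real (4 * n)) ^ (4 * n) \<le> (real (4 * n) / (2 * c)) ^ (4 * n) * E"
    using c by (intro mult_left_mono) auto
   moreover have "(real (4 * n) / (2 * c)) ^ (4 * n) * (2 * c * sqrt T / real (4 * n)) ^ (4 * n) = sqrt T ^ (4 * n)"
    unfolding power_mult_distrib[symmetric] using c n by simp
   ultimately show ?thesis unfolding K_def by simp
  qed
  finally have "1 / E \<le> K * (1 / (1 + (norm x)^2) ^ n)"
   unfolding E_def by (simp add: field_simps add_pos_nonneg zero_less_power)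
  then show "norm ((exp (- c * (sqrt (tt (fst x)) + sqrt (tt (snd x)))))^2) \<le> norm (K * (1 / (1 + (norm x)^2) ^ n))"
   using le unfolding real_norm_def abs_power2 by linarith
 qed
qed

section \<open>The comparison argument and the weighted bounds on \<open>u\<close>\<close>

context coulomb_subsolution
begin

lemma w_mult_le:
 assumes "p \<le> Z * (tt (fst x) + tt (snd x)) - c * (sqrt (tt (fst x)) + sqrt (tt (snd x)))"
 shows "w x * exp p \<le> exp (2 * Z) * (u x * exp (- c * (sqrt (tt (fst x)) + sqrt (tt (snd x)))))"
proof -
 have "Z * (tt (fst x) + tt (snd x)) \<le> Z * (2 + norm (fst x) + norm (snd x))"
  using tt_le[of "fst x"] tt_le[of "snd x"] Zpos by (intro mult_left_mono) auto
 then have "- Z * (norm (fst x) + norm (snd x)) + p \<le> 2 * Z + - c * (sqrt (tt (fst x)) + sqrt (tt (snd x)))"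
  using assms by (simp add: algebra_simps)
 then have "exp (- Z * (norm (fst x) + norm (snd x)) + p) \<le> exp (2 * Z + - c * (sqrt (tt (fst x)) + sqrt (tt (snd x))))" by (rule iffD2[OF exp_le_cancel_iff])
 from mult_left_mono[OF this u_nonneg] show ?thesis unfolding w_def exp_add by (simp only: ac_simps)
qed

text \<open>After multiplication by \<open>w\<close> each of the three summands is at most a
  constant times \<open>u exp (- c (sqrt t1 + sqrt t2))\<close>, a product of two square integrable
  functions. Where a summand lacks one of the roots, \<open>c sqrt t \<le> Z t\<close> or
  \<open>c sqrt t \<le> be t\<close> supplies it.\<close>

lemma w_Theta_integrable:
 assumes c: "0 < c" "c \<le> Z" "c \<le> be"
 shows "integrable lborel (\<lambda>x. w x * (Ex (\<lambda>_. 0) (hT Z (- c)) x + Ex (hT Z (- c)) (\<lambda>_. 0) x + Ex (\<lambda>t. (Z - be) * t) (\<lambda>t. (Z - be) * t) x))"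
  (is "integrable lborel (\<lambda>x. w x * ?T x)")
proof (rule bintegrable_bound)
 define D where "D x = exp (- c * (sqrt (tt (fst x)) + sqrt (tt (snd x))))" for x :: conf2
 show "integrable lborel (\<lambda>x. 3 * exp (2 * Z) * ((u x)^2 + (D x)^2))"
  unfolding D_def using exp_sqrt_square_integrable[OF c(1)] by (intro integrable_mult_right bintegrable_add u_sq)
 have [measurable]: "?T \<in> borel_measurable borel"
  unfolding Ex_def[abs_def] hT_def[abs_def] by measurable
 show "(\<lambda>x. w x * ?T x) \<in> borel_measurable lborel" by measurable
 show "AE x in lborel. norm (w x * ?T x) \<le> norm (3 * exp (2 * Z) * ((u x)^2 + (D x)^2))"
 proof (rule AE_I2)
  fix x :: conf2
  define s where "s = tt (fst x)"
  define t where "t = tt (snd x)"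
  have st: "s \<ge> 1" "t \<ge> 1" unfolding s_def t_def by (rule tt_ge_1)+
  have q: "0 \<le> sqrt y" "sqrt y \<le> y" if "y \<ge> 1" for y :: real
   using that mult_left_mono[OF that, of y] by (auto intro!: real_le_lsqrt simp: power2_eq_square)
  have cz: "c * sqrt y \<le> Z * y" "c * sqrt y \<le> be * y" if "y \<ge> 1" for y
   using q[OF that] c by (auto intro!: mult_mono)
  have 1: "w x * Ex (\<lambda>_. 0) (hT Z (- c)) x \<le> exp (2 * Z) * (u x * D x)"
   unfolding Ex_def D_def hT_def by (rule w_mult_le) (use cz[OF st(1)] in \<open>simp add: s_def algebra_simps\<close>)
  have 2: "w x * Ex (hT Z (- c)) (\<lambda>_. 0) x \<le> exp (2 * Z) * (u x * D x)"
   unfolding Ex_def D_def hT_def by (rule w_mult_le) (use cz[OF st(2)] in \<open>simp add: t_def algebra_simps\<close>)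
  have 3: "w x * Ex (\<lambda>t. (Z - be) * t) (\<lambda>t. (Z - be) * t) x \<le> exp (2 * Z) * (u x * D x)"
   unfolding Ex_def D_def by (rule w_mult_le) (use cz[OF st(1)] cz[OF st(2)] in \<open>simp add: s_def t_def algebra_simps\<close>)
  have "u x * D x \<le> (u x)^2 + (D x)^2"
   using sum_squares_bound[of "u x" "D x"] mult_nonneg_nonneg[OF u_nonneg[of x], of "D x"] unfolding D_def by simp
  from mult_left_mono[OF this, of "3 * exp (2 * Z)"]
  have "3 * exp (2 * Z) * (u x * D x) \<le> 3 * exp (2 * Z) * ((u x)^2 + (D x)^2)" by simp
  then have "w x * ?T x \<le> 3 * exp (2 * Z) * ((u x)^2 + (D x)^2)"
   using 1 2 3 unfolding distrib_left[of "w x"] mult.assoc[of 3] by linarith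
  moreover have "w x * ?T x \<ge> 0" using w_nonneg[of x] unfolding Ex_def by (simp add: add_nonneg_nonneg)
  ultimately show "norm (w x * ?T x) \<le> norm (3 * exp (2 * Z) * ((u x)^2 + (D x)^2))" by simp
 qed
qed

text \<open>The harmonic mean inherits the better half of each function. Lying below
  \<open>n T\<close>, it is integrable against \<open>w\<close> and may be tested with; lying below
  \<open>P\<close>, it bounds the contribution of the inner region independently of
  \<open>n\<close>. In the outer region only the factor \<open>(q n x)^2\<close> is lost, which
  tends to one, and Fatou's lemma passes to the limit.\<close>

lemma comparison_bound:
 assumes P: "adm C1 P gP lP" and T: "adm C2 T gT lT" and iT: "integrable lborel (\<lambda>x. w x * T x)"
  and W: "W \<in> borel_measurable borel" "\<And>x. W x \<ge> 0"
  and LP: "\<And>x. tmax x \<ge> R \<Longrightarrow> Lop Z P gP lP x \<ge> W x" and LT: "\<And>x. tmax x \<ge> R \<Longrightarrow> Lop Z T gT lT x \<ge> 0"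
 shows "(\<integral>\<^sup>+x. ennreal (w x * W x) * indicator {x. tmax x \<ge> R} x \<partial>lborel) < \<infinity>"
proof -
 define C where "C = max C1 C2"
 note P = adm_mono[OF P, of C] and T = adm_mono[OF T, of C]
 have P: "adm C P gP lP" and T: "adm C T gT lT" using P T unfolding C_def by auto
 have Pp: "P x > 0" and Tp: "T x > 0" for x using admD(2)[OF P] admD(2)[OF T] by auto
 have [measurable]: "P \<in> borel_measurable borel" "T \<in> borel_measurable borel" "W \<in> borel_measurable borel"
  using C2GL_measurable[OF admD(1)[OF P]] C2GL_measurable[OF admD(1)[OF T]] W(1) by auto
 define H where "H n x = hm (P x) (real (Suc n) * T x)" for n x
 define q where "q n x = real (Suc n) * T x / (P x + real (Suc n) * T x)" for n x
 have nT: "real (Suc n) * T x > 0" for n x using Tp[of x] by (intro mult_pos_pos) auto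
 have q: "0 \<le> q n x" "q n x \<le> 1" for n x unfolding q_def using Pp[of x] nT[where n=n and x=x] by (auto simp: field_simps)
 define K where "K = (C + 8 * C^2) + 2 * Z * (C + 8 * C^2) + 1 + Z^2"
 have "C \<ge> 0" by (rule admD(5)[OF P])
 then have K: "K \<ge> 0" unfolding K_def using Zpos by (auto intro!: add_nonneg_nonneg)
 have "\<exists>g l. adm (C + 8 * C^2) (H n) g l \<and> (\<forall>x. tmax x \<ge> R \<longrightarrow> Lop Z (H n) g l x \<ge> (q n x)^2 * W x)" for n
 proof -
  obtain g l where gl: "adm (C + 8 * C^2) (\<lambda>x. hm (P x) (real (Suc n) * T x)) g l"
   "\<And>Z x. Lop Z (\<lambda>x. hm (P x) (real (Suc n) * T x)) g l x \<ge> (real (Suc n) * T x / (P x + real (Suc n) * T x))^2 * Lop Z P gP lP x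
     + (P x / (P x + real (Suc n) * T x))^2 * Lop Z (\<lambda>x. real (Suc n) * T x) (\<lambda>x. real (Suc n) *\<^sub>R gT x) (\<lambda>x. real (Suc n) * lT x) x"
   by (rule adm_hm[OF P adm_cmult[OF T, of "real (Suc n)"]]) auto
  have "Lop Z (H n) g l x \<ge> (q n x)^2 * W x" if "tmax x \<ge> R" for x
  proof -
   have "(q n x)^2 * W x \<le> (q n x)^2 * Lop Z P gP lP x" by (intro mult_left_mono LP that) simp
   moreover have "0 \<le> (P x / (P x + real (Suc n) * T x))^2 * Lop Z (\<lambda>x. real (Suc n) * T x) (\<lambda>x. real (Suc n) *\<^sub>R gT x) (\<lambda>x. real (Suc n) * lT x) x"
    unfolding Lop_cmult by (intro mult_nonneg_nonneg LT that) auto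
   ultimately show ?thesis using gl(2)[where Z=Z and x=x] unfolding H_def[abs_def] q_def by linarith
  qed
  then show ?thesis using gl(1) unfolding H_def[abs_def] by blast
 qed
 then obtain g l where a: "\<And>n. adm (C + 8 * C^2) (H n) (g n) (l n)"
  and L: "\<And>n x. tmax x \<ge> R \<Longrightarrow> Lop Z (H n) (g n) (l n) x \<ge> (q n x)^2 * W x" by metis
 have cP: "continuous_on (cball 0 (2 * R)) P" using C2GL_D(2)[OF admD(1)[OF P]] continuous_on_subset by blast
 obtain M where M: "M \<ge> 0" "\<And>x. x \<in> cball 0 (2 * R) \<Longrightarrow> P x \<le> M"
 proof -
  have "bounded (P ` cball 0 (2 * R))" by (intro compact_imp_bounded compact_continuous_image cP compact_cball)
  then obtain b where "\<forall>y\<in>P ` cball 0 (2 * R). norm y \<le> b" unfolding bounded_iff by blast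
  then have "P x \<le> max b 0" if "x \<in> cball 0 (2 * R)" for x using that by (force simp: abs_le_iff)
  then show ?thesis using that[of "max b 0"] by auto
 qed
 define N where "N = K * M * (LBINT x. indicator (cball 0 (2 * R)) x * w x)"
 have [measurable]: "cball (0::conf2) (2 * R) \<in> sets borel" by simp
 have bd: "(\<integral>\<^sup>+x. ennreal ((q n x)^2 * (w x * W x)) * indicator {x. tmax x \<ge> R} x \<partial>lborel) \<le> ennreal N" for n
 proof -
  have iH: "integrable lborel (\<lambda>x. w x * H n x)"
  proof (rule bintegrable_bound)
   show "integrable lborel (\<lambda>x. real (Suc n) * (w x * T x))" by (rule integrable_mult_right[OF iT])
   show "(\<lambda>x. w x * H n x) \<in> borel_measurable lborel" unfolding H_def hm_def by measurable
   show "AE x in lborel. norm (w x * H n x) \<le> norm (real (Suc n) * (w x * T x))"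
   proof (rule AE_I2)
    fix x
    have h: "0 < H n x" "H n x \<le> real (Suc n) * T x" unfolding H_def using hm_bounds(1,3)[OF Pp nT] by auto
    have "w x * H n x \<le> w x * (real (Suc n) * T x)" by (intro mult_left_mono h w_nonneg)
    then have "w x * H n x \<le> real (Suc n) * (w x * T x)" by (simp only: ac_simps)
    moreover have "0 \<le> w x * H n x" using h w_nonneg by simp
    ultimately show "norm (w x * H n x) \<le> norm (real (Suc n) * (w x * T x))"
     unfolding real_norm_def by linarith
   qed
  qed
  note LI = Lop_integral_nonpos[OF a iH]
  define r where "r x = w x * Lop Z (H n) (g n) (l n) x + K * M * (indicator (cball 0 (2 * R)) x * w x)" for x
  have ir: "integrable lborel r" unfolding r_def
   by (intro bintegrable_add LI(1) integrable_mult_right w_loc_integrable)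
  have pw: "((q n x)^2 * (w x * W x)) * indicator {x. tmax x \<ge> R} x \<le> r x" for x
  proof (cases "tmax x \<ge> R")
   case True
   have "w x * ((q n x)^2 * W x) \<le> w x * Lop Z (H n) (g n) (l n) x" by (intro mult_left_mono L True w_nonneg)
   moreover have "0 \<le> K * M * (indicator (cball 0 (2 * R)) x * w x)" using K M w_nonneg[of x] by simp
   ultimately have "w x * ((q n x)^2 * W x) \<le> r x" unfolding r_def by linarith
   then show ?thesis using True by (simp add: ac_simps)
  next
   case False
   then have x: "x \<in> cball 0 (2 * R)" using tmax_inner_ball[of x R] by simp
   have "\<bar>Lop Z (H n) (g n) (l n) x\<bar> \<le> K * H n x" unfolding K_def by (rule Lop_bound[OF a Zpos])
   moreover have "K * H n x \<le> K * M"
    using order_trans[OF hm_bounds(2)[OF Pp nT] M(2)[OF x]] K unfolding H_def by (intro mult_left_mono) auto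
   ultimately have "- (K * M) \<le> Lop Z (H n) (g n) (l n) x" by linarith
   from mult_left_mono[OF this w_nonneg[of x]] have "0 \<le> r x" unfolding r_def using x by (simp add: ac_simps)
   then show ?thesis using False by simp
  qed
  have r0: "0 \<le> r x" for x
   by (rule order_trans[OF _ pw]) (intro mult_nonneg_nonneg W w_nonneg zero_le_power2 indicator_pos_le)
  have "(\<integral>\<^sup>+x. ennreal ((q n x)^2 * (w x * W x)) * indicator {x. tmax x \<ge> R} x \<partial>lborel) \<le> (\<integral>\<^sup>+x. ennreal (r x) \<partial>lborel)"
  proof (rule nn_integral_mono)
   fix x show "ennreal ((q n x)^2 * (w x * W x)) * indicator {x. tmax x \<ge> R} x \<le> ennreal (r x)"
    using ennreal_leI[OF pw[of x]] by (auto simp: indicator_def)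
  qed
  also have "\<dots> = ennreal (LBINT x. r x)" by (rule nn_integral_eq_integral[OF ir]) (simp add: r0)
  also have "(LBINT x. r x) = (LBINT x. w x * Lop Z (H n) (g n) (l n) x) + N"
   unfolding r_def N_def by (simp only: bintegral_add[OF LI(1) integrable_mult_right[OF w_loc_integrable]] bintegral_mult_right[OF w_loc_integrable])
  also have "ennreal \<dots> \<le> ennreal N" using LI(2) by (intro ennreal_leI) simp
  finally show ?thesis .
 qed
 have lim: "(\<lambda>n. q n x) \<longlonglongrightarrow> 1" for x
 proof -
  have "q n x = 1 / (P x / T x / real (Suc n) + 1)" for n
  proof -
   have "P x / T x / real (Suc n) + 1 = (P x + real (Suc n) * T x) / (real (Suc n) * T x)"
    using Tp[of x] by (simp add: add_divide_distrib del: of_nat_Suc)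
   then show ?thesis unfolding q_def by simp
  qed
  moreover have "(\<lambda>n. 1 / (a / real (Suc n) + 1)) \<longlonglongrightarrow> 1" for a :: real by real_asymp
  ultimately show ?thesis by (simp only:)
 qed
 have "(\<integral>\<^sup>+x. ennreal (w x * W x) * indicator {x. tmax x \<ge> R} x \<partial>lborel)
   = (\<integral>\<^sup>+x. liminf (\<lambda>n. ennreal ((q n x)^2 * (w x * W x)) * indicator {x. tmax x \<ge> R} x) \<partial>lborel)"
 proof (rule nn_integral_cong)
  fix x
  have "(\<lambda>n. ennreal ((q n x)^2 * (w x * W x))) \<longlonglongrightarrow> ennreal (1^2 * (w x * W x))"
   by (intro tendsto_ennrealI tendsto_intros lim)
  then have "(\<lambda>n. ennreal ((q n x)^2 * (w x * W x)) * indicator {x. tmax x \<ge> R} x) \<longlonglongrightarrow> ennreal (w x * W x) * indicator {x. tmax x \<ge> R} x"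
   by (cases "tmax x \<ge> R") auto
  from lim_imp_Liminf[OF sequentially_bot this]
  show "ennreal (w x * W x) * indicator {x. tmax x \<ge> R} x = liminf (\<lambda>n. ennreal ((q n x)^2 * (w x * W x)) * indicator {x. tmax x \<ge> R} x)" ..
 qed
 also have "\<dots> \<le> liminf (\<lambda>n. \<integral>\<^sup>+x. ennreal ((q n x)^2 * (w x * W x)) * indicator {x. tmax x \<ge> R} x \<partial>lborel)"
  by (rule nn_integral_liminf) (unfold q_def, measurable)
 also have "\<dots> \<le> liminf (\<lambda>n. ennreal N)" by (intro Liminf_mono) (simp add: bd)
 also have "\<dots> = ennreal N" by (simp add: Liminf_const)
 finally show ?thesis by (rule order_le_less_trans) simp
qed

text \<open>The divisor \<open>(tmax x)^2\<close> in the lower bound for \<open>Lop\<close> of the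
  supersolution is paid for by half of \<open>c\<close>: \<open>exp (c / 2 * sqrt t)\<close> is at
  least \<open>(c / 8)^4 * t^2\<close>. In the inner region the weight is bounded and local
  integrability of \<open>u\<close> suffices.\<close>

lemma exponential_L1_bound:
 assumes Z1: "Z < 1" and be: "be = Z * ((1 - Z) / 4) / 4" and c: "0 < c" "c \<le> be" "c \<le> Z" "c^2 \<le> 2 * (1 - Z)"
 shows "(\<integral>\<^sup>+x. ennreal (u x * exp (decay_exponent Z (c / 2) x)) \<partial>lborel) < \<infinity>"
proof -
 obtain C1 P gP lP R1 k where P: "adm C1 P gP lP" "R1 \<ge> 1" "k > 0"
  "\<forall>x. tmax x \<ge> R1 \<longrightarrow> Lop Z P gP lP x \<ge> k * (exp (pA Z (tmin x)) * exp (hT Z c (tmax x)) / (tmax x)^2)"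
  using Psi_exists[OF Zpos Z1 c(1,3,4)] by blast
 obtain C2 gT lT R2 where T: "adm C2 (\<lambda>x. Ex (\<lambda>_. 0) (hT Z (- c)) x + Ex (hT Z (- c)) (\<lambda>_. 0) x + Ex (\<lambda>t. (Z - be) * t) (\<lambda>t. (Z - be) * t) x) gT lT" "R2 \<ge> 1"
  "\<forall>x. tmax x \<ge> R2 \<longrightarrow> Lop Z (\<lambda>x. Ex (\<lambda>_. 0) (hT Z (- c)) x + Ex (hT Z (- c)) (\<lambda>_. 0) x + Ex (\<lambda>t. (Z - be) * t) (\<lambda>t. (Z - be) * t) x) gT lT x \<ge> 0"
  using Theta_exists[OF Zpos Z1 c(1,3,4) be] by blast
 define R where "R = max R1 R2"
 have R: "R \<ge> R1" "R \<ge> R2" "R \<ge> 1" unfolding R_def using P(2) by auto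
 define W where "W x = k * (exp (pA Z (tmin x)) * exp (hT Z c (tmax x)) / (tmax x)^2)" for x
 have Wm[measurable]: "W \<in> borel_measurable borel" unfolding W_def[abs_def] pA_def hT_def by measurable
 have fin: "(\<integral>\<^sup>+x. ennreal (w x * W x) * indicator {x. tmax x \<ge> R} x \<partial>lborel) < \<infinity>"
 proof (rule comparison_bound[OF P(1) T(1) w_Theta_integrable[OF c(1,3,2)] Wm])
  show "W x \<ge> 0" for x unfolding W_def using P(3) by simp
 qed (use P(4) T(3) R in \<open>auto simp: W_def\<close>)
 define d where "d = k * (c / 8) ^ 4"
 have d: "d > 0" unfolding d_def using P(3) c(1) by simp
 let ?F = "decay_exponent Z (c / 2)"
 have out: "u x * exp (?F x) \<le> 1 / d * (w x * W x)" for x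
 proof -
  define y where "y = sqrt (tmax x)"
  have y: "y > 0" "y ^ 4 = (tmax x)^2" unfolding y_def using tmin_tmax(3)[of x] by (auto simp: power4_eq_xxxx power2_eq_square)
  have "(c / 2 * y / real 4) ^ 4 \<le> exp (c / 2 * y)" using c y by (intro power_le_exp) auto
  then have e1: "(c / 8) ^ 4 * y ^ 4 \<le> exp (c / 2 * y)" by (simp add: power_mult_distrib[symmetric])
  have "Z * (norm (fst x) + norm (snd x)) \<le> Z * (tmin x + tmax x)"
   unfolding tmin_tmax(4) using norm_le_smr[of "fst x" 1] norm_le_smr[of "snd x" 1] Zpos by (intro mult_left_mono add_mono) auto
  then have "c / 2 * y + ?F x \<le> - Z * (norm (fst x) + norm (snd x)) + (pA Z (tmin x) + hT Z c (tmax x))"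
   unfolding decay_exponent_def pA_def hT_def y_def by (simp add: algebra_simps)
  then have "exp (c / 2 * y + ?F x) \<le> exp (- Z * (norm (fst x) + norm (snd x)) + (pA Z (tmin x) + hT Z c (tmax x)))" by (rule iffD2[OF exp_le_cancel_iff])
  then have e2: "exp (c / 2 * y) * exp (?F x) \<le> exp (- Z * (norm (fst x) + norm (snd x))) * (exp (pA Z (tmin x)) * exp (hT Z c (tmax x)))"
   unfolding exp_add .
  have "(c / 8) ^ 4 * y ^ 4 * exp (?F x) \<le> exp (c / 2 * y) * exp (?F x)" by (intro mult_right_mono e1) simp
  from order_trans[OF this e2]
  have "u x * ((c / 8) ^ 4 * y ^ 4 * exp (?F x)) \<le> u x * (exp (- Z * (norm (fst x) + norm (snd x))) * (exp (pA Z (tmin x)) * exp (hT Z c (tmax x))))"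
   using u_nonneg by (rule mult_left_mono)
  also have "\<dots> = w x * (exp (pA Z (tmin x)) * exp (hT Z c (tmax x)))" unfolding w_def by (simp only: ac_simps)
  finally have "k * ((c / 8) ^ 4 * (u x * exp (?F x)) * y ^ 4) \<le> k * (w x * (exp (pA Z (tmin x)) * exp (hT Z c (tmax x))))"
   using P(3) by (intro mult_left_mono) (auto simp: ac_simps)
  then have "d * (u x * exp (?F x)) * (tmax x)^2 \<le> k * (w x * (exp (pA Z (tmin x)) * exp (hT Z c (tmax x))))"
   unfolding d_def y(2) by (simp only: ac_simps)
  then have "d * (u x * exp (?F x)) \<le> k * (w x * (exp (pA Z (tmin x)) * exp (hT Z c (tmax x)))) / (tmax x)^2"
   using tmin_tmax(3)[of x] by (subst pos_le_divide_eq) auto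
  also have "\<dots> = w x * W x" unfolding W_def by (simp only: times_divide_eq_right mult.left_commute)
  finally have "d * (u x * exp (?F x)) \<le> w x * W x" .
  then show ?thesis using d by (simp add: field_simps)
 qed
 define K where "K = exp (Z * R + c / 2 * R)"
 have inn: "u x * exp (?F x) \<le> K * (indicator (cball 0 (2 * R)) x * u x)" if "\<not> tmax x \<ge> R" for x
 proof -
  have t: "tmax x \<le> R" "tmin x \<le> R" "1 \<le> tmax x" using that tmin_tmax(2,3)[of x] by auto
  have "sqrt (tmax x) \<le> tmax x" using t mult_left_mono[OF t(3), of "tmax x"] by (auto intro!: real_le_lsqrt simp: power2_eq_square)
  then have "c / 2 * sqrt (tmax x) \<le> c / 2 * R" using c t by (intro mult_left_mono) auto
  moreover have "Z * tmin x \<le> Z * R" using Zpos t by (intro mult_left_mono) auto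
  moreover have "tmin x powr (3/4) \<ge> 0" by simp
  ultimately have "?F x \<le> Z * R + c / 2 * R" unfolding decay_exponent_def by linarith
  then have "exp (?F x) \<le> K" unfolding K_def by simp
  from mult_left_mono[OF this u_nonneg[of x]] show ?thesis using tmax_inner_ball[OF t(1)] by (simp add: ac_simps)
 qed
 have "ennreal (u x * exp (?F x)) \<le> ennreal (1 / d) * (ennreal (w x * W x) * indicator {x. tmax x \<ge> R} x)
    + ennreal K * ennreal (indicator (cball 0 (2 * R)) x * u x)" for x
 proof (cases "tmax x \<ge> R")
  case True
  have "ennreal (u x * exp (?F x)) \<le> ennreal (1 / d) * ennreal (w x * W x)"
   using ennreal_leI[OF out[of x]] d by (simp only: ennreal_mult' zero_le_divide_1_iff less_imp_le)
  then show ?thesis using True by (simp add: add_increasing2)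
 next
  case False
  have "ennreal (u x * exp (?F x)) \<le> ennreal K * ennreal (indicator (cball 0 (2 * R)) x * u x)"
   using ennreal_leI[OF inn[OF False]] unfolding K_def by (simp add: ennreal_mult')
  then show ?thesis using False by simp
 qed
 then have "(\<integral>\<^sup>+x. ennreal (u x * exp (?F x)) \<partial>lborel) \<le> (\<integral>\<^sup>+x. ennreal (1 / d) * (ennreal (w x * W x) * indicator {x. tmax x \<ge> R} x)
    + ennreal K * ennreal (indicator (cball 0 (2 * R)) x * u x) \<partial>lborel)" by (intro nn_integral_mono)
 also have "\<dots> = ennreal (1 / d) * (\<integral>\<^sup>+x. ennreal (w x * W x) * indicator {x. tmax x \<ge> R} x \<partial>lborel)
    + ennreal K * (\<integral>\<^sup>+x. ennreal (indicator (cball 0 (2 * R)) x * u x) \<partial>lborel)"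
 proof -
  have [measurable]: "cball (0::conf2) (2 * R) \<in> sets borel" by simp
  show ?thesis by (subst nn_integral_add, measurable) (simp add: nn_integral_cmult)
 qed
 also have "\<dots> < \<infinity>"
 proof -
  have "(\<integral>\<^sup>+x. ennreal (indicator (cball 0 (2 * R)) x * u x) \<partial>lborel) < \<infinity>"
   using nn_integral_eq_integral[OF u_loc_integrable[of "2 * R"]] u_nonneg by simp
  then show ?thesis using fin by (simp add: ennreal_mult_less_top)
 qed
 finally show ?thesis .
qed

text \<open>The mean value inequality for \<open>w\<close>, combined with the Lipschitz bound on the
  exponent, yields \<open>u * exp F \<le> D\<close> almost everywhere. The square of this product is
  then at most \<open>D\<close> times the product itself, which is integrable.\<close>

lemma exponential_L2_bound:
 assumes Z1: "Z < 1" and be: "be = Z * ((1 - Z) / 4) / 4" and c: "0 < c" "c \<le> be" "c \<le> Z" "c^2 \<le> 2 * (1 - Z)"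
 shows "(\<integral>\<^sup>+x. ennreal ((u x)^2 * exp (2 * decay_exponent Z (c / 2) x)) \<partial>lborel) < \<infinity>"
proof -
 define F where "F = decay_exponent Z (c / 2)"
 have [measurable]: "F \<in> borel_measurable borel" unfolding F_def by measurable
 have fin: "(\<integral>\<^sup>+x. ennreal (u x * exp (F x)) \<partial>lborel) < \<infinity>" unfolding F_def by (rule exponential_L1_bound[OF assms])
 have int: "integrable lborel (\<lambda>x. u x * exp (F x))"
  by (rule integrableI_bounded) (use fin u_nonneg in \<open>auto simp: abs_mult\<close>)
 obtain C where C: "C \<ge> 0" "AE y in lborel. w y \<le> C * (LBINT x. indicator (cball y 1) x * w x)"
  using local_bound_w by blast
 define L where "L = 2 * Z + (Z + 1 + c / 2)"
 define D where "D = C * (exp L * (LBINT x. u x * exp (F x)))"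
 have bd: "AE y in lborel. u y * exp (F y) \<le> D"
  using C(2)
 proof eventually_elim
  case (elim y)
  define e where "e = Z * (norm (fst y) + norm (snd y)) + F y"
  have "(LBINT x. exp e * (indicator (cball y 1) x * w x)) \<le> (LBINT x. exp L * (u x * exp (F x)))"
  proof (rule integral_mono)
   show "integrable lborel (\<lambda>x. exp e * (indicator (cball y 1) x * w x))" by (intro integrable_mult_right w_integrable_cball)
   show "integrable lborel (\<lambda>x. exp L * (u x * exp (F x)))" by (intro integrable_mult_right int)
   fix x
   show "exp e * (indicator (cball y 1) x * w x) \<le> exp L * (u x * exp (F x))"
   proof (cases "x \<in> cball y 1")
    case True
    then have n: "norm (x - y) \<le> 1" by (simp add: dist_norm norm_minus_commute)
    have "norm (fst x - fst y) \<le> 1" "norm (snd x - snd y) \<le> 1"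
     using n norm_fst_snd_diff_le[of x y] by linarith+
    then have "norm (fst y) \<le> norm (fst x) + 1" "norm (snd y) \<le> norm (snd x) + 1"
     using norm_triangle_ineq3[of "fst x" "fst y"] norm_triangle_ineq3[of "snd x" "snd y"] by linarith+
    then have "Z * (norm (fst y) + norm (snd y)) \<le> Z * ((norm (fst x) + norm (snd x)) + 2)" using Zpos by (intro mult_left_mono) auto
    moreover have "F y \<le> F x + (Z + 1 + c / 2)" unfolding F_def using decay_exponent_lipschitz[OF n Zpos, of "c / 2"] c by simp
    ultimately have "e + - Z * (norm (fst x) + norm (snd x)) \<le> L + F x" unfolding e_def L_def by (simp add: algebra_simps)
    then have "exp (e + - Z * (norm (fst x) + norm (snd x))) \<le> exp (L + F x)" by (rule iffD2[OF exp_le_cancel_iff])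
    from mult_left_mono[OF this u_nonneg[of x]]
    show ?thesis using True unfolding w_def exp_add by (simp add: ac_simps)
   qed (use u_nonneg in simp)
  qed
  then have "exp e * (LBINT x. indicator (cball y 1) x * w x) \<le> exp L * (LBINT x. u x * exp (F x))"
   by (simp only: bintegral_mult_right[OF w_integrable_cball] bintegral_mult_right[OF int])
  from mult_left_mono[OF this C(1)] have "exp e * (C * (LBINT x. indicator (cball y 1) x * w x)) \<le> D"
   unfolding D_def by (simp only: ac_simps)
  moreover have "exp e * w y \<le> exp e * (C * (LBINT x. indicator (cball y 1) x * w x))" using elim by (intro mult_left_mono) auto
  moreover have "exp e * w y = u y * exp (F y)"
  proof -
   have "e + - Z * (norm (fst y) + norm (snd y)) = F y" unfolding e_def by simp
   then have "exp (F y) = exp e * exp (- Z * (norm (fst y) + norm (snd y)))" by (metis exp_add)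
   then show ?thesis unfolding w_def by (simp only: ac_simps)
  qed
  ultimately show ?case by linarith
 qed
 have "(\<integral>\<^sup>+x. ennreal ((u x)^2 * exp (2 * F x)) \<partial>lborel) \<le> (\<integral>\<^sup>+x. ennreal D * ennreal (u x * exp (F x)) \<partial>lborel)"
 proof (rule nn_integral_mono_AE, use bd in eventually_elim)
  case (elim x)
  have "(u x)^2 * exp (2 * F x) = (u x * exp (F x)) * (u x * exp (F x))"
   by (simp add: exp_double power2_eq_square)
  also have "\<dots> \<le> D * (u x * exp (F x))" using elim u_nonneg by (intro mult_right_mono) auto
  finally show ?case using u_nonneg[of x] by (simp add: ennreal_mult''[symmetric] ennreal_leI)
 qed
 also have "\<dots> = ennreal D * (\<integral>\<^sup>+x. ennreal (u x * exp (F x)) \<partial>lborel)" by (rule nn_integral_cmult) measurable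
 also have "\<dots> < \<infinity>" using fin by (simp add: ennreal_mult_less_top)
 finally show ?thesis unfolding F_def .
qed

end

section \<open>The critical charge is less than one\<close>

lemma V2_measurable [measurable]: "V2 Z \<in> borel_measurable borel"
proof -
 have [measurable]: "(fst :: conf2 \<Rightarrow> _) \<in> borel_measurable borel" "(snd :: conf2 \<Rightarrow> _) \<in> borel_measurable borel"
  by (intro borel_measurable_continuous_onI continuous_intros)+
 show ?thesis unfolding V2_def[abs_def] by measurable
qed

lemma conf2_projections_measurable:
 "(fst :: conf2 \<Rightarrow> _) \<in> borel_measurable borel" "(snd :: conf2 \<Rightarrow> _) \<in> borel_measurable borel"
 "(\<lambda>x::conf2. fst x - snd x) \<in> borel_measurable borel"
 by (intro borel_measurable_continuous_onI continuous_intros)+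

lemma local_integrable_inverse_norm:
 fixes p :: "conf2 \<Rightarrow> real^3"
 assumes "integrable lborel (\<lambda>x. gauss2 1 1 0 x / (norm (p x))^2)" and [measurable]: "p \<in> borel_measurable borel"
  and f: "f \<in> borel_measurable borel" "bounded {x. f x \<noteq> 0}" "\<And>x. \<bar>f x\<bar> \<le> C"
 shows "integrable lborel (\<lambda>x. f x / norm (p x))"
proof -
 have [measurable]: "f \<in> borel_measurable borel" by (rule f)
 obtain R where R: "{x. f x \<noteq> 0} \<subseteq> cball 0 R" using bounded_subset_cball_zero[OF f(2)] by blast
 have [measurable]: "cball (0::conf2) R \<in> sets borel" by simp
 have "integrable lborel (\<lambda>x. (f x)^2)"
 proof (rule bintegrable_bound)
  show "integrable lborel (\<lambda>x. C^2 * indicator (cball (0::conf2) R) x)"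
   using emeasure_bounded_finite[of "cball (0::conf2) R"] by (intro integrable_mult_right integrable_real_indicator) auto
  have "(f x)^2 \<le> C^2 * indicator (cball (0::conf2) R) x" for x
  proof (cases "f x = 0")
   case False
   have "\<bar>f x\<bar>\<^sup>2 \<le> C^2" using f(3)[of x] by (intro power_mono) auto
   then show ?thesis using R False by auto
  qed simp
  then show "AE x in lborel. norm ((f x)^2) \<le> norm (C^2 * indicator (cball (0::conf2) R) x :: real)"
   by (intro AE_I2) (auto intro: order_trans[OF _ abs_ge_self])
 qed measurable
 from integrable_ball_div_norm[OF assms(1,2) f(1) this, of R]
 have "integrable lborel (\<lambda>x. indicator (cball 0 R) x * (f x / norm (p x)))" .
 moreover have "indicator (cball 0 R) x * (f x / norm (p x)) = f x / norm (p x)" for x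
  using R by (cases "f x = 0") (auto simp: indicator_def)
 ultimately show ?thesis by (simp only:)
qed

text \<open>The Laplacian of the distance is \<open>2 / r\<close> in three dimensions. Testing it
  with \<open>f^2\<close> and integrating by parts bounds twice the left-hand side by twice the
  integral of \<open>|f| |g|\<close>, and Young's inequality splits that product. Regularised
  distances make the integration by parts legitimate.\<close>

lemma inverse_norm_form_bound:
 fixes p :: "conf2 \<Rightarrow> real^3"
 assumes f: "C2GL f g l" "bounded {x. f x \<noteq> 0}"
  and i: "integrable lborel (\<lambda>x. gauss2 1 1 0 x / (norm (p x))^2)" and [measurable]: "p \<in> borel_measurable borel"
  and s: "\<And>n. n > 0 \<Longrightarrow> \<exists>gh lh. C2GL (\<lambda>x. smr n (p x)) gh lh \<and> (\<forall>x. norm (gh x) \<le> 1) \<and> (\<forall>x. lh x \<ge> 2 / smr n (p x))"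
  and nz: "AE x in lborel. p x \<noteq> 0"
 shows "integrable lborel (\<lambda>x. (f x)^2 / norm (p x))"
  "(LBINT x. (f x)^2 / norm (p x)) \<le> 1/4 * (LBINT x. g x \<bullet> g x) + (LBINT x. (f x)^2)"
proof -
 note c = C2GL_D[OF f(1)] and m = C2GL_measurable[OF f(1)] and sp = C2GL_support[OF f]
 have [measurable]: "f \<in> borel_measurable borel" "g \<in> borel_measurable borel" "l \<in> borel_measurable borel" using m by auto
 obtain C where C: "\<And>x. \<bar>f x\<bar> \<le> C" using continuous_bounded_support_bound[OF c(2) f(2)] by auto
 show i1: "integrable lborel (\<lambda>x. (f x)^2 / norm (p x))"
 proof (rule local_integrable_inverse_norm[OF i, of "\<lambda>x. (f x)^2" "C^2"])
  show "\<bar>(f x)\<^sup>2\<bar> \<le> C^2" for x using C[of x] by (simp add: abs_le_square_iff[symmetric])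
 qed (use f(2) in auto)
 have if2: "integrable lborel (\<lambda>x. (f x)^2)"
  by (rule integrable_continuous_bounded_support) (use c f(2) in \<open>auto intro!: continuous_intros\<close>)
 have ig2: "integrable lborel (\<lambda>x. g x \<bullet> g x)"
  by (rule integrable_continuous_bounded_support) (use c sp in \<open>auto intro!: continuous_intros elim: bounded_subset\<close>)
 define n where "n k = 1 / real (Suc k)" for k
 have n: "n k > 0" for k unfolding n_def by simp
 have sm: "smr (n k) y > 0" for k and y :: "real^3" by (rule smr_pos) (use n[of k] in simp)
 have [measurable]: "(\<lambda>x. smr (n k) (p x)) \<in> borel_measurable borel" for k by measurable
 have le: "(f x)^2 / smr (n k) (p x) \<le> (f x)^2 / norm (p x)" if "p x \<noteq> 0" for k x
  using that norm_le_smr[of "p x" "n k"] sm[of k "p x"] by (intro divide_left_mono) auto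
 have bd: "(LBINT x. (f x)^2 / smr (n k) (p x)) \<le> 1/4 * (LBINT x. g x \<bullet> g x) + (LBINT x. (f x)^2)" for k
 proof -
  obtain gh lh where h: "C2GL (\<lambda>x. smr (n k) (p x)) gh lh" "\<And>x. norm (gh x) \<le> 1" "\<And>x. lh x \<ge> 2 / smr (n k) (p x)"
   using s[OF n[of k]] by blast
  note ch = C2GL_D[OF h(1)]
  have F: "C2GL (\<lambda>x. (f x)^2) (\<lambda>x. (2 * f x) *\<^sub>R g x) (\<lambda>x. 2 * f x * l x + 2 * (g x \<bullet> g x))"
   by (rule C2GL_cong[OF C2GL_mult[OF f(1) f(1)]]) (auto simp: power2_eq_square scaleR_left.add[symmetric])
  have G: "(LBINT x. (f x)^2 * lh x + ((2 * f x) *\<^sub>R g x) \<bullet> gh x) = 0"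
   by (rule Green_identity[OF F h(1)]) (use f(2) in auto)
  have iS: "integrable lborel (\<lambda>x. (f x)^2 / smr (n k) (p x))"
   by (rule integrable_continuous_bounded_support)
     (use c f(2) ch(2) sm[of k] in \<open>auto intro!: continuous_intros simp: less_imp_neq[symmetric] elim: bounded_subset\<close>)
  have "(LBINT x. 2 * ((f x)^2 / smr (n k) (p x)) - (1/2 * (g x \<bullet> g x) + 2 * (f x)^2)) \<le> (LBINT x. (f x)^2 * lh x + ((2 * f x) *\<^sub>R g x) \<bullet> gh x)"
  proof (rule integral_mono)
   show "integrable lborel (\<lambda>x. 2 * ((f x)^2 / smr (n k) (p x)) - (1/2 * (g x \<bullet> g x) + 2 * (f x)^2))"
    by (intro bintegrable_diff bintegrable_add integrable_mult_right iS if2 ig2)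
   have "{x. (f x)^2 * lh x + ((2 * f x) *\<^sub>R g x) \<bullet> gh x \<noteq> 0} \<subseteq> {x. f x \<noteq> 0}" by auto
   from bounded_subset[OF f(2) this]
   show "integrable lborel (\<lambda>x. (f x)^2 * lh x + ((2 * f x) *\<^sub>R g x) \<bullet> gh x)"
    by (intro integrable_continuous_bounded_support continuous_intros c(2,3) ch(3,4))
   fix x
   have "\<bar>g x \<bullet> gh x\<bar> \<le> norm (g x) * norm (gh x)" by (rule Cauchy_Schwarz_ineq2)
   also have "\<dots> \<le> norm (g x) * 1" by (intro mult_left_mono h(2)) simp
   finally have "\<bar>f x\<bar> * \<bar>g x \<bullet> gh x\<bar> \<le> \<bar>f x\<bar> * norm (g x)" by (intro mult_left_mono) auto
   moreover have "2 * (\<bar>f x\<bar> * norm (g x)) \<le> 1/2 * (norm (g x))^2 + 2 * \<bar>f x\<bar>\<^sup>2"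
    using zero_le_power2[of "norm (g x) - 2 * \<bar>f x\<bar>"] unfolding power2_diff by (simp add: power_mult_distrib algebra_simps)
   ultimately have "- (1/2 * (g x \<bullet> g x) + 2 * (f x)^2) \<le> 2 * (f x * (g x \<bullet> gh x))"
    using abs_ge_minus_self[of "f x * (g x \<bullet> gh x)"] unfolding abs_mult by (simp add: power2_norm_eq_inner)
   moreover have "(f x)^2 * (2 / smr (n k) (p x)) \<le> (f x)^2 * lh x" by (intro mult_left_mono h(3)) simp
   ultimately show "2 * ((f x)^2 / smr (n k) (p x)) - (1/2 * (g x \<bullet> g x) + 2 * (f x)^2) \<le> (f x)^2 * lh x + ((2 * f x) *\<^sub>R g x) \<bullet> gh x"
    by simp
  qed
  also have "\<dots> = 0" by (rule G)
  also have "(LBINT x. 2 * ((f x)^2 / smr (n k) (p x)) - (1/2 * (g x \<bullet> g x) + 2 * (f x)^2))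
   = 2 * (LBINT x. (f x)^2 / smr (n k) (p x)) - (1/2 * (LBINT x. g x \<bullet> g x) + 2 * (LBINT x. (f x)^2))"
   using iS if2 ig2
   by (simp only: bintegral_add bintegral_diff bintegrable_add
    integrable_mult_right integral_mult_right_zero)
  finally show ?thesis by linarith
 qed
 have "(\<lambda>k. LBINT x. (f x)^2 / smr (n k) (p x)) \<longlonglongrightarrow> (LBINT x. (f x)^2 / norm (p x))"
 proof (rule integral_dominated_convergence[OF _ _ i1])
  show "AE x in lborel. (\<lambda>k. (f x)^2 / smr (n k) (p x)) \<longlonglongrightarrow> (f x)^2 / norm (p x)"
   using nz
  proof eventually_elim
   case (elim x)
   have "(\<lambda>k. smr (n k) (p x)) \<longlonglongrightarrow> sqrt ((norm (p x))^2 + 0^2)"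
    unfolding smr_def n_def by (intro tendsto_intros LIMSEQ_Suc[OF lim_1_over_n])
   then show ?case using elim by (intro tendsto_divide tendsto_const) auto
  qed
  show "AE x in lborel. norm ((f x)^2 / smr (n k) (p x)) \<le> (f x)^2 / norm (p x)" for k
   using nz
  proof eventually_elim
   case (elim x)
   then show ?case using le[OF elim, of k] sm[of k "p x"] by simp
  qed
 qed measurable
 then show "(LBINT x. (f x)^2 / norm (p x)) \<le> 1/4 * (LBINT x. g x \<bullet> g x) + (LBINT x. (f x)^2)"
  by (rule LIMSEQ_le_const2) (use bd in auto)
qed

text \<open>Since the norm is at most \<open>smr n\<close>, the subtracted term of the Laplacian
  \<open>3 / q - r^2 / q^3\<close> is at most \<open>1 / q\<close>; this is the input for the form
  bound at either nucleus term.\<close>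

lemma smr_projection_bounds:
 assumes "n > 0"
 shows "\<exists>gh lh. C2GL (\<lambda>x::conf2. smr n (fst x)) gh lh \<and> (\<forall>x. norm (gh x) \<le> 1) \<and> (\<forall>x. lh x \<ge> 2 / smr n (fst x))"
  "\<exists>gh lh. C2GL (\<lambda>x::conf2. smr n (snd x)) gh lh \<and> (\<forall>x. norm (gh x) \<le> 1) \<and> (\<forall>x. lh x \<ge> 2 / smr n (snd x))"
proof -
 have n0: "n \<noteq> 0" using assms by simp
 have s: "smr n z > 0" for z :: "real^3" by (rule smr_pos[OF n0])
 have a: "norm ((1 / smr n z) *\<^sub>R z) \<le> 1" for z :: "real^3" using s[of z] norm_le_smr[of z n] by simp
 have b: "3 / smr n z - (norm z)^2 / smr n z ^ 3 \<ge> 2 / smr n z" for z :: "real^3"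
 proof -
  have "(norm z)^2 / smr n z ^ 3 \<le> (smr n z)^2 / smr n z ^ 3" using s[of z] norm_le_smr[of z n] by (intro divide_right_mono power_mono) auto
  also have "\<dots> = 1 / smr n z" using s[of z] by (simp add: power2_eq_square power3_eq_cube)
  finally show ?thesis by simp
 qed
 show "\<exists>gh lh. C2GL (\<lambda>x::conf2. smr n (fst x)) gh lh \<and> (\<forall>x. norm (gh x) \<le> 1) \<and> (\<forall>x. lh x \<ge> 2 / smr n (fst x))"
  using C2GL_smr_fst[OF n0] a b by (intro exI conjI) (assumption | simp add: norm_Pair)+
 show "\<exists>gh lh. C2GL (\<lambda>x::conf2. smr n (snd x)) gh lh \<and> (\<forall>x. norm (gh x) \<le> 1) \<and> (\<forall>x. lh x \<ge> 2 / smr n (snd x))"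
  using C2GL_smr_snd[OF n0] a b by (intro exI conjI) (assumption | simp add: norm_Pair)+
qed

text \<open>\<open>E2\<close> is an infimum of reals, so a trial function bounds it only once the
  set is known to be bounded below. Each of the two attraction terms takes one quarter of the
  integral of \<open>g \<bullet> g\<close>, together exactly the kinetic energy, and one copy of the
  squared norm of \<open>f\<close>; the repulsion is nonnegative.\<close>

lemma Rayleigh_quotient_bounded_below:
 assumes "test_fun f"
 shows "(\<integral>x. f x * H2 1 f x \<partial>lebesgue) / (\<integral>x. (f x)^2 \<partial>lebesgue) \<ge> - 2"
proof -
 have f: "bounded {x. f x \<noteq> 0}" using assms unfolding test_fun_def by blast
 obtain g l where c: "C2GL f g l" using test_fun_C2GL[OF assms] by blast
 note C = C2GL_D[OF c] and sp = C2GL_support[OF c f]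
 have [measurable]: "f \<in> borel_measurable borel" "g \<in> borel_measurable borel" "l \<in> borel_measurable borel" using C2GL_measurable[OF c] by auto
 have H: "H2 1 f x = - (1/2) * l x + V2 1 x * f x" for x unfolding H2_def C2GL_laplacian[OF c] ..
 have nz: "AE x in (lborel::conf2 measure). fst x \<noteq> 0" "AE x in (lborel::conf2 measure). snd x \<noteq> 0"
  using AE_conf2_nonzero by (auto elim: eventually_mono)
 have b1: "integrable lborel (\<lambda>x. (f x)^2 / norm (fst x))"
  "(LBINT x. (f x)^2 / norm (fst x)) \<le> 1/4 * (LBINT x. g x \<bullet> g x) + (LBINT x. (f x)^2)"
  by (rule inverse_norm_form_bound(1)[OF c f inverse_square_gauss2_integrable(1) conf2_projections_measurable(1) _ nz(1)], erule smr_projection_bounds(1))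
    (rule inverse_norm_form_bound(2)[OF c f inverse_square_gauss2_integrable(1) conf2_projections_measurable(1) _ nz(1)], erule smr_projection_bounds(1))
 have b2: "integrable lborel (\<lambda>x. (f x)^2 / norm (snd x))"
  "(LBINT x. (f x)^2 / norm (snd x)) \<le> 1/4 * (LBINT x. g x \<bullet> g x) + (LBINT x. (f x)^2)"
  by (rule inverse_norm_form_bound(1)[OF c f inverse_square_gauss2_integrable(2) conf2_projections_measurable(2) _ nz(2)], erule smr_projection_bounds(2))
    (rule inverse_norm_form_bound(2)[OF c f inverse_square_gauss2_integrable(2) conf2_projections_measurable(2) _ nz(2)], erule smr_projection_bounds(2))
 obtain K where K: "\<And>x. \<bar>f x\<bar> \<le> K" using continuous_bounded_support_bound[OF C(2) f] by auto
 have i3: "integrable lborel (\<lambda>x. (f x)^2 / norm (fst x - snd x))"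
 proof (rule local_integrable_inverse_norm[OF inverse_square_gauss2_integrable(3) conf2_projections_measurable(3), of "\<lambda>x. (f x)^2" "K^2"])
  show "\<bar>(f x)\<^sup>2\<bar> \<le> K^2" for x using K[of x] by (simp add: abs_le_square_iff[symmetric])
 qed (use f in auto)
 have if2: "integrable lborel (\<lambda>x. (f x)^2)"
  by (rule integrable_continuous_bounded_support) (use C f in \<open>auto intro!: continuous_intros\<close>)
 have ig2: "integrable lborel (\<lambda>x. g x \<bullet> g x)"
  by (rule integrable_continuous_bounded_support) (use C sp in \<open>auto intro!: continuous_intros elim: bounded_subset\<close>)
 have ifl: "integrable lborel (\<lambda>x. f x * l x)" by (rule integrable_continuous_support_mult[OF C(2,4) f])
 have Gr: "(LBINT x. f x * l x) = - (LBINT x. g x \<bullet> g x)"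
  using Green_identity[OF c c] f ifl ig2 by (simp add: bintegral_add)
 have e: "f x * H2 1 f x = - (1/2) * (f x * l x) + (- ((f x)^2 / norm (fst x)) - (f x)^2 / norm (snd x) + (f x)^2 / norm (fst x - snd x))" for x
  unfolding H V2_def by (simp add: field_simps power2_eq_square)
 have [measurable]: "(\<lambda>x. f x * H2 1 f x) \<in> borel_measurable borel" unfolding H by measurable
 have "(\<integral>x. f x * H2 1 f x \<partial>lebesgue) = (LBINT x. f x * H2 1 f x)" by (rule integral_completion) measurable
 also have "\<dots> = - (1/2) * (LBINT x. f x * l x) + (- (LBINT x. (f x)^2 / norm (fst x)) - (LBINT x. (f x)^2 / norm (snd x)) + (LBINT x. (f x)^2 / norm (fst x - snd x)))"
  unfolding e using ifl b1(1) b2(1) i3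
  by (simp only: bintegral_add bintegral_diff integral_minus bintegrable_add bintegrable_diff
    integrable_minus integrable_mult_right integral_mult_right_zero)
 also have "\<dots> \<ge> - 2 * (LBINT x. (f x)^2)"
 proof -
  have "(LBINT x. (f x)^2 / norm (fst x - snd x)) \<ge> 0" by (rule integral_nonneg_AE) simp
  then show ?thesis unfolding Gr using b1(2) b2(2) by linarith
 qed
 finally have 1: "(\<integral>x. f x * H2 1 f x \<partial>lebesgue) \<ge> - 2 * (LBINT x. (f x)^2)" .
 have 2: "(\<integral>x. (f x)^2 \<partial>lebesgue) = (LBINT x. (f x)^2)" by (rule integral_completion) measurable
 have 3: "(LBINT x. (f x)^2) \<ge> 0" by (rule integral_nonneg_AE) simp
 show ?thesis
 \<comment> \<open>A vanishing denominator makes the quotient zero by the convention for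
   division.\<close>
 proof (cases "(LBINT x. (f x)^2) = 0")
  case False
  then have "(LBINT x. (f x)^2) > 0" using 3 by linarith
  then show ?thesis using 1 unfolding 2 by (subst pos_le_divide_eq)
 qed (use 2 in simp)
qed

text \<open>The sign of \<open>c\<close> excludes the zero function, whose quotient is zero by
  convention.\<close>

lemma E2_less:
 assumes "test_fun f" "(\<integral>x. f x * H2 1 f x \<partial>lebesgue) / (\<integral>x. (f x)^2 \<partial>lebesgue) < c" "c < 0"
 shows "E2 1 < c"
proof -
 have "f \<noteq> (\<lambda>_. 0)" using assms(2,3) by auto
 then have "E2 1 \<le> (\<integral>x. f x * H2 1 f x \<partial>lebesgue) / (\<integral>x. (f x)^2 \<partial>lebesgue)"
  unfolding E2_def using assms(1) Rayleigh_quotient_bounded_below by (intro cInf_lower bdd_belowI[of _ "- 2"]) auto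
 then show ?thesis using assms(2) by simp
qed

section \<open>Coulomb integrals and second moments of Gaussians\<close>

lemma nn_integral_inverse_cube:
 assumes "P > 0" "q > (0::real)"
 shows "(\<integral>\<^sup>+t. ennreal (1 / sqrt (P + q * t^2) ^ 3) \<partial>lborel) = ennreal (2 / (P * sqrt q))"
proof -
 define F where "F t = t / (P * sqrt (P + q * t^2))" for t
 have pos: "P + q * t^2 > 0" for t using assms by (simp add: add_pos_nonneg)
 have F: "(F has_real_derivative 1 / sqrt (P + q * t^2) ^ 3) (at t)" for t
 proof -
  define s where "s = sqrt (P + q * t^2)"
  have s: "s > 0" "s^2 = P + q * t^2" unfolding s_def using pos[of t] by auto
  have d: "((\<lambda>t. sqrt (P + q * t^2)) has_real_derivative q * t / s) (at t)"
   unfolding s_def using pos[of t] by (auto intro!: derivative_eq_intros simp: field_simps)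
  have "(F has_real_derivative (1 * (P * s) - t * (P * (q * t / s))) / ((P * s) * (P * s))) (at t)"
   unfolding F_def using DERIV_divide[OF DERIV_ident DERIV_cmult[OF d, of P]] s assms unfolding s_def by simp
  moreover have "(1 * (P * s) - t * (P * (q * t / s))) / ((P * s) * (P * s)) = 1 / s ^ 3"
  proof -
   have "(1 * (P * s) - t * (P * (q * t / s))) = P * (s^2 - q * t^2) / s" using s(1) by (simp add: field_simps power2_eq_square)
   also have "\<dots> = P * P / s" unfolding s(2) by simp
   finally show ?thesis using s(1) assms by (simp add: power3_eq_cube)
  qed
  ultimately show ?thesis unfolding s_def by simp
 qed
 have lim: "(F \<longlongrightarrow> 1 / (P * sqrt q)) at_top" "(F \<longlongrightarrow> - 1 / (P * sqrt q)) at_bot"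
 proof -
  have t: "(F \<longlongrightarrow> 1 / (P * sqrt q)) at_top"
  proof (rule Lim_transform_eventually)
   have "((\<lambda>t. P / t^2) \<longlongrightarrow> 0) at_top" by real_asymp
   then have "((\<lambda>t. 1 / (P * sqrt (P / t^2 + q))) \<longlongrightarrow> 1 / (P * sqrt (0 + q))) at_top"
    using assms by (intro tendsto_intros) auto
   then show "((\<lambda>t. 1 / (P * sqrt (P / t^2 + q))) \<longlongrightarrow> 1 / (P * sqrt q)) at_top" by simp
   show "\<forall>\<^sub>F t in at_top. 1 / (P * sqrt (P / t^2 + q)) = F t"
    using eventually_gt_at_top[of 0]
   proof eventually_elim
    case (elim t)
    have "P / t^2 + q = (P + q * t^2) / t^2" using elim by (simp add: field_simps)
    then show ?case unfolding F_def using elim by (simp add: real_sqrt_divide)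
   qed
  qed
  then show "(F \<longlongrightarrow> 1 / (P * sqrt q)) at_top" .
  have "F t = - F (- t)" for t unfolding F_def by simp
  then have "F = (\<lambda>t. - F (- t))" by blast
  moreover have "((\<lambda>t. - F (- t)) \<longlongrightarrow> - (1 / (P * sqrt q))) at_bot"
   by (intro tendsto_minus filterlim_compose[OF t] filterlim_uminus_at_top_at_bot)
  ultimately show "(F \<longlongrightarrow> - 1 / (P * sqrt q)) at_bot" by simp
 qed
 note I = interval_integral_FTC_nonneg[of "-\<infinity>" "\<infinity>" F "\<lambda>t. 1 / sqrt (P + q * t^2) ^ 3" "- 1 / (P * sqrt q)" "1 / (P * sqrt q)"]
 have c: "isCont (\<lambda>t. 1 / sqrt (P + q * t^2) ^ 3) t" for t using pos[of t] by (intro continuous_intros) auto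
 have nn: "1 / sqrt (P + q * t^2) ^ 3 \<ge> 0" for t using pos[of t] by simp
 have i: "integrable lborel (\<lambda>t. 1 / sqrt (P + q * t^2) ^ 3)" "(LBINT t. 1 / sqrt (P + q * t^2) ^ 3) = 2 / (P * sqrt q)"
 proof -
  have "set_integrable lborel (einterval (-\<infinity>) \<infinity>) (\<lambda>t. 1 / sqrt (P + q * t^2) ^ 3)"
   by (rule I(1)) (use F c nn lim in \<open>auto simp: ereal_tendsto_simps\<close>)
  then show "integrable lborel (\<lambda>t. 1 / sqrt (P + q * t^2) ^ 3)" unfolding set_integrable_def by simp
  have "(LBINT t=-\<infinity>..\<infinity>. 1 / sqrt (P + q * t^2) ^ 3) = 1 / (P * sqrt q) - - 1 / (P * sqrt q)"
   by (rule I(2)) (use F c nn lim in \<open>auto simp: ereal_tendsto_simps\<close>)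
  then show "(LBINT t. 1 / sqrt (P + q * t^2) ^ 3) = 2 / (P * sqrt q)"
   unfolding interval_lebesgue_integral_def set_lebesgue_integral_def by simp
 qed
 show ?thesis using nn_integral_eq_integral[OF i(1)] nn unfolding i(2) by simp
qed

text \<open>\<open>1 / r\<close> is \<open>1 / sqrt pi\<close> times the integral of
  \<open>exp (- r^2 t^2)\<close> over the real line. The Coulomb integral thus becomes an integral
  over Gaussian integrals with determinant \<open>a b + q t^2\<close>, whose power
  \<open>- 3/2\<close> has an elementary antiderivative.\<close>

lemma coulomb_gauss2:
 fixes p :: "conf2 \<Rightarrow> real^3"
 assumes a: "a > 0" and b: "b > 0" and [measurable]: "p \<in> borel_measurable borel"
  and g: "\<And>t x. gauss2 a b 0 x * exp (- (norm (p x))\<^sup>2 * (t - 0)^2) = gauss2 (a + ka * t^2) (b + kb * t^2) (kg * t^2) x"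
  and k: "ka \<ge> 0" "kb \<ge> 0" "kg \<ge> 0" "q > 0"
   "\<And>t. (a + ka * t^2) * (b + kb * t^2) + (a + ka * t^2) * (kg * t^2) + (b + kb * t^2) * (kg * t^2) = a * b + q * t^2"
  and nz: "AE x in lborel. p x \<noteq> 0"
 shows "integrable lborel (\<lambda>x. gauss2 a b 0 x / norm (p x))"
  "(LBINT x. gauss2 a b 0 x / norm (p x)) = pi ^ 3 * (2 / sqrt pi / (a * b) * (1 / sqrt q))"
proof -
 define c where "c = pi ^ 3 * (2 / sqrt pi / (a * b) * (1 / sqrt q))"
 have c: "c \<ge> 0" unfolding c_def using a b k by simp
 have "(\<integral>\<^sup>+x. ennreal (gauss2 a b 0 x / norm (p x)) \<partial>lborel)
   = (\<integral>\<^sup>+x. (\<integral>\<^sup>+t. ennreal (1 / sqrt pi) * ennreal (gauss2 (a + ka * t^2) (b + kb * t^2) (kg * t^2) x) \<partial>lborel) \<partial>lborel)"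
 proof (rule nn_integral_cong_AE, use nz in eventually_elim)
  case (elim x)
  then have s: "(norm (p x))^2 > 0" by simp
  have "(\<integral>\<^sup>+t. ennreal (1 / sqrt pi) * ennreal (gauss2 (a + ka * t^2) (b + kb * t^2) (kg * t^2) x) \<partial>lborel)
   = (\<integral>\<^sup>+t. ennreal (1 / sqrt pi * gauss2 a b 0 x) * ennreal (exp (- (norm (p x))\<^sup>2 * (t - 0)^2)) \<partial>lborel)"
   using gauss2_pos[of a b 0 x] by (intro nn_integral_cong) (simp add: g[symmetric] flip: ennreal_mult)
  also have "\<dots> = ennreal (1 / sqrt pi * gauss2 a b 0 x) * ennreal (sqrt (pi / (norm (p x))^2))"
   unfolding nn_integral_gaussian_real[OF s, of 0, symmetric] by (rule nn_integral_cmult) measurable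
  also have "\<dots> = ennreal (gauss2 a b 0 x / norm (p x))"
   using gauss2_pos[of a b 0 x] by (simp add: real_sqrt_divide flip: ennreal_mult)
  finally show ?case by simp
 qed
 also have "\<dots> = (\<integral>\<^sup>+t. (\<integral>\<^sup>+x. ennreal (1 / sqrt pi) * ennreal (gauss2 (a + ka * t^2) (b + kb * t^2) (kg * t^2) x) \<partial>lborel) \<partial>lborel)"
 proof (rule lborel_pair.Fubini'[symmetric])
  have [measurable]: "(\<lambda>z::conf2 \<times> real. gauss2 (a + ka * (snd z)^2) (b + kb * (snd z)^2) (kg * (snd z)^2) (fst z)) \<in> borel_measurable borel"
   unfolding gauss2_def by (intro borel_measurable_continuous_onI continuous_intros)+
  show "(\<lambda>(x, t). ennreal (1 / sqrt pi) * ennreal (gauss2 (a + ka * t^2) (b + kb * t^2) (kg * t^2) x)) \<in> borel_measurable (lborel \<Otimes>\<^sub>M lborel)"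
   unfolding lborel_prod split_beta' by measurable
 qed
 also have "\<dots> = (\<integral>\<^sup>+t. ennreal (pi ^ 3 / sqrt pi) * ennreal (1 / sqrt (a * b + q * t^2) ^ 3) \<partial>lborel)"
 proof (rule nn_integral_cong)
  fix t :: real
  have ab: "a * b > 0" using a b by simp
  have "(\<integral>\<^sup>+x. ennreal (gauss2 (a + ka * t^2) (b + kb * t^2) (kg * t^2) x) \<partial>lborel) = ennreal (pi ^ 3 / sqrt (a * b + q * t^2) ^ 3)"
   unfolding k(5)[symmetric] by (rule nn_integral_gauss2) (use a b k in \<open>auto simp: add_pos_nonneg\<close>)
  moreover have "(\<integral>\<^sup>+x. ennreal (1 / sqrt pi) * ennreal (gauss2 (a + ka * t^2) (b + kb * t^2) (kg * t^2) x) \<partial>lborel)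
   = ennreal (1 / sqrt pi) * (\<integral>\<^sup>+x. ennreal (gauss2 (a + ka * t^2) (b + kb * t^2) (kg * t^2) x) \<partial>lborel)"
   by (rule nn_integral_cmult) measurable
  moreover have "a * b + q * t^2 \<ge> 0" using ab k by simp
  ultimately show "(\<integral>\<^sup>+x. ennreal (1 / sqrt pi) * ennreal (gauss2 (a + ka * t^2) (b + kb * t^2) (kg * t^2) x) \<partial>lborel)
    = ennreal (pi ^ 3 / sqrt pi) * ennreal (1 / sqrt (a * b + q * t^2) ^ 3)"
   by (simp flip: ennreal_mult)
 qed
 also have "\<dots> = ennreal (pi ^ 3 / sqrt pi) * ennreal (2 / (a * b * sqrt q))"
  using a b k(4) by (subst nn_integral_cmult) (auto simp: nn_integral_inverse_cube)
 also have "\<dots> = ennreal c" unfolding c_def using a b k by (simp add: ac_simps flip: ennreal_mult)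
 finally have *: "(\<integral>\<^sup>+x. ennreal (gauss2 a b 0 x / norm (p x)) \<partial>lborel) = ennreal c" .
 show i: "integrable lborel (\<lambda>x. gauss2 a b 0 x / norm (p x))"
  by (rule integrableI_bounded) (use * gauss2_pos[of a b 0] in \<open>auto simp: abs_of_pos\<close>)
 have "ennreal (LBINT x. gauss2 a b 0 x / norm (p x)) = ennreal c"
  using nn_integral_eq_integral[OF i] * gauss2_pos[of a b 0] by (simp add: less_imp_le)
 then show "(LBINT x. gauss2 a b 0 x / norm (p x)) = pi ^ 3 * (2 / sqrt pi / (a * b) * (1 / sqrt q))"
  unfolding c_def[symmetric] using c gauss2_pos[of a b 0] by (subst (asm) ennreal_inj) (auto intro!: integral_nonneg_AE simp: less_imp_le)
qed

text \<open>The moment enters the energy with a negative sign, so a lower bound is what counts. The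
  quotients \<open>(1 - exp (- h r^2)) / h\<close> lie below \<open>r^2\<close>, and their integrals
  converge, as \<open>h\<close> decreases to zero, to minus the derivative of the Gaussian integral
  in its exponent.\<close>

lemma moment_gauss2:
 fixes p :: "conf2 \<Rightarrow> real^3"
 assumes ab: "a > 0" "b > 0" and [measurable]: "p \<in> borel_measurable borel"
  and g: "\<And>t x. G t x = G 0 x * exp (- t * (norm (p x))^2)"
  and m[measurable]: "\<And>t. G t \<in> borel_measurable borel" and G0: "\<And>x. G 0 x > 0"
  and I: "\<And>t. t > - a \<Longrightarrow> integrable lborel (G t)" "\<And>t. t > - a \<Longrightarrow> (LBINT x. G t x) = pi ^ 3 / sqrt ((a + t) * b) ^ 3"
 shows "integrable lborel (\<lambda>x. G 0 x * (norm (p x))^2)"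
  "(LBINT x. G 0 x * (norm (p x))^2) \<ge> pi ^ 3 * (3 / (2 * a) / sqrt (a * b) ^ 3)"
proof -
 show i: "integrable lborel (\<lambda>x. G 0 x * (norm (p x))^2)"
 proof (rule bintegrable_bound)
  \<comment> \<open>Half of the decay in this variable is given up to dominate the quadratic
    factor.\<close>
  show "integrable lborel (\<lambda>x. 2 / a * G (- a / 2) x)" by (intro integrable_mult_right I) (use ab in auto)
  show "AE x in lborel. norm (G 0 x * (norm (p x))^2) \<le> norm (2 / a * G (- a / 2) x)"
  proof (rule AE_I2)
   fix x
   have "a / 2 * (norm (p x))^2 \<le> exp (a / 2 * (norm (p x))^2)" using exp_ge_add_one_self[of "a / 2 * (norm (p x))^2"] by linarith
   then have "2 / a * (a / 2 * (norm (p x))^2) \<le> 2 / a * exp (a / 2 * (norm (p x))^2)" using ab by (intro mult_left_mono) auto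
   then have "(norm (p x))^2 \<le> 2 / a * exp (a / 2 * (norm (p x))^2)" using ab by simp
   from mult_left_mono[OF this less_imp_le[OF G0[of x]]]
   show "norm (G 0 x * (norm (p x))^2) \<le> norm (2 / a * G (- a / 2) x)"
    unfolding g[of "- a / 2" x] using G0[of x] ab by (simp add: abs_mult ac_simps)
  qed
 qed measurable
 define F where "F t = - (1 / sqrt (t * b) ^ 3)" for t
 have F: "(F has_real_derivative 3 / (2 * a) / sqrt (a * b) ^ 3) (at a)"
 proof -
  define s where "s = sqrt (a * b)"
  have s: "s > 0" "s * s = a * b" unfolding s_def using mult_pos_pos[OF ab] by auto
  have "((\<lambda>t. sqrt (t * b)) has_real_derivative b / (2 * s)) (at a)"
  proof -
   have "((\<lambda>t. t * b) has_real_derivative b) (at a)" by (auto intro!: derivative_eq_intros)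
   from DERIV_chain2[OF DERIV_real_sqrt[OF mult_pos_pos[OF ab]] this]
   show ?thesis by (rule DERIV_cong) (simp add: s_def inverse_eq_divide)
  qed
  from DERIV_power[OF this, of 3]
  have d: "((\<lambda>t. sqrt (t * b) ^ 3) has_real_derivative 3 * s^2 * (b / (2 * s))) (at a)" unfolding s_def by (simp add: ac_simps)
  have "(F has_real_derivative - ((0 * s ^ 3 - 1 * (3 * s^2 * (b / (2 * s)))) / (s ^ 3 * s ^ 3))) (at a)"
   unfolding F_def s_def by (rule DERIV_minus[OF DERIV_divide[OF DERIV_const d[unfolded s_def]]]) (use ab in simp)
  moreover have "- ((0 * s ^ 3 - 1 * (3 * s^2 * (b / (2 * s)))) / (s ^ 3 * s ^ 3)) = 3 / (2 * a) / s ^ 3"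
  proof -
   have "b = s * s / a" using s ab by simp
   then show ?thesis using s(1) ab by (simp add: field_simps power2_eq_square power3_eq_cube)
  qed
  ultimately show ?thesis unfolding s_def by simp
 qed
 have "((\<lambda>h. pi ^ 3 * ((F (a + h) - F a) / h)) \<longlongrightarrow> pi ^ 3 * (3 / (2 * a) / sqrt (a * b) ^ 3)) (at_right 0)"
  using F unfolding DERIV_def by (intro tendsto_mult tendsto_const) (auto intro: filterlim_mono[OF _ order_refl at_le])
 moreover have "eventually (\<lambda>h. pi ^ 3 * ((F (a + h) - F a) / h) \<le> (LBINT x. G 0 x * (norm (p x))^2)) (at_right 0)"
  using eventually_at_right_less[of "0::real"]
 proof eventually_elim
  case (elim h)
  have "(LBINT x. 1 / h * (G 0 x - G h x)) \<le> (LBINT x. G 0 x * (norm (p x))^2)"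
  proof (rule integral_mono[OF _ i])
   show "integrable lborel (\<lambda>x. 1 / h * (G 0 x - G h x))" using elim ab by (intro integrable_mult_right bintegrable_diff I) auto
   fix x
   have "1 - exp (- h * (norm (p x))^2) \<le> h * (norm (p x))^2" using exp_ge_add_one_self[of "- h * (norm (p x))^2"] by linarith
   then have "1 / h * (1 - exp (- h * (norm (p x))^2)) \<le> 1 / h * (h * (norm (p x))^2)" using elim by (intro mult_left_mono) auto
   then have "1 / h * (1 - exp (- h * (norm (p x))^2)) \<le> (norm (p x))^2" using elim by simp
   from mult_left_mono[OF this less_imp_le[OF G0[of x]]]
   show "1 / h * (G 0 x - G h x) \<le> G 0 x * (norm (p x))^2" unfolding g[of h x] by (simp add: algebra_simps)
  qed
  moreover have "(LBINT x. 1 / h * (G 0 x - G h x)) = 1 / h * (pi ^ 3 / sqrt ((a + 0) * b) ^ 3 - pi ^ 3 / sqrt ((a + h) * b) ^ 3)"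
   using I[of 0] I[of h] elim ab by (simp add: bintegral_diff)
  moreover have "1 / h * (pi ^ 3 / sqrt ((a + 0) * b) ^ 3 - pi ^ 3 / sqrt ((a + h) * b) ^ 3) = pi ^ 3 * ((F (a + h) - F a) / h)"
   unfolding F_def by (simp add: algebra_simps diff_divide_distrib)
  ultimately show ?case by linarith
 qed
 ultimately show "(LBINT x. G 0 x * (norm (p x))^2) \<ge> pi ^ 3 * (3 / (2 * a) / sqrt (a * b) ^ 3)"
  by (rule tendsto_upperbound) simp
qed

lemma gauss2_moments:
 assumes ab: "a > 0" "b > 0"
 shows "integrable lborel (\<lambda>x. gauss2 a b 0 x * (norm (fst x))^2)"
  "(LBINT x. gauss2 a b 0 x * (norm (fst x))^2) \<ge> pi ^ 3 * (3 / (2 * a) / sqrt (a * b) ^ 3)"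
  "integrable lborel (\<lambda>x. gauss2 a b 0 x * (norm (snd x))^2)"
  "(LBINT x. gauss2 a b 0 x * (norm (snd x))^2) \<ge> pi ^ 3 * (3 / (2 * b) / sqrt (a * b) ^ 3)"
proof -
 have f: "gauss2 (a + t) b 0 x = gauss2 (a + 0) b 0 x * exp (- t * (norm (fst x))^2)"
  "gauss2 a (b + t) 0 x = gauss2 a (b + 0) 0 x * exp (- t * (norm (snd x))^2)" for t x
  unfolding gauss2_def by (simp_all add: algebra_simps flip: exp_add)
 note 1 = moment_gauss2[of a b fst "\<lambda>t. gauss2 (a + t) b 0", OF ab conf2_projections_measurable(1) f(1)]
 note 2 = moment_gauss2[of b a snd "\<lambda>t. gauss2 a (b + t) 0", OF ab(2,1) conf2_projections_measurable(2) f(2)]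
 show "integrable lborel (\<lambda>x. gauss2 a b 0 x * (norm (fst x))^2)"
  "(LBINT x. gauss2 a b 0 x * (norm (fst x))^2) \<ge> pi ^ 3 * (3 / (2 * a) / sqrt (a * b) ^ 3)"
  using 1 has_integral_gauss2[of "a + _" b 0] ab by (simp_all add: gauss2_pos)
 show "integrable lborel (\<lambda>x. gauss2 a b 0 x * (norm (snd x))^2)"
  "(LBINT x. gauss2 a b 0 x * (norm (snd x))^2) \<ge> pi ^ 3 * (3 / (2 * b) / sqrt (a * b) ^ 3)"
  using 2 has_integral_gauss2[of a "b + _" 0] ab by (simp_all add: gauss2_pos mult.commute)
qed

lemma gauss2_coulomb_integrals:
 assumes ab: "a > 0" "b > 0"
 shows "integrable lborel (\<lambda>x. gauss2 a b 0 x / norm (fst x))"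
  "(LBINT x. gauss2 a b 0 x / norm (fst x)) = pi ^ 3 * (2 / sqrt pi / (a * b) * (1 / sqrt b))"
  "integrable lborel (\<lambda>x. gauss2 a b 0 x / norm (snd x))"
  "(LBINT x. gauss2 a b 0 x / norm (snd x)) = pi ^ 3 * (2 / sqrt pi / (a * b) * (1 / sqrt a))"
  "integrable lborel (\<lambda>x. gauss2 a b 0 x / norm (fst x - snd x))"
  "(LBINT x. gauss2 a b 0 x / norm (fst x - snd x)) = pi ^ 3 * (2 / sqrt pi / (a * b) * (1 / sqrt (a + b)))"
proof -
 have nz: "AE x in (lborel::conf2 measure). fst x \<noteq> 0" "AE x in (lborel::conf2 measure). snd x \<noteq> 0"
  "AE x in (lborel::conf2 measure). fst x - snd x \<noteq> 0"
  using AE_conf2_nonzero by (auto elim: eventually_mono)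
 have g: "gauss2 a b 0 x * exp (- (norm (fst x))\<^sup>2 * (t - 0)^2) = gauss2 (a + 1 * t^2) (b + 0 * t^2) (0 * t^2) x"
  "gauss2 a b 0 x * exp (- (norm (snd x))\<^sup>2 * (t - 0)^2) = gauss2 (a + 0 * t^2) (b + 1 * t^2) (0 * t^2) x"
  "gauss2 a b 0 x * exp (- (norm (fst x - snd x))\<^sup>2 * (t - 0)^2) = gauss2 (a + 0 * t^2) (b + 0 * t^2) (1 * t^2) x" for t x
  unfolding gauss2_def by (simp_all add: algebra_simps flip: exp_add)
 show "integrable lborel (\<lambda>x. gauss2 a b 0 x / norm (fst x))"
  "(LBINT x. gauss2 a b 0 x / norm (fst x)) = pi ^ 3 * (2 / sqrt pi / (a * b) * (1 / sqrt b))"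
  by (rule coulomb_gauss2[where q=b, OF ab conf2_projections_measurable(1) g(1) _ _ _ _ _ nz(1)]; use ab in \<open>simp add: algebra_simps\<close>)+
 show "integrable lborel (\<lambda>x. gauss2 a b 0 x / norm (snd x))"
  "(LBINT x. gauss2 a b 0 x / norm (snd x)) = pi ^ 3 * (2 / sqrt pi / (a * b) * (1 / sqrt a))"
  by (rule coulomb_gauss2[where q=a, OF ab conf2_projections_measurable(2) g(2) _ _ _ _ _ nz(2)]; use ab in \<open>simp add: algebra_simps\<close>)+
 show "integrable lborel (\<lambda>x. gauss2 a b 0 x / norm (fst x - snd x))"
  "(LBINT x. gauss2 a b 0 x / norm (fst x - snd x)) = pi ^ 3 * (2 / sqrt pi / (a * b) * (1 / sqrt (a + b)))"
  by (rule coulomb_gauss2[where q="a + b", OF ab conf2_projections_measurable(3) g(3) _ _ _ _ _ nz(3)]; use ab in \<open>simp add: algebra_simps\<close>)+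
qed

section \<open>Trial functions of Gaussian decay in place of bounded support\<close>

definition gauss_decay :: "real \<Rightarrow> (conf2 \<Rightarrow> real) \<Rightarrow> (conf2 \<Rightarrow> conf2) \<Rightarrow> (conf2 \<Rightarrow> real) \<Rightarrow> bool" where
 "gauss_decay m f g l \<longleftrightarrow> C2GL f g l \<and> (\<exists>C\<ge>0. \<forall>x. \<bar>f x\<bar> \<le> C * gauss2 m m 0 x
   \<and> norm (g x) \<le> C * (1 + (norm x)^2) * gauss2 m m 0 x \<and> \<bar>l x\<bar> \<le> C * (1 + (norm x)^2) * gauss2 m m 0 x)"

lemma gauss_decay_add:
 assumes "gauss_decay m f1 g1 l1" "gauss_decay m f2 g2 l2"
 shows "gauss_decay m (\<lambda>x. f1 x + f2 x) (\<lambda>x. g1 x + g2 x) (\<lambda>x. l1 x + l2 x)"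
proof -
 obtain C1 where 1: "C1 \<ge> 0" "\<And>x. \<bar>f1 x\<bar> \<le> C1 * gauss2 m m 0 x" "\<And>x. norm (g1 x) \<le> C1 * (1 + (norm x)^2) * gauss2 m m 0 x"
  "\<And>x. \<bar>l1 x\<bar> \<le> C1 * (1 + (norm x)^2) * gauss2 m m 0 x" using assms(1) unfolding gauss_decay_def by blast
 obtain C2 where 2: "C2 \<ge> 0" "\<And>x. \<bar>f2 x\<bar> \<le> C2 * gauss2 m m 0 x" "\<And>x. norm (g2 x) \<le> C2 * (1 + (norm x)^2) * gauss2 m m 0 x"
  "\<And>x. \<bar>l2 x\<bar> \<le> C2 * (1 + (norm x)^2) * gauss2 m m 0 x" using assms(2) unfolding gauss_decay_def by blast
 have "\<bar>f1 x + f2 x\<bar> \<le> (C1 + C2) * gauss2 m m 0 x" "norm (g1 x + g2 x) \<le> (C1 + C2) * (1 + (norm x)^2) * gauss2 m m 0 x"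
  "\<bar>l1 x + l2 x\<bar> \<le> (C1 + C2) * (1 + (norm x)^2) * gauss2 m m 0 x" for x
  using 1(2-4)[of x] 2(2-4)[of x] norm_triangle_ineq[of "g1 x" "g2 x"] unfolding distrib_right by linarith+
 moreover have "C1 + C2 \<ge> 0" using 1(1) 2(1) by simp
 ultimately show ?thesis using C2GL_add assms unfolding gauss_decay_def by blast
qed

lemma gauss_decay_cmult:
 assumes "gauss_decay m f g l"
 shows "gauss_decay m (\<lambda>x. c * f x) (\<lambda>x. c *\<^sub>R g x) (\<lambda>x. c * l x)"
proof -
 obtain C where C: "C \<ge> 0" "\<And>x. \<bar>f x\<bar> \<le> C * gauss2 m m 0 x" "\<And>x. norm (g x) \<le> C * (1 + (norm x)^2) * gauss2 m m 0 x"
  "\<And>x. \<bar>l x\<bar> \<le> C * (1 + (norm x)^2) * gauss2 m m 0 x" using assms unfolding gauss_decay_def by blast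
 have "\<bar>c * f x\<bar> \<le> (\<bar>c\<bar> * C) * gauss2 m m 0 x" "norm (c *\<^sub>R g x) \<le> (\<bar>c\<bar> * C) * (1 + (norm x)^2) * gauss2 m m 0 x"
  "\<bar>c * l x\<bar> \<le> (\<bar>c\<bar> * C) * (1 + (norm x)^2) * gauss2 m m 0 x" for x
  using mult_left_mono[OF C(2), of "\<bar>c\<bar>" x] mult_left_mono[OF C(3), of "\<bar>c\<bar>" x] mult_left_mono[OF C(4), of "\<bar>c\<bar>" x]
  by (simp_all add: abs_mult mult.assoc)
 moreover have "\<bar>c\<bar> * C \<ge> 0" using C(1) by simp
 ultimately show ?thesis using C2GL_cmult assms unfolding gauss_decay_def by blast
qed

lemma gauss_decay_sum:
 assumes "finite I" "\<And>i. i \<in> I \<Longrightarrow> gauss_decay m (f i) (g i) (l i)"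
 shows "gauss_decay m (\<lambda>x. \<Sum>i\<in>I. f i x) (\<lambda>x. \<Sum>i\<in>I. g i x) (\<lambda>x. \<Sum>i\<in>I. l i x)"
 using assms
proof (induction I rule: finite_induct)
 case empty
 have "gauss_decay m (\<lambda>_. 0) (\<lambda>_. 0) (\<lambda>_. 0)" unfolding gauss_decay_def using C2GL_const[of 0] by (auto intro!: exI[of _ 0])
 then show ?case by simp
next
 case (insert i I)
 then show ?case using gauss_decay_add[of m "f i" "g i" "l i"] by simp
qed

text \<open>The Laplacian of \<open>gauss2 a b 0\<close> divided by
  \<open>gauss2 a b 0\<close>.\<close>

definition glap :: "real \<Rightarrow> real \<Rightarrow> conf2 \<Rightarrow> real" where
 "glap a b x = 4 * a^2 * (norm (fst x))^2 + 4 * b^2 * (norm (snd x))^2 - 6 * a - 6 * b"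

lemma gauss_decay_gauss2:
 assumes m: "m \<le> a" "m \<le> b" "m > 0"
 shows "gauss_decay m (gauss2 a b 0) (\<lambda>x. gauss2 a b 0 x *\<^sub>R (- (2 * a) *\<^sub>R fst x, - (2 * b) *\<^sub>R snd x)) (\<lambda>x. gauss2 a b 0 x * glap a b x)"
 unfolding gauss_decay_def
proof (intro conjI exI[of _ "1 + 6 * a + 6 * b + 4 * a^2 + 4 * b^2"] allI)
 note Q = C2GL_add[OF C2GL_cmult[OF C2GL_fst_sq, of "- a"] C2GL_cmult[OF C2GL_snd_sq, of "- b"]]
 show "C2GL (gauss2 a b 0) (\<lambda>x. gauss2 a b 0 x *\<^sub>R (- (2 * a) *\<^sub>R fst x, - (2 * b) *\<^sub>R snd x)) (\<lambda>x. gauss2 a b 0 x * glap a b x)"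
 proof (rule C2GL_cong[OF C2GL_exp[OF Q]])
  fix x :: conf2
  have e: "- a *\<^sub>R (2 *\<^sub>R fst x, 0::real^3) + - b *\<^sub>R (0::real^3, 2 *\<^sub>R snd x) = (- (2 * a) *\<^sub>R fst x, - (2 * b) *\<^sub>R snd x)"
   by (simp add: mult.commute)
  have ip: "(- (2 * a) *\<^sub>R fst x, - (2 * b) *\<^sub>R snd x) \<bullet> (- (2 * a) *\<^sub>R fst x, - (2 * b) *\<^sub>R snd x)
   = 4 * a^2 * (norm (fst x))^2 + 4 * b^2 * (norm (snd x))^2"
   unfolding power2_norm_eq_inner by (simp add: inner_Pair power2_eq_square)
  show G: "gauss2 a b 0 x = exp (- a * (norm (fst x))^2 + - b * (norm (snd x))^2)" unfolding gauss2_def by (simp add: algebra_simps)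
  show "gauss2 a b 0 x *\<^sub>R (- (2 * a) *\<^sub>R fst x, - (2 * b) *\<^sub>R snd x)
   = exp (- a * (norm (fst x))^2 + - b * (norm (snd x))^2) *\<^sub>R (- a *\<^sub>R (2 *\<^sub>R fst x, 0) + - b *\<^sub>R (0, 2 *\<^sub>R snd x))"
   unfolding e G ..
  show "gauss2 a b 0 x * glap a b x = exp (- a * (norm (fst x))^2 + - b * (norm (snd x))^2) * ((- a * (2 * real DIM(real^3)) + - b * (2 * real DIM(real^3)))
   + (- a *\<^sub>R (2 *\<^sub>R fst x, 0) + - b *\<^sub>R (0, 2 *\<^sub>R snd x)) \<bullet> (- a *\<^sub>R (2 *\<^sub>R fst x, 0) + - b *\<^sub>R (0, 2 *\<^sub>R snd x)))"
   unfolding e ip G glap_def by simp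
 qed
 define C where "C = 1 + 6 * a + 6 * b + 4 * a^2 + 4 * b^2"
 have ab: "a > 0" "b > 0" using m by auto
 then show C0: "1 + 6 * a + 6 * b + 4 * a^2 + 4 * b^2 \<ge> 0" by simp
 fix x :: conf2
 have G: "gauss2 a b 0 x \<le> gauss2 m m 0 x"    unfolding gauss2_def using mult_right_mono[OF m(1), of "(norm (fst x))^2"] mult_right_mono[OF m(2), of "(norm (snd x))^2"] by simp
 have Gp: "gauss2 a b 0 x > 0" "gauss2 m m 0 x > 0" by (rule gauss2_pos)+
 define n where "n = 1 + (norm x)^2"
 have n1: "n \<ge> 1" unfolding n_def by simp
 have nn: "norm x \<le> n"
 proof -
  have "2 * norm x \<le> 1 + (norm x)^2" using sum_squares_bound[of 1 "norm x"] by simp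
  then show ?thesis unfolding n_def using norm_ge_zero[of x] by linarith
 qed
 have xs: "(norm x)^2 = (norm (fst x))^2 + (norm (snd x))^2" by (simp add: norm_prod_def)
 have x12: "(norm (fst x))^2 \<le> n" "(norm (snd x))^2 \<le> n" unfolding n_def xs by auto
 have x12': "norm (fst x) \<le> n" "norm (snd x) \<le> n"
  using norm_fst_snd_diff_le[of x 0] nn by auto
 have *: "\<bar>gauss2 a b 0 x\<bar> * y \<le> C * z * gauss2 m m 0 x" if "y \<le> C * z" "0 \<le> y" for y z
  using mult_mono[OF G that(1)] that Gp by (simp add: ac_simps)
 have Cn: "C = 1 * C" by simp
 have "\<bar>gauss2 a b 0 x\<bar> * 1 \<le> C * 1 * gauss2 m m 0 x" by (rule *) (use ab in \<open>auto simp: C_def\<close>)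
 then show "\<bar>gauss2 a b 0 x\<bar> \<le> (1 + 6 * a + 6 * b + 4 * a^2 + 4 * b^2) * gauss2 m m 0 x" unfolding C_def by simp
 have "norm (- (2 * a) *\<^sub>R fst x, - (2 * b) *\<^sub>R snd x) \<le> 2 * a * norm (fst x) + 2 * b * norm (snd x)"
  using norm_Pair_le[of "- (2 * a) *\<^sub>R fst x" "- (2 * b) *\<^sub>R snd x"] ab by simp
 also have "\<dots> \<le> 2 * a * n + 2 * b * n" using ab by (intro add_mono mult_left_mono x12') auto
 also have "\<dots> = (2 * a + 2 * b) * n" by (simp add: algebra_simps)
 also have "\<dots> \<le> C * n" unfolding C_def using ab n1 by (intro mult_right_mono) auto
 finally have g: "norm (- (2 * a) *\<^sub>R fst x, - (2 * b) *\<^sub>R snd x) \<le> C * n" .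
 show "norm (gauss2 a b 0 x *\<^sub>R (- (2 * a) *\<^sub>R fst x, - (2 * b) *\<^sub>R snd x)) \<le> (1 + 6 * a + 6 * b + 4 * a^2 + 4 * b^2) * (1 + (norm x)^2) * gauss2 m m 0 x"
  unfolding norm_scaleR using *[OF g] unfolding C_def n_def by simp
 have "\<bar>glap a b x\<bar> \<le> 4 * a^2 * (norm (fst x))^2 + 4 * b^2 * (norm (snd x))^2 + 6 * a + 6 * b"
  unfolding glap_def using ab by (simp add: abs_le_iff add_nonneg_nonneg)
 also have "\<dots> \<le> 4 * a^2 * n + 4 * b^2 * n + 6 * a * n + 6 * b * n"
  using ab n1 by (intro add_mono mult_left_mono x12) auto
 also have "\<dots> \<le> C * n" unfolding C_def using n1 by (simp add: algebra_simps)
 finally have l: "\<bar>glap a b x\<bar> \<le> C * n" .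
 show "\<bar>gauss2 a b 0 x * glap a b x\<bar> \<le> (1 + 6 * a + 6 * b + 4 * a^2 + 4 * b^2) * (1 + (norm x)^2) * gauss2 m m 0 x"
  unfolding abs_mult using *[OF l] unfolding C_def n_def by simp
qed

text \<open>Gaussians are not of bounded support, so the trial function is cut off. The decay bounds
  furnish one integrable majorant for the energy densities of all cut-offs, the energies converge,
  and strict negativity survives for some \<open>k\<close>. The shift \<open>1/2\<close> is the
  modulus of \<open>E1 1\<close>.\<close>

lemma E2_less_gauss_decay:
 assumes f: "gauss_decay m f g l" and m: "m > 0"
  and neg: "(LBINT x. f x * (- (1/2) * l x) + (V2 1 x + 1/2) * (f x)^2) < 0"
 shows "E2 1 < - 1/2"
proof -
 obtain C where c: "C2GL f g l" and C: "C \<ge> 0" "\<And>x. \<bar>f x\<bar> \<le> C * gauss2 m m 0 x" "\<And>x. norm (g x) \<le> C * (1 + (norm x)^2) * gauss2 m m 0 x"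
  "\<And>x. \<bar>l x\<bar> \<le> C * (1 + (norm x)^2) * gauss2 m m 0 x" using f unfolding gauss_decay_def by blast
 obtain B :: "nat \<Rightarrow> conf2 \<Rightarrow> real" and GB LB where
  B: "\<And>k. C2GL (B k) (GB k) (LB k)" "\<And>k. bounded {x. B k x \<noteq> 0}" "\<And>k x. 0 \<le> B k x" "\<And>k x. B k x \<le> 1"
  "\<And>k x. norm (GB k x) \<le> 6" "\<And>k x. \<bar>LB k x\<bar> \<le> 6 * real DIM(conf2) + 24"
  "\<And>x. (\<lambda>k. B k x) \<longlonglongrightarrow> 1" "\<And>x. (\<lambda>k. GB k x) \<longlonglongrightarrow> 0" "\<And>x. (\<lambda>k. LB k x) \<longlonglongrightarrow> 0"
  using exhausting_cutoffs[where 'a=conf2] by blast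
 have LB60: "\<bar>LB k x\<bar> \<le> 60" for k x using B(6)[of k x] by simp
 have [measurable]: "f \<in> borel_measurable borel" "g \<in> borel_measurable borel" "l \<in> borel_measurable borel" using C2GL_measurable[OF c] by auto
 have [measurable]: "B k \<in> borel_measurable borel" "GB k \<in> borel_measurable borel" "LB k \<in> borel_measurable borel" for k
  using C2GL_measurable[OF B(1)] by auto
 define F where "F k x = f x * B k x" for k x
 define L where "L k x = f x * LB k x + B k x * l x + 2 * (g x \<bullet> GB k x)" for k x
 have CF: "C2GL (F k) (\<lambda>x. f x *\<^sub>R GB k x + B k x *\<^sub>R g x) (L k)" for k unfolding F_def L_def by (rule C2GL_mult[OF c B(1)])
 have bF: "bounded {x. F k x \<noteq> 0}" for k by (rule bounded_subset[OF B(2)[of k]]) (auto simp: F_def)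
 define q where "q k x = F k x * (- (1/2) * L k x) + (V2 1 x + 1/2) * (F k x)^2" for k x
 have [measurable]: "F k \<in> borel_measurable borel" "L k \<in> borel_measurable borel" for k using C2GL_measurable[OF CF] by auto
 have [measurable]: "q k \<in> borel_measurable borel" for k unfolding q_def by measurable
 define G where "G x = gauss2 (2 * m) (2 * m) 0 x" for x
 have GG: "gauss2 m m 0 x * gauss2 m m 0 x = G x" for x
  unfolding G_def gauss2_def by (simp add: algebra_simps flip: exp_add)
 define N where "N x = 1 + (norm x)^2" for x :: conf2
 have N: "N x \<ge> 1" for x unfolding N_def by simp
 \<comment> \<open>The kinetic part costs \<open>(60 + 1 + 12) / 2\<close> from the Laplacian of the
   cut-off, the Laplacian of \<open>f\<close> and the cross term; the shift by \<open>1/2\<close>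
   completes this to \<open>37\<close>.\<close>
 define D where "D x = C^2 * (37 * (N x * G x)) + C^2 * (G x / norm (fst x) + G x / norm (snd x) + G x / norm (fst x - snd x))" for x
 have m2: "2 * m > 0" using m by simp
 have iD: "integrable lborel D"
 proof -
  have e: "N x * G x = G x + (G x * (norm (fst x))^2 + G x * (norm (snd x))^2)" for x
  proof -
   have "(norm x)^2 = (norm (fst x))^2 + (norm (snd x))^2" by (simp add: norm_prod_def)
   then show ?thesis unfolding N_def by (simp add: algebra_simps)
  qed
  show ?thesis unfolding D_def e unfolding G_def
   by (intro bintegrable_add integrable_mult_right gauss2_moments gauss2_coulomb_integrals has_integral_gauss2 m2 order_refl)
 qed
 have ff: "\<bar>f x * y\<bar> \<le> C^2 * (N x * G x) * z" if "\<bar>y\<bar> \<le> C * N x * gauss2 m m 0 x * z" "z \<ge> 0" for x y z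
 proof -
  have "\<bar>f x\<bar> * \<bar>y\<bar> \<le> (C * gauss2 m m 0 x) * (C * N x * gauss2 m m 0 x * z)"
   using C(1) gauss2_pos[of m m 0 x] by (intro mult_mono C(2) that) auto
  also have "\<dots> = C^2 * (N x * (gauss2 m m 0 x * gauss2 m m 0 x)) * z" by (simp add: power2_eq_square)
  finally show ?thesis unfolding GG abs_mult .
 qed
 have bound: "\<bar>q k x\<bar> \<le> D x" for k x
 proof -
  have Np: "0 \<le> N x * G x" using N[of x] gauss2_pos[of "2 * m" "2 * m" 0 x] unfolding G_def by simp
  have f2: "(f x)^2 \<le> C^2 * G x"
  proof -
   have "\<bar>f x\<bar> * \<bar>f x\<bar> \<le> (C * gauss2 m m 0 x) * (C * gauss2 m m 0 x)"
    using C(1) gauss2_pos[of m m 0 x] by (intro mult_mono C(2)) auto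
   also have "\<dots> = C^2 * (gauss2 m m 0 x * gauss2 m m 0 x)" by (simp add: power2_eq_square)
   finally show ?thesis unfolding GG by (simp add: power2_eq_square)
  qed
  have fN: "\<bar>f x\<bar> \<le> C * N x * gauss2 m m 0 x * 1"
  proof -
   have "C * gauss2 m m 0 x * 1 \<le> C * gauss2 m m 0 x * N x" using N[of x] C(1) gauss2_pos[of m m 0 x] by (intro mult_left_mono) auto
   then show ?thesis using C(2)[of x] by (simp add: ac_simps)
  qed
  have b1: "\<bar>f x * (f x * LB k x)\<bar> \<le> C^2 * (N x * G x) * 60"
  proof (rule ff)
   show "\<bar>f x * LB k x\<bar> \<le> C * N x * gauss2 m m 0 x * 60"
    unfolding abs_mult by (rule mult_mono) (use fN LB60[of k x] in auto)
  qed simp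
  have b2: "\<bar>f x * (B k x * l x)\<bar> \<le> C^2 * (N x * G x) * 1"
  proof (rule ff)
   have "B k x * \<bar>l x\<bar> \<le> 1 * \<bar>l x\<bar>" by (intro mult_right_mono B(4)) simp
   then show "\<bar>B k x * l x\<bar> \<le> C * N x * gauss2 m m 0 x * 1"
    unfolding abs_mult N_def using C(4)[of x] B(3)[of k x] by simp
  qed simp
  have b3: "\<bar>f x * (2 * (g x \<bullet> GB k x))\<bar> \<le> C^2 * (N x * G x) * 12"
  proof (rule ff)
   have "\<bar>g x \<bullet> GB k x\<bar> \<le> norm (g x) * norm (GB k x)" by (rule Cauchy_Schwarz_ineq2)
   also have "\<dots> \<le> norm (g x) * 6" by (intro mult_left_mono B(5)) simp
   finally show "\<bar>2 * (g x \<bullet> GB k x)\<bar> \<le> C * N x * gauss2 m m 0 x * 12" unfolding N_def using C(3)[of x] by simp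
  qed simp
  have "\<bar>f x * L k x\<bar> \<le> 73 * (C^2 * (N x * G x))"
   unfolding L_def distrib_left using b1 b2 b3 by linarith
  moreover have "\<bar>F k x * (- (1/2) * L k x)\<bar> \<le> 1/2 * \<bar>f x * L k x\<bar>"
  proof -
   have "B k x * \<bar>f x * L k x\<bar> \<le> 1 * \<bar>f x * L k x\<bar>" by (intro mult_right_mono B(4)) simp
   moreover have "\<bar>F k x * (- (1/2) * L k x)\<bar> = 1/2 * (B k x * \<bar>f x * L k x\<bar>)"
    unfolding F_def using B(3)[of k x] by (simp add: abs_mult)
   ultimately show ?thesis by linarith
  qed
  ultimately have q1: "\<bar>F k x * (- (1/2) * L k x)\<bar> \<le> 73/2 * (C^2 * (N x * G x))" by linarith
  have F2: "(F k x)^2 \<le> C^2 * G x"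
  proof -
   have "(B k x)^2 \<le> 1" by (rule power_le_one[OF B(3,4)])
   then have "(f x)^2 * (B k x)^2 \<le> (f x)^2 * 1" by (intro mult_left_mono) auto
   then show ?thesis unfolding F_def power_mult_distrib using f2 by linarith
  qed
  define v where "v = 1 / norm (fst x) + 1 / norm (snd x) + 1 / norm (fst x - snd x)"
  have v: "\<bar>V2 1 x + 1/2\<bar> \<le> v + 1/2"
  proof -
   have "0 \<le> 1 / norm (fst x)" "0 \<le> 1 / norm (snd x)" "0 \<le> 1 / norm (fst x - snd x)" by simp_all
   moreover have "V2 1 x = - (1 / norm (fst x)) - 1 / norm (snd x) + 1 / norm (fst x - snd x)" unfolding V2_def by simp
   ultimately show ?thesis unfolding v_def by linarith
  qed
  have v0: "v \<ge> 0" unfolding v_def by (intro add_nonneg_nonneg) auto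
  have "\<bar>(V2 1 x + 1/2) * (F k x)\<^sup>2\<bar> \<le> (v + 1/2) * (C^2 * G x)"
   unfolding abs_mult abs_power2 using v0 by (intro mult_mono v F2) auto
  also have "\<dots> = C^2 * (G x / norm (fst x) + G x / norm (snd x) + G x / norm (fst x - snd x)) + 1/2 * (C^2 * G x)"
   unfolding v_def by (simp add: algebra_simps)
  also have "C^2 * G x \<le> C^2 * (N x * G x)"
  proof -
   have "1 * G x \<le> N x * G x" using N[of x] gauss2_pos[of "2 * m" "2 * m" 0 x] unfolding G_def by (intro mult_right_mono) auto
   then show ?thesis by (intro mult_left_mono) auto
  qed
  finally have "\<bar>(V2 1 x + 1/2) * (F k x)\<^sup>2\<bar> \<le> C^2 * (G x / norm (fst x) + G x / norm (snd x) + G x / norm (fst x - snd x)) + 1/2 * (C^2 * (N x * G x))"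
   by simp
  then show ?thesis unfolding q_def D_def using q1
   abs_triangle_ineq[of "F k x * (- (1/2) * L k x)" "(V2 1 x + 1/2) * (F k x)^2"] mult.left_commute[of "C^2" 37 "N x * G x"] by linarith
 qed
 have iq: "integrable lborel (q k)" for k
  by (rule bintegrable_bound[OF iD]) (auto intro!: AE_I2 order_trans[OF bound abs_ge_self])
 have "(\<lambda>k. LBINT x. q k x) \<longlonglongrightarrow> (LBINT x. f x * (- (1/2) * l x) + (V2 1 x + 1/2) * (f x)^2)"
 proof (rule integral_dominated_convergence[OF _ _ iD])
  show "AE x in lborel. (\<lambda>k. q k x) \<longlonglongrightarrow> f x * (- (1/2) * l x) + (V2 1 x + 1/2) * (f x)^2"
  proof (rule AE_I2)
   fix x
   have "(\<lambda>k. q k x) \<longlonglongrightarrow> (f x * 1) * (- (1/2) * (f x * 0 + 1 * l x + 2 * (g x \<bullet> 0))) + (V2 1 x + 1/2) * (f x * 1)^2"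
    unfolding q_def F_def L_def by (intro tendsto_intros B)
   then show "(\<lambda>k. q k x) \<longlonglongrightarrow> f x * (- (1/2) * l x) + (V2 1 x + 1/2) * (f x)^2" by simp
  qed
  show "AE x in lborel. norm (q k x) \<le> D x" for k using bound by simp
 qed measurable
 then have "eventually (\<lambda>k. (LBINT x. q k x) < 0) sequentially" using neg by (rule order_tendstoD(2))
 then obtain k where k: "(LBINT x. q k x) < 0" using eventually_happens sequentially_bot by blast
 have H: "F k x * H2 1 (F k) x = q k x - 1/2 * (F k x)^2" for x
  unfolding H2_def C2GL_laplacian[OF CF] q_def by (simp add: algebra_simps power2_eq_square)
 have iF: "integrable lborel (\<lambda>x. (F k x)^2)"
  by (rule integrable_continuous_bounded_support) (use C2GL_D(2)[OF CF] bF in \<open>auto intro!: continuous_intros\<close>)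
 have F0: "(LBINT x. (F k x)^2) \<noteq> 0"
 proof
  assume "(LBINT x. (F k x)^2) = 0"
  then have "AE x in lborel. (F k x)^2 = 0" using integral_nonneg_eq_0_iff_AE[OF iF] by simp
  then have "AE x in lborel. q k x = 0" by eventually_elim (simp add: q_def)
  then have "(LBINT x. q k x) = 0" by (rule integral_eq_zero_AE)
  then show False using k by simp
 qed
 moreover have "(LBINT x. (F k x)^2) \<ge> 0" by (rule integral_nonneg_AE) simp
 ultimately have Fp: "(LBINT x. (F k x)^2) > 0" by linarith
 have [measurable]: "(\<lambda>x. F k x * H2 1 (F k) x) \<in> borel_measurable borel" unfolding H by measurable
 have "(\<integral>x. F k x * H2 1 (F k) x \<partial>lebesgue) = (LBINT x. F k x * H2 1 (F k) x)" by (rule integral_completion) measurable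
 also have "\<dots> = (LBINT x. q k x) - 1/2 * (LBINT x. (F k x)^2)"
  unfolding H using iq[of k] iF by (simp add: bintegral_diff)
 also have "\<dots> < - 1/2 * (LBINT x. (F k x)^2)" using k by simp
 finally have "(\<integral>x. F k x * H2 1 (F k) x \<partial>lebesgue) / (LBINT x. (F k x)^2) < - 1/2"
  using Fp by (subst pos_divide_less_eq) auto
 moreover have "(\<integral>x. (F k x)^2 \<partial>lebesgue) = (LBINT x. (F k x)^2)" by (rule integral_completion) measurable
 ultimately show ?thesis using E2_less[OF C2GL_test_fun[OF CF bF], of k "- 1/2"] by simp
qed

text \<open>Matrix element of the Hamiltonian at charge one, shifted by \<open>1/2\<close>, between
  \<open>gauss2 a b 0\<close> and \<open>gauss2 a' b' 0\<close>, divided by \<open>pi ^ 3\<close>: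
  kinetic energy and shift in the first summand, Coulomb terms in the second.\<close>

definition pair_energy :: "real \<Rightarrow> real \<Rightarrow> real \<Rightarrow> real \<Rightarrow> real" where
 "pair_energy a b a' b' = (3 * a * a' / (a + a') + 3 * b * b' / (b + b') + 1/2) / sqrt ((a + a') * (b + b')) ^ 3
   + 2 / sqrt pi / ((a + a') * (b + b')) * (1 / sqrt (a + a' + (b + b')) - 1 / sqrt (a + a') - 1 / sqrt (b + b'))"

text \<open>The product of the two Gaussians is one Gaussian with added exponents, so every term
  reduces to a known integral. The second moments are known only from below, which gives an
  inequality in the direction wanted for an upper bound on the energy.\<close>

lemma gauss2_pair_energy:
 assumes p: "a > 0" "b > 0" "a' > 0" "b' > 0"
 defines "h \<equiv> \<lambda>x. gauss2 a' b' 0 x * (- (1/2) * (gauss2 a b 0 x * glap a b x)) + (V2 1 x + 1/2) * (gauss2 a b 0 x * gauss2 a' b' 0 x)"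
 shows "integrable lborel h" "(LBINT x. h x) \<le> pi ^ 3 * pair_energy a b a' b'"
proof -
 define A where "A = a + a'"
 define B where "B = b + b'"
 have AB: "A > 0" "B > 0" unfolding A_def B_def using p by auto
 define G where "G = gauss2 A B 0"
 have GG: "gauss2 a b 0 x * gauss2 a' b' 0 x = G x" for x
  unfolding G_def A_def B_def gauss2_def by (simp add: algebra_simps flip: exp_add)
 define k where "k = 3 * a + 3 * b + 1/2"
 have e: "h = (\<lambda>x. k * G x + - (2 * a^2) * (G x * (norm (fst x))^2) + - (2 * b^2) * (G x * (norm (snd x))^2)
   + - 1 * (G x / norm (fst x)) + - 1 * (G x / norm (snd x)) + G x / norm (fst x - snd x))"
 proof
  fix x
  have "h x = (gauss2 a b 0 x * gauss2 a' b' 0 x) * (- (1/2) * glap a b x + (V2 1 x + 1/2))" unfolding h_def by (simp add: algebra_simps)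
  then show "h x = k * G x + - (2 * a^2) * (G x * (norm (fst x))^2) + - (2 * b^2) * (G x * (norm (snd x))^2)
   + - 1 * (G x / norm (fst x)) + - 1 * (G x / norm (snd x)) + G x / norm (fst x - snd x)"
   unfolding GG V2_def glap_def k_def by (simp add: algebra_simps add_divide_distrib)
 qed
 note mo = gauss2_moments[OF AB, folded G_def] and co = gauss2_coulomb_integrals[OF AB, folded G_def]
 have gi: "integrable lborel G" "(LBINT x. G x) = pi ^ 3 / sqrt (A * B) ^ 3"
  using has_integral_gauss2[OF AB order_refl] unfolding G_def by simp_all
 show "integrable lborel h" unfolding e
  by (intro bintegrable_add integrable_mult_right gi mo co)
 have "(LBINT x. h x) = k * (LBINT x. G x) + - (2 * a^2) * (LBINT x. G x * (norm (fst x))^2) + - (2 * b^2) * (LBINT x. G x * (norm (snd x))^2)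
   + - 1 * (LBINT x. G x / norm (fst x)) + - 1 * (LBINT x. G x / norm (snd x)) + (LBINT x. G x / norm (fst x - snd x))"
  unfolding e using gi(1) mo(1,3) co(1,3,5)
  by (simp only: bintegral_add bintegrable_add integrable_mult_right integral_mult_right_zero)
 also have "\<dots> \<le> k * (pi ^ 3 / sqrt (A * B) ^ 3) + - (2 * a^2) * (pi ^ 3 * (3 / (2 * A) / sqrt (A * B) ^ 3)) + - (2 * b^2) * (pi ^ 3 * (3 / (2 * B) / sqrt (A * B) ^ 3))
   + - 1 * (pi ^ 3 * (2 / sqrt pi / (A * B) * (1 / sqrt B))) + - 1 * (pi ^ 3 * (2 / sqrt pi / (A * B) * (1 / sqrt A))) + pi ^ 3 * (2 / sqrt pi / (A * B) * (1 / sqrt (A + B)))"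
  unfolding gi(2) co(2,4,6) by (intro add_mono mult_left_mono_neg mo order_refl) auto
 also have "\<dots> = pi ^ 3 * ((k - 3 * a^2 / A - 3 * b^2 / B) / sqrt (A * B) ^ 3 + 2 / sqrt pi / (A * B) * (1 / sqrt (A + B) - 1 / sqrt A - 1 / sqrt B))"
  by (simp add: right_diff_distrib distrib_left diff_divide_distrib add_divide_distrib ac_simps)
 also have "k - 3 * a^2 / A - 3 * b^2 / B = 3 * a * a' / A + 3 * b * b' / B + 1/2"
 proof -
  have "3 * a - 3 * a^2 / A = 3 * a * a' / A" using AB unfolding A_def by (simp add: field_simps power2_eq_square)
  moreover have "3 * b - 3 * b^2 / B = 3 * b * b' / B" using AB unfolding B_def by (simp add: field_simps power2_eq_square)
  ultimately show ?thesis unfolding k_def by linarith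
 qed
 finally show "(LBINT x. h x) \<le> pi ^ 3 * pair_energy a b a' b'" unfolding pair_energy_def A_def B_def .
qed

text \<open>The energy is a quadratic form in the coefficients. Their positivity allows each matrix
  element to be replaced by its upper bound.\<close>

lemma E2_less_gaussian_sum:
 fixes a b c :: "'i \<Rightarrow> real"
 assumes I: "finite I" and m: "m > 0" and ab: "\<And>i. i \<in> I \<Longrightarrow> m \<le> a i" "\<And>i. i \<in> I \<Longrightarrow> m \<le> b i" "\<And>i. i \<in> I \<Longrightarrow> c i > 0"
  and neg: "(\<Sum>i\<in>I. \<Sum>j\<in>I. c i * c j * pair_energy (a i) (b i) (a j) (b j)) < 0"
 shows "E2 1 < - 1/2"
proof -
 have p: "a i > 0" "b i > 0" if "i \<in> I" for i using ab[OF that] m by linarith+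
 define F where "F i = gauss2 (a i) (b i) 0" for i
 define f where "f x = (\<Sum>i\<in>I. c i * F i x)" for x
 define g where "g x = (\<Sum>i\<in>I. c i *\<^sub>R (F i x *\<^sub>R (- (2 * a i) *\<^sub>R fst x, - (2 * b i) *\<^sub>R snd x)))" for x
 define l where "l x = (\<Sum>i\<in>I. c i * (F i x * glap (a i) (b i) x))" for x
 have d: "gauss_decay m f g l" unfolding f_def g_def l_def F_def
  by (intro gauss_decay_sum[OF I] gauss_decay_cmult gauss_decay_gauss2 ab m)
 define h where "h i j x = F j x * (- (1/2) * (F i x * glap (a i) (b i) x)) + (V2 1 x + 1/2) * (F i x * F j x)" for i j x
 have h: "integrable lborel (h i j)" "(LBINT x. h i j x) \<le> pi ^ 3 * pair_energy (a i) (b i) (a j) (b j)" if "i \<in> I" "j \<in> I" for i j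
  using gauss2_pair_energy[OF p[OF that(1)] p[OF that(2)]] unfolding h_def[abs_def] F_def by auto
 have e: "f x * (- (1/2) * l x) + (V2 1 x + 1/2) * (f x)^2 = (\<Sum>i\<in>I. \<Sum>j\<in>I. c i * c j * h i j x)" for x
 proof -
  have 1: "f x * (- (1/2) * l x) = (\<Sum>i\<in>I. \<Sum>j\<in>I. c i * c j * (F j x * (- (1/2) * (F i x * glap (a i) (b i) x))))"
  proof -
   have l': "- (1/2) * l x = (\<Sum>i\<in>I. - (1/2) * (c i * (F i x * glap (a i) (b i) x)))"
    unfolding l_def by (rule sum_distrib_left)
   have "f x * (- (1/2) * l x) = (\<Sum>i\<in>I. - (1/2) * (c i * (F i x * glap (a i) (b i) x))) * f x"
    unfolding l' by (rule mult.commute)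
   also have "\<dots> = (\<Sum>i\<in>I. \<Sum>j\<in>I. (- (1/2) * (c i * (F i x * glap (a i) (b i) x))) * (c j * F j x))"
    unfolding f_def by (rule sum_product)
   also have "\<dots> = (\<Sum>i\<in>I. \<Sum>j\<in>I. c i * c j * (F j x * (- (1/2) * (F i x * glap (a i) (b i) x))))"
    by (intro sum.cong refl) simp
   finally show ?thesis .
  qed
  have ff: "f x * f x = (\<Sum>i\<in>I. \<Sum>j\<in>I. (c i * F i x) * (c j * F j x))" unfolding f_def by (rule sum_product)
  have 2: "(V2 1 x + 1/2) * (f x)^2 = (\<Sum>i\<in>I. \<Sum>j\<in>I. c i * c j * ((V2 1 x + 1/2) * (F i x * F j x)))"
   unfolding power2_eq_square ff sum_distrib_left by (intro sum.cong refl) simp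
  show ?thesis unfolding 1 2 h_def distrib_left sum.distrib ..
 qed
 have "(LBINT x. f x * (- (1/2) * l x) + (V2 1 x + 1/2) * (f x)^2) = (\<Sum>i\<in>I. \<Sum>j\<in>I. c i * c j * (LBINT x. h i j x))"
  unfolding e using h(1) by (subst bintegral_sum bintegral_sum; auto intro!: bintegrable_sum sum.cong)+
 also have "\<dots> \<le> (\<Sum>i\<in>I. \<Sum>j\<in>I. c i * c j * (pi ^ 3 * pair_energy (a i) (b i) (a j) (b j)))"
  using ab(3) by (intro sum_mono mult_left_mono h) (auto simp: less_imp_le)
 also have "\<dots> = pi ^ 3 * (\<Sum>i\<in>I. \<Sum>j\<in>I. c i * c j * pair_energy (a i) (b i) (a j) (b j))"
  unfolding sum_distrib_left by (intro sum.cong refl) simp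
 also have "\<dots> < 0" using neg by (intro mult_pos_neg) auto
 finally show ?thesis by (rule E2_less_gauss_decay[OF d m])
qed

text \<open>Reduces the energies to rational arithmetic by enclosing the three square roots.
  \<open>K\<close> makes the Coulomb bracket nonpositive, so there \<open>2 / sqrt pi\<close> may be
  replaced by the smaller \<open>1128/1000\<close>.\<close>

lemma pair_energy_le:
 assumes p: "a > 0" "b > 0" "a' > 0" "b' > 0"
  and A: "lA > 0" "lA^2 \<le> a + a'" "a + a' \<le> uA^2" "uA > 0"
  and B: "lB > 0" "lB^2 \<le> b + b'" "b + b' \<le> uB^2" "uB > 0"
  and C: "lC > 0" "lC^2 \<le> a + a' + (b + b')"
  and K: "1 / lC \<le> 1 / uA + 1 / uB"
 shows "pair_energy a b a' b' \<le> (3 * a * a' / (a + a') + 3 * b * b' / (b + b') + 1/2) / ((a + a') * (b + b') * (lA * lB))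
   + 1128/1000 / ((a + a') * (b + b')) * (1 / lC - 1 / uA - 1 / uB)"
proof -
 define X where "X = a + a'"
 define Y where "Y = b + b'"
 have X: "X > 0" "Y > 0" unfolding X_def Y_def using p by auto
 note A = A[folded X_def] and B = B[folded Y_def] and C = C[folded X_def Y_def]
 have sA: "lA \<le> sqrt X" "sqrt X \<le> uA" using A by (auto intro: real_le_rsqrt real_le_lsqrt)
 have sB: "lB \<le> sqrt Y" "sqrt Y \<le> uB" using B by (auto intro: real_le_rsqrt real_le_lsqrt)
 have sC: "lC \<le> sqrt (X + Y)" using C by (auto intro: real_le_rsqrt)
 have k: "3 * a * a' / X + 3 * b * b' / Y + 1/2 \<ge> 0" using p X by (auto intro!: add_nonneg_nonneg)
 have q: "sqrt (X * Y) * sqrt (X * Y) = X * Y" using mult_pos_pos[OF X] by simp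
 have "sqrt (X * Y) ^ 3 = X * Y * (sqrt X * sqrt Y)"
  by (simp only: power3_eq_cube q) (simp only: real_sqrt_mult)
 moreover have "X * Y * (sqrt X * sqrt Y) \<ge> X * Y * (lA * lB)" using X A B sA sB by (intro mult_left_mono mult_mono) auto
 ultimately have 1: "(3 * a * a' / X + 3 * b * b' / Y + 1/2) / sqrt (X * Y) ^ 3 \<le> (3 * a * a' / X + 3 * b * b' / Y + 1/2) / (X * Y * (lA * lB))"
  using k X A B by (intro divide_left_mono) auto
 have pi: "1128/1000 \<le> 2 / sqrt pi"
 proof -
  have "pi \<le> (2 / (1128/1000))^2" using pi_less_4 pi_approx(2) by (simp add: power2_eq_square)
  then have "sqrt pi \<le> 2 / (1128/1000)" by (intro real_le_lsqrt) auto
  then show ?thesis by (simp add: field_simps)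
 qed
 have "1 / sqrt (X + Y) - 1 / sqrt X - 1 / sqrt Y \<le> 1 / lC - 1 / uA - 1 / uB"
 proof -
  have "1 / sqrt (X + Y) \<le> 1 / lC" using C X sC by (intro divide_left_mono) auto
  moreover have "1 / uA \<le> 1 / sqrt X" using A X sA by (intro divide_left_mono) auto
  moreover have "1 / uB \<le> 1 / sqrt Y" using B X sB by (intro divide_left_mono) auto
  ultimately show ?thesis by linarith
 qed
 then have "2 / sqrt pi / (X * Y) * (1 / sqrt (X + Y) - 1 / sqrt X - 1 / sqrt Y) \<le> 2 / sqrt pi / (X * Y) * (1 / lC - 1 / uA - 1 / uB)"
  using X by (intro mult_left_mono) auto
 also have "\<dots> \<le> 1128/1000 / (X * Y) * (1 / lC - 1 / uA - 1 / uB)"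
  using pi K X by (intro mult_right_mono_neg divide_right_mono) auto
 finally show ?thesis unfolding pair_energy_def X_def[symmetric] Y_def[symmetric] using 1 by linarith
qed

lemma pair_energy_symmetric:
 "pair_energy a b a' b' = pair_energy b a b' a'" "pair_energy a b a' b' = pair_energy a' b' a b"
 "pair_energy a b a' b' = pair_energy b' a' b a"
 unfolding pair_energy_def by (simp_all add: ac_simps)

text \<open>The Rayleigh quotient of this trial function is about \<open>- 0.5054\<close>.\<close>

lemma E2_one_less: "E2 1 < - 1/2"
proof -
 \<comment> \<open>An open shell product: three Gaussians with exponents \<open>1/6\<close>,
   \<open>3/4\<close>, \<open>5\<close> form a compact inner orbital, the exponent
   \<open>1/32\<close> a diffuse outer one, and the last three entries are the copies with the
   electrons exchanged.\<close>
 define a where "a = (!) [1/6, 3/4, 5, 1/32, 1/32, 1/32 :: real]"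
 define b where "b = (!) [1/32, 1/32, 1/32, 1/6, 3/4, 5 :: real]"
 define c where "c = (!) [10, 20, 14, 10, 20, 14 :: real]"
 have e0: "pair_energy (1/6) (1/32) (1/6) (1/32) \<le> 41"
  by (rule order_trans[OF pair_energy_le[where lA="577/1000" and uA="289/500" and lB="1/4" and uB="1/4" and lC="629/1000"]]) (simp_all add: power2_eq_square)
 have e1: "pair_energy (1/6) (1/32) (1/32) (1/6) \<le> 39/25"
  by (rule order_trans[OF pair_energy_le[where lA="111/250" and uA="89/200" and lB="111/250" and uB="89/200" and lC="629/1000"]]) (simp_all add: power2_eq_square)
 have e2: "pair_energy (1/6) (1/32) (3/4) (1/32) \<le> - 193/20"
  by (rule order_trans[OF pair_energy_le[where lA="957/1000" and uA="479/500" and lB="1/4" and uB="1/4" and lC="989/1000"]]) (simp_all add: power2_eq_square)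
 have e3: "pair_energy (1/6) (1/32) (1/32) (3/4) \<le> - 623/100"
  by (rule order_trans[OF pair_energy_le[where lA="111/250" and uA="89/200" and lB="883/1000" and uB="221/250" and lC="989/1000"]]) (simp_all add: power2_eq_square)
 have e4: "pair_energy (1/6) (1/32) (5) (1/32) \<le> - 209/25"
  by (rule order_trans[OF pair_energy_le[where lA="2273/1000" and uA="1137/500" and lB="1/4" and uB="1/4" and lC="1143/500"]]) (simp_all add: power2_eq_square)
 have e5: "pair_energy (1/6) (1/32) (1/32) (5) \<le> - 187/100"
  by (rule order_trans[OF pair_energy_le[where lA="111/250" and uA="89/200" and lB="2243/1000" and uB="561/250" and lC="1143/500"]]) (simp_all add: power2_eq_square)
 have e6: "pair_energy (3/4) (1/32) (3/4) (1/32) \<le> 249/25"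
  by (rule order_trans[OF pair_energy_le[where lA="153/125" and uA="49/40" and lB="1/4" and uB="1/4" and lC="5/4"]]) (simp_all add: power2_eq_square)
 have e7: "pair_energy (3/4) (1/32) (1/32) (3/4) \<le> - 127/100"
  by (rule order_trans[OF pair_energy_le[where lA="883/1000" and uA="221/250" and lB="883/1000" and uB="221/250" and lC="5/4"]]) (simp_all add: power2_eq_square)
 have e8: "pair_energy (3/4) (1/32) (5) (1/32) \<le> - 93/100"
  by (rule order_trans[OF pair_energy_le[where lA="2397/1000" and uA="1199/500" and lB="1/4" and uB="1/4" and lC="241/100"]]) (simp_all add: power2_eq_square)
 have e9: "pair_energy (3/4) (1/32) (1/32) (5) \<le> - 6/25"
  by (rule order_trans[OF pair_energy_le[where lA="883/1000" and uA="221/250" and lB="2243/1000" and uB="561/250" and lC="241/100"]]) (simp_all add: power2_eq_square)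
 have e10: "pair_energy (5) (1/32) (5) (1/32) \<le> 907/100"
  by (rule order_trans[OF pair_energy_le[where lA="1581/500" and uA="3163/1000" and lB="1/4" and uB="1/4" and lC="793/250"]]) (simp_all add: power2_eq_square)
 have e11: "pair_energy (5) (1/32) (1/32) (5) \<le> - 1/50"
  by (rule order_trans[OF pair_energy_le[where lA="2243/1000" and uA="561/250" and lB="2243/1000" and uB="561/250" and lC="793/250"]]) (simp_all add: power2_eq_square)
 note e = e0 e1 e2 e3 e4 e5 e6 e7 e8 e9 e10 e11
 have I: "{..<6::nat} = {0, 1, 2, 3, 4, 5}" by auto
 show ?thesis
 proof (rule E2_less_gaussian_sum[where I="{..<6::nat}" and m="1/32" and a=a and b=b and c=c])
  show "1/32 \<le> a i" "1/32 \<le> b i" "c i > 0" if "i \<in> {..<6::nat}" for i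
   using that unfolding I a_def b_def c_def by auto
  \<comment> \<open>The 36 terms fall into twelve classes under exchange of the electrons and of the
    two factors; each class has two or four members, which is included in the coefficients.\<close>
  have "(\<Sum>i<6::nat. \<Sum>j<6::nat. c i * c j * pair_energy (a i) (b i) (a j) (b j))
   = 200 * pair_energy (1/6) (1/32) (1/6) (1/32) + 200 * pair_energy (1/6) (1/32) (1/32) (1/6)
   + 800 * pair_energy (1/6) (1/32) (3/4) (1/32) + 800 * pair_energy (1/6) (1/32) (1/32) (3/4)
   + 560 * pair_energy (1/6) (1/32) 5 (1/32) + 560 * pair_energy (1/6) (1/32) (1/32) 5
   + 800 * pair_energy (3/4) (1/32) (3/4) (1/32) + 800 * pair_energy (3/4) (1/32) (1/32) (3/4)
   + 1120 * pair_energy (3/4) (1/32) 5 (1/32) + 1120 * pair_energy (3/4) (1/32) (1/32) 5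
   + 392 * pair_energy 5 (1/32) 5 (1/32) + 392 * pair_energy 5 (1/32) (1/32) 5"
   unfolding I by (simp add: a_def b_def c_def) (simp add: pair_energy_symmetric)
  then show "(\<Sum>i\<in>{..<6::nat}. \<Sum>j\<in>{..<6::nat}. c i * c j * pair_energy (a i) (b i) (a j) (b j)) < 0"
   using e by linarith
 qed simp_all
qed

lemma critical_charge_less_one:
 assumes "critical_charge Z"
 shows "Z < 1"
proof (rule ccontr)
 assume "\<not> Z < 1"
 then consider "Z > 1" | "Z = 1" by linarith
 then have "\<not> E2 1 < E1 1" using assms unfolding critical_charge_def by cases auto
 then show False using E2_one_less unfolding E1_def by simp
qed

section \<open>From the eigenfunction to a real subsolution\<close>

lemma abs_eigenfunction_subsolution:
 assumes Z: "Z > 0" and [measurable]: "v \<in> borel_measurable borel" and v2: "integrable lborel (\<lambda>x. (v x)^2)"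
  and ev: "\<And>f. test_fun f \<Longrightarrow> (LBINT x. v x * (H2 Z f x + Z^2 / 2 * f x)) = 0"
 shows "coulomb_subsolution Z (\<lambda>x. \<bar>v x\<bar>)"
proof
 \<comment> \<open>The factor two brings the eigenvalue equation into the form in which the
   Laplacian of \<open>v\<close> equals \<open>W v\<close>, as Kato's inequality expects.\<close>
 define W where "W x = 2 * (V2 Z x + Z^2 / 2)" for x
 have [measurable]: "W \<in> borel_measurable borel" unfolding W_def[abs_def] by measurable
 fix f :: "conf2 \<Rightarrow> real" and g l
 assume f: "C2GL f g l" "bounded {x. f x \<noteq> 0}" "\<And>x. f x \<ge> 0"
 have "(LBINT x. \<bar>v x\<bar> * (l x - W x * f x)) \<ge> 0"
 proof (rule Kato_inequality[OF _ _ integrable_ball_of_square[OF _ v2] _ _ f])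
  fix R
  have e: "indicator (cball 0 R) x * (W x * v x) = - (2 * Z) * (indicator (cball 0 R) x * (v x / norm (fst x)))
    + - (2 * Z) * (indicator (cball 0 R) x * (v x / norm (snd x))) + 2 * (indicator (cball 0 R) x * (v x / norm (fst x - snd x)))
    + Z^2 * (indicator (cball 0 R) x * v x)" for x
   unfolding W_def V2_def by (simp add: algebra_simps)
  show "integrable lborel (\<lambda>x. indicator (cball 0 R) x * (W x * v x))"
   unfolding e by (intro bintegrable_add integrable_mult_right integrable_ball_of_square
     integrable_ball_div_norm inverse_square_gauss2_integrable conf2_projections_measurable v2 assms(2))
 next
  fix ph :: "conf2 \<Rightarrow> real" and g l
  assume ph: "C2GL ph g l" "bounded {x. ph x \<noteq> 0}"
  have "v x * (l x - W x * ph x) = - 2 * (v x * (H2 Z ph x + Z^2 / 2 * ph x))" for x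
   unfolding H2_def C2GL_laplacian[OF ph(1)] W_def by (simp add: algebra_simps)
  then show "(LBINT x. v x * (l x - W x * ph x)) = 0"
   using ev[OF C2GL_test_fun[OF ph]] by (simp only: integral_mult_right_zero mult_zero_right)
 qed measurable
 moreover have "\<bar>v x\<bar> * (- (1/2) * l x + (V2 Z x + Z^2 / 2) * f x) = - (1/2) * (\<bar>v x\<bar> * (l x - W x * f x))" for x
  unfolding W_def by (simp add: algebra_simps)
 ultimately show "(LBINT x. \<bar>v x\<bar> * (- (1/2) * l x + (V2 Z x + Z^2 / 2) * f x)) \<le> 0"
  by (simp only: integral_mult_right_zero)
qed (use Z v2 in auto)

text \<open>Real and imaginary part commute with the integral only for integrable integrands; for
  others the integral is zero by convention, and the weak equation would say nothing about the
  parts.\<close>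

lemma integrable_mult_H2:
 assumes [measurable]: "v \<in> borel_measurable lebesgue" and v2: "integrable lebesgue (\<lambda>x. (v x)^2)" and f: "test_fun f"
 shows "integrable lebesgue (\<lambda>x. v x * (H2 Z f x - E * f x))"
proof -
 obtain v' where v'[measurable]: "v' \<in> borel_measurable borel" and AE0: "AE x in lborel. v x = v' x"
  using completion_ex_borel_measurable_real[of v lborel] by auto
 have AE: "AE x in lebesgue. v x = v' x" by (rule AE_completion[OF AE0])
 have mv': "v' \<in> borel_measurable lebesgue" by (rule measurable_completion) simp
 have "integrable lebesgue (\<lambda>x. (v' x)^2)"
  by (rule integrable_cong_AE_imp[OF v2]) (use AE mv' in auto)
 then have v'2: "integrable lborel (\<lambda>x. (v' x)^2)" by (subst (asm) integrable_completion) auto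
 have bf: "bounded {x. f x \<noteq> 0}" using f unfolding test_fun_def by blast
 obtain g l where fl: "C2GL f g l" using test_fun_C2GL[OF f] by blast
 note m = C2GL_measurable[OF fl] and bl = C2GL_support(2)[OF fl bf]
 have [measurable]: "f \<in> borel_measurable borel" "l \<in> borel_measurable borel" using m by auto
 obtain Cf where Cf: "\<And>x. \<bar>f x\<bar> \<le> Cf" using continuous_bounded_support_bound[OF C2GL_D(2)[OF fl] bf] by auto
 obtain Cl where Cl: "\<And>x. \<bar>l x\<bar> \<le> Cl" using continuous_bounded_support_bound[OF C2GL_D(4)[OF fl] bl] by auto
 note i = integrable_loc_mult[OF _ m(1) bf Cf]
 have e: "v' x * (H2 Z f x - E * f x) = - (1/2) * (v' x * l x) + - Z * (v' x / norm (fst x) * f x) + - Z * (v' x / norm (snd x) * f x)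
   + v' x / norm (fst x - snd x) * f x + - E * (v' x * f x)" for x
  unfolding H2_def C2GL_laplacian[OF fl] V2_def by (simp add: algebra_simps)
 have i0: "integrable lborel (\<lambda>x. v' x * (H2 Z f x - E * f x))"
  unfolding e
  by (intro bintegrable_add integrable_mult_right i integrable_loc_mult[OF integrable_ball_of_square[OF v' v'2] m(3) bl Cl]
    integrable_ball_of_square[OF v' v'2] integrable_ball_div_norm[OF inverse_square_gauss2_integrable(1) conf2_projections_measurable(1) v' v'2]
    integrable_ball_div_norm[OF inverse_square_gauss2_integrable(2) conf2_projections_measurable(2) v' v'2]
    integrable_ball_div_norm[OF inverse_square_gauss2_integrable(3) conf2_projections_measurable(3) v' v'2])
 have [measurable]: "H2 Z f \<in> borel_measurable borel" unfolding H2_def[abs_def] C2GL_laplacian[OF fl] by measurable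
 have mH: "(\<lambda>x. H2 Z f x - E * f x) \<in> borel_measurable lebesgue" by (rule measurable_completion) measurable
 have "integrable lebesgue (\<lambda>x. v' x * (H2 Z f x - E * f x))"
  using i0 by (subst integrable_completion) auto
 then show ?thesis
  by (rule integrable_cong_AE_imp) (use AE mH in \<open>auto intro!: borel_measurable_times elim!: eventually_mono\<close>)
qed

text \<open>The eigenfunction is Lebesgue measurable, whereas the estimates for subsolutions are
  formulated for Borel functions. A Borel representative agrees almost everywhere and carries the
  result over.\<close>

lemma real_eigenfunction_decay:
 assumes Z: "Z > 0" "Z < 1" and [measurable]: "v \<in> borel_measurable lebesgue" and v2: "integrable lebesgue (\<lambda>x. (v x)^2)"
  and ev: "\<And>f. test_fun f \<Longrightarrow> (\<integral>x. v x * (H2 Z f x + Z^2 / 2 * f x) \<partial>lebesgue) = 0"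
  and be: "be = Z * ((1 - Z) / 4) / 4" and c: "0 < c" "c \<le> be" "c \<le> Z" "c^2 \<le> 2 * (1 - Z)"
 shows "(\<integral>\<^sup>+x. ennreal ((v x)^2 * exp (2 * decay_exponent Z (c / 2) x)) \<partial>lebesgue) < \<infinity>"
proof -
 obtain v' where v'[measurable]: "v' \<in> borel_measurable borel" and AE0: "AE x in lborel. v x = v' x"
  using completion_ex_borel_measurable_real[of v lborel] by auto
 have AE: "AE x in lebesgue. v x = v' x" by (rule AE_completion[OF AE0])
 have mv': "v' \<in> borel_measurable lebesgue" by (rule measurable_completion) simp
 have "integrable lebesgue (\<lambda>x. (v' x)^2)"
  by (rule integrable_cong_AE_imp[OF v2]) (use AE mv' in auto)
 then have v'2: "integrable lborel (\<lambda>x. (v' x)^2)" by (subst (asm) integrable_completion) auto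
 have "coulomb_subsolution Z (\<lambda>x. \<bar>v' x\<bar>)"
 proof (rule abs_eigenfunction_subsolution[OF Z(1) v' v'2])
  fix f :: "conf2 \<Rightarrow> real" assume f: "test_fun f"
  obtain g l where fl: "C2GL f g l" using test_fun_C2GL[OF f] by blast
  have [measurable]: "f \<in> borel_measurable borel" "l \<in> borel_measurable borel" using C2GL_measurable[OF fl] by auto
  have [measurable]: "H2 Z f \<in> borel_measurable borel" unfolding H2_def[abs_def] C2GL_laplacian[OF fl] by measurable
  have m: "(\<lambda>x. H2 Z f x + Z^2 / 2 * f x) \<in> borel_measurable lebesgue" by (rule measurable_completion) measurable
  have "(LBINT x. v' x * (H2 Z f x + Z^2 / 2 * f x)) = (\<integral>x. v' x * (H2 Z f x + Z^2 / 2 * f x) \<partial>lebesgue)"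
   by (rule integral_completion[symmetric]) measurable
  also have "\<dots> = (\<integral>x. v x * (H2 Z f x + Z^2 / 2 * f x) \<partial>lebesgue)"
   by (rule integral_cong_AE) (use AE m mv' in \<open>auto intro!: borel_measurable_times\<close>)
  finally show "(LBINT x. v' x * (H2 Z f x + Z^2 / 2 * f x)) = 0" using ev[OF f] by simp
 qed
 then interpret coulomb_subsolution Z "\<lambda>x. \<bar>v' x\<bar>" .
 have "(\<integral>\<^sup>+x. ennreal ((v x)^2 * exp (2 * decay_exponent Z (c / 2) x)) \<partial>lebesgue)
   = (\<integral>\<^sup>+x. ennreal (\<bar>v' x\<bar>\<^sup>2 * exp (2 * decay_exponent Z (c / 2) x)) \<partial>lebesgue)"
  by (rule nn_integral_cong_AE) (use AE in \<open>auto elim!: eventually_mono\<close>)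
 also have "\<dots> < \<infinity>" unfolding nn_integral_completion by (rule exponential_L2_bound[OF Z(2) be c])
 finally show ?thesis .
qed

text \<open>From \<open>t = Z powr (- 4)\<close> on, the correction lies below \<open>Z t\<close>.
  Hence the inner part of \<open>decay_exponent\<close> is bounded below, and the weight without
  inner factor is covered as well.\<close>

lemma powr_three_quarters_le:
 assumes Z: "Z > 0" and t: "t \<ge> (1::real)"
 shows "t powr (3/4) \<le> Z * t + Z powr (- 4)"
proof (cases "t \<ge> Z powr (- 4)")
 case True
 have "t powr (- 1/4) \<le> (Z powr (- 4)) powr (- 1/4)" using True Z by (intro powr_mono2') auto
 also have "\<dots> = Z" using Z by (simp add: powr_powr)
 finally have "t powr (- 1/4) * t \<le> Z * t" using t by (intro mult_right_mono) auto
 moreover have "t powr (- 1/4) * t = t powr (3/4)" using t powr_add[of t "- 1/4" 1] by simp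
 moreover have "0 \<le> Z powr (- 4)" by simp
 ultimately show ?thesis by linarith
next
 case False
 have "t powr (3/4) \<le> t powr 1" using t by (intro powr_mono) auto
 moreover have "0 \<le> Z * t" using Z t by simp
 ultimately show ?thesis using False t by simp
qed

text \<open>One weight serves both integrals of the theorem. Passing from \<open>norm_0\<close> to
  \<open>tmin\<close> changes the correction by at most two, \<open>norm_inf\<close> lies below
  \<open>tmax\<close>, and the term with the power \<open>1/4\<close> only lowers the left-hand
  sides.\<close>

lemma decay_exponent_comparison:
 assumes "Z > 0" "c > 0"
 shows "Z * norm_0 x - norm_0 x powr (3/4) + c * sqrt (norm_inf x) - norm_inf x powr (1/4) \<le> decay_exponent Z c x + 2"
  "c * sqrt (norm_inf x) - norm_inf x powr (1/4) \<le> decay_exponent Z c x + Z powr (- 4)"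
proof -
 have n0: "0 \<le> norm_0 x" "norm_0 x \<le> tmin x" "tmin x \<le> norm_0 x + 1" "norm_inf x \<le> tmax x"
  unfolding norm_0_def norm_inf_def tmin_def tmax_def
  using norm_le_smr[of "fst x" 1] norm_le_smr[of "snd x" 1] tt_le[of "fst x"] tt_le[of "snd x"] by auto
 have s: "c * sqrt (norm_inf x) \<le> c * sqrt (tmax x)" using n0 assms by (intro mult_left_mono) auto
 have z: "Z * norm_0 x \<le> Z * tmin x" using n0 assms by (intro mult_left_mono) auto
 have p: "tmin x powr (3/4) \<le> norm_0 x powr (3/4) + 2"
 proof (cases "norm_0 x \<ge> 1")
  case True
  then show ?thesis using powr_lipschitz[of "tmin x" "norm_0 x" "3/4"] tmin_tmax(1)[of x] n0 by linarith
 next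
  case False
  have "tmin x powr (3/4) \<le> tmin x" using powr_mono[of "3/4" 1 "tmin x"] tmin_tmax(1)[of x] by simp
  moreover have "norm_0 x powr (3/4) \<ge> 0" by simp
  ultimately show ?thesis using False n0 by linarith
 qed
 have i: "norm_inf x powr (1/4) \<ge> 0" by simp
 show "Z * norm_0 x - norm_0 x powr (3/4) + c * sqrt (norm_inf x) - norm_inf x powr (1/4) \<le> decay_exponent Z c x + 2"
  unfolding decay_exponent_def using s z p i by linarith
 show "c * sqrt (norm_inf x) - norm_inf x powr (1/4) \<le> decay_exponent Z c x + Z powr (- 4)"
  unfolding decay_exponent_def using s i powr_three_quarters_le[OF assms(1) tmin_tmax(1)[of x]] by linarith
qed

theorem mainTheorem5:
 fixes Zc \<alpha> \<delta> :: real and psi :: "conf2 \<Rightarrow> complex"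
 assumes "critical_charge Zc"
  and "eigenfunction2 Zc (E1 Zc) psi"
  and "\<not> (AE x in lebesgue. psi x = 0)"
  and "1/2 < \<alpha>" and "\<alpha> < 1" and "\<delta> > 0"
 shows "\<exists>\<epsilon>0 \<epsilon>inf K0 Kinf c.
   1 > \<epsilon>0 \<and> \<epsilon>0 > 1/2 \<and> 1/2 > \<epsilon>inf \<and> \<epsilon>inf > 0 \<and> K0 > 0 \<and> Kinf > 0 \<and> c > 0
  \<and> (\<integral>\<^sup>+x\<in>A_set \<delta> \<alpha>. ennreal (exp (2 * (sqrt (2 * \<bar>E1 Zc\<bar>) * norm_0 x
     - K0 * norm_0 x powr \<epsilon>0 + c * sqrt (norm_inf x) - Kinf * norm_inf x powr \<epsilon>inf))
     * (cmod (psi x))^2) \<partial>lebesgue) < \<infinity>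
  \<and> (\<integral>\<^sup>+x\<in>- A_set \<delta> \<alpha>. ennreal (exp (2 * (c * sqrt (norm_inf x)
     - Kinf * norm_inf x powr \<epsilon>inf)) * (cmod (psi x))^2) \<partial>lebesgue) < \<infinity>"
proof -
 have Z: "Zc > 0" "Zc < 1" using assms(1) critical_charge_less_one unfolding critical_charge_def by auto
 have psi[measurable]: "psi \<in> borel_measurable lebesgue" and psi2: "integrable lebesgue (\<lambda>x. (cmod (psi x))^2)"
  and ev: "\<And>f. test_fun f \<Longrightarrow> (\<integral>x. psi x * complex_of_real (H2 Zc f x - E1 Zc * f x) \<partial>lebesgue) = 0"
  using assms(2) unfolding eigenfunction2_def by auto
 define \<beta> where "\<beta> = Zc * ((1 - Zc) / 4) / 4"
 \<comment> \<open>The bound by \<open>\<beta>\<close> makes \<open>Theta\<close> integrable against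
   \<open>w\<close>; the bound by \<open>1 - Zc\<close>, which is below one, yields the condition on
   \<open>c^2\<close>.\<close>
 define c where "c = min \<beta> (1 - Zc)"
 have b: "\<beta> > 0" "\<beta> \<le> Zc"
 proof -
  show "\<beta> > 0" unfolding \<beta>_def using Z by simp
  have "Zc * ((1 - Zc) / 4 / 4) \<le> Zc * 1" using Z by (intro mult_left_mono) auto
  then show "\<beta> \<le> Zc" unfolding \<beta>_def by simp
 qed
 have c: "0 < c" "c \<le> \<beta>" "c \<le> Zc" "c^2 \<le> 2 * (1 - Zc)"
 proof -
  show c0: "0 < c" "c \<le> \<beta>" "c \<le> Zc" unfolding c_def using b Z by auto
  have "c * c \<le> 1 * (1 - Zc)" using c0 Z unfolding c_def by (intro mult_mono) auto
  then show "c^2 \<le> 2 * (1 - Zc)" using Z by (simp add: power2_eq_square)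
 qed
 have E: "H2 Zc f x - E1 Zc * f x = H2 Zc f x + Zc^2 / 2 * f x" for f x unfolding E1_def by simp
 \<comment> \<open>The Hamiltonian has real coefficients, so real and imaginary part satisfy the
   weak equation separately and Kato's inequality is needed for real functions only.\<close>
 have sq: "integrable lebesgue (\<lambda>x. (P (psi x))^2)" if P: "P = Re \<or> P = Im" for P
 proof (rule bintegrable_bound[OF psi2])
  show "(\<lambda>x. (P (psi x))^2) \<in> borel_measurable lebesgue" using P by auto
  have "\<bar>P z\<bar> \<le> cmod z" for z using P abs_Re_le_cmod abs_Im_le_cmod by auto
  then have "\<bar>P z\<bar>\<^sup>2 \<le> (cmod z)^2" for z by (intro power_mono) auto
  then show "AE x in lebesgue. norm ((P (psi x))^2) \<le> norm ((cmod (psi x))^2)" by simp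
 qed
 have dec: "(\<integral>\<^sup>+x. ennreal ((P (psi x))^2 * exp (2 * decay_exponent Zc (c / 2) x)) \<partial>lebesgue) < \<infinity>"
  if P: "P = Re \<or> P = Im" for P
 proof (rule real_eigenfunction_decay[OF Z _ _ _ \<beta>_def c])
  show m: "(\<lambda>x. P (psi x)) \<in> borel_measurable lebesgue" using P by auto
  show "integrable lebesgue (\<lambda>x. (P (psi x))^2)" by (rule sq[OF P])
  fix f :: "conf2 \<Rightarrow> real" assume f: "test_fun f"
  define h where "h x = psi x * complex_of_real (H2 Zc f x - E1 Zc * f x)" for x
  have h0: "(\<integral>x. h x \<partial>lebesgue) = 0" unfolding h_def by (rule ev[OF f])
  have Ph: "P (h x) = P (psi x) * (H2 Zc f x + Zc^2 / 2 * f x)" for x unfolding h_def E using P by auto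
  have "(\<integral>x. P (h x) \<partial>lebesgue) = 0"
  proof -
   \<comment> \<open>Integrability of the complex function \<open>h\<close> is assembled from its
     two real parts; after that \<open>P\<close> may be pulled out of the integral.\<close>
   have i: "integrable lebesgue (\<lambda>x. Q (psi x) * (H2 Zc f x - E1 Zc * f x))" if Q: "Q = Re \<or> Q = Im" for Q
   proof (rule integrable_mult_H2[OF _ _ f])
    show m: "(\<lambda>x. Q (psi x)) \<in> borel_measurable lebesgue" using Q by auto
    show "integrable lebesgue (\<lambda>x. (Q (psi x))^2)" by (rule sq[OF Q])
   qed
   have "h = (\<lambda>x. complex_of_real (Re (psi x) * (H2 Zc f x - E1 Zc * f x)) + \<i> * complex_of_real (Im (psi x) * (H2 Zc f x - E1 Zc * f x)))"
    unfolding h_def by (auto simp: complex_eq_iff)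
   then have "integrable lebesgue h"
    by (simp only:) (intro bintegrable_add integrable_mult_right integrable_of_real i disjI1 disjI2 refl)
   then have "(\<integral>x. P (h x) \<partial>lebesgue) = P (\<integral>x. h x \<partial>lebesgue)" using P by (auto simp: integral_Re integral_Im)
   then show ?thesis using h0 P by auto
  qed
  then show "(\<integral>x. P (psi x) * (H2 Zc f x + Zc^2 / 2 * f x) \<partial>lebesgue) = 0" unfolding Ph .
 qed
 define F where "F = decay_exponent Zc (c / 2)"
 have mF[measurable]: "F \<in> borel_measurable lebesgue" unfolding F_def by (rule measurable_completion) simp
 define I where "I = (\<integral>\<^sup>+x. ennreal ((cmod (psi x))^2 * exp (2 * F x)) \<partial>lebesgue)"
 have I: "I < \<infinity>"
 proof -
  have "I = (\<integral>\<^sup>+x. ennreal ((Re (psi x))^2 * exp (2 * F x)) + ennreal ((Im (psi x))^2 * exp (2 * F x)) \<partial>lebesgue)"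
   unfolding I_def cmod_power2 by (intro nn_integral_cong) (simp add: distrib_right flip: ennreal_plus)
  also have "\<dots> = (\<integral>\<^sup>+x. ennreal ((Re (psi x))^2 * exp (2 * F x)) \<partial>lebesgue) + (\<integral>\<^sup>+x. ennreal ((Im (psi x))^2 * exp (2 * F x)) \<partial>lebesgue)"
   by (rule nn_integral_add) measurable
  also have "\<dots> < \<infinity>" using dec[of Re] dec[of Im] unfolding F_def by simp
  finally show ?thesis .
 qed
 \<comment> \<open>The integral \<open>I\<close> dominates every weighted integral whose exponent
   exceeds \<open>F\<close> by at most a constant, which costs the factor
   \<open>exp (2 * K)\<close>.\<close>
 have fin: "(\<integral>\<^sup>+x\<in>S. ennreal (exp (2 * q x) * (cmod (psi x))^2) \<partial>lebesgue) < \<infinity>" if q: "\<And>x. q x \<le> F x + K" for q K S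
 proof -
  have "(\<integral>\<^sup>+x\<in>S. ennreal (exp (2 * q x) * (cmod (psi x))^2) \<partial>lebesgue)
   \<le> (\<integral>\<^sup>+x. ennreal (exp (2 * K)) * ennreal ((cmod (psi x))^2 * exp (2 * F x)) \<partial>lebesgue)"
  proof (rule nn_integral_mono)
   fix x
   have "exp (2 * q x) \<le> exp (2 * K + 2 * F x)" using q[of x] by simp
   then have "exp (2 * q x) * (cmod (psi x))^2 \<le> exp (2 * K + 2 * F x) * (cmod (psi x))^2" by (intro mult_right_mono) auto
   also have "\<dots> = exp (2 * K) * ((cmod (psi x))^2 * exp (2 * F x))" unfolding exp_add by simp
   finally have "ennreal (exp (2 * q x) * (cmod (psi x))^2) \<le> ennreal (exp (2 * K)) * ennreal ((cmod (psi x))^2 * exp (2 * F x))"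
    by (simp add: ennreal_leI flip: ennreal_mult)
   then show "ennreal (exp (2 * q x) * (cmod (psi x))^2) * indicator S x \<le> ennreal (exp (2 * K)) * ennreal ((cmod (psi x))^2 * exp (2 * F x))"
    by (auto simp: indicator_def)
  qed
  also have "\<dots> = ennreal (exp (2 * K)) * I" unfolding I_def by (rule nn_integral_cmult) measurable
  also have "\<dots> < \<infinity>" using I by (simp add: ennreal_mult_less_top)
  finally show ?thesis .
 qed
 have Ze: "sqrt (2 * \<bar>E1 Zc\<bar>) = Zc" unfolding E1_def using Z by simp
 have c2: "c / 2 > 0" using c(1) by simp
 note 1 = fin[OF decay_exponent_comparison(1)[OF Z(1) c2, folded F_def]]
  and 2 = fin[OF decay_exponent_comparison(2)[OF Z(1) c2, folded F_def]]
 \<comment> \<open>\<open>3/4\<close> is the power in the inner exponent of the supersolution and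
   \<open>1/4\<close> any number below one half; \<open>c / 2\<close> appears because the other half
   of \<open>c\<close> was spent on the divisor \<open>(tmax x)^2\<close>.\<close>
 show ?thesis
  by (rule exI[of _ "3/4"], rule exI[of _ "1/4"], rule exI[of _ 1], rule exI[of _ 1], rule exI[of _ "c / 2"])
    (unfold Ze mult_1, intro conjI 1 2, use c2 in simp_all)
qed

end
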